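(* Let $\lambda>0$. Assume that $f\in C(\mathbb{R})$, that $a\in C(\mathbb{R}^+)$ satisfies $a(s)\ge m>0$ for all $s\ge 0$ (for some constant $m$), and that $h\in L^2_{loc}(0,+\infty;L^2(\Omega))$ (that is, $h\in L^2(0,T;L^2(\Omega))$ for every $T>0$). Assume also that there exist constants $\beta,\gamma>0$ such that $f(u)u\le \gamma+\beta u^2$ for all $u\in\mathbb{R}$. Then for any $u_0\in H_0^1(\Omega)$ the problem $$\begin{cases}\dfrac{\partial u}{\partial t}-a(\|u\|_{H_0^1}^2)\dfrac{\partial^2u}{\partial x^2}=\lambda f(u)+h(t), & t>0,\ x\in\Omega,\\ u(t,0)=u(t,1)=0,\\ u(0,x)=u_0(x),\end{cases}$$ has at least one strong solution.
   Context: $\Omega=(0,1)$, $\mathbb{R}^+=[0,\infty)$, $(\cdot,\cdot)$ is the inner product of $L^2(\Omega)$, and $\|u\|_{H_0^1}=\|u_x\|_{L^2}$. A weak solution of the problem is a function $u\in L^\infty(0,T;L^2(\Omega))\cap L^2(0,T;H_0^1(\Omega))$ for any $T>0$ such that $\frac{d}{dt}(u,v)+a(\|u\|_{H_0^1}^2)(u_x,v_x)=\lambda(f(u),v)+(h(t),v)$ for all $v\in H_0^1(\Omega)$, in the sense of distributions in $t$, with $u(0)=u_0$. A strong solution (for $u_0\in H_0^1(\Omega)$) is a weak solution with, in addition, $u\in L^\infty(0,T;H_0^1(\Omega))$, $u\in L^2(0,T;H^2(\Omega)\cap H_0^1(\Omega))$ and $\frac{du}{dt}\in L^2(0,T;L^2(\Omega))$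 for any $T>0$. Strong solutions belong to $C([0,T];H_0^1(\Omega))$, so the initial condition makes sense. *)

theory Defs
  imports "HOL-Analysis.Analysis"
begin

section \<open>Scalar distributions on an open subset of the real line\<close>

definition test_functions :: "real set \<Rightarrow> (real \<Rightarrow> real) set" where
  "test_functions S =
    {\<phi>. (\<forall>n x. (deriv ^^ n) \<phi> field_differentiable at x) \<and>
         compact (closure {x. \<phi> x \<noteq> 0}) \<and> closure {x. \<phi> x \<noteq> 0} \<subseteq> S}"

definition locally_integrable_on :: "(real \<Rightarrow> real) \<Rightarrow> real set \<Rightarrow> bool" where
  "locally_integrable_on g S \<longleftrightarrow> (\<forall>K. compact K \<and> K \<subseteq> S \<longrightarrow> g absolutely_integrable_on K)"

text \<open>The distribution \<open>distr_of S g\<close> is only meaningful when \<open>g\<close> is locally integrable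
  on \<open>S\<close>; the definitions below always require this explicitly.\<close>

definition distr_of :: "real set \<Rightarrow> (real \<Rightarrow> real) \<Rightarrow> (real \<Rightarrow> real) \<Rightarrow> real" where
  "distr_of S g \<phi> = (LINT t|lebesgue_on S. g t * \<phi> t)"

definition distr_deriv :: "((real \<Rightarrow> real) \<Rightarrow> real) \<Rightarrow> (real \<Rightarrow> real) \<Rightarrow> real" where
  "distr_deriv D \<phi> = - D (deriv \<phi>)"

section \<open>Function spaces on the interval \<open>(0,1)\<close>\<close>

text \<open>Elements of the spaces below are represented by functions; all carriers are closed under
  equality almost everywhere, and all norms are invariant under it on their carriers.\<close>

abbreviation \<Omega> :: "real set" where "\<Omega> \<equiv> {0<..<1}"

definition L2 :: "(real \<Rightarrow> real) set" where
  "L2 = {u \<in> borel_measurable (lebesgue_on \<Omega>). integrable (lebesgue_on \<Omega>) (\<lambda>x. (u x)\<^sup>2)}"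

definition L2_inner :: "(real \<Rightarrow> real) \<Rightarrow> (real \<Rightarrow> real) \<Rightarrow> real" where
  "L2_inner u v = (LINT x|lebesgue_on \<Omega>. u x * v x)"

definition L2_norm :: "(real \<Rightarrow> real) \<Rightarrow> real" where
  "L2_norm u = sqrt (L2_inner u u)"

definition has_weak_deriv :: "(real \<Rightarrow> real) \<Rightarrow> (real \<Rightarrow> real) \<Rightarrow> bool" where
  "has_weak_deriv u g \<longleftrightarrow> locally_integrable_on u \<Omega> \<and> locally_integrable_on g \<Omega> \<and>
     (\<forall>\<phi>\<in>test_functions \<Omega>. distr_deriv (distr_of \<Omega> u) \<phi> = distr_of \<Omega> g \<phi>)"

text \<open>A representative of the weak derivative, which is unique almost everywhere.\<close>

definition weak_deriv :: "(real \<Rightarrow> real) \<Rightarrow> real \<Rightarrow> real" where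
  "weak_deriv u = (SOME g. g \<in> L2 \<and> has_weak_deriv u g)"

primrec Hk :: "nat \<Rightarrow> (real \<Rightarrow> real) set" where
  "Hk 0 = L2"
| "Hk (Suc k) = {u \<in> L2. \<exists>g\<in>Hk k. has_weak_deriv u g}"

definition Hk_norm :: "nat \<Rightarrow> (real \<Rightarrow> real) \<Rightarrow> real" where
  "Hk_norm k u = sqrt (\<Sum>i\<le>k. (L2_norm ((weak_deriv ^^ i) u))\<^sup>2)"

text \<open>The closure of the test functions in \<open>H\<^sup>1\<close>.\<close>

definition H01 :: "(real \<Rightarrow> real) set" where
  "H01 = {u \<in> Hk 1. \<forall>\<epsilon>>0. \<exists>\<phi>\<in>test_functions \<Omega>. Hk_norm 1 (\<lambda>x. u x - \<phi> x) < \<epsilon>}"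

definition H01_norm :: "(real \<Rightarrow> real) \<Rightarrow> real" where
  "H01_norm u = L2_norm (weak_deriv u)"

section \<open>Functions of time with values in a function space\<close>

text \<open>A normed function space is given by a carrier \<open>X\<close> and a norm \<open>N\<close>. A function with values
  in \<open>X\<close> is strongly measurable if it is the limit almost everywhere of simple functions.\<close>

definition strongly_measurable ::
    "'a measure \<Rightarrow> ('b \<Rightarrow> real) set \<Rightarrow> (('b \<Rightarrow> real) \<Rightarrow> real) \<Rightarrow> ('a \<Rightarrow> 'b \<Rightarrow> real) \<Rightarrow> bool" where
  "strongly_measurable M X N u \<longleftrightarrow> (AE t in M. u t \<in> X) \<and>
     (\<exists>s. (\<forall>n::nat. simple_function M (s n) \<and> s n ` space M \<subseteq> X) \<and>
          (AE t in M. (\<lambda>n. N (\<lambda>x. u t x - s n t x)) \<longlonglongrightarrow> 0))"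

definition Bochner_L2 ::
    "'a measure \<Rightarrow> ('b \<Rightarrow> real) set \<Rightarrow> (('b \<Rightarrow> real) \<Rightarrow> real) \<Rightarrow> ('a \<Rightarrow> 'b \<Rightarrow> real) set" where
  "Bochner_L2 M X N = {u. strongly_measurable M X N u \<and> integrable M (\<lambda>t. (N (u t))\<^sup>2)}"

definition Bochner_Linf ::
    "'a measure \<Rightarrow> ('b \<Rightarrow> real) set \<Rightarrow> (('b \<Rightarrow> real) \<Rightarrow> real) \<Rightarrow> ('a \<Rightarrow> 'b \<Rightarrow> real) set" where
  "Bochner_Linf M X N = {u. strongly_measurable M X N u \<and> (\<exists>C. AE t in M. N (u t) \<le> C)}"

text \<open>The Bochner integral over a finite measure space. It is determined up to equality in \<open>X\<close>
  and hence a relation; the library version needs a Banach space as a type.\<close>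

definition simple_integral_in :: "'a measure \<Rightarrow> ('a \<Rightarrow> 'b \<Rightarrow> real) \<Rightarrow> 'b \<Rightarrow> real" where
  "simple_integral_in M s x = (\<Sum>y\<in>s ` space M. measure M {t \<in> space M. s t = y} * y x)"

definition has_Bochner_integral_in ::
    "'a measure \<Rightarrow> ('b \<Rightarrow> real) set \<Rightarrow> (('b \<Rightarrow> real) \<Rightarrow> real) \<Rightarrow> ('a \<Rightarrow> 'b \<Rightarrow> real) \<Rightarrow> ('b \<Rightarrow> real) \<Rightarrow> bool"
  where
  "has_Bochner_integral_in M X N u I \<longleftrightarrow> strongly_measurable M X N u \<and> I \<in> X \<and>
     (\<exists>s. (\<forall>n::nat. simple_function M (s n) \<and> s n ` space M \<subseteq> X) \<and>
          (\<lambda>n. \<integral>\<^sup>+ t. ennreal (N (\<lambda>x. u t x - s n t x)) \<partial>M) \<longlonglongrightarrow> 0 \<and>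
          (\<lambda>n. N (\<lambda>x. I x - simple_integral_in M (s n) x)) \<longlonglongrightarrow> 0)"

abbreviation time_interval :: "real \<Rightarrow> real measure" where
  "time_interval T \<equiv> lebesgue_on {0<..<T}"

text \<open>\<open>du/dt = w\<close> on \<open>(0,T)\<close> in the sense of \<open>L\<^sup>2(\<Omega>)\<close>-valued distributions:
  \<open>\<integral> u \<phi>' dt = - \<integral> w \<phi> dt\<close> as Bochner integrals.\<close>

definition has_time_deriv ::
    "real \<Rightarrow> (real \<Rightarrow> real \<Rightarrow> real) \<Rightarrow> (real \<Rightarrow> real \<Rightarrow> real) \<Rightarrow> bool" where
  "has_time_deriv T u w \<longleftrightarrow>
     (\<forall>\<phi>\<in>test_functions {0<..<T}. \<exists>I.
        has_Bochner_integral_in (time_interval T) L2 L2_norm (\<lambda>t x. deriv \<phi> t * u t x) I \<and>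
        has_Bochner_integral_in (time_interval T) L2 L2_norm (\<lambda>t x. \<phi> t * w t x) (\<lambda>x. - I x))"

section \<open>Solutions\<close>

text \<open>\<open>u(0) = u\<^sub>0\<close> for a function \<open>u\<close> given up to null sets in time: the representative of \<open>u\<close>
  that is continuous from \<open>[0,\<infinity>)\<close> to \<open>L\<^sup>2(\<Omega>)\<close> takes the value \<open>u\<^sub>0\<close> at \<open>0\<close>.\<close>

definition has_initial_value :: "(real \<Rightarrow> real \<Rightarrow> real) \<Rightarrow> (real \<Rightarrow> real) \<Rightarrow> bool" where
  "has_initial_value u u0 \<longleftrightarrow>
     (\<exists>w. (AE t in lebesgue_on {0<..}. AE x in lebesgue_on \<Omega>. w t x = u t x) \<and>
          (\<forall>t\<ge>0. w t \<in> L2 \<and> ((\<lambda>s. L2_norm (\<lambda>x. w s x - w t x)) \<longlongrightarrow> 0) (at t within {0..})) \<and>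
          (AE x in lebesgue_on \<Omega>. w 0 x = u0 x))"

definition weak_solution ::
    "real \<Rightarrow> (real \<Rightarrow> real) \<Rightarrow> (real \<Rightarrow> real) \<Rightarrow> (real \<Rightarrow> real \<Rightarrow> real) \<Rightarrow> (real \<Rightarrow> real) \<Rightarrow>
     (real \<Rightarrow> real \<Rightarrow> real) \<Rightarrow> bool" where
  "weak_solution lam a f h u0 u \<longleftrightarrow>
     (\<forall>T>0. u \<in> Bochner_Linf (time_interval T) L2 L2_norm \<and>
            u \<in> Bochner_L2 (time_interval T) H01 H01_norm) \<and>
     (\<forall>v\<in>H01.
        let mass = (\<lambda>t. L2_inner (u t) v);
            diffusion = (\<lambda>t. a ((H01_norm (u t))\<^sup>2) * L2_inner (weak_deriv (u t)) (weak_deriv v));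
            reaction = (\<lambda>t. lam * L2_inner (\<lambda>x. f (u t x)) v);
            source = (\<lambda>t. L2_inner (h t) v)
        in locally_integrable_on mass {0<..} \<and> locally_integrable_on diffusion {0<..} \<and>
           locally_integrable_on reaction {0<..} \<and> locally_integrable_on source {0<..} \<and>
           (\<forall>\<phi>\<in>test_functions {0<..}.
              distr_deriv (distr_of {0<..} mass) \<phi> + distr_of {0<..} diffusion \<phi> =
              distr_of {0<..} reaction \<phi> + distr_of {0<..} source \<phi>)) \<and>
     has_initial_value u u0"

definition strong_solution ::
    "real \<Rightarrow> (real \<Rightarrow> real) \<Rightarrow> (real \<Rightarrow> real) \<Rightarrow> (real \<Rightarrow> real \<Rightarrow> real) \<Rightarrow> (real \<Rightarrow> real) \<Rightarrow>
     (real \<Rightarrow> real \<Rightarrow> real) \<Rightarrow> bool" where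
  "strong_solution lam a f h u0 u \<longleftrightarrow>
     weak_solution lam a f h u0 u \<and>
     (\<forall>T>0. u \<in> Bochner_Linf (time_interval T) H01 H01_norm \<and>
            u \<in> Bochner_L2 (time_interval T) (Hk 2 \<inter> H01) (Hk_norm 2) \<and>
            (\<exists>w\<in>Bochner_L2 (time_interval T) L2 L2_norm. has_time_deriv T u w))"

end

theory Submission
  imports Defs "HOL-Complex_Analysis.Great_Picard" "HOL-Computational_Algebra.Polynomial"
begin

text \<open>Galerkin approximation in the sine basis, in which every function space involved is a weighted
  \<open>l\<^sup>2\<close> space of coefficients. Since \<open>f\<close> is only continuous and \<open>|f|\<close> may grow arbitrarily fast, the
  bound in \<open>H\<^sub>0\<^sup>1\<close> comes from the energy \<open>1/2 A(\<parallel>u\<parallel>\<^sup>2) - \<lambda> \<integral> F(u) dx\<close>, where \<open>A\<close> and \<open>F\<close> are primitives of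
  \<open>a\<close> and \<open>f\<close>: \<open>f(u) u \<le> \<gamma> + \<beta> u\<^sup>2\<close> bounds \<open>F\<close> from above by a quadratic function,
  so the \<open>L\<^sup>2\<close> estimate controls the second term and \<open>A(s) \<ge> m s\<close> controls \<open>\<parallel>u\<parallel>\<^sup>2\<close>.
  In one dimension the approximations are then uniformly bounded, hence so is \<open>f(u)\<close>, and the decay of the
  \<open>k\<close>-th mode at rate \<open>a \<omega>\<^sub>k\<^sup>2 \<ge> m \<omega>\<^sub>k\<^sup>2\<close> makes the tails of the \<open>H\<^sub>0\<^sup>1\<close> norm uniformly small. Together with
  equicontinuity of the coefficients this gives convergence in \<open>H\<^sub>0\<^sup>1\<close> for every time, so the nonlocal
  coefficient \<open>a(\<parallel>u\<parallel>\<^sup>2)\<close> passes to the limit.\<close>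

section \<open>Square integrable functions and orthonormal systems\<close>

text \<open>Since \<open>a\<close> and \<open>f\<close> are only continuous, the Galerkin systems
  need not be uniquely solvable: they are solved by Peano's theorem for clamped coefficients, and
  the a priori bound then shows that the clamp is inactive. For the same reason a weak limit in
  \<open>H01\<close> would not identify the value of \<open>a\<close> at the squared norm, and no
  monotonicity is at hand to repair this. Convergence of the norm is reached coordinate by
  coordinate: a diagonal selection makes each coefficient converge at each time, and uniform tails
  sum this up. All compactness is thus that of countably many scalar functions of time; no compact
  embedding of Bochner spaces enters. The limit is a sine series defined at every time, so it is its
  own continuous representative, and the weak form, the time derivative and the initial value are
  read off from its integrated coefficient equations. The source is only square integrable in time;
  in the n-th system each of its coefficients is replaced by a continuous function with squared
  error at most 1/(n+1)^2, which over n modes adds up to less than 1/(n+1).\<close>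

definition sqint :: "'a measure \<Rightarrow> ('a \<Rightarrow> real) \<Rightarrow> bool" where
  "sqint M u \<longleftrightarrow> u \<in> borel_measurable M \<and> integrable M (\<lambda>x. (u x)\<^sup>2)"

lemma sqintD: "sqint M u \<Longrightarrow> u \<in> borel_measurable M" "sqint M u \<Longrightarrow> integrable M (\<lambda>x. (u x)\<^sup>2)"
  by (auto simp: sqint_def)

lemma L2_iff_sqint: "u \<in> L2 \<longleftrightarrow> sqint (lebesgue_on \<Omega>) u"
  by (simp add: L2_def sqint_def)

lemma sqint_mult_integrable:
  assumes "sqint M u" "sqint M v"
  shows "integrable M (\<lambda>x. u x * v x)"
proof (rule Bochner_Integration.integrable_bound)
  show "integrable M (\<lambda>x. (u x)\<^sup>2 + (v x)\<^sup>2)" using assms by (auto simp: sqint_def)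
  show "(\<lambda>x. u x * v x) \<in> borel_measurable M" using assms by (auto simp: sqint_def)
  have "\<bar>a * b\<bar> \<le> a\<^sup>2 + b\<^sup>2" for a b :: real
  proof -
    have "2 * (\<bar>a\<bar> * \<bar>b\<bar>) \<le> a\<^sup>2 + b\<^sup>2"
      using sum_squares_bound[of "\<bar>a\<bar>" "\<bar>b\<bar>"] by simp
    moreover have "0 \<le> \<bar>a\<bar> * \<bar>b\<bar>" by simp
    ultimately show ?thesis unfolding abs_mult by linarith
  qed
  then show "AE x in M. norm (u x * v x) \<le> norm ((u x)\<^sup>2 + (v x)\<^sup>2)" by auto
qed

lemma sqint_zero: "sqint M (\<lambda>x. 0)"
  by (simp add: sqint_def)

lemma sqint_cmult: "sqint M u \<Longrightarrow> sqint M (\<lambda>x. c * u x)"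
  by (auto simp: sqint_def power_mult_distrib)

lemma sqint_uminus: "sqint M u \<Longrightarrow> sqint M (\<lambda>x. - u x)"
  by (simp add: sqint_def)

lemma sqint_add:
  assumes "sqint M u" "sqint M v" shows "sqint M (\<lambda>x. u x + v x)"
proof -
  have "integrable M (\<lambda>x. (u x)\<^sup>2 + 2 * (u x * v x) + (v x)\<^sup>2)"
    using assms sqint_mult_integrable[OF assms] by (auto simp: sqint_def)
  then show ?thesis using assms by (auto simp: sqint_def power2_sum algebra_simps)
qed

lemma sqint_diff: "sqint M u \<Longrightarrow> sqint M v \<Longrightarrow> sqint M (\<lambda>x. u x - v x)"
  using sqint_add[OF _ sqint_uminus, of M u v] by simp

lemma sqint_sum: "finite I \<Longrightarrow> (\<And>i. i \<in> I \<Longrightarrow> sqint M (u i)) \<Longrightarrow> sqint M (\<lambda>x. \<Sum>i\<in>I. u i x)"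
  by (induction I rule: finite_induct) (auto intro: sqint_add sqint_zero)

lemma sqint_bounded:
  assumes "finite_measure M" "u \<in> borel_measurable M" "AE x in M. \<bar>u x\<bar> \<le> B"
  shows "sqint M u"
proof -
  interpret finite_measure M by fact
  have "integrable M (\<lambda>x. (u x)\<^sup>2)"
  proof (rule integrable_const_bound)
    show "AE x in M. norm ((u x)\<^sup>2) \<le> B\<^sup>2"
      using assms(3) by eventually_elim (metis abs_ge_zero norm_power power_mono real_norm_def)
  qed (use assms in auto)
  then show ?thesis using assms by (auto simp: sqint_def)
qed

lemma sqint_integrable:
  assumes "finite_measure M" "sqint M u" shows "integrable M u"
  using sqint_mult_integrable[OF assms(2) sqint_bounded[OF assms(1), of "\<lambda>x. 1" 1]] by simp

text \<open>The discriminant criterion behind Cauchy-Schwarz. Admitting \<open>C = 0\<close> covers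
  functions that vanish almost everywhere without a case split there.\<close>

lemma quadratic_discriminant_nonneg:
  fixes A B C :: real
  assumes "\<And>t. 0 \<le> A + 2 * t * B + t\<^sup>2 * C" and "0 \<le> C"
  shows "B\<^sup>2 \<le> A * C"
proof (cases "C = 0")
  case True
  have "B = 0"
  proof (rule ccontr)
    assume "B \<noteq> 0"
    \<comment> \<open>For \<open>C = 0\<close> the polynomial is affine in \<open>t\<close>, and at
      this point it takes the value -1.\<close>
    with assms(1)[of "-(A + 1) / (2 * B)"] True show False by (simp add: field_simps)
  qed
  then show ?thesis using True by simp
next
  case False
  with assms have "C > 0" by simp
  have "0 \<le> A + 2 * (- B / C) * B + (- B / C)\<^sup>2 * C" by (rule assms)
  also have "\<dots> = A - B\<^sup>2 / C" using \<open>C > 0\<close> by (simp add: field_simps power2_eq_square)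
  finally show ?thesis using \<open>C > 0\<close> by (simp add: field_simps)
qed

lemma Cauchy_Schwarz_integral:
  assumes "sqint M u" "sqint M v"
  shows "(\<integral>x. u x * v x \<partial>M)\<^sup>2 \<le> (\<integral>x. (u x)\<^sup>2 \<partial>M) * (\<integral>x. (v x)\<^sup>2 \<partial>M)"
proof (rule quadratic_discriminant_nonneg)
  fix t :: real
  have "0 \<le> (\<integral>x. (u x + t * v x)\<^sup>2 \<partial>M)" by simp
  also have "\<dots> = (\<integral>x. (u x)\<^sup>2 + 2 * t * (u x * v x) + t\<^sup>2 * (v x)\<^sup>2 \<partial>M)"
    by (simp add: power2_sum power_mult_distrib algebra_simps)
  also have "\<dots> = (\<integral>x. (u x)\<^sup>2 \<partial>M) + 2 * t * (\<integral>x. u x * v x \<partial>M) + t\<^sup>2 * (\<integral>x. (v x)\<^sup>2 \<partial>M)"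
    using assms sqint_mult_integrable[OF assms] by (simp add: sqint_def)
  finally show "0 \<le> (\<integral>x. (u x)\<^sup>2 \<partial>M) + 2 * t * (\<integral>x. u x * v x \<partial>M) + t\<^sup>2 * (\<integral>x. (v x)\<^sup>2 \<partial>M)" .
qed simp

lemma integral_sq_add_le:
  assumes "sqint M u" "sqint M v"
  shows "(\<integral>x. (u x + v x)\<^sup>2 \<partial>M) \<le> 2 * (\<integral>x. (u x)\<^sup>2 \<partial>M) + 2 * (\<integral>x. (v x)\<^sup>2 \<partial>M)"
proof -
  have "(\<integral>x. (u x + v x)\<^sup>2 \<partial>M) \<le> (\<integral>x. 2 * (u x)\<^sup>2 + 2 * (v x)\<^sup>2 \<partial>M)"
  proof (rule integral_mono)
    show "integrable M (\<lambda>x. (u x + v x)\<^sup>2)" using sqint_add[OF assms] by (simp add: sqint_def)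
    show "(u x + v x)\<^sup>2 \<le> 2 * (u x)\<^sup>2 + 2 * (v x)\<^sup>2" for x
      using sum_squares_bound[of "u x" "v x"] by (simp add: power2_sum)
  qed (use assms in \<open>auto simp: sqint_def\<close>)
  then show ?thesis using assms by (simp add: sqint_def)
qed

lemma integral_sq_triangle:
  assumes "sqint M u" "sqint M v" "sqint M w"
  shows "(\<integral>x. (u x - w x)\<^sup>2 \<partial>M) \<le> 2 * (\<integral>x. (u x - v x)\<^sup>2 \<partial>M) + 2 * (\<integral>x. (v x - w x)\<^sup>2 \<partial>M)"
  using integral_sq_add_le[OF sqint_diff[OF assms(1,2)] sqint_diff[OF assms(2,3)]] by simp

text \<open>Strong convergence implies weak convergence. Coefficients, weak derivatives and
  integrals against test functions pass to the limit in this way.\<close>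

lemma integral_mult_tendsto:
  assumes u: "\<And>n. sqint M (u n)" "sqint M g" and v: "sqint M v"
    and lim: "(\<lambda>n. \<integral>x. (u n x - g x)\<^sup>2 \<partial>M) \<longlonglongrightarrow> 0"
  shows "(\<lambda>n. \<integral>x. u n x * v x \<partial>M) \<longlonglongrightarrow> (\<integral>x. g x * v x \<partial>M)"
proof -
  have "(\<lambda>n. sqrt ((\<integral>x. (u n x - g x)\<^sup>2 \<partial>M) * (\<integral>x. (v x)\<^sup>2 \<partial>M))) \<longlonglongrightarrow> sqrt (0 * (\<integral>x. (v x)\<^sup>2 \<partial>M))"
    by (intro tendsto_intros lim)
  then have z: "(\<lambda>n. sqrt ((\<integral>x. (u n x - g x)\<^sup>2 \<partial>M) * (\<integral>x. (v x)\<^sup>2 \<partial>M))) \<longlonglongrightarrow> 0" by simp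
  have "(\<lambda>n. (\<integral>x. u n x * v x \<partial>M) - (\<integral>x. g x * v x \<partial>M)) \<longlonglongrightarrow> 0"
  proof (rule Lim_null_comparison[OF _ z], intro always_eventually allI)
    fix n
    have "(\<integral>x. u n x * v x \<partial>M) - (\<integral>x. g x * v x \<partial>M) = (\<integral>x. (u n x - g x) * v x \<partial>M)"
      using sqint_mult_integrable[OF u(1)[of n] v] sqint_mult_integrable[OF u(2) v] by (simp add: left_diff_distrib)
    moreover have "\<bar>\<integral>x. (u n x - g x) * v x \<partial>M\<bar> \<le> sqrt ((\<integral>x. (u n x - g x)\<^sup>2 \<partial>M) * (\<integral>x. (v x)\<^sup>2 \<partial>M))"
      using Cauchy_Schwarz_integral[OF sqint_diff[OF u] v] by (simp add: real_le_rsqrt)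
    ultimately show "norm ((\<integral>x. u n x * v x \<partial>M) - (\<integral>x. g x * v x \<partial>M))
        \<le> sqrt ((\<integral>x. (u n x - g x)\<^sup>2 \<partial>M) * (\<integral>x. (v x)\<^sup>2 \<partial>M))" by simp
  qed
  then show ?thesis using LIM_zero_iff by blast
qed

lemma integral_sq_eq_0:
  assumes "sqint M u" shows "(\<integral>x. (u x)\<^sup>2 \<partial>M) = 0 \<longleftrightarrow> (AE x in M. u x = 0)"
  using integral_nonneg_eq_0_iff_AE[OF sqintD(2)[OF assms]] by simp

text \<open>Integrability of the limit is a conclusion, obtained from Fatou for the extended
  integral. The bound on the integrals is asked only eventually, because a Cauchy bound holds only
  from some index on.\<close>

lemma Fatou_bound:
  fixes f :: "nat \<Rightarrow> 'a \<Rightarrow> real"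
  assumes f: "\<And>n. integrable M (f n)" "\<And>n. AE x in M. 0 \<le> f n x"
    and g: "g \<in> borel_measurable M" "AE x in M. (\<lambda>n. f n x) \<longlonglongrightarrow> g x"
    and C: "\<forall>\<^sub>F n in sequentially. (\<integral>x. f n x \<partial>M) \<le> C"
  shows "integrable M g" "(\<integral>x. g x \<partial>M) \<le> C" "AE x in M. 0 \<le> g x"
proof -
  have "AE x in M. \<forall>n. 0 \<le> f n x" using f(2) by (simp add: AE_all_countable)
  with g(2) show pos: "AE x in M. 0 \<le> g x"
    by eventually_elim (blast intro: LIMSEQ_le_const)
  have "(\<integral>\<^sup>+x. ennreal (g x) \<partial>M) = (\<integral>\<^sup>+x. liminf (\<lambda>n. ennreal (f n x)) \<partial>M)"
  proof (rule nn_integral_cong_AE)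
    show "AE x in M. ennreal (g x) = liminf (\<lambda>n. ennreal (f n x))"
      using g(2) by eventually_elim
        (metis lim_imp_Liminf sequentially_bot tendsto_ennrealI)
  qed
  also have "\<dots> \<le> liminf (\<lambda>n. \<integral>\<^sup>+x. ennreal (f n x) \<partial>M)"
    by (rule nn_integral_liminf) (use f in auto)
  also have "\<dots> \<le> limsup (\<lambda>n. \<integral>\<^sup>+x. ennreal (f n x) \<partial>M)"
    by (rule Liminf_le_Limsup) simp
  also have "\<dots> \<le> ennreal C"
  proof (rule Limsup_bounded)
    show "\<forall>\<^sub>F n in sequentially. (\<integral>\<^sup>+x. ennreal (f n x) \<partial>M) \<le> ennreal C"
      using C by eventually_elim (use f in \<open>auto simp: nn_integral_eq_integral intro!: ennreal_leI\<close>)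
  qed
  finally have le: "(\<integral>\<^sup>+x. ennreal (g x) \<partial>M) \<le> ennreal C" .
  show int: "integrable M g"
    by (rule integrableI_nonneg[OF g(1) pos]) (use le in \<open>simp add: le_less_trans ennreal_less_top\<close>)
  obtain N where "(\<integral>x. f N x \<partial>M) \<le> C" using C eventually_happens' sequentially_bot by blast
  moreover have "0 \<le> (\<integral>x. f N x \<partial>M)" using f(2) by (rule integral_nonneg_AE)
  ultimately have "0 \<le> C" by linarith
  moreover have "ennreal (\<integral>x. g x \<partial>M) \<le> ennreal C"
    using le nn_integral_eq_integral[OF int pos] by simp
  ultimately show "(\<integral>x. g x \<partial>M) \<le> C" by simp
qed

text \<open>Tonelli: the integral of the sum of the absolute values is finite, so the sum is finite
  almost everywhere.\<close>

lemma AE_summable_of_integrals: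
  fixes f :: "nat \<Rightarrow> 'a \<Rightarrow> real"
  assumes f: "\<And>n. integrable M (f n)" and s: "summable (\<lambda>n. \<integral>x. \<bar>f n x\<bar> \<partial>M)"
  shows "AE x in M. summable (\<lambda>n. \<bar>f n x\<bar>)"
proof -
  have "(\<integral>\<^sup>+x. (\<Sum>n. ennreal \<bar>f n x\<bar>) \<partial>M) = (\<Sum>n. \<integral>\<^sup>+x. ennreal \<bar>f n x\<bar> \<partial>M)"
    by (rule nn_integral_suminf) (use f in auto)
  also have "\<dots> = (\<Sum>n. ennreal (\<integral>x. \<bar>f n x\<bar> \<partial>M))"
    by (intro suminf_cong nn_integral_eq_integral) (use f in auto)
  also have "\<dots> < \<infinity>"
    by (subst suminf_ennreal2) (use s in auto)
  finally have "AE x in M. (\<Sum>n. ennreal \<bar>f n x\<bar>) \<noteq> \<infinity>"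
    by (intro nn_integral_PInf_AE) (use f in auto)
  then show ?thesis
    by eventually_elim (auto intro!: summable_suminf_not_top)
qed

text \<open>A fast Cauchy subsequence converges almost everywhere because the space is finite.\<close>

lemma sqint_complete:
  assumes fin: "finite_measure M" and u: "\<And>n. sqint M (u n)"
    and cauchy: "\<And>\<epsilon>. \<epsilon> > 0 \<Longrightarrow> \<exists>N. \<forall>m\<ge>N. \<forall>n\<ge>N. (\<integral>x. (u m x - u n x)\<^sup>2 \<partial>M) \<le> \<epsilon>"
  obtains g where "sqint M g" "(\<lambda>n. \<integral>x. (u n x - g x)\<^sup>2 \<partial>M) \<longlonglongrightarrow> 0"
proof -
  interpret finite_measure M by fact
  \<comment> \<open>Squared distances of size \<open>(1/4)^j\<close> are distances of size
    \<open>(1/2)^j\<close>, which are summable.\<close>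
  have "\<exists>N. \<forall>j. \<forall>m\<ge>N j. \<forall>n\<ge>N j. (\<integral>x. (u m x - u n x)\<^sup>2 \<partial>M) \<le> (1/4)^j"
    by (intro choice allI cauchy) simp
  then obtain N where N: "\<And>j m n. m \<ge> N j \<Longrightarrow> n \<ge> N j \<Longrightarrow> (\<integral>x. (u m x - u n x)\<^sup>2 \<partial>M) \<le> (1/4)^j"
    by blast
  \<comment> \<open>The sum dominates every \<open>N i\<close> with \<open>i <= j\<close>, so
    \<open>r j\<close> and \<open>r (Suc j)\<close> both lie beyond \<open>N j\<close>; the summand
    \<open>j\<close> makes \<open>r\<close> tend to infinity.\<close>
  define r where "r j = (\<Sum>i\<le>j. N i) + j" for j
  have rN: "N j \<le> r j" "N j \<le> r (Suc j)" and rj: "j \<le> r j" for j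
  proof -
    have "N j \<le> sum N {..j}" by (rule member_le_sum) auto
    then show "N j \<le> r j" "N j \<le> r (Suc j)" "j \<le> r j" unfolding r_def by auto
  qed
  define d where "d j x = u (r (Suc j)) x - u (r j) x" for j x
  have d: "sqint M (d j)" for j unfolding d_def by (intro sqint_diff u)
  define c where "c = sqrt (measure M (space M))"
  have one: "sqint M (\<lambda>x. 1)" by (rule sqint_bounded[OF fin, of _ 1]) auto
  \<comment> \<open>Cauchy-Schwarz against the constant 1 passes from squared integrals to
    integrals; the finite total mass enters through \<open>c\<close>.\<close>
  have dle: "(\<integral>x. \<bar>d j x\<bar> \<partial>M) \<le> c * (1/2)^j" for j
  proof -
    have a: "sqint M (\<lambda>x. \<bar>d j x\<bar>)" using d[of j] by (auto simp: sqint_def)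
    have "(\<integral>x. \<bar>d j x\<bar> * 1 \<partial>M)\<^sup>2 \<le> (\<integral>x. \<bar>d j x\<bar>\<^sup>2 \<partial>M) * (\<integral>x. 1\<^sup>2 \<partial>M)"
      by (rule Cauchy_Schwarz_integral[OF a one])
    also have "\<dots> \<le> (1/4)^j * measure M (space M)"
      using N[OF rN(2) rN(1)] by (auto simp: d_def intro!: mult_right_mono)
    also have "\<dots> = (c * (1/2)^j)\<^sup>2"
    proof -
      have "((1/2)^j)\<^sup>2 = ((1/4)^j :: real)" by (simp add: power2_eq_square flip: power_mult_distrib)
      then show ?thesis unfolding power_mult_distrib by (simp add: c_def)
    qed
    finally have "(\<integral>x. \<bar>d j x\<bar> * 1 \<partial>M) \<le> c * (1/2)^j"
      by (rule power2_le_imp_le) (simp add: c_def)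
    then show ?thesis by simp
  qed
  have "summable (\<lambda>j. \<integral>x. \<bar>d j x\<bar> \<partial>M)"
    by (rule summable_comparison_test_ev[of _ "\<lambda>j. c * (1/2)^j"])
      (use dle in \<open>auto intro!: summable_mult summable_geometric always_eventually\<close>)
  then have "AE x in M. summable (\<lambda>j. \<bar>d j x\<bar>)"
    by (intro AE_summable_of_integrals sqint_integrable[OF fin d])
  then have conv: "AE x in M. convergent (\<lambda>j. u (r j) x)"
  proof eventually_elim
    case (elim x)
    then have "summable (\<lambda>j. d j x)" by (rule summable_rabs_cancel)
    then have "convergent (\<lambda>n. \<Sum>j<n. d j x)" by (simp add: summable_iff_convergent)
    moreover have "(\<Sum>j<n. d j x) = u (r n) x - u (r 0) x" for n
      unfolding d_def by (rule sum_lessThan_telescope)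
    ultimately have "convergent (\<lambda>n. (u (r n) x - u (r 0) x) + u (r 0) x)"
      by (intro convergent_add convergent_const) simp
    then show ?case by simp
  qed
  define g where "g x = lim (\<lambda>j. u (r j) x)" for x
  have gm: "g \<in> borel_measurable M"
    unfolding g_def[abs_def] by (rule borel_measurable_lim_metric) (use u in \<open>auto simp: sqint_def\<close>)
  have lim: "AE x in M. (\<lambda>j. u (r j) x) \<longlonglongrightarrow> g x"
    using conv by eventually_elim (simp add: g_def convergent_LIMSEQ_iff)
  \<comment> \<open>Fatou along the subsequence compares an arbitrary \<open>u n\<close> with the
    limit \<open>g\<close>, so the whole sequence inherits the Cauchy bound.\<close>
  have key: "integrable M (\<lambda>x. (u n x - g x)\<^sup>2)" "(\<integral>x. (u n x - g x)\<^sup>2 \<partial>M) \<le> \<epsilon>"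
    if "\<epsilon> > 0" and K: "\<And>m. m \<ge> K \<Longrightarrow> (\<integral>x. (u n x - u m x)\<^sup>2 \<partial>M) \<le> \<epsilon>" for n \<epsilon> K
  proof -
    have a: "integrable M (\<lambda>x. (u n x - u (r j) x)\<^sup>2)" for j
      using sqint_diff[OF u u] by (auto simp: sqint_def)
    have b: "AE x in M. (\<lambda>j. (u n x - u (r j) x)\<^sup>2) \<longlonglongrightarrow> (u n x - g x)\<^sup>2"
      using lim by eventually_elim (intro tendsto_intros)
    have c: "\<forall>\<^sub>F j in sequentially. (\<integral>x. (u n x - u (r j) x)\<^sup>2 \<partial>M) \<le> \<epsilon>"
      using eventually_ge_at_top[of K] by eventually_elim (rule K, use rj order_trans in blast)
    have m: "(\<lambda>x. (u n x - g x)\<^sup>2) \<in> borel_measurable M" using gm u[of n] by (auto simp: sqint_def)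
    show "integrable M (\<lambda>x. (u n x - g x)\<^sup>2)" "(\<integral>x. (u n x - g x)\<^sup>2 \<partial>M) \<le> \<epsilon>"
      using Fatou_bound[OF a _ m b c] by auto
  qed
  have "sqint M (\<lambda>x. u (N 0) x - g x)"
    using key(1)[of 1 "N 0" "N 0"] N[of 0 "N 0"] gm u[of "N 0"] by (auto simp: sqint_def)
  from sqint_diff[OF u[of "N 0"] this] have g: "sqint M g" by simp
  have "(\<lambda>n. \<integral>x. (u n x - g x)\<^sup>2 \<partial>M) \<longlonglongrightarrow> 0"
  proof (rule LIMSEQ_I)
    fix \<epsilon> :: real assume "\<epsilon> > 0"
    then obtain K where K: "\<And>m n. m \<ge> K \<Longrightarrow> n \<ge> K \<Longrightarrow> (\<integral>x. (u m x - u n x)\<^sup>2 \<partial>M) \<le> \<epsilon> / 2"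
      using cauchy[of "\<epsilon>/2"] by auto
    have "norm ((\<integral>x. (u n x - g x)\<^sup>2 \<partial>M) - 0) < \<epsilon>" if "n \<ge> K" for n
      using key(2)[of "\<epsilon>/2" K n] K[OF that] \<open>\<epsilon> > 0\<close> by auto
    then show "\<exists>no. \<forall>n\<ge>no. norm ((\<integral>x. (u n x - g x)\<^sup>2 \<partial>M) - 0) < \<epsilon>" by blast
  qed
  with g show thesis by (rule that)
qed

lemma finite_measure_interval: "finite_measure (lebesgue_on {a<..<b::real})"
  by (rule finite_measure_lebesgue_on) (metis box_real(1) lmeasurable_box)

lemma continuous_imp_measurable_interval:
  "continuous_on {a<..<b} g \<Longrightarrow> g \<in> borel_measurable (lebesgue_on {a<..<b::real})" for g :: "real \<Rightarrow> real"
  by (rule continuous_imp_measurable_on_sets_lebesgue) auto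

lemma sqint_continuous:
  fixes g :: "real \<Rightarrow> real"
  assumes "continuous_on {a..b} g" shows "sqint (lebesgue_on {a<..<b}) g"
proof -
  have "bounded (g ` {a..b})" using assms compact_continuous_image compact_imp_bounded by blast
  then obtain B where B: "\<And>x. x \<in> {a..b} \<Longrightarrow> \<bar>g x\<bar> \<le> B"
    unfolding bounded_iff by force
  show ?thesis
  proof (rule sqint_bounded[OF finite_measure_interval, where B=B])
    show "g \<in> borel_measurable (lebesgue_on {a<..<b})"
      by (rule continuous_imp_measurable_interval)
        (rule continuous_on_subset[OF assms], auto)
    show "AE x in lebesgue_on {a<..<b}. \<bar>g x\<bar> \<le> B"
      by (rule AE_I2) (auto intro: B simp: less_imp_le)
  qed
qed

text \<open>Dominated convergence with majorant \<open>(u x)^2\<close>. The truncation supplies the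
  constant majorant used for approximation by continuous functions.\<close>

lemma sqint_bounded_dense:
  assumes u: "sqint M u" and "\<epsilon> > 0"
  obtains B where "(\<integral>x. (u x - max (- B) (min B (u x)))\<^sup>2 \<partial>M) < \<epsilon>" "B > 0"
proof -
  have m[measurable]: "u \<in> borel_measurable M" using u by (simp add: sqint_def)
  have "(\<lambda>n. \<integral>x. (u x - max (- real n) (min (real n) (u x)))\<^sup>2 \<partial>M) \<longlonglongrightarrow> (\<integral>x. 0 \<partial>M)"
  proof (rule integral_dominated_convergence[where w="\<lambda>x. (u x)\<^sup>2"])
    show "integrable M (\<lambda>x. (u x)\<^sup>2)" using u by (simp add: sqint_def)
    show "AE x in M. (\<lambda>n. (u x - max (- real n) (min (real n) (u x)))\<^sup>2) \<longlonglongrightarrow> 0"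
    proof (rule AE_I2, rule tendsto_eventually)
      fix x
      obtain K where "\<bar>u x\<bar> \<le> real K" using real_arch_simple by blast
      then show "\<forall>\<^sub>F n in sequentially. (u x - max (- real n) (min (real n) (u x)))\<^sup>2 = 0"
        by (intro eventually_sequentiallyI[of K]) (auto simp: max_def min_def)
    qed
    show "AE x in M. norm ((u x - max (- real n) (min (real n) (u x)))\<^sup>2) \<le> (u x)\<^sup>2" for n
    proof (rule AE_I2)
      fix x
      have "\<bar>u x - max (- real n) (min (real n) (u x))\<bar> \<le> \<bar>u x\<bar>" by (auto simp: max_def min_def)
      then show "norm ((u x - max (- real n) (min (real n) (u x)))\<^sup>2) \<le> (u x)\<^sup>2"
        by (simp add: abs_le_square_iff)
    qed
  qed auto
  then have "\<forall>\<^sub>F n in sequentially. (\<integral>x. (u x - max (- real n) (min (real n) (u x)))\<^sup>2 \<partial>M) < \<epsilon>"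
    using order_tendstoD(2)[of _ 0 sequentially \<epsilon>] \<open>\<epsilon> > 0\<close> by simp
  then have "\<exists>n>0. (\<integral>x. (u x - max (- real n) (min (real n) (u x)))\<^sup>2 \<partial>M) < \<epsilon>"
    using eventually_conj[OF _ eventually_gt_at_top[of 0]] eventually_happens' sequentially_bot by (metis (no_types, lifting))
  then show thesis using that by auto
qed

text \<open>\<open>measurable_on\<close> provides continuous functions converging off a negligible
  set, but without a bound. Truncating \<open>u\<close> first and clamping the approximations at the
  same level \<open>B\<close> makes dominated convergence applicable, because the clamp leaves the
  truncated function unchanged.\<close>

lemma continuous_dense_sqint:
  fixes u :: "real \<Rightarrow> real"
  assumes u: "sqint (lebesgue_on {a<..<b}) u" and "\<epsilon> > 0"
  obtains g where "continuous_on UNIV g" "(\<integral>x. (u x - g x)\<^sup>2 \<partial>lebesgue_on {a<..<b}) < \<epsilon>"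
proof -
  let ?M = "lebesgue_on {a<..<b}"
  obtain B where B: "(\<integral>x. (u x - max (- B) (min B (u x)))\<^sup>2 \<partial>?M) < \<epsilon>/4" "B > 0"
    using sqint_bounded_dense[OF u, of "\<epsilon>/4"] \<open>\<epsilon> > 0\<close> by auto
  define v where "v x = max (- B) (min B (u x))" for x
  have um[measurable]: "u \<in> borel_measurable ?M" using u by (simp add: sqint_def)
  have vm: "v \<in> borel_measurable ?M" unfolding v_def by measurable
  have vB: "\<bar>v x\<bar> \<le> B" for x using B(2) by (auto simp: v_def max_def min_def)
  have v: "sqint ?M v" by (rule sqint_bounded[OF finite_measure_interval vm]) (use vB in auto)
  have "v measurable_on {a<..<b}"
    using vm by (subst measurable_on_iff_borel_measurable) auto
  then obtain N g where N: "negligible N" and gc: "\<And>n. continuous_on UNIV (g n)"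
    and g: "\<And>x. x \<notin> N \<Longrightarrow> (\<lambda>n. g n x) \<longlonglongrightarrow> (if x \<in> {a<..<b} then v x else 0)"
    unfolding measurable_on_def by blast
  define G where "G n x = max (- B) (min B (g n x))" for n x
  have Gc: "continuous_on UNIV (G n)" for n unfolding G_def by (intro continuous_intros gc)
  have Gm: "G n \<in> borel_measurable ?M" for n
    by (rule continuous_imp_measurable_interval) (rule continuous_on_subset[OF Gc], simp)
  have GB: "\<bar>G n x\<bar> \<le> B" for n x using B(2) by (auto simp: G_def max_def min_def)
  have G: "sqint ?M (G n)" for n by (rule sqint_bounded[OF finite_measure_interval Gm]) (use GB in auto)
  have "N \<in> null_sets lebesgue" using N by (simp add: negligible_iff_null_sets)
  then have "AE x in lebesgue. x \<notin> N" by (rule AE_not_in)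
  then have AEN: "AE x in ?M. x \<notin> N" by (subst AE_restrict_space_iff) auto
  have "(\<lambda>n. \<integral>x. (v x - G n x)\<^sup>2 \<partial>?M) \<longlonglongrightarrow> (\<integral>x. 0 \<partial>?M)"
  proof (rule integral_dominated_convergence[where w="\<lambda>x. (2 * B)\<^sup>2"])
    show "integrable ?M (\<lambda>x. (2 * B)\<^sup>2)"
      using finite_measure_interval finite_measure.integrable_const by blast
    show "AE x in ?M. (\<lambda>n. (v x - G n x)\<^sup>2) \<longlonglongrightarrow> 0"
      using AEN
    proof (rule AE_mp, intro AE_I2 impI)
      fix x assume "x \<in> space ?M" "x \<notin> N"
      with g have "(\<lambda>n. g n x) \<longlonglongrightarrow> v x" by fastforce
      then have "(\<lambda>n. (v x - G n x)\<^sup>2) \<longlonglongrightarrow> (v x - max (- B) (min B (v x)))\<^sup>2"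
        unfolding G_def by (intro tendsto_intros)
      moreover have "max (- B) (min B (v x)) = v x" using vB[of x] by (auto simp: max_def min_def)
      ultimately show "(\<lambda>n. (v x - G n x)\<^sup>2) \<longlonglongrightarrow> 0" by simp
    qed
    show "AE x in ?M. norm ((v x - G n x)\<^sup>2) \<le> (2 * B)\<^sup>2" for n
    proof (rule AE_I2)
      fix x
      have "\<bar>v x - G n x\<bar> \<le> \<bar>2 * B\<bar>" using vB[of x] GB[of n x] by linarith
      then show "norm ((v x - G n x)\<^sup>2) \<le> (2 * B)\<^sup>2" by (simp add: abs_le_square_iff)
    qed
  qed (use vm Gm in auto)
  then have "\<forall>\<^sub>F n in sequentially. (\<integral>x. (v x - G n x)\<^sup>2 \<partial>?M) < \<epsilon>/4"
    using order_tendstoD(2)[of _ 0 sequentially "\<epsilon>/4"] \<open>\<epsilon> > 0\<close> by simp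
  then obtain n where n: "(\<integral>x. (v x - G n x)\<^sup>2 \<partial>?M) < \<epsilon>/4"
    using eventually_happens' sequentially_bot by blast
  have "(\<integral>x. (u x - G n x)\<^sup>2 \<partial>?M) \<le> 2 * (\<integral>x. (u x - v x)\<^sup>2 \<partial>?M) + 2 * (\<integral>x. (v x - G n x)\<^sup>2 \<partial>?M)"
    by (rule integral_sq_triangle[OF u v G])
  also have "\<dots> < \<epsilon>" using n B(1) by (simp add: v_def)
  finally show thesis using that Gc by blast
qed

section \<open>Orthonormal systems: Bessel, best approximation, Riesz-Fischer and Parseval\<close>

locale orthonormal_system = finite_measure M for M :: "'a measure" +
  fixes e :: "nat \<Rightarrow> 'a \<Rightarrow> real"
  assumes e_sqint: "\<And>k. sqint M (e k)"
    and ortho: "\<And>j k. (\<integral>x. e j x * e k x \<partial>M) = (if j = k then 1 else 0)"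
begin

definition partial :: "(nat \<Rightarrow> real) \<Rightarrow> nat \<Rightarrow> 'a \<Rightarrow> real" where
  "partial b n x = (\<Sum>k<n. b k * e k x)"

lemma partial_sqint: "sqint M (partial b n)"
  unfolding partial_def[abs_def] by (intro sqint_sum sqint_cmult e_sqint) auto

lemma integral_sum_mult:
  assumes "finite I" "sqint M v"
  shows "(\<integral>x. (\<Sum>k\<in>I. b k * e k x) * v x \<partial>M) = (\<Sum>k\<in>I. b k * (\<integral>x. e k x * v x \<partial>M))"
  using assms sqint_mult_integrable[OF e_sqint assms(2)]
  by (simp add: sum_distrib_right mult.assoc)

lemma integral_partial_mult:
  "sqint M v \<Longrightarrow> (\<integral>x. partial b n x * v x \<partial>M) = (\<Sum>k<n. b k * (\<integral>x. e k x * v x \<partial>M))"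
  unfolding partial_def by (rule integral_sum_mult) auto

lemma integral_partial_e: "(\<integral>x. partial b n x * e k x \<partial>M) = (if k < n then b k else 0)"
  by (simp add: integral_partial_mult[OF e_sqint] ortho if_distrib[of "(*) _"] cong: if_cong)

lemma integral_sum_sq:
  assumes "finite I"
  shows "(\<integral>x. (\<Sum>k\<in>I. b k * e k x)\<^sup>2 \<partial>M) = (\<Sum>k\<in>I. (b k)\<^sup>2)"
proof -
  have s: "sqint M (\<lambda>x. \<Sum>k\<in>I. b k * e k x)"
    by (intro sqint_sum sqint_cmult e_sqint assms)
  have "(\<integral>x. e j x * (\<Sum>k\<in>I. b k * e k x) \<partial>M) = b j" if "j \<in> I" for j
  proof -
    have "(\<integral>x. (\<Sum>k\<in>I. b k * e k x) * e j x \<partial>M) = (\<Sum>k\<in>I. b k * (if k = j then 1 else 0))"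
      by (simp only: integral_sum_mult[OF assms e_sqint] ortho)
    also have "\<dots> = b j" using that assms by (simp add: if_distrib[of "(*) _"] cong: if_cong)
    finally show ?thesis by (simp add: mult.commute)
  qed
  then show ?thesis
    using integral_sum_mult[OF assms s, of b] by (simp add: power2_eq_square)
qed

lemma integral_partial_sq: "(\<integral>x. (partial b n x)\<^sup>2 \<partial>M) = (\<Sum>k<n. (b k)\<^sup>2)"
  unfolding partial_def by (rule integral_sum_sq) auto

lemma integral_diff_partial_sq:
  assumes "sqint M v"
  shows "(\<integral>x. (v x - partial b n x)\<^sup>2 \<partial>M) =
    (\<integral>x. (v x)\<^sup>2 \<partial>M) - 2 * (\<Sum>k<n. b k * (\<integral>x. e k x * v x \<partial>M)) + (\<Sum>k<n. (b k)\<^sup>2)"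
proof -
  have "(\<integral>x. (v x - partial b n x)\<^sup>2 \<partial>M) =
     (\<integral>x. (v x)\<^sup>2 - 2 * (partial b n x * v x) + (partial b n x)\<^sup>2 \<partial>M)"
    by (simp add: power2_diff algebra_simps)
  also have "\<dots> = (\<integral>x. (v x)\<^sup>2 \<partial>M) - 2 * (\<integral>x. partial b n x * v x \<partial>M) + (\<integral>x. (partial b n x)\<^sup>2 \<partial>M)"
    using sqint_mult_integrable[OF partial_sqint[of b n] assms] assms partial_sqint[of b n]
    by (simp add: sqint_def)
  finally show ?thesis by (simp add: integral_partial_mult[OF assms] integral_partial_sq)
qed

definition cf :: "('a \<Rightarrow> real) \<Rightarrow> nat \<Rightarrow> real" where
  "cf v k = (\<integral>x. v x * e k x \<partial>M)"

lemma integral_diff_partial_cf: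
  assumes "sqint M v"
  shows "(\<integral>x. (v x - partial (cf v) n x)\<^sup>2 \<partial>M) = (\<integral>x. (v x)\<^sup>2 \<partial>M) - (\<Sum>k<n. (cf v k)\<^sup>2)"
  unfolding integral_diff_partial_sq[OF assms] cf_def
  by (simp add: power2_eq_square mult.commute)

lemma bessel:
  assumes "sqint M v"
  shows "(\<Sum>k<n. (cf v k)\<^sup>2) \<le> (\<integral>x. (v x)\<^sup>2 \<partial>M)"
proof -
  have "0 \<le> (\<integral>x. (v x - partial (cf v) n x)\<^sup>2 \<partial>M)" by simp
  then show ?thesis unfolding integral_diff_partial_cf[OF assms] by simp
qed

lemma bessel_summable:
  assumes "sqint M v"
  shows "summable (\<lambda>k. (cf v k)\<^sup>2)"
  by (rule bounded_imp_summable[where B="\<integral>x. (v x)\<^sup>2 \<partial>M"])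
    (simp_all only: lessThan_Suc_atMost[symmetric] bessel[OF assms] zero_le_power2)

text \<open>The two errors differ by the sum of the squares of \<open>b k - cf v k\<close>.\<close>

lemma best_approximation:
  assumes "sqint M v"
  shows "(\<integral>x. (v x - partial (cf v) n x)\<^sup>2 \<partial>M) \<le> (\<integral>x. (v x - partial b n x)\<^sup>2 \<partial>M)"
proof -
  have "0 \<le> (\<Sum>k<n. (b k - cf v k)\<^sup>2)" by (rule sum_nonneg) simp
  also have "\<dots> = (\<Sum>k<n. (b k)\<^sup>2) - 2 * (\<Sum>k<n. b k * cf v k) + (\<Sum>k<n. (cf v k)\<^sup>2)"
    by (simp add: power2_diff sum.distrib sum_subtractf sum_distrib_left mult.assoc algebra_simps)
  finally show ?thesis
    unfolding integral_diff_partial_cf[OF assms] integral_diff_partial_sq[OF assms]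
    by (simp add: cf_def mult.commute)
qed

text \<open>Coefficients are continuous functionals, and the k-th one of \<open>partial b n\<close>
  is constant once \<open>n > k\<close>. Completeness of the system is not assumed, so the result
  also serves for the cosines.\<close>

lemma cf_limit:
  assumes "sqint M g" "(\<lambda>n. \<integral>x. (partial b n x - g x)\<^sup>2 \<partial>M) \<longlonglongrightarrow> 0"
  shows "cf g = b" "(\<lambda>k. (b k)\<^sup>2) sums (\<integral>x. (g x)\<^sup>2 \<partial>M)"
proof -
  show cf: "cf g = b"
  proof
    fix k
    have "(\<lambda>n. \<integral>x. partial b n x * e k x \<partial>M) \<longlonglongrightarrow> (\<integral>x. g x * e k x \<partial>M)"
      by (rule integral_mult_tendsto[OF partial_sqint assms(1) e_sqint assms(2)])
    moreover have "(\<lambda>n. \<integral>x. partial b n x * e k x \<partial>M) \<longlonglongrightarrow> b k"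
      unfolding integral_partial_e
      by (rule tendsto_eventually, rule eventually_sequentiallyI[of "Suc k"]) auto
    ultimately show "cf g k = b k" unfolding cf_def by (rule LIMSEQ_unique)
  qed
  have "(\<integral>x. (partial b n x - g x)\<^sup>2 \<partial>M) = (\<integral>x. (g x)\<^sup>2 \<partial>M) - (\<Sum>k<n. (b k)\<^sup>2)" for n
    using integral_diff_partial_cf[OF assms(1), of n] by (simp add: cf power2_commute)
  then have "(\<lambda>n. (\<integral>x. (g x)\<^sup>2 \<partial>M) - ((\<integral>x. (g x)\<^sup>2 \<partial>M) - (\<Sum>k<n. (b k)\<^sup>2))) \<longlonglongrightarrow> (\<integral>x. (g x)\<^sup>2 \<partial>M) - 0"
    using assms(2) by (intro tendsto_intros) simp
  then show "(\<lambda>k. (b k)\<^sup>2) sums (\<integral>x. (g x)\<^sup>2 \<partial>M)" by (simp add: sums_def)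
qed

lemma riesz_fischer:
  assumes "summable (\<lambda>k. (b k)\<^sup>2)"
  obtains g where "sqint M g" "(\<lambda>n. \<integral>x. (partial b n x - g x)\<^sup>2 \<partial>M) \<longlonglongrightarrow> 0"
proof (rule sqint_complete[OF finite_measure_axioms partial_sqint[of b]])
  fix \<epsilon> :: real assume "\<epsilon> > 0"
  have mono: "\<exists>N. \<forall>m\<ge>N. \<forall>n\<ge>m. norm (sum (\<lambda>k. (b k)\<^sup>2) {m..<n}) < \<epsilon>"
    using assms \<open>\<epsilon> > 0\<close> unfolding summable_Cauchy by blast
  then obtain N where N: "\<And>m n. m \<ge> N \<Longrightarrow> n \<ge> m \<Longrightarrow> sum (\<lambda>k. (b k)\<^sup>2) {m..<n} \<le> \<epsilon>"
    by fastforce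
  have *: "(\<integral>x. (partial b n x - partial b m x)\<^sup>2 \<partial>M) = sum (\<lambda>k. (b k)\<^sup>2) {m..<n}" if "m \<le> n" for m n
  proof -
    have "partial b n x - partial b m x = (\<Sum>k\<in>{m..<n}. b k * e k x)" for x
      unfolding partial_def using sum_diff_nat_ivl[of 0 m n "\<lambda>k. b k * e k x"] that
      by (simp add: atLeast0LessThan)
    then show ?thesis by (simp add: integral_sum_sq)
  qed
  have "(\<integral>x. (partial b m x - partial b n x)\<^sup>2 \<partial>M) \<le> \<epsilon>" if "m \<ge> N" "n \<ge> N" for m n
  proof (cases "m \<le> n")
    case True
    then show ?thesis using *[OF True] N[OF that(1) True] by (simp add: power2_commute)
  next
    case False
    then show ?thesis using *[of n m] N[OF that(2), of m] by simp
  qed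
  then show "\<exists>N. \<forall>m\<ge>N. \<forall>n\<ge>N. (\<integral>x. (partial b m x - partial b n x)\<^sup>2 \<partial>M) \<le> \<epsilon>" by blast
qed (use that in blast)

end

text \<open>Separated from \<open>orthonormal_system\<close> because the cosines \<open>cs\<close>
  start at frequency \<open>pi\<close>: they are orthonormal but miss the constants.\<close>

locale complete_orthonormal_system = orthonormal_system +
  assumes dense: "\<And>v \<epsilon>. sqint M v \<Longrightarrow> \<epsilon> > 0 \<Longrightarrow> \<exists>b n. (\<integral>x. (v x - partial b n x)\<^sup>2 \<partial>M) < \<epsilon>"
begin

text \<open>Density yields a small error at one index; by \<open>integral_diff_partial_cf\<close>
  the errors of the Fourier sums decrease in \<open>n\<close>, so it stays small afterwards.\<close>

lemma partial_tendsto: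
  assumes v: "sqint M v"
  shows "(\<lambda>n. \<integral>x. (partial (cf v) n x - v x)\<^sup>2 \<partial>M) \<longlonglongrightarrow> 0"
proof (rule LIMSEQ_I)
  fix \<epsilon> :: real assume "\<epsilon> > 0"
  obtain b n where bn: "(\<integral>x. (v x - partial b n x)\<^sup>2 \<partial>M) < \<epsilon>" using dense[OF v \<open>\<epsilon> > 0\<close>] by blast
  have "norm ((\<integral>x. (partial (cf v) m x - v x)\<^sup>2 \<partial>M) - 0) < \<epsilon>" if "m \<ge> n" for m
  proof -
    have "(\<Sum>k<n. (cf v k)\<^sup>2) \<le> (\<Sum>k<m. (cf v k)\<^sup>2)" by (rule sum_mono2) (use that in auto)
    then have "(\<integral>x. (v x - partial (cf v) m x)\<^sup>2 \<partial>M) \<le> (\<integral>x. (v x - partial (cf v) n x)\<^sup>2 \<partial>M)"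
      unfolding integral_diff_partial_cf[OF v] by simp
    also have "\<dots> < \<epsilon>" using best_approximation[OF v, of n b] bn by simp
    finally show ?thesis by (simp add: power2_commute)
  qed
  then show "\<exists>no. \<forall>n\<ge>no. norm ((\<integral>x. (partial (cf v) n x - v x)\<^sup>2 \<partial>M) - 0) < \<epsilon>" by blast
qed

lemma parseval:
  assumes "sqint M v"
  shows "(\<lambda>k. (cf v k)\<^sup>2) sums (\<integral>x. (v x)\<^sup>2 \<partial>M)"
  using cf_limit(2)[OF assms partial_tendsto[OF assms]] .

lemma parseval_inner:
  assumes u: "sqint M u" and v: "sqint M v"
  shows "(\<lambda>k. cf u k * cf v k) sums (\<integral>x. u x * v x \<partial>M)"
proof -
  have "(\<lambda>n. \<integral>x. partial (cf u) n x * v x \<partial>M) \<longlonglongrightarrow> (\<integral>x. u x * v x \<partial>M)"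
    by (rule integral_mult_tendsto[OF partial_sqint u v partial_tendsto[OF u]])
  then show ?thesis
    unfolding sums_def integral_partial_mult[OF v] by (simp add: cf_def mult.commute)
qed

lemma cf_eq_imp_AE_eq:
  assumes u: "sqint M u" and v: "sqint M v" and eq: "cf u = cf v"
  shows "AE x in M. u x = v x"
proof -
  have "cf (\<lambda>x. u x - v x) k = 0" for k
    using sqint_mult_integrable[OF u e_sqint] sqint_mult_integrable[OF v e_sqint] fun_cong[OF eq, of k]
    unfolding cf_def by (simp add: left_diff_distrib)
  then have "(\<integral>x. (u x - v x)\<^sup>2 \<partial>M) = 0"
    using parseval[OF sqint_diff[OF u v]] by (simp add: sums_unique2)
  then have "AE x in M. u x - v x = 0"
    using integral_sq_eq_0[OF sqint_diff[OF u v]] by simp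
  then show ?thesis by simp
qed

end

section \<open>Sine and cosine series on the unit interval\<close>

lemma LINT_interval_eq:
  fixes g :: "real \<Rightarrow> real"
  assumes "continuous_on {a..b} g"
  shows "(LINT x|lebesgue_on {a<..<b}. g x) = integral {a..b} g"
proof -
  have "integrable (lebesgue_on {a<..<b}) g"
    by (rule sqint_integrable[OF finite_measure_interval sqint_continuous[OF assms]])
  then show ?thesis
    by (simp add: lebesgue_integral_eq_integral integral_open_interval_real)
qed

lemma LINT_FTC:
  fixes F f :: "real \<Rightarrow> real"
  assumes "a \<le> b" and F: "\<And>x. x \<in> {a..b} \<Longrightarrow> (F has_real_derivative f x) (at x within {a..b})"
    and f: "continuous_on {a..b} f"
  shows "(LINT x|lebesgue_on {a<..<b}. f x) = F b - F a"
proof -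
  have "(f has_integral (F b - F a)) {a..b}"
    by (rule fundamental_theorem_of_calculus)
      (use assms in \<open>auto simp: has_real_derivative_iff_has_vector_derivative\<close>)
  then show ?thesis by (simp add: LINT_interval_eq[OF f] integral_unique)
qed

text \<open>The squares \<open>(om k)^2\<close> are the Dirichlet eigenvalues of minus the second
  derivative on \<Omega>. Indices are shifted by one, so \<open>sn 0\<close> is the lowest
  eigenfunction; the factor \<open>sqrt 2\<close> normalises it.\<close>

definition om :: "nat \<Rightarrow> real" where "om k = (real k + 1) * pi"
definition sn :: "nat \<Rightarrow> real \<Rightarrow> real" where "sn k x = sqrt 2 * sin (om k * x)"
definition cs :: "nat \<Rightarrow> real \<Rightarrow> real" where "cs k x = sqrt 2 * cos (om k * x)"

lemma om_pos: "om k > 0" by (simp add: om_def)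
lemma om_ge_1: "om k \<ge> 1"
proof -
  have "1 * 1 \<le> (real k + 1) * pi" by (rule mult_mono) (use pi_gt3 in auto)
  then show ?thesis by (simp add: om_def)
qed
lemma sin_om: "sin (om k) = 0"
  using sin_npi[of "Suc k"] by (simp add: om_def algebra_simps)

lemma sn_deriv: "(sn k has_real_derivative om k * cs k x) (at x within S)"
  unfolding sn_def[abs_def] cs_def by (auto intro!: derivative_eq_intros simp: algebra_simps)
lemma cs_deriv: "(cs k has_real_derivative - om k * sn k x) (at x within S)"
  unfolding cs_def[abs_def] sn_def by (auto intro!: derivative_eq_intros simp: algebra_simps)
lemma sn_cont: "continuous_on S (sn k)"
  unfolding sn_def[abs_def] by (intro continuous_intros)
lemma cs_cont: "continuous_on S (cs k)"
  unfolding cs_def[abs_def] by (intro continuous_intros)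
lemma sn_bound: "\<bar>sn k x\<bar> \<le> sqrt 2"
  using mult_left_mono[OF abs_sin_le_one, of "sqrt 2"] by (simp add: sn_def abs_mult)
lemma sn_0: "sn k 0 = 0" and sn_1: "sn k 1 = 0"
  by (simp_all add: sn_def sin_om)
lemma sn_sqint: "sqint (lebesgue_on \<Omega>) (sn k)"
  by (rule sqint_continuous[OF sn_cont])
lemma cs_sqint: "sqint (lebesgue_on \<Omega>) (cs k)"
  by (rule sqint_continuous[OF cs_cont])

lemma LINT_cos:
  assumes "sin m = 0" "m \<noteq> 0" shows "(LINT x|lebesgue_on \<Omega>. cos (m * x)) = 0"
proof -
  have "(LINT x|lebesgue_on \<Omega>. cos (m * x)) = sin (m * 1) / m - sin (m * 0) / m"
    by (rule LINT_FTC) (auto intro!: derivative_eq_intros continuous_intros simp: assms)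
  then show ?thesis using assms by simp
qed

lemma LINT_const_\<Omega>: "(LINT x|lebesgue_on \<Omega>. c :: real) = c"
  using LINT_FTC[of 0 1 "\<lambda>x. c * x" "\<lambda>x. c"] by (auto intro!: derivative_eq_intros)

lemma sin_om_diff_sum: "sin (om j - om k) = 0" "sin (om j + om k) = 0"
  by (simp_all add: sin_diff sin_add sin_om)

lemma LINT_cos_om_diff: "(LINT x|lebesgue_on \<Omega>. cos ((om j - om k) * x)) = (if j = k then 1 else 0)"
proof (cases "j = k")
  case False
  then have "om j - om k \<noteq> 0" by (auto simp: om_def)
  then show ?thesis using LINT_cos[OF sin_om_diff_sum(1)] False by simp
qed (simp add: LINT_const_\<Omega> del: lebesgue_integral_const)

lemma LINT_cos_om_sum: "(LINT x|lebesgue_on \<Omega>. cos ((om j + om k) * x)) = 0"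
  by (rule LINT_cos[OF sin_om_diff_sum(2)]) (use om_pos[of j] om_pos[of k] in auto)

lemma cos_mult_integrable: "integrable (lebesgue_on \<Omega>) (\<lambda>x. cos (m * x))" for m :: real
  by (intro sqint_integrable[OF finite_measure_interval] sqint_continuous continuous_intros)

lemma sn_ortho: "(LINT x|lebesgue_on \<Omega>. sn j x * sn k x) = (if j = k then 1 else 0)"
proof -
  have "sn j x * sn k x = cos ((om j - om k) * x) - cos ((om j + om k) * x)" for x
  proof -
    have "sn j x * sn k x = (sqrt 2 * sqrt 2) * (sin (om j * x) * sin (om k * x))"
      by (simp only: sn_def mult_ac)
    then show ?thesis by (simp add: sin_times_sin left_diff_distrib distrib_right)
  qed
  then show ?thesis
    by (simp add: cos_mult_integrable LINT_cos_om_diff LINT_cos_om_sum)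
qed

lemma cs_ortho: "(LINT x|lebesgue_on \<Omega>. cs j x * cs k x) = (if j = k then 1 else 0)"
proof -
  have "cs j x * cs k x = cos ((om j - om k) * x) + cos ((om j + om k) * x)" for x
  proof -
    have "cs j x * cs k x = (sqrt 2 * sqrt 2) * (cos (om j * x) * cos (om k * x))"
      by (simp only: cs_def mult_ac)
    then show ?thesis by (simp add: cos_times_cos left_diff_distrib distrib_right)
  qed
  then show ?thesis
    by (simp add: cos_mult_integrable LINT_cos_om_diff LINT_cos_om_sum)
qed

lemma sine_orthonormal: "orthonormal_system (lebesgue_on \<Omega>) sn"
  by (intro orthonormal_system.intro finite_measure_interval orthonormal_system_axioms.intro sn_sqint sn_ortho)

lemma cosine_orthonormal: "orthonormal_system (lebesgue_on \<Omega>) cs"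
  by (intro orthonormal_system.intro finite_measure_interval orthonormal_system_axioms.intro cs_sqint cs_ortho)

section \<open>Completeness of the sine system\<close>

inductive_set sine_span :: "(real \<Rightarrow> real) set" where
  sn: "sn k \<in> sine_span"
| zero: "(\<lambda>x. 0) \<in> sine_span"
| cmult: "s \<in> sine_span \<Longrightarrow> (\<lambda>x. c * s x) \<in> sine_span"
| add: "s \<in> sine_span \<Longrightarrow> t \<in> sine_span \<Longrightarrow> (\<lambda>x. s x + t x) \<in> sine_span"

lemma sine_span_partial:
  assumes "s \<in> sine_span" shows "\<exists>b n. s = (\<lambda>x. \<Sum>k<n. b k * sn k x)"
  using assms
proof induction
  case (sn k)
  have "sn k = (\<lambda>x. \<Sum>j<Suc k. (if j = k then 1 else 0) * sn j x)"
    by (simp add: if_distrib[of "\<lambda>z. z * _"] cong: if_cong)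
  then show ?case by (intro exI)
next
  case zero
  have "(\<lambda>x. 0) = (\<lambda>x. \<Sum>k<(0::nat). (\<lambda>k. 0) k * sn k x)" by simp
  then show ?case by (intro exI)
next
  case (cmult s c)
  then obtain b n where "s = (\<lambda>x. \<Sum>k<n. b k * sn k x)" by blast
  then have "(\<lambda>x. c * s x) = (\<lambda>x. \<Sum>k<n. (c * b k) * sn k x)"
    by (simp add: sum_distrib_left mult.assoc)
  then show ?case by (intro exI)
next
  case (add s t)
  then obtain b n b' n' where s: "s = (\<lambda>x. \<Sum>k<n. b k * sn k x)" and t: "t = (\<lambda>x. \<Sum>k<n'. b' k * sn k x)"
    by blast
  have ext: "(\<Sum>k<n. b k * sn k x) = (\<Sum>k<max n n'. (if k < n then b k else 0) * sn k x)" for b n n' x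
    by (rule sum.mono_neutral_cong_left) auto
  have "(\<lambda>x. s x + t x) = (\<lambda>x. \<Sum>k<max n n'. ((if k < n then b k else 0) + (if k < n' then b' k else 0)) * sn k x)"
    unfolding s t ext[where n=n and b=b and n'=n'] ext[where n=n' and b=b' and n'=n] max.commute[of n' n]
      distrib_right sum.distrib ..
  then show ?case by (intro exI)
qed

text \<open>The product formula turns a sine into the mean of its two neighbours. For
  \<open>k = 0\<close> the lower neighbour is \<open>sin 0 = 0\<close>, so the span of the sines is
  not left. Iterating this admits every polynomial in \<open>cos (pi * x)\<close> as a
  factor.\<close>

lemma sine_span_times_cos:
  assumes "s \<in> sine_span" shows "(\<lambda>x. s x * cos (pi * x)) \<in> sine_span"
  using assms
proof induction
  case (sn k)
  have id: "sn k x * cos (pi * x) = (1/2) * sn (Suc k) x + (1/2) * (if k = 0 then 0 else sn (k - 1) x)" for x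
  proof -
    have a: "om k * x + pi * x = om (Suc k) * x" by (simp add: om_def algebra_simps)
    have b: "om k * x - pi * x = (if k = 0 then 0 else om (k - 1) * x)"
      by (auto simp: om_def algebra_simps of_nat_diff)
    have "sn k x * cos (pi * x) = sqrt 2 * ((sin (om k * x + pi * x) + sin (om k * x - pi * x)) / 2)"
      unfolding sn_def by (subst mult.assoc) (simp only: sin_times_cos)
    also have "\<dots> = (1/2) * (sqrt 2 * sin (om k * x + pi * x)) + (1/2) * (sqrt 2 * sin (om k * x - pi * x))"
      by (simp add: algebra_simps)
    finally show ?thesis unfolding a b by (simp add: sn_def)
  qed
  have "(\<lambda>x. if k = 0 then 0 else sn (k - 1) x) \<in> sine_span"
    by (cases "k = 0") (auto intro: sine_span.intros)
  then show ?case unfolding id by (intro sine_span.intros)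
next
  case zero
  then show ?case by (simp add: sine_span.zero)
next
  case (cmult s c)
  then show ?case using sine_span.cmult[OF cmult.IH, of c] by (simp add: mult.assoc)
next
  case (add s t)
  then show ?case using sine_span.add[OF add.IH] by (simp add: distrib_right)
qed

lemma sine_span_times_polynomial:
  assumes "real_polynomial_function P" "s \<in> sine_span"
  shows "(\<lambda>x. s x * P (cos (pi * x))) \<in> sine_span"
  using assms
proof (induction arbitrary: s)
  case (linear f)
  obtain c where "f = (\<lambda>x. x * c)" using linear(1) real_bounded_linear by blast
  then have "(\<lambda>x. s x * f (cos (pi * x))) = (\<lambda>x. c * (s x * cos (pi * x)))" by (auto simp: algebra_simps)
  then show ?case using sine_span_times_cos[OF linear(2)] by (simp add: sine_span.cmult)
next
  case (const c)
  then show ?case using sine_span.cmult[OF const, of c] by (simp add: mult.commute)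
next
  case (add f g)
  then show ?case using sine_span.add[OF add.IH(1)[OF add.prems] add.IH(2)[OF add.prems]]
    by (simp add: distrib_left)
next
  case (mult f g)
  then show ?case using mult.IH(2)[OF mult.IH(1)[OF mult.prems]] by (simp add: mult.assoc)
qed

lemma continuous_bounded_01:
  fixes g :: "real \<Rightarrow> real"
  assumes "continuous_on {a..b} g"
  obtains B where "\<And>x. x \<in> {a..b} \<Longrightarrow> \<bar>g x\<bar> \<le> B" "B \<ge> 0"
proof -
  have "bounded (g ` {a..b})" using assms compact_continuous_image compact_imp_bounded by blast
  then obtain B where "\<And>x. x \<in> {a..b} \<Longrightarrow> \<bar>g x\<bar> \<le> B"
    unfolding bounded_iff by force
  then show thesis using that[of "max B 0"] by fastforce
qed

text \<open>Combinations of sines vanish at 0 and 1, which \<open>g\<close> need not do. The cutoff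
  factor equals 1 as soon as \<open>real n * sin (pi * x) >= 1\<close>, which happens at each
  interior point for large \<open>n\<close>.\<close>

lemma sin_pi_cutoff_dense:
  fixes g :: "real \<Rightarrow> real"
  assumes g: "continuous_on UNIV g" and "\<epsilon> > 0"
  obtains n where "n > 0" "(LINT x|lebesgue_on \<Omega>. (g x - g x * min 1 (real n * sin (pi * x)))\<^sup>2) < \<epsilon>"
proof -
  obtain B where B: "\<And>x. x \<in> {0..1} \<Longrightarrow> \<bar>g x\<bar> \<le> B" "B \<ge> 0"
    using continuous_bounded_01[OF continuous_on_subset[OF g]] by blast
  have "(\<lambda>n. LINT x|lebesgue_on \<Omega>. (g x - g x * min 1 (real n * sin (pi * x)))\<^sup>2) \<longlonglongrightarrow> (LINT x|lebesgue_on \<Omega>. 0)"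
  proof (rule integral_dominated_convergence[where w="\<lambda>x. B\<^sup>2"])
    show "integrable (lebesgue_on \<Omega>) (\<lambda>x. B\<^sup>2)"
      using finite_measure_interval finite_measure.integrable_const by blast
    show "(\<lambda>x. (g x - g x * min 1 (real n * sin (pi * x)))\<^sup>2) \<in> borel_measurable (lebesgue_on \<Omega>)" for n
      by (intro continuous_imp_measurable_interval continuous_intros continuous_on_subset[OF g]) auto
    have s: "0 < sin (pi * x)" if "x \<in> \<Omega>" for x
      by (rule sin_gt_zero) (use that in auto)
    show "AE x in lebesgue_on \<Omega>. (\<lambda>n. (g x - g x * min 1 (real n * sin (pi * x)))\<^sup>2) \<longlonglongrightarrow> 0"
    proof (rule AE_I2, rule tendsto_eventually)
      fix x assume "x \<in> space (lebesgue_on \<Omega>)"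
      then have x: "x \<in> \<Omega>" by simp
      obtain K where "1 < real K * sin (pi * x)" using reals_Archimedean3[OF s[OF x]] by blast
      then have K: "1 \<le> real n * sin (pi * x)" if "n \<ge> K" for n
        using mult_right_mono[of "real K" "real n" "sin (pi * x)"] that s[OF x] by linarith
      show "\<forall>\<^sub>F n in sequentially. (g x - g x * min 1 (real n * sin (pi * x)))\<^sup>2 = 0"
        by (rule eventually_sequentiallyI[of K]) (use K in \<open>auto simp: min_def\<close>)
    qed
    show "AE x in lebesgue_on \<Omega>. norm ((g x - g x * min 1 (real n * sin (pi * x)))\<^sup>2) \<le> B\<^sup>2" for n
    proof (rule AE_I2)
      fix x assume "x \<in> space (lebesgue_on \<Omega>)"
      then have x: "x \<in> \<Omega>" by simp
      have "0 \<le> real n * sin (pi * x)" using s[OF x] by simp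
      then have "\<bar>1 - min 1 (real n * sin (pi * x))\<bar> \<le> 1" by (auto simp: min_def)
      then have "\<bar>g x\<bar> * \<bar>1 - min 1 (real n * sin (pi * x))\<bar> \<le> B * 1"
        using B x by (intro mult_mono) auto
      moreover have "g x - g x * min 1 (real n * sin (pi * x)) = g x * (1 - min 1 (real n * sin (pi * x)))"
        by (simp add: algebra_simps)
      ultimately have "\<bar>g x - g x * min 1 (real n * sin (pi * x))\<bar> \<le> \<bar>B\<bar>"
        using B by (simp add: abs_mult)
      then show "norm ((g x - g x * min 1 (real n * sin (pi * x)))\<^sup>2) \<le> B\<^sup>2"
        by (simp add: abs_le_square_iff)
    qed
  qed auto
  then have "\<forall>\<^sub>F n in sequentially. (LINT x|lebesgue_on \<Omega>. (g x - g x * min 1 (real n * sin (pi * x)))\<^sup>2) < \<epsilon>"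
    using order_tendstoD(2)[of _ 0 sequentially "\<epsilon>"] \<open>\<epsilon> > 0\<close> by simp
  from eventually_conj[OF this eventually_gt_at_top[of 0]] show thesis
    using that eventually_happens' sequentially_bot by (metis (no_types, lifting))
qed

text \<open>Away from the endpoints a continuous function is \<open>sin (\<pi> x)\<close> times a continuous function
  of \<open>cos (\<pi> x)\<close>, so the Weierstrass theorem applies.\<close>

lemma sine_span_dense:
  assumes v: "sqint (lebesgue_on \<Omega>) v" and "\<epsilon> > 0"
  shows "\<exists>b n. (LINT x|lebesgue_on \<Omega>. (v x - (\<Sum>k<n. b k * sn k x))\<^sup>2) < \<epsilon>"
proof -
  let ?M = "lebesgue_on \<Omega>"
  obtain g where g: "continuous_on UNIV g" and vg: "(\<integral>x. (v x - g x)\<^sup>2 \<partial>?M) < \<epsilon>/12"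
    using continuous_dense_sqint[OF v, of "\<epsilon>/12"] \<open>\<epsilon> > 0\<close> by auto
  obtain n where n: "n > 0" and gn: "(LINT x|?M. (g x - g x * min 1 (real n * sin (pi * x)))\<^sup>2) < \<epsilon>/12"
    using sin_pi_cutoff_dense[OF g, of "\<epsilon>/12"] \<open>\<epsilon> > 0\<close> by auto
  define w where "w x = g x * min 1 (real n * sin (pi * x))" for x
  \<comment> \<open>The quotient of \<open>w\<close> by \<open>sin (pi * x)\<close>. It is
    continuous because the denominator is at least \<open>1 / real n\<close>; where the sine is
    smaller than that, the cutoff is exactly \<open>real n * sin (pi * x)\<close> and the sine
    cancels.\<close>
  define h where "h x = g x / max (sin (pi * x)) (1 / real n)" for x
  have hpos: "max (sin (pi * x)) (1 / real n) > 0" for x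
    using n by (simp add: less_max_iff_disj)
  have hc: "continuous_on S h" for S
    unfolding h_def using hpos by (intro continuous_intros continuous_on_subset[OF g]) (auto simp: less_le)
  have wh: "w x = sin (pi * x) * h x" if "x \<in> \<Omega>" for x
  proof (cases "sin (pi * x) \<ge> 1 / real n")
    case True
    then have "1 \<le> real n * sin (pi * x)" using n by (simp add: field_simps)
    moreover have "sin (pi * x) > 0" by (rule sin_gt_zero) (use that in auto)
    ultimately show ?thesis using True by (simp add: w_def h_def min_def max_def)
  next
    case False
    then have "real n * sin (pi * x) < 1" using n by (simp add: field_simps)
    then show ?thesis using False n by (simp add: w_def h_def min_def max_def)
  qed
  \<comment> \<open>Any \<delta> with \<delta>^2 < \<epsilon>/12 will do. Two triangle inequalities
    with factor 2 add up to 2 + 4 + 4 = 10 portions of \<epsilon>/12.\<close>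
  define \<delta> where "\<delta> = sqrt (\<epsilon>/13)"
  have \<delta>: "\<delta> > 0" "\<delta>\<^sup>2 < \<epsilon>/12" using \<open>\<epsilon> > 0\<close> by (auto simp: \<delta>_def)
  \<comment> \<open>Substituting \<open>y = cos (pi * x)\<close> maps [0,1] bijectively onto [-1,1],
    so a polynomial close to this function of \<open>y\<close> becomes a polynomial in
    \<open>cos (pi * x)\<close> close to \<open>h\<close>.\<close>
  have "continuous_on {-1..1} (\<lambda>y. h (arccos y / pi))"
    by (rule continuous_on_compose2[OF hc[of UNIV]]) (auto intro!: continuous_intros)
  then obtain P where P: "real_polynomial_function P"
    and hP: "\<And>y. y \<in> {-1..1} \<Longrightarrow> \<bar>h (arccos y / pi) - P y\<bar> < \<delta>"
    using Stone_Weierstrass_real_polynomial_function[of "{-1..1::real}" _ \<delta>] \<delta>(1) by (metis compact_Icc)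
  have "(\<lambda>x. ((1 / sqrt 2) * sn 0 x) * P (cos (pi * x))) \<in> sine_span"
    by (intro sine_span_times_polynomial[OF P] sine_span.intros)
  then obtain b m where bm: "(\<lambda>x. ((1 / sqrt 2) * sn 0 x) * P (cos (pi * x))) = (\<lambda>x. \<Sum>k<m. b k * sn k x)"
    using sine_span_partial by metis
  define p where "p x = (\<Sum>k<m. b k * sn k x)" for x
  have peq: "p x = sin (pi * x) * P (cos (pi * x))" for x
    using fun_cong[OF bm, of x] by (simp add: p_def sn_def om_def)
  have gs: "sqint ?M g" by (rule sqint_continuous) (rule continuous_on_subset[OF g], simp)
  have ws: "sqint ?M w" unfolding w_def
    by (intro sqint_continuous continuous_intros continuous_on_subset[OF g]) auto
  have ps: "sqint ?M p" unfolding p_def[abs_def] by (intro sqint_sum sqint_cmult sn_sqint) auto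
  have "(\<integral>x. (w x - p x)\<^sup>2 \<partial>?M) \<le> (\<integral>x. \<delta>\<^sup>2 \<partial>?M)"
  proof (rule integral_mono_AE)
    show "integrable ?M (\<lambda>x. (w x - p x)\<^sup>2)" using sqint_diff[OF ws ps] by (simp add: sqint_def)
    show "integrable ?M (\<lambda>x. \<delta>\<^sup>2)"
      using finite_measure_interval finite_measure.integrable_const by blast
    show "AE x in ?M. (w x - p x)\<^sup>2 \<le> \<delta>\<^sup>2"
    proof (rule AE_I2)
      fix x assume "x \<in> space ?M"
      then have x: "x \<in> \<Omega>" by simp
      have "arccos (cos (pi * x)) = pi * x" by (rule arccos_cos) (use x in auto)
      then have "\<bar>h x - P (cos (pi * x))\<bar> < \<delta>" using hP[of "cos (pi * x)"] by simp
      then have "\<bar>sin (pi * x)\<bar> * \<bar>h x - P (cos (pi * x))\<bar> \<le> 1 * \<delta>"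
        by (intro mult_mono) auto
      then have "\<bar>w x - p x\<bar> \<le> \<bar>\<delta>\<bar>" unfolding wh[OF x] peq
        using \<delta>(1) by (simp flip: right_diff_distrib add: abs_mult)
      then show "(w x - p x)\<^sup>2 \<le> \<delta>\<^sup>2" by (simp add: abs_le_square_iff)
    qed
  qed
  then have wp: "(\<integral>x. (w x - p x)\<^sup>2 \<partial>?M) < \<epsilon>/12" using \<delta>(2) unfolding LINT_const_\<Omega> by linarith
  have gw: "(\<integral>x. (g x - w x)\<^sup>2 \<partial>?M) < \<epsilon>/12" using gn by (simp add: w_def)
  have "(\<integral>x. (v x - p x)\<^sup>2 \<partial>?M) < \<epsilon>"
    using integral_sq_triangle[OF v gs ps] integral_sq_triangle[OF gs ws ps] vg wp gw \<open>\<epsilon> > 0\<close> by linarith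
  then show ?thesis unfolding p_def by blast
qed

interpretation sine: complete_orthonormal_system "lebesgue_on \<Omega>" sn
proof -
  interpret orthonormal_system "lebesgue_on \<Omega>" sn by (rule sine_orthonormal)
  show "complete_orthonormal_system (lebesgue_on \<Omega>) sn"
    by unfold_locales (use sine_span_dense in \<open>simp add: partial_def\<close>)
qed

interpretation cosine: orthonormal_system "lebesgue_on \<Omega>" cs
  by (rule cosine_orthonormal)

lemma L2_sqint: "u \<in> L2 \<Longrightarrow> sqint (lebesgue_on \<Omega>) u"
  by (simp add: L2_iff_sqint)

lemma L2_norm_sq: "(L2_norm u)\<^sup>2 = (LINT x|lebesgue_on \<Omega>. (u x)\<^sup>2)"
  by (simp add: L2_norm_def L2_inner_def power2_eq_square[symmetric])

lemma L2_norm_nonneg: "0 \<le> L2_norm u"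
  by (simp add: L2_norm_def L2_inner_def power2_eq_square[symmetric])

lemma L2_parseval: "u \<in> L2 \<Longrightarrow> (\<lambda>k. (sine.cf u k)\<^sup>2) sums (L2_norm u)\<^sup>2"
  unfolding L2_norm_sq by (intro sine.parseval L2_sqint)

lemma L2_inner_sums:
  "u \<in> L2 \<Longrightarrow> v \<in> L2 \<Longrightarrow> (\<lambda>k. sine.cf u k * sine.cf v k) sums L2_inner u v"
  unfolding L2_inner_def by (intro sine.parseval_inner L2_sqint)

section \<open>Test functions and weak derivatives\<close>

text \<open>\<open>test_functions\<close> speaks of iterated \<open>deriv\<close>, a choice
  operator. Explicit derivative witnesses make closure under sums, products and affine substitutions
  a plain induction; the translation back is \<open>smooth_iff_test\<close>.\<close>

primrec Cn :: "nat \<Rightarrow> (real \<Rightarrow> real) \<Rightarrow> bool" where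
  "Cn 0 f \<longleftrightarrow> True"
| "Cn (Suc n) f \<longleftrightarrow> (\<exists>f'. (\<forall>x. (f has_real_derivative f' x) (at x)) \<and> Cn n f')"

definition smooth :: "(real \<Rightarrow> real) \<Rightarrow> bool" where "smooth f \<longleftrightarrow> (\<forall>n. Cn n f)"

lemma Cn_SucD: "Cn (Suc n) f \<Longrightarrow> Cn n f"
proof (induction n arbitrary: f)
  case (Suc n)
  then obtain f' where "\<forall>x. (f has_real_derivative f' x) (at x)" "Cn (Suc n) f'" by auto
  with Suc.IH[of f'] show ?case by auto
qed simp

lemma Cn_const: "Cn n (\<lambda>x. c)"
  by (induction n arbitrary: c) (auto intro!: exI[of _ "\<lambda>x. 0"])

lemma Cn_add: "Cn n f \<Longrightarrow> Cn n g \<Longrightarrow> Cn n (\<lambda>x. f x + g x)"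
proof (induction n arbitrary: f g)
  case (Suc n)
  then obtain f' g' where "\<forall>x. (f has_real_derivative f' x) (at x)" "Cn n f'"
    "\<forall>x. (g has_real_derivative g' x) (at x)" "Cn n g'" by auto
  with Suc.IH[of f' g'] have "\<forall>x. ((\<lambda>x. f x + g x) has_real_derivative f' x + g' x) (at x)"
    "Cn n (\<lambda>x. f' x + g' x)" by (simp_all add: DERIV_add)
  then show ?case unfolding Cn.simps by (intro exI conjI)
qed simp

lemma Cn_mult: "Cn n f \<Longrightarrow> Cn n g \<Longrightarrow> Cn n (\<lambda>x. f x * g x)"
proof (induction n arbitrary: f g)
  case (Suc n)
  then obtain f' g' where *: "\<forall>x. (f has_real_derivative f' x) (at x)" "Cn n f'"
    "\<forall>x. (g has_real_derivative g' x) (at x)" "Cn n g'" by auto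
  have "Cn n (\<lambda>x. f' x * g x)" "Cn n (\<lambda>x. g' x * f x)"
    using Suc.IH * Cn_SucD[OF Suc.prems(1)] Cn_SucD[OF Suc.prems(2)] by auto
  then have "Cn n (\<lambda>x. f' x * g x + g' x * f x)" by (rule Cn_add)
  moreover have "\<forall>x. ((\<lambda>x. f x * g x) has_real_derivative f' x * g x + g' x * f x) (at x)"
    using * by (simp add: DERIV_mult)
  ultimately show ?case unfolding Cn.simps by (intro exI conjI)
qed simp

lemma Cn_affine: "Cn n f \<Longrightarrow> Cn n (\<lambda>x. f (c * x + d))"
proof (induction n arbitrary: f)
  case (Suc n)
  then obtain f' where *: "\<forall>x. (f has_real_derivative f' x) (at x)" "Cn n f'" by auto
  have "((\<lambda>x. f (c * x + d)) has_real_derivative f' (c * x + d) * c) (at x)" for x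
  proof (rule DERIV_chain2[where f=f and g="\<lambda>x. c * x + d"])
    show "(f has_real_derivative f' (c * x + d)) (at (c * x + d))" using *(1) by blast
    show "((\<lambda>x. c * x + d) has_real_derivative c) (at x)" by (auto intro!: derivative_eq_intros)
  qed
  moreover have "Cn n (\<lambda>x. f' (c * x + d) * c)" by (rule Cn_mult[OF Suc.IH[OF *(2)] Cn_const])
  ultimately show ?case unfolding Cn.simps by (intro exI conjI allI)
qed simp

lemma smooth_const: "smooth (\<lambda>x. c)"
  unfolding smooth_def by (intro allI Cn_const)

lemma smooth_add: "smooth f \<Longrightarrow> smooth g \<Longrightarrow> smooth (\<lambda>x. f x + g x)"
  unfolding smooth_def by (simp add: Cn_add)

lemma smooth_mult: "smooth f \<Longrightarrow> smooth g \<Longrightarrow> smooth (\<lambda>x. f x * g x)"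
  unfolding smooth_def by (simp add: Cn_mult)

lemma smooth_affine: "smooth f \<Longrightarrow> smooth (\<lambda>x. f (c * x + d))"
  unfolding smooth_def by (rule allI, rule Cn_affine[where f=f], erule spec)

lemma deriv_eqI:
  assumes "\<And>x. (f has_real_derivative f' x) (at x)" shows "deriv f = f'"
  by (rule ext, rule DERIV_imp_deriv, rule assms)

lemma smooth_deriv:
  assumes "smooth f" shows "(f has_real_derivative deriv f x) (at x)" "smooth (deriv f)"
proof -
  have "(\<forall>x. (f has_real_derivative deriv f x) (at x)) \<and> Cn n (deriv f)" for n
  proof -
    have "Cn (Suc n) f" using assms unfolding smooth_def by blast
    then obtain f' where f': "\<forall>x. (f has_real_derivative f' x) (at x)" "Cn n f'"
      unfolding Cn.simps by blast
    then have "deriv f = f'" by (intro deriv_eqI) blast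
    with f' show ?thesis by metis
  qed
  then show "(f has_real_derivative deriv f x) (at x)" "smooth (deriv f)"
    unfolding smooth_def by blast+
qed

lemma smooth_iff_test: "smooth f \<Longrightarrow> (deriv ^^ n) f field_differentiable at x"
proof -
  assume "smooth f"
  then have "smooth ((deriv ^^ n) f)"
  proof (induction n)
    case (Suc n)
    then show ?case using smooth_deriv(2) by simp
  qed simp
  then show ?thesis using smooth_deriv(1) field_differentiable_def by blast
qed

lemma smooth_trig: "Cn n (\<lambda>x. a * sin (c * x) + b * cos (c * x))"
proof (induction n arbitrary: a b)
  case (Suc n)
  have "\<forall>x. ((\<lambda>x. a * sin (c * x) + b * cos (c * x)) has_real_derivative
     (- b * c) * sin (c * x) + (a * c) * cos (c * x)) (at x)"
    by (auto intro!: derivative_eq_intros simp: algebra_simps)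
  with Suc[of "- b * c" "a * c"] show ?case unfolding Cn.simps by (intro exI conjI)
qed simp

lemma smooth_sn: "smooth (sn k)"
  unfolding smooth_def sn_def[abs_def] using smooth_trig[of _ "sqrt 2" "om k" 0] by simp

lemma smooth_partial: "smooth (\<lambda>x. \<Sum>k<(n::nat). b k * sn k x)"
proof (induction n)
  case (Suc n)
  then show ?case using smooth_add[OF Suc smooth_mult[OF smooth_const smooth_sn]] by simp
qed (simp add: smooth_const)

section \<open>Bump functions and cutoffs\<close>

definition bump :: "real poly \<Rightarrow> real \<Rightarrow> real" where
  "bump p x = (if x > 0 then poly p (1 / x) * exp (- (1 / x)) else 0)"

lemma poly_exp_tendsto_0: "((\<lambda>y::real. poly p y * exp (- y)) \<longlongrightarrow> 0) at_top"
proof -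
  have "((\<lambda>y::real. \<Sum>i\<le>degree p. coeff p i * (y ^ i / exp y)) \<longlongrightarrow> (\<Sum>i\<le>degree p. coeff p i * 0)) at_top"
    by (intro tendsto_intros tendsto_power_div_exp_0)
  then show ?thesis by (simp add: poly_altdef sum_distrib_right exp_minus divide_inverse mult.assoc)
qed

text \<open>With \<open>z = 1 / x\<close> the derivative of \<open>p(z) exp(-z)\<close> is
  \<open>z^2 (p(z) - p'(z)) exp(-z)\<close>, and \<open>[:0, 0, 1:]\<close> is the polynomial
  \<open>z^2\<close>. The family is therefore closed under differentiation, which reduces smoothness
  to one induction over all \<open>p\<close>.\<close>

lemma bump_deriv: "(bump p has_real_derivative bump ([:0, 0, 1:] * (p - pderiv p)) x) (at x)"
proof -
  consider "x > 0" | "x < 0" | "x = 0" by linarith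
  then show ?thesis
  proof cases
    case 1
    have d: "((\<lambda>x. poly p (1 / x) * exp (- (1 / x))) has_real_derivative
       bump ([:0, 0, 1:] * (p - pderiv p)) x) (at x)"
    proof (rule DERIV_cong)
      have d1: "((\<lambda>x. 1 / x) has_real_derivative - (1 / x)\<^sup>2) (at x)"
        using 1 by (auto intro!: derivative_eq_intros simp: power2_eq_square)
      show "((\<lambda>x. poly p (1 / x) * exp (- (1 / x))) has_real_derivative
          (poly (pderiv p) (1 / x) * - (1 / x)\<^sup>2) * exp (- (1 / x)) +
          (exp (- (1 / x)) * - (- (1 / x)\<^sup>2)) * poly p (1 / x)) (at x)"
        by (intro DERIV_mult DERIV_chain2[OF poly_DERIV d1] DERIV_chain2[OF DERIV_exp DERIV_minus[OF d1]])
    qed (use 1 in \<open>simp add: bump_def algebra_simps power2_eq_square\<close>)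
    show ?thesis
      by (rule has_field_derivative_transform_within_open[OF d, of "{0<..}"])
        (use 1 in \<open>auto simp: bump_def\<close>)
  next
    case 2
    have d: "((\<lambda>x. 0) has_real_derivative 0) (at x)" by simp
    have "(bump p has_real_derivative 0) (at x)"
      by (rule has_field_derivative_transform_within_open[OF d, of "{..<0}"])
        (use 2 in \<open>auto simp: bump_def\<close>)
    then show ?thesis using 2 by (simp add: bump_def)
  next
    case 3
    have "((\<lambda>h. (bump p (0 + h) - bump p 0) / h) \<longlongrightarrow> 0) (at_right 0)"
    proof -
      have "filterlim (\<lambda>h::real. 1 / h) at_top (at_right 0)"
        using filterlim_inverse_at_top_right by (simp add: inverse_eq_divide)
      \<comment> \<open>The right difference quotient at 0 is \<open>z p(z) exp(-z)\<close> with
        \<open>z = 1 / h\<close>, hence the extra factor \<open>[:0, 1:]\<close>.\<close>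
      from filterlim_compose[OF poly_exp_tendsto_0[of "[:0, 1:] * p"] this]
      have "((\<lambda>h. poly ([:0, 1:] * p) (1 / h) * exp (- (1 / h))) \<longlongrightarrow> 0) (at_right 0)" .
      moreover have "\<forall>\<^sub>F h in at_right 0. poly ([:0, 1:] * p) (1 / h) * exp (- (1 / h)) = (bump p (0 + h) - bump p 0) / h"
        by (auto simp: eventually_at_right_less bump_def eventually_at_filter intro!: always_eventually)
      ultimately show ?thesis by (rule Lim_transform_eventually)
    qed
    moreover have "((\<lambda>h. (bump p (0 + h) - bump p 0) / h) \<longlongrightarrow> 0) (at_left 0)"
      by (rule tendsto_eventually) (auto simp: bump_def eventually_at_filter)
    ultimately have "((\<lambda>h. (bump p (0 + h) - bump p 0) / h) \<longlongrightarrow> 0) (at 0)"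
      by (simp add: filterlim_at_split)
    then show ?thesis using 3 by (simp add: DERIV_def bump_def)
  qed
qed

lemma smooth_bump: "smooth (bump p)"
proof -
  have "Cn n (bump p)" for n
  proof (induction n arbitrary: p)
    case (Suc n)
    with bump_deriv show ?case unfolding Cn.simps by (intro exI conjI allI)
  qed simp
  then show ?thesis by (simp add: smooth_def)
qed

text \<open>\<open>e\<^sup>-\<^sup>1\<^sup>/\<^sup>y\<close> and its derivative, continued by zero.\<close>

definition bm :: "real \<Rightarrow> real" where "bm = bump 1"
definition bm' :: "real \<Rightarrow> real" where "bm' = bump ([:0, 0, 1:] * (1 - pderiv 1))"

lemma bm_deriv: "(bm has_real_derivative bm' x) (at x)"
  unfolding bm_def bm'_def by (rule bump_deriv)

lemma bm_smooth: "smooth bm" "smooth bm'"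
  by (simp_all add: bm_def bm'_def smooth_bump)

lemma bm_range: "0 \<le> bm y" "bm y \<le> 1"
  by (auto simp: bm_def bump_def)

lemma bm_eq_0: "y \<le> 0 \<Longrightarrow> bm y = 0"
  by (simp add: bm_def bump_def)

lemma bm'_eq:
  assumes "y > 0" shows "(y + 1) * bm' y = (1 / y + (1 / y)\<^sup>2) * exp (- (1 / y))"
proof -
  have "bm' y = (1 / y)\<^sup>2 * exp (- (1 / y))"
    using assms by (simp add: bm'_def bump_def pderiv_1 power2_eq_square)
  moreover have "(y + 1) * (1 / y)\<^sup>2 = 1 / y + (1 / y)\<^sup>2"
    using assms by (simp add: power2_eq_square add_divide_distrib distrib_right)
  ultimately show ?thesis by (simp add: mult.assoc[symmetric])
qed

text \<open>For \<open>y = n x - 1\<close> the weight \<open>y + 1\<close> is \<open>n x\<close>,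
  the form in which the derivative of a cutoff meets a function of size \<open>x\<close>. With
  \<open>z = 1 / y\<close> the claim follows from \<open>z + z^2 <= 2 exp z\<close>, a consequence
  of \<open>exp z >= 1 + z + z^2 / 2\<close>.\<close>

lemma bm'_bound: "\<bar>(y + 1) * bm' y\<bar> \<le> 2"
proof (cases "y > 0")
  case True
  define z where "z = 1 / y"
  have z: "z > 0" using True by (simp add: z_def)
  have "(y + 1) * bm' y = (z + z\<^sup>2) * exp (- z)"
    using bm'_eq[OF True] by (simp add: z_def)
  moreover have "z + z\<^sup>2 \<le> 2 * exp z" using exp_lower_Taylor_quadratic[of z] z by simp
  then have "(z + z\<^sup>2) * exp (- z) \<le> 2" by (simp add: exp_minus field_simps)
  ultimately show ?thesis using z by simp
qed (simp add: bm'_def bump_def)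

lemma bm_limits:
  fixes x :: real assumes "x > 0"
  shows "(\<lambda>n. bm (real n * x - 1)) \<longlonglongrightarrow> 1" "(\<lambda>n. (real n * x) * bm' (real n * x - 1)) \<longlonglongrightarrow> 0"
proof -
  have top: "filterlim (\<lambda>n. real n * x - 1) at_top sequentially"
    using assms by real_asymp
  have z: "(\<lambda>n. 1 / (real n * x - 1)) \<longlonglongrightarrow> 0"
    using assms by real_asymp
  have pos: "\<forall>\<^sub>F n in sequentially. real n * x - 1 > 0"
    using filterlim_at_top_dense[THEN iffD1, OF top, rule_format, of 0] by simp
  have "(\<lambda>n. exp (- (1 / (real n * x - 1)))) \<longlonglongrightarrow> exp (- 0)" by (intro tendsto_intros z)
  then have e: "(\<lambda>n. exp (- (1 / (real n * x - 1)))) \<longlonglongrightarrow> 1" by simp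
  show "(\<lambda>n. bm (real n * x - 1)) \<longlonglongrightarrow> 1"
    by (rule Lim_transform_eventually[OF e])
      (use pos in \<open>eventually_elim, simp add: bm_def bump_def\<close>)
  have "(\<lambda>n. (1 / (real n * x - 1) + (1 / (real n * x - 1))\<^sup>2) * exp (- (1 / (real n * x - 1)))) \<longlonglongrightarrow> (0 + 0\<^sup>2) * exp (- 0)"
    by (intro tendsto_intros z)
  then have l: "(\<lambda>n. (1 / (real n * x - 1) + (1 / (real n * x - 1))\<^sup>2) * exp (- (1 / (real n * x - 1)))) \<longlonglongrightarrow> 0" by simp
  show "(\<lambda>n. (real n * x) * bm' (real n * x - 1)) \<longlonglongrightarrow> 0"
  proof (rule Lim_transform_eventually[OF l])
    show "\<forall>\<^sub>F n in sequentially. (1 / (real n * x - 1) + (1 / (real n * x - 1))\<^sup>2) * exp (- (1 / (real n * x - 1)))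
        = (real n * x) * bm' (real n * x - 1)"
      using pos
    proof eventually_elim
      case (elim n)
      define y where "y = real n * x - 1"
      have "y > 0" "real n * x = y + 1" using elim by (auto simp: y_def)
      then show ?case
        unfolding y_def[symmetric] using bm'_eq[of y] by simp
    qed
  qed
qed

text \<open>A smooth cutoff supported in [1/n, 1 - 1/n]. As \<open>bm\<close> stays below 1, it is
  nowhere equal to 1 and only tends to 1 pointwise on \<Omega>; limits are therefore taken by
  dominated convergence.\<close>

definition cut :: "nat \<Rightarrow> real \<Rightarrow> real" where
  "cut n x = bm (real n * x - 1) * bm (real n * (1 - x) - 1)"

definition cut' :: "nat \<Rightarrow> real \<Rightarrow> real" where
  "cut' n x = real n * bm' (real n * x - 1) * bm (real n * (1 - x) - 1)
     - real n * bm (real n * x - 1) * bm' (real n * (1 - x) - 1)"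

lemma cut_deriv: "(cut n has_real_derivative cut' n x) (at x)"
proof -
  have 1: "((\<lambda>x. bm (real n * x - 1)) has_real_derivative bm' (real n * x - 1) * real n) (at x)"
    by (rule DERIV_chain2[OF bm_deriv]) (auto intro!: derivative_eq_intros)
  have 2: "((\<lambda>x. bm (real n * (1 - x) - 1)) has_real_derivative bm' (real n * (1 - x) - 1) * - real n) (at x)"
    by (rule DERIV_chain2[OF bm_deriv]) (auto intro!: derivative_eq_intros)
  show ?thesis
    unfolding cut_def[abs_def] by (rule DERIV_cong[OF DERIV_mult[OF 1 2]]) (simp add: cut'_def)
qed

lemma cut_smooth: "smooth (cut n)"
proof -
  have "smooth (\<lambda>x. bm (real n * x + (- 1)) * bm ((- real n) * x + (real n - 1)))"
    by (rule smooth_mult[OF smooth_affine[OF bm_smooth(1)] smooth_affine[OF bm_smooth(1)]])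
  moreover have "cut n = (\<lambda>x. bm (real n * x + (- 1)) * bm ((- real n) * x + (real n - 1)))"
    by (auto simp: cut_def fun_eq_iff algebra_simps)
  ultimately show ?thesis by simp
qed

lemma smooth_continuous: "smooth f \<Longrightarrow> continuous_on S f"
  by (intro continuous_at_imp_continuous_on ballI DERIV_isCont[OF smooth_deriv(1)])

lemma cut_cont: "continuous_on S (cut n)" "continuous_on S (cut' n)"
proof -
  show "continuous_on S (cut n)" by (rule smooth_continuous[OF cut_smooth])
  have "deriv (cut n) = cut' n" by (intro deriv_eqI cut_deriv)
  then show "continuous_on S (cut' n)" using smooth_continuous[OF smooth_deriv(2)[OF cut_smooth, of n]] by simp
qed

lemma cut_test:
  assumes g: "smooth g" shows "(\<lambda>x. g x * cut n x) \<in> test_functions \<Omega>"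
proof -
  let ?\<phi> = "\<lambda>x. g x * cut n x"
  let ?I = "{1 / real n .. 1 - 1 / real n}"
  \<comment> \<open>In HOL \<open>1 / real 0 = 0\<close>, so for \<open>n = 0\<close> the interval
    \<open>?I\<close> would be all of [0,1]; there \<open>cut 0\<close> vanishes identically and the
    support is empty.\<close>
  have supp: "{x. ?\<phi> x \<noteq> 0} \<subseteq> (if n = 0 then {} else ?I)"
  proof (cases "n = 0")
    case False
    have "x \<in> ?I" if "?\<phi> x \<noteq> 0" for x
    proof -
      have "real n * x - 1 > 0" "real n * (1 - x) - 1 > 0"
        using that bm_eq_0[of "real n * x - 1"] bm_eq_0[of "real n * (1 - x) - 1"]
        unfolding cut_def by (metis mult_zero_left mult_zero_right not_le)+
      then show ?thesis using False by (auto simp: field_simps)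
    qed
    then show ?thesis using False by auto
  qed (simp add: cut_def bm_eq_0)
  then have cl: "closure {x. ?\<phi> x \<noteq> 0} \<subseteq> (if n = 0 then {} else ?I)"
    by (rule closure_minimal) auto
  then have "bounded (closure {x. ?\<phi> x \<noteq> 0})"
    by (rule bounded_subset[rotated]) auto
  then have "compact (closure {x. ?\<phi> x \<noteq> 0})" by (simp add: compact_eq_bounded_closed)
  moreover have "(if n = 0 then {} else ?I) \<subseteq> \<Omega>"
  proof -
    have "x > 0 \<and> x < 1" if "n \<noteq> 0" "x \<ge> 1 / real n" "x \<le> 1 - 1 / real n" for x
    proof -
      have "1 / real n > 0" using that(1) by simp
      then show ?thesis using that by linarith
    qed
    then show ?thesis by auto
  qed
  ultimately show ?thesis
    using smooth_iff_test[OF smooth_mult[OF g cut_smooth]] cl unfolding test_functions_def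
    by (intro CollectI conjI allI) (assumption | rule order_trans)+
qed

lemma test_functionsD:
  assumes "\<phi> \<in> test_functions S"
  shows "(\<phi> has_real_derivative deriv \<phi> x) (at x)" "continuous_on A \<phi>" "continuous_on A (deriv \<phi>)"
    "x \<notin> S \<Longrightarrow> \<phi> x = 0"
proof -
  have d: "(deriv ^^ n) \<phi> field_differentiable at x" for n x using assms by (auto simp: test_functions_def)
  have d0: "\<And>x. \<phi> field_differentiable at x" using d[of 0] by simp
  have d1: "\<And>x. deriv \<phi> field_differentiable at x" using d[of 1] by simp
  show "(\<phi> has_real_derivative deriv \<phi> x) (at x)" using d0 by (simp add: DERIV_deriv_iff_field_differentiable)
  show "continuous_on A \<phi>"
    by (intro continuous_at_imp_continuous_on ballI field_differentiable_imp_continuous_at d0)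
  show "continuous_on A (deriv \<phi>)"
    by (intro continuous_at_imp_continuous_on ballI field_differentiable_imp_continuous_at d1)
  have "closure {x. \<phi> x \<noteq> 0} \<subseteq> S" using assms by (simp add: test_functions_def)
  with closure_subset have "{x. \<phi> x \<noteq> 0} \<subseteq> S" by (rule order_trans)
  then show "x \<notin> S \<Longrightarrow> \<phi> x = 0" by auto
qed

lemma test_function_sqint:
  assumes "\<phi> \<in> test_functions S" shows "sqint (lebesgue_on \<Omega>) \<phi>" "sqint (lebesgue_on \<Omega>) (deriv \<phi>)"
  by (rule sqint_continuous, rule test_functionsD[OF assms])+

text \<open>A function vanishing at the endpoints is \<open>O(x)\<close> there, which compensates the derivative of
  the cutoff.\<close>

lemma cut_approximation:
  assumes g: "smooth g" and g0: "g 0 = 0" "g 1 = 0"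
  shows "(\<lambda>n. LINT x|lebesgue_on \<Omega>. (g x * cut n x - g x)\<^sup>2) \<longlonglongrightarrow> 0"
    "(\<lambda>n. LINT x|lebesgue_on \<Omega>. (deriv (\<lambda>x. g x * cut n x) x - deriv g x)\<^sup>2) \<longlonglongrightarrow> 0"
proof -
  let ?M = "lebesgue_on \<Omega>"
  have gc: "continuous_on S g" "continuous_on S (deriv g)" for S
    by (rule smooth_continuous[OF g], rule smooth_continuous[OF smooth_deriv(2)[OF g]])
  obtain B where B: "\<And>x. x \<in> {0..1} \<Longrightarrow> \<bar>g x\<bar> \<le> B" "B \<ge> 0" using continuous_bounded_01[OF gc(1)] by blast
  obtain L where L: "\<And>x. x \<in> {0..1} \<Longrightarrow> \<bar>deriv g x\<bar> \<le> L" "L \<ge> 0" using continuous_bounded_01[OF gc(2)] by blast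
  have lip: "\<bar>g x - g y\<bar> \<le> L * \<bar>x - y\<bar>" if "x \<in> {0..1}" "y \<in> {0..1}" for x y
    using field_differentiable_bound[of "{0..1}" g "deriv g" L x y] that L smooth_deriv(1)[OF g]
    by (auto intro: has_field_derivative_at_within)
  have d: "deriv (\<lambda>x. g x * cut n x) x = deriv g x * cut n x + g x * cut' n x" for n x
    by (rule DERIV_imp_deriv[OF DERIV_cong[OF DERIV_mult[OF smooth_deriv(1)[OF g] cut_deriv]]]) simp
  have cut01: "0 \<le> cut n x" "cut n x \<le> 1" for n x
    unfolding cut_def using mult_le_one[OF bm_range(2) bm_range] by (simp_all add: bm_range)
  have cutlim: "(\<lambda>n. cut n x) \<longlonglongrightarrow> 1" if "x \<in> \<Omega>" for x
    unfolding cut_def using tendsto_mult[OF bm_limits(1)[of x] bm_limits(1)[of "1 - x"]] that by simp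
  \<comment> \<open>The left end is charged to \<open>|g x| <= L x\<close> and the right end to
    \<open>|g x| <= L (1 - x)\<close>, so each factor \<open>n\<close> of \<open>cut'\<close> meets
    the matching small factor.\<close>
  have gcut: "\<bar>g x * cut' n x\<bar> \<le> L * \<bar>(real n * x) * bm' (real n * x - 1)\<bar> + L * \<bar>(real n * (1 - x)) * bm' (real n * (1 - x) - 1)\<bar>"
    if "x \<in> \<Omega>" for x n
  proof -
    have 1: "\<bar>g x\<bar> \<le> L * x" "\<bar>g x\<bar> \<le> L * (1 - x)" using lip[of x 0] lip[of x 1] that g0 by auto
    have "\<bar>g x * cut' n x\<bar> \<le> \<bar>g x * (real n * bm' (real n * x - 1) * bm (real n * (1 - x) - 1))\<bar>
        + \<bar>g x * (real n * bm (real n * x - 1) * bm' (real n * (1 - x) - 1))\<bar>"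
      unfolding cut'_def right_diff_distrib by (rule abs_triangle_ineq4)
    also have "\<bar>g x * (real n * bm' (real n * x - 1) * bm (real n * (1 - x) - 1))\<bar>
        \<le> (L * x) * (real n * \<bar>bm' (real n * x - 1)\<bar> * 1)"
      unfolding abs_mult using 1 bm_range that L by (intro mult_mono) auto
    also have "\<bar>g x * (real n * bm (real n * x - 1) * bm' (real n * (1 - x) - 1))\<bar>
        \<le> (L * (1 - x)) * (real n * 1 * \<bar>bm' (real n * (1 - x) - 1)\<bar>)"
      unfolding abs_mult using 1 bm_range that L by (intro mult_mono) auto
    finally show ?thesis using that by (simp add: abs_mult mult_ac)
  qed
  have gcut4: "\<bar>g x * cut' n x\<bar> \<le> 4 * L" if "x \<in> \<Omega>" for x n
  proof -
    have "L * \<bar>(real n * x) * bm' (real n * x - 1)\<bar> \<le> L * 2"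
      "L * \<bar>(real n * (1 - x)) * bm' (real n * (1 - x) - 1)\<bar> \<le> L * 2"
      using bm'_bound[of "real n * x - 1"] bm'_bound[of "real n * (1 - x) - 1"] L
      by (auto intro!: mult_left_mono)
    with gcut[OF that, of n] show ?thesis by linarith
  qed
  have gcutlim: "(\<lambda>n. g x * cut' n x) \<longlonglongrightarrow> 0" if "x \<in> \<Omega>" for x
  proof (rule Lim_null_comparison[OF always_eventually])
    show "\<forall>n. norm (g x * cut' n x) \<le> L * \<bar>(real n * x) * bm' (real n * x - 1)\<bar> + L * \<bar>(real n * (1 - x)) * bm' (real n * (1 - x) - 1)\<bar>"
      using gcut[OF that] by simp
    have "(\<lambda>n. L * \<bar>(real n * x) * bm' (real n * x - 1)\<bar> + L * \<bar>(real n * (1 - x)) * bm' (real n * (1 - x) - 1)\<bar>)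
      \<longlonglongrightarrow> L * \<bar>0\<bar> + L * \<bar>0\<bar>"
      by (intro tendsto_intros bm_limits(2)) (use that in auto)
    then show "(\<lambda>n. L * \<bar>(real n * x) * bm' (real n * x - 1)\<bar> + L * \<bar>(real n * (1 - x)) * bm' (real n * (1 - x) - 1)\<bar>) \<longlonglongrightarrow> 0"
      by simp
  qed
  have "(\<lambda>n. LINT x|?M. (g x * cut n x - g x)\<^sup>2) \<longlonglongrightarrow> (LINT x|?M. 0)"
  proof (rule integral_dominated_convergence[where w="\<lambda>x. B\<^sup>2"])
    show "integrable ?M (\<lambda>x. B\<^sup>2)" using finite_measure_interval finite_measure.integrable_const by blast
    show "(\<lambda>x. (g x * cut n x - g x)\<^sup>2) \<in> borel_measurable ?M" for n
      by (intro continuous_imp_measurable_interval continuous_intros gc cut_cont)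
    show "AE x in ?M. (\<lambda>n. (g x * cut n x - g x)\<^sup>2) \<longlonglongrightarrow> 0"
    proof (rule AE_I2)
      fix x assume "x \<in> space ?M"
      then have "(\<lambda>n. (g x * cut n x - g x)\<^sup>2) \<longlonglongrightarrow> (g x * 1 - g x)\<^sup>2" by (intro tendsto_intros cutlim) simp
      then show "(\<lambda>n. (g x * cut n x - g x)\<^sup>2) \<longlonglongrightarrow> 0" by simp
    qed
    show "AE x in ?M. norm ((g x * cut n x - g x)\<^sup>2) \<le> B\<^sup>2" for n
    proof (rule AE_I2)
      fix x assume "x \<in> space ?M"
      then have "\<bar>g x\<bar> * \<bar>cut n x - 1\<bar> \<le> B * 1" using B cut01[of n x] by (intro mult_mono) auto
      then have "\<bar>g x * cut n x - g x\<bar> \<le> \<bar>B\<bar>" using B by (simp add: abs_mult[symmetric] right_diff_distrib)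
      then show "norm ((g x * cut n x - g x)\<^sup>2) \<le> B\<^sup>2" by (simp add: abs_le_square_iff)
    qed
  qed auto
  then show "(\<lambda>n. LINT x|?M. (g x * cut n x - g x)\<^sup>2) \<longlonglongrightarrow> 0" by simp
  have "(\<lambda>n. LINT x|?M. (deriv g x * cut n x + g x * cut' n x - deriv g x)\<^sup>2) \<longlonglongrightarrow> (LINT x|?M. 0)"
  proof (rule integral_dominated_convergence[where w="\<lambda>x. (5 * L)\<^sup>2"])
    show "integrable ?M (\<lambda>x. (5 * L)\<^sup>2)" using finite_measure_interval finite_measure.integrable_const by blast
    show "(\<lambda>x. (deriv g x * cut n x + g x * cut' n x - deriv g x)\<^sup>2) \<in> borel_measurable ?M" for n
      by (intro continuous_imp_measurable_interval continuous_intros gc cut_cont)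
    show "AE x in ?M. (\<lambda>n. (deriv g x * cut n x + g x * cut' n x - deriv g x)\<^sup>2) \<longlonglongrightarrow> 0"
    proof (rule AE_I2)
      fix x assume "x \<in> space ?M"
      then have "(\<lambda>n. (deriv g x * cut n x + g x * cut' n x - deriv g x)\<^sup>2) \<longlonglongrightarrow> (deriv g x * 1 + 0 - deriv g x)\<^sup>2"
        by (intro tendsto_intros cutlim gcutlim) simp_all
      then show "(\<lambda>n. (deriv g x * cut n x + g x * cut' n x - deriv g x)\<^sup>2) \<longlonglongrightarrow> 0" by simp
    qed
    show "AE x in ?M. norm ((deriv g x * cut n x + g x * cut' n x - deriv g x)\<^sup>2) \<le> (5 * L)\<^sup>2" for n
    proof (rule AE_I2)
      fix x assume "x \<in> space ?M"
      then have x: "x \<in> \<Omega>" by simp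
      then have "\<bar>deriv g x\<bar> * \<bar>cut n x - 1\<bar> \<le> L * 1" using L cut01[of n x] by (intro mult_mono) auto
      then have "\<bar>deriv g x * cut n x - deriv g x\<bar> \<le> L" by (simp add: abs_mult[symmetric] right_diff_distrib)
      then have "\<bar>deriv g x * cut n x + g x * cut' n x - deriv g x\<bar> \<le> \<bar>5 * L\<bar>" using gcut4[OF x, of n] by linarith
      then show "norm ((deriv g x * cut n x + g x * cut' n x - deriv g x)\<^sup>2) \<le> (5 * L)\<^sup>2" by (simp add: abs_le_square_iff)
    qed
  qed auto
  then show "(\<lambda>n. LINT x|?M. (deriv (\<lambda>x. g x * cut n x) x - deriv g x)\<^sup>2) \<longlonglongrightarrow> 0" by (simp add: d)
qed

section \<open>Weak derivatives and Sobolev spaces in terms of sine coefficients\<close>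

lemma integrable_locally_integrable:
  assumes S: "S \<in> sets lebesgue" and u: "integrable (lebesgue_on S) u"
  shows "locally_integrable_on u S"
  unfolding locally_integrable_on_def
proof (intro allI impI)
  fix K assume K: "compact K \<and> K \<subseteq> S"
  have "u absolutely_integrable_on S"
    using u S by (simp add: set_integrable_def integrable_restrict_space)
  then show "u absolutely_integrable_on K"
    by (rule set_integrable_subset) (use K in \<open>auto intro!: borel_closed compact_imp_closed sets_completionI_sets\<close>)
qed

lemma L2_locally_integrable: "u \<in> L2 \<Longrightarrow> locally_integrable_on u \<Omega>"
  by (intro integrable_locally_integrable sqint_integrable[OF finite_measure_interval] L2_sqint) auto

lemma has_weak_deriv_L2:
  assumes "u \<in> L2" "g \<in> L2"
  shows "has_weak_deriv u g \<longleftrightarrow> (\<forall>\<phi>\<in>test_functions \<Omega>.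
    (LINT x|lebesgue_on \<Omega>. u x * deriv \<phi> x) = - (LINT x|lebesgue_on \<Omega>. g x * \<phi> x))"
proof -
  have *: "- a = b \<longleftrightarrow> a = - b" for a b :: real by auto
  show ?thesis
    unfolding has_weak_deriv_def distr_deriv_def distr_of_def *
    using assms by (simp add: L2_locally_integrable)
qed

lemma classical_weak_deriv:
  assumes F: "\<And>x. (F has_real_derivative F' x) (at x)" and F': "continuous_on UNIV F'"
  shows "F \<in> L2" "F' \<in> L2" "has_weak_deriv F F'"
proof -
  have Fc: "continuous_on S F" for S
    by (intro continuous_at_imp_continuous_on ballI DERIV_isCont[OF F])
  have F'c: "continuous_on S F'" for S using F' continuous_on_subset by blast
  show L: "F \<in> L2" "F' \<in> L2" unfolding L2_iff_sqint by (rule sqint_continuous, rule Fc F'c)+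
  show "has_weak_deriv F F'"
    unfolding has_weak_deriv_L2[OF L]
  proof
    fix \<phi> assume \<phi>: "\<phi> \<in> test_functions \<Omega>"
    note t = test_functionsD[OF \<phi>]
    have "(LINT x|lebesgue_on \<Omega>. F' x * \<phi> x + deriv \<phi> x * F x) = F 1 * \<phi> 1 - F 0 * \<phi> 0"
    proof (rule LINT_FTC)
      show "((\<lambda>x. F x * \<phi> x) has_real_derivative F' x * \<phi> x + deriv \<phi> x * F x) (at x within {0..1})" for x
        by (rule has_field_derivative_at_within[OF DERIV_mult[OF F t(1)]])
      show "continuous_on {0..1} (\<lambda>x. F' x * \<phi> x + deriv \<phi> x * F x)"
        by (intro continuous_intros Fc F'c t(2,3))
    qed simp
    also have "\<dots> = 0" using t(4)[of 0] t(4)[of 1] by simp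
    also have "(LINT x|lebesgue_on \<Omega>. F' x * \<phi> x + deriv \<phi> x * F x) =
       (LINT x|lebesgue_on \<Omega>. F' x * \<phi> x) + (LINT x|lebesgue_on \<Omega>. deriv \<phi> x * F x)"
      by (intro Bochner_Integration.integral_add sqint_mult_integrable L2_sqint L test_function_sqint[OF \<phi>])
    finally show "(LINT x|lebesgue_on \<Omega>. F x * deriv \<phi> x) = - (LINT x|lebesgue_on \<Omega>. F' x * \<phi> x)"
      by (simp add: mult.commute)
  qed
qed

lemma test_function_weak_deriv:
  assumes "\<phi> \<in> test_functions S" shows "\<phi> \<in> L2" "deriv \<phi> \<in> L2" "has_weak_deriv \<phi> (deriv \<phi>)"
  using classical_weak_deriv[OF test_functionsD(1)[OF assms] test_functionsD(3)[OF assms]] by auto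

text \<open>Products of sines with cutoffs are test functions and converge to the sines in
  \<open>L2\<close>, so both derivatives have the same sine coefficients, and the sines are
  complete.\<close>

lemma weak_deriv_unique:
  assumes g: "g \<in> L2" "has_weak_deriv u g" and g': "g' \<in> L2" "has_weak_deriv u g'"
  shows "AE x in lebesgue_on \<Omega>. g x = g' x"
proof (rule sine.cf_eq_imp_AE_eq)
  show "sqint (lebesgue_on \<Omega>) g" "sqint (lebesgue_on \<Omega>) g'" using g g' L2_sqint by auto
  show "sine.cf g = sine.cf g'"
  proof
    fix k
    have t: "(\<lambda>x. sn k x * cut n x) \<in> test_functions \<Omega>" for n by (rule cut_test[OF smooth_sn])
    have lim: "(\<lambda>n. LINT x|lebesgue_on \<Omega>. (sn k x * cut n x) * v x) \<longlonglongrightarrow> (LINT x|lebesgue_on \<Omega>. sn k x * v x)"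
      if "v \<in> L2" for v
      by (rule integral_mult_tendsto[OF test_function_sqint(1)[OF t] sn_sqint L2_sqint[OF that]
            cut_approximation(1)[OF smooth_sn sn_0 sn_1]])
    have "(LINT x|lebesgue_on \<Omega>. (sn k x * cut n x) * g x) = (LINT x|lebesgue_on \<Omega>. (sn k x * cut n x) * g' x)" for n
    proof -
      have "distr_of \<Omega> g (\<lambda>x. sn k x * cut n x) = distr_of \<Omega> g' (\<lambda>x. sn k x * cut n x)"
        using g(2) g'(2) t[of n] unfolding has_weak_deriv_def by metis
      then show ?thesis by (simp add: distr_of_def mult.commute)
    qed
    with lim[OF g(1)] lim[OF g'(1)] show "sine.cf g k = sine.cf g' k"
      unfolding sine.cf_def by (simp add: mult.commute LIMSEQ_unique)
  qed
qed

lemma weak_deriv_props: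
  assumes "g \<in> L2" "has_weak_deriv u g"
  shows "weak_deriv u \<in> L2" "has_weak_deriv u (weak_deriv u)"
    "AE x in lebesgue_on \<Omega>. weak_deriv u x = g x"
proof -
  have *: "weak_deriv u \<in> L2 \<and> has_weak_deriv u (weak_deriv u)"
    unfolding weak_deriv_def by (rule someI[of _ g]) (use assms in auto)
  then show "weak_deriv u \<in> L2" "has_weak_deriv u (weak_deriv u)" by auto
  show "AE x in lebesgue_on \<Omega>. weak_deriv u x = g x"
    by (rule weak_deriv_unique) (use * assms in auto)
qed

text \<open>The weak derivative is a closed operator in \<open>L2\<close>; this is what allows sine
  and cosine series to be differentiated termwise.\<close>

lemma has_weak_deriv_limit:
  assumes u: "\<And>n. u n \<in> L2" "v \<in> L2" "(\<lambda>n. LINT x|lebesgue_on \<Omega>. (u n x - v x)\<^sup>2) \<longlonglongrightarrow> 0"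
    and g: "\<And>n. g n \<in> L2" "w \<in> L2" "(\<lambda>n. LINT x|lebesgue_on \<Omega>. (g n x - w x)\<^sup>2) \<longlonglongrightarrow> 0"
    and ug: "\<And>n. has_weak_deriv (u n) (g n)"
  shows "has_weak_deriv v w"
  unfolding has_weak_deriv_L2[OF u(2) g(2)]
proof
  fix \<phi> assume \<phi>: "\<phi> \<in> test_functions \<Omega>"
  have 1: "(\<lambda>n. LINT x|lebesgue_on \<Omega>. u n x * deriv \<phi> x) \<longlonglongrightarrow> (LINT x|lebesgue_on \<Omega>. v x * deriv \<phi> x)"
    by (intro integral_mult_tendsto L2_sqint u test_function_sqint[OF \<phi>])
  have 2: "(\<lambda>n. LINT x|lebesgue_on \<Omega>. g n x * \<phi> x) \<longlonglongrightarrow> (LINT x|lebesgue_on \<Omega>. w x * \<phi> x)"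
    by (intro integral_mult_tendsto L2_sqint g test_function_sqint[OF \<phi>])
  have "(LINT x|lebesgue_on \<Omega>. u n x * deriv \<phi> x) = - (LINT x|lebesgue_on \<Omega>. g n x * \<phi> x)" for n
    using ug[of n] \<phi> unfolding has_weak_deriv_L2[OF u(1) g(1)] by blast
  then show "(LINT x|lebesgue_on \<Omega>. v x * deriv \<phi> x) = - (LINT x|lebesgue_on \<Omega>. w x * \<phi> x)"
    using LIMSEQ_unique[OF 1] tendsto_minus[OF 2] by simp
qed

lemma L2_add: "u \<in> L2 \<Longrightarrow> v \<in> L2 \<Longrightarrow> (\<lambda>x. u x + v x) \<in> L2"
  and L2_diff: "u \<in> L2 \<Longrightarrow> v \<in> L2 \<Longrightarrow> (\<lambda>x. u x - v x) \<in> L2"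
  and L2_cmult: "u \<in> L2 \<Longrightarrow> (\<lambda>x. c * u x) \<in> L2"
  by (auto simp: L2_iff_sqint intro: sqint_add sqint_diff sqint_cmult)

lemma has_weak_deriv_diff:
  assumes "u \<in> L2" "g \<in> L2" "has_weak_deriv u g" "v \<in> L2" "w \<in> L2" "has_weak_deriv v w"
  shows "has_weak_deriv (\<lambda>x. u x - v x) (\<lambda>x. g x - w x)"
  using assms(3,6)
  unfolding has_weak_deriv_L2[OF assms(1,2)] has_weak_deriv_L2[OF assms(4,5)]
    has_weak_deriv_L2[OF L2_diff[OF assms(1,4)] L2_diff[OF assms(2,5)]]
  by (simp add: left_diff_distrib sqint_mult_integrable L2_sqint assms test_function_sqint)

lemma L2_norm_sq_cong:
  assumes "u \<in> L2" "v \<in> L2" "AE x in lebesgue_on \<Omega>. u x = v x" shows "L2_norm u = L2_norm v"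
proof -
  have "(LINT x|lebesgue_on \<Omega>. (u x)\<^sup>2) = (LINT x|lebesgue_on \<Omega>. (v x)\<^sup>2)"
    by (rule integral_cong_AE) (use assms in \<open>auto simp: L2_def\<close>)
  then show ?thesis by (simp add: L2_norm_def L2_inner_def power2_eq_square)
qed

lemma L2_norm_eq: "L2_norm u = sqrt (LINT x|lebesgue_on \<Omega>. (u x)\<^sup>2)"
  by (simp add: L2_norm_def L2_inner_def power2_eq_square)

lemma Hk_norm_1:
  "u \<in> L2 \<Longrightarrow> g \<in> L2 \<Longrightarrow> has_weak_deriv u g \<Longrightarrow>
    (Hk_norm 1 u)\<^sup>2 = (LINT x|lebesgue_on \<Omega>. (u x)\<^sup>2) + (LINT x|lebesgue_on \<Omega>. (g x)\<^sup>2)"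
  using L2_norm_sq_cong[OF weak_deriv_props(1) _ weak_deriv_props(3), of g u g]
  by (simp add: Hk_norm_def sum_nonneg atMost_Suc flip: L2_norm_sq)

lemma partial_weak_deriv:
  "has_weak_deriv (sine.partial b n) (cosine.partial (\<lambda>k. om k * b k) n)"
  "has_weak_deriv (cosine.partial b n) (sine.partial (\<lambda>k. - om k * b k) n)"
proof -
  show "has_weak_deriv (sine.partial b n) (cosine.partial (\<lambda>k. om k * b k) n)"
    unfolding sine.partial_def[abs_def] cosine.partial_def[abs_def]
    by (rule classical_weak_deriv(3))
      (auto intro!: derivative_eq_intros sn_deriv continuous_intros cs_cont simp: mult_ac)
  show "has_weak_deriv (cosine.partial b n) (sine.partial (\<lambda>k. - om k * b k) n)"
    unfolding sine.partial_def[abs_def] cosine.partial_def[abs_def]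
    by (rule classical_weak_deriv(3))
      (auto intro!: derivative_eq_intros cs_deriv continuous_intros sn_cont simp: mult_ac)
qed

lemma partial_L2: "sine.partial b n \<in> L2" "cosine.partial b n \<in> L2"
  by (simp_all add: L2_iff_sqint sine.partial_sqint cosine.partial_sqint)

text \<open>Riesz-Fischer in the cosine system produces the candidate \<open>g\<close>, and
  closedness of the weak derivative identifies it.\<close>

lemma sine_series_weak_deriv:
  assumes v: "v \<in> L2" and s: "summable (\<lambda>k. (om k)\<^sup>2 * (sine.cf v k)\<^sup>2)"
  obtains g where "g \<in> L2" "has_weak_deriv v g"
    "(\<lambda>n. LINT x|lebesgue_on \<Omega>. (cosine.partial (\<lambda>k. om k * sine.cf v k) n x - g x)\<^sup>2) \<longlonglongrightarrow> 0"
proof -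
  have "summable (\<lambda>k. (om k * sine.cf v k)\<^sup>2)" using s by (simp add: power_mult_distrib)
  then obtain g where g: "sqint (lebesgue_on \<Omega>) g"
    "(\<lambda>n. LINT x|lebesgue_on \<Omega>. (cosine.partial (\<lambda>k. om k * sine.cf v k) n x - g x)\<^sup>2) \<longlonglongrightarrow> 0"
    by (rule cosine.riesz_fischer)
  have "has_weak_deriv v g"
    by (rule has_weak_deriv_limit[OF partial_L2(1) v sine.partial_tendsto[OF L2_sqint[OF v]] partial_L2(2) _ g(2)])
      (use g(1) partial_weak_deriv(1) in \<open>auto simp: L2_iff_sqint\<close>)
  with g that show thesis by (auto simp: L2_iff_sqint)
qed

text \<open>Partial sums vanish at the endpoints but have no compact support in \<Omega>, so
  membership in the closure of the test functions takes two approximations: by a partial sum, then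
  by the partial sum times a cutoff.\<close>

lemma H01_of_sine_series:
  assumes v: "v \<in> L2" and s: "summable (\<lambda>k. (om k)\<^sup>2 * (sine.cf v k)\<^sup>2)"
  shows "v \<in> H01" "H01_norm v = sqrt (\<Sum>k. (om k)\<^sup>2 * (sine.cf v k)\<^sup>2)"
proof -
  let ?M = "lebesgue_on \<Omega>"
  obtain g where g: "g \<in> L2" "has_weak_deriv v g"
    and lim: "(\<lambda>n. LINT x|?M. (cosine.partial (\<lambda>k. om k * sine.cf v k) n x - g x)\<^sup>2) \<longlonglongrightarrow> 0"
    by (rule sine_series_weak_deriv[OF v s])
  have "L2_norm (weak_deriv v) = L2_norm g"
    by (rule L2_norm_sq_cong) (use weak_deriv_props[OF g] g in auto)
  moreover have "(\<lambda>k. (om k)\<^sup>2 * (sine.cf v k)\<^sup>2) sums (LINT x|?M. (g x)\<^sup>2)"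
    using cosine.cf_limit(2)[OF L2_sqint[OF g(1)] lim] by (simp add: power_mult_distrib)
  ultimately show "H01_norm v = sqrt (\<Sum>k. (om k)\<^sup>2 * (sine.cf v k)\<^sup>2)"
    by (simp add: H01_norm_def L2_norm_eq sums_iff)
  show "v \<in> H01"
    unfolding H01_def
  proof (intro CollectI conjI allI impI)
    show "v \<in> Hk 1" using v g by auto
    fix \<epsilon> :: real assume "\<epsilon> > 0"
    \<comment> \<open>Function and derivative each cost 2\<delta> + 2\<delta>, in total 8\<delta>,
      which must stay below \<epsilon>^2.\<close>
    define \<delta> where "\<delta> = \<epsilon>\<^sup>2 / 10"
    have "\<delta> > 0" using \<open>\<epsilon> > 0\<close> by (simp add: \<delta>_def)
    have "\<forall>\<^sub>F n in sequentially. (LINT x|?M. (cosine.partial (\<lambda>k. om k * sine.cf v k) n x - g x)\<^sup>2) < \<delta>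
        \<and> (LINT x|?M. (sine.partial (sine.cf v) n x - v x)\<^sup>2) < \<delta>"
      using order_tendstoD(2)[OF lim \<open>\<delta> > 0\<close>] order_tendstoD(2)[OF sine.partial_tendsto[OF L2_sqint[OF v]] \<open>\<delta> > 0\<close>]
      by eventually_elim auto
    then obtain n where n: "(LINT x|?M. (cosine.partial (\<lambda>k. om k * sine.cf v k) n x - g x)\<^sup>2) < \<delta>"
        "(LINT x|?M. (sine.partial (sine.cf v) n x - v x)\<^sup>2) < \<delta>"
      using eventually_happens'[OF sequentially_bot] by blast
    define p where "p = sine.partial (sine.cf v) n"
    define p' where "p' = cosine.partial (\<lambda>k. om k * sine.cf v k) n"
    have psm: "smooth p" unfolding p_def sine.partial_def[abs_def] by (rule smooth_partial)
    have p01: "p 0 = 0" "p 1 = 0" by (simp_all add: p_def sine.partial_def sn_0 sn_1)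
    have pd: "(p has_real_derivative p' x) (at x)" for x
      unfolding p_def p'_def sine.partial_def[abs_def] cosine.partial_def
      by (auto intro!: derivative_eq_intros sn_deriv simp: mult_ac)
    have dp: "deriv p = p'" by (intro deriv_eqI pd)
    note ca = cut_approximation[OF psm p01]
    have "\<forall>\<^sub>F i in sequentially. (LINT x|?M. (p x * cut i x - p x)\<^sup>2) < \<delta>
        \<and> (LINT x|?M. (deriv (\<lambda>x. p x * cut i x) x - deriv p x)\<^sup>2) < \<delta>"
      using order_tendstoD(2)[OF ca(1) \<open>\<delta> > 0\<close>] order_tendstoD(2)[OF ca(2) \<open>\<delta> > 0\<close>]
      by eventually_elim auto
    then obtain i where i: "(LINT x|?M. (p x * cut i x - p x)\<^sup>2) < \<delta>"
        "(LINT x|?M. (deriv (\<lambda>x. p x * cut i x) x - p' x)\<^sup>2) < \<delta>"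
      using eventually_happens'[OF sequentially_bot] unfolding dp by blast
    define \<phi> where "\<phi> x = p x * cut i x" for x
    have \<phi>: "\<phi> \<in> test_functions \<Omega>" unfolding \<phi>_def by (rule cut_test[OF psm])
    note \<phi>w = test_function_weak_deriv[OF \<phi>]
    have pL: "sqint ?M p" "sqint ?M p'" by (simp_all add: p_def p'_def sine.partial_sqint cosine.partial_sqint)
    have v\<phi>: "(LINT x|?M. (v x - \<phi> x)\<^sup>2) \<le> 2 * (LINT x|?M. (v x - p x)\<^sup>2) + 2 * (LINT x|?M. (p x - \<phi> x)\<^sup>2)"
      by (intro integral_sq_triangle L2_sqint v pL \<phi>w)
    have g\<phi>: "(LINT x|?M. (g x - deriv \<phi> x)\<^sup>2) \<le> 2 * (LINT x|?M. (g x - p' x)\<^sup>2) + 2 * (LINT x|?M. (p' x - deriv \<phi> x)\<^sup>2)"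
      by (intro integral_sq_triangle L2_sqint g pL \<phi>w)
    have "(LINT x|?M. (v x - \<phi> x)\<^sup>2) + (LINT x|?M. (g x - deriv \<phi> x)\<^sup>2) < 8 * \<delta>"
    proof -
      have \<phi>eq: "\<phi> = (\<lambda>x. p x * cut i x)" by (simp add: \<phi>_def[abs_def])
      have "(LINT x|?M. (v x - p x)\<^sup>2) < \<delta>" unfolding p_def by (subst power2_commute) (rule n(2))
      moreover have "(LINT x|?M. (g x - p' x)\<^sup>2) < \<delta>" unfolding p'_def by (subst power2_commute) (rule n(1))
      moreover have "(LINT x|?M. (p x - \<phi> x)\<^sup>2) < \<delta>" unfolding \<phi>eq by (subst power2_commute) (rule i(1))
      moreover have "(LINT x|?M. (p' x - deriv \<phi> x)\<^sup>2) < \<delta>" unfolding \<phi>eq by (subst power2_commute) (rule i(2))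
      ultimately show ?thesis using v\<phi> g\<phi> by linarith
    qed
    also have "\<dots> < \<epsilon>\<^sup>2" using \<open>\<epsilon> > 0\<close> by (simp add: \<delta>_def)
    finally have "(Hk_norm 1 (\<lambda>x. v x - \<phi> x))\<^sup>2 < \<epsilon>\<^sup>2"
      using Hk_norm_1[OF L2_diff[OF v \<phi>w(1)] L2_diff[OF g(1) \<phi>w(2)] has_weak_deriv_diff[OF v g \<phi>w]] by simp
    then have "Hk_norm 1 (\<lambda>x. v x - \<phi> x) < \<epsilon>"
      using \<open>\<epsilon> > 0\<close> by (simp add: power_less_imp_less_base)
    with \<phi> show "\<exists>\<phi>\<in>test_functions \<Omega>. Hk_norm 1 (\<lambda>x. v x - \<phi> x) < \<epsilon>" by blast
  qed
qed

text \<open>The zero boundary values enter here: \<open>cs k\<close> does not vanish at the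
  endpoints, so integration by parts against it is carried out for test functions and passed to the
  limit in the \<open>H01\<close> approximation. Bessel for the cosines then gives the
  summability.\<close>

lemma H01_imp_sine_series:
  assumes v: "v \<in> H01"
  shows "v \<in> L2" "summable (\<lambda>k. (om k)\<^sup>2 * (sine.cf v k)\<^sup>2)"
    "weak_deriv v \<in> L2" "has_weak_deriv v (weak_deriv v)" "cosine.cf (weak_deriv v) k = om k * sine.cf v k"
proof -
  let ?M = "lebesgue_on \<Omega>"
  obtain g0 where "v \<in> L2" "g0 \<in> L2" "has_weak_deriv v g0" using v by (auto simp: H01_def)
  then have vL: "v \<in> L2" and g: "weak_deriv v \<in> L2" "has_weak_deriv v (weak_deriv v)"
    using weak_deriv_props by auto
  then show "v \<in> L2" "weak_deriv v \<in> L2" "has_weak_deriv v (weak_deriv v)" by auto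
  let ?g = "weak_deriv v"
  have "\<forall>n. \<exists>\<phi>\<in>test_functions \<Omega>. Hk_norm 1 (\<lambda>x. v x - \<phi> x) < inverse (real (Suc n))"
    using v by (auto simp: H01_def)
  then obtain \<phi> where \<phi>: "\<And>n. \<phi> n \<in> test_functions \<Omega>" "\<And>n. Hk_norm 1 (\<lambda>x. v x - \<phi> n x) < inverse (real (Suc n))"
    by metis
  note \<phi>w = test_function_weak_deriv[OF \<phi>(1)]
  have le: "(LINT x|?M. (v x - \<phi> n x)\<^sup>2) + (LINT x|?M. (?g x - deriv (\<phi> n) x)\<^sup>2) \<le> (inverse (real (Suc n)))\<^sup>2" for n
  proof -
    have "0 \<le> Hk_norm 1 (\<lambda>x. v x - \<phi> n x)" by (simp add: Hk_norm_def sum_nonneg)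
    then have "(Hk_norm 1 (\<lambda>x. v x - \<phi> n x))\<^sup>2 \<le> (inverse (real (Suc n)))\<^sup>2"
      using \<phi>(2)[of n] by (intro power_mono) auto
    then show ?thesis
      using Hk_norm_1[OF L2_diff[OF vL \<phi>w(1)] L2_diff[OF g(1) \<phi>w(2)] has_weak_deriv_diff[OF vL g \<phi>w]] by simp
  qed
  have z: "(\<lambda>n. (inverse (real (Suc n)))\<^sup>2) \<longlonglongrightarrow> 0"
    using tendsto_power[OF LIMSEQ_inverse_real_of_nat, of 2] by simp
  have 1: "(\<lambda>n. LINT x|?M. (\<phi> n x - v x)\<^sup>2) \<longlonglongrightarrow> 0"
  proof (rule Lim_null_comparison[OF always_eventually z], rule allI)
    fix n
    have "0 \<le> (LINT x|?M. (?g x - deriv (\<phi> n) x)\<^sup>2)" by simp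
    moreover have "(LINT x|?M. (\<phi> n x - v x)\<^sup>2) = (LINT x|?M. (v x - \<phi> n x)\<^sup>2)"
      by (simp only: power2_commute)
    ultimately have "(LINT x|?M. (\<phi> n x - v x)\<^sup>2) \<le> (inverse (real (Suc n)))\<^sup>2"
      using le[of n] by linarith
    then show "norm (LINT x|?M. (\<phi> n x - v x)\<^sup>2) \<le> (inverse (real (Suc n)))\<^sup>2" by simp
  qed
  have 2: "(\<lambda>n. LINT x|?M. (deriv (\<phi> n) x - ?g x)\<^sup>2) \<longlonglongrightarrow> 0"
  proof (rule Lim_null_comparison[OF always_eventually z], rule allI)
    fix n
    have "0 \<le> (LINT x|?M. (v x - \<phi> n x)\<^sup>2)" by simp
    moreover have "(LINT x|?M. (deriv (\<phi> n) x - ?g x)\<^sup>2) = (LINT x|?M. (?g x - deriv (\<phi> n) x)\<^sup>2)"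
      by (simp only: power2_commute)
    ultimately have "(LINT x|?M. (deriv (\<phi> n) x - ?g x)\<^sup>2) \<le> (inverse (real (Suc n)))\<^sup>2"
      using le[of n] by linarith
    then show "norm (LINT x|?M. (deriv (\<phi> n) x - ?g x)\<^sup>2) \<le> (inverse (real (Suc n)))\<^sup>2" by simp
  qed
  show cfk: "cosine.cf ?g k = om k * sine.cf v k" for k
  proof -
    have eq: "(LINT x|?M. deriv (\<phi> n) x * cs k x) = om k * (LINT x|?M. \<phi> n x * sn k x)" for n
    proof -
      have c: "continuous_on UNIV (\<lambda>x. - om k * sn k x)" by (intro continuous_intros sn_cont)
      note cw = classical_weak_deriv[OF cs_deriv c]
      then have "(LINT x|?M. cs k x * deriv (\<phi> n) x) = - (LINT x|?M. - om k * sn k x * \<phi> n x)"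
        using \<phi>(1)[of n] cw(3) unfolding has_weak_deriv_L2[OF cw(1,2)] by blast
      then show ?thesis by (simp add: mult_ac)
    qed
    have l1: "(\<lambda>n. LINT x|?M. deriv (\<phi> n) x * cs k x) \<longlonglongrightarrow> (LINT x|?M. ?g x * cs k x)"
      by (intro integral_mult_tendsto L2_sqint \<phi>w g 2 cs_sqint)
    have l2: "(\<lambda>n. om k * (LINT x|?M. \<phi> n x * sn k x)) \<longlonglongrightarrow> om k * (LINT x|?M. v x * sn k x)"
      by (intro tendsto_intros integral_mult_tendsto L2_sqint \<phi>w vL 1 sn_sqint)
    show ?thesis using LIMSEQ_unique[OF l1[unfolded eq] l2] unfolding sine.cf_def cosine.cf_def .
  qed
  show "summable (\<lambda>k. (om k)\<^sup>2 * (sine.cf v k)\<^sup>2)"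
    using cosine.bessel_summable[OF L2_sqint[OF g(1)]] by (simp add: cfk power_mult_distrib)
qed

text \<open>As the cosines are not complete, Parseval is replaced by expanding one factor only: the
  derivative of \<open>u\<close> is the limit of its cosine partial sums, and this suffices against
  any \<open>L2\<close> function.\<close>

lemma H01_inner_sums:
  assumes u: "u \<in> H01" and v: "v \<in> H01"
  shows "(\<lambda>k. (om k)\<^sup>2 * (sine.cf u k * sine.cf v k)) sums L2_inner (weak_deriv u) (weak_deriv v)"
proof -
  let ?M = "lebesgue_on \<Omega>"
  note ul = H01_imp_sine_series[OF u] and vl = H01_imp_sine_series[OF v]
  obtain g where g: "g \<in> L2" "has_weak_deriv u g"
    and lim: "(\<lambda>n. LINT x|?M. (cosine.partial (\<lambda>k. om k * sine.cf u k) n x - g x)\<^sup>2) \<longlonglongrightarrow> 0"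
    by (rule sine_series_weak_deriv[OF ul(1,2)])
  have "(\<lambda>n. LINT x|?M. cosine.partial (\<lambda>k. om k * sine.cf u k) n x * weak_deriv v x) \<longlonglongrightarrow> (LINT x|?M. g x * weak_deriv v x)"
    by (intro integral_mult_tendsto L2_sqint g lim vl partial_L2)
  also have "(\<lambda>n. LINT x|?M. cosine.partial (\<lambda>k. om k * sine.cf u k) n x * weak_deriv v x)
      = (\<lambda>n. \<Sum>k<n. (om k)\<^sup>2 * (sine.cf u k * sine.cf v k))"
  proof -
    have "(LINT x|?M. cs k x * weak_deriv v x) = cosine.cf (weak_deriv v) k" for k
      unfolding cosine.cf_def by (simp only: mult.commute)
    then show ?thesis
      unfolding cosine.integral_partial_mult[OF L2_sqint[OF vl(3)]] by (simp add: vl(5) power2_eq_square mult_ac)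
  qed
  also have "(LINT x|?M. g x * weak_deriv v x) = (LINT x|?M. weak_deriv u x * weak_deriv v x)"
    using weak_deriv_props(3)[OF g] weak_deriv_props(1)[OF g] g(1) vl(3)
    by (intro integral_cong_AE) (auto simp: L2_def)
  finally show ?thesis by (simp add: sums_def L2_inner_def)
qed

lemma om_sq_le: "(om k)\<^sup>2 \<le> (om k)^4" "1 \<le> (om k)\<^sup>2"
  using om_ge_1[of k] by (auto intro: power_increasing)

lemma Hk_2_of_sine_series:
  assumes v: "v \<in> L2" and s: "summable (\<lambda>k. (1 + (om k)\<^sup>2 + (om k)^4) * (sine.cf v k)\<^sup>2)"
  shows "v \<in> Hk 2 \<inter> H01" "Hk_norm 2 v = sqrt (\<Sum>k. (1 + (om k)\<^sup>2 + (om k)^4) * (sine.cf v k)\<^sup>2)"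
proof -
  let ?M = "lebesgue_on \<Omega>"
  have s2: "summable (\<lambda>k. (om k)\<^sup>2 * (sine.cf v k)\<^sup>2)" and s4: "summable (\<lambda>k. (om k)^4 * (sine.cf v k)\<^sup>2)"
    by (rule summable_comparison_test'[OF s, of 0], simp add: mult_right_mono)+
  obtain g where g: "g \<in> L2" "has_weak_deriv v g"
    and lim: "(\<lambda>n. LINT x|?M. (cosine.partial (\<lambda>k. om k * sine.cf v k) n x - g x)\<^sup>2) \<longlonglongrightarrow> 0"
    by (rule sine_series_weak_deriv[OF v s2])
  \<comment> \<open>Sine coefficients of the second derivative: each differentiation contributes
    \<open>om k\<close>, and that of a cosine a sign.\<close>
  let ?b = "\<lambda>k. - om k * (om k * sine.cf v k)"
  have bsq: "(?b k)\<^sup>2 = (om k)^4 * (sine.cf v k)\<^sup>2" for k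
    by (simp add: power_mult_distrib mult.assoc[symmetric] power_add[symmetric] flip: power2_eq_square) 
  have "summable (\<lambda>k. (?b k)\<^sup>2)" using s4 by (simp only: bsq)
  then obtain q where q: "sqint ?M q" "(\<lambda>n. LINT x|?M. (sine.partial ?b n x - q x)\<^sup>2) \<longlonglongrightarrow> 0"
    by (rule sine.riesz_fischer)
  have qL: "q \<in> L2" using q(1) by (simp add: L2_iff_sqint)
  have gq: "has_weak_deriv g q"
    by (rule has_weak_deriv_limit[OF partial_L2(2) g(1) lim partial_L2(1) qL q(2)]) (rule partial_weak_deriv(2))
  note wv = weak_deriv_props[OF g]
  \<comment> \<open>\<open>weak_deriv v\<close> is a chosen representative that agrees with
    \<open>g\<close> only almost everywhere, so the tested identity is transferred under the
    integral.\<close>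
  have wq: "has_weak_deriv (weak_deriv v) q"
  proof -
    have "(LINT x|?M. weak_deriv v x * deriv \<phi> x) = (LINT x|?M. g x * deriv \<phi> x)" if "\<phi> \<in> test_functions \<Omega>" for \<phi>
      using wv(1,3) g(1) test_function_weak_deriv(2)[OF that] by (intro integral_cong_AE) (auto simp: L2_def)
    then show ?thesis using gq unfolding has_weak_deriv_L2[OF g(1) qL] has_weak_deriv_L2[OF wv(1) qL] by simp
  qed
  note ww = weak_deriv_props[OF qL wq]
  have 2: "(L2_norm (weak_deriv v))\<^sup>2 = (\<Sum>k. (om k)\<^sup>2 * (sine.cf v k)\<^sup>2)"
    using H01_of_sine_series(2)[OF v s2] s2 unfolding H01_norm_def by (simp add: suminf_nonneg)
  have "L2_norm (weak_deriv (weak_deriv v)) = L2_norm q" by (rule L2_norm_sq_cong[OF ww(1) qL ww(3)])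
  moreover have "(\<lambda>k. (om k)^4 * (sine.cf v k)\<^sup>2) sums (LINT x|?M. (q x)\<^sup>2)"
    using sine.cf_limit(2)[OF q] by (simp only: bsq)
  ultimately have 3: "(L2_norm (weak_deriv (weak_deriv v)))\<^sup>2 = (\<Sum>k. (om k)^4 * (sine.cf v k)\<^sup>2)"
    by (simp add: L2_norm_sq sums_iff)
  have 1: "(L2_norm v)\<^sup>2 = (\<Sum>k. (sine.cf v k)\<^sup>2)" "summable (\<lambda>k. (sine.cf v k)\<^sup>2)"
    using L2_parseval[OF v] by (auto simp: sums_iff)
  have "(\<Sum>k. (1 + (om k)\<^sup>2 + (om k)^4) * (sine.cf v k)\<^sup>2) = (L2_norm v)\<^sup>2 + (L2_norm (weak_deriv v))\<^sup>2 + (L2_norm (weak_deriv (weak_deriv v)))\<^sup>2"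
    unfolding 1(1) 2 3 using suminf_add[OF summable_add[OF 1(2) s2] s4] suminf_add[OF 1(2) s2] by (simp add: distrib_right)
  then show "Hk_norm 2 v = sqrt (\<Sum>k. (1 + (om k)\<^sup>2 + (om k)^4) * (sine.cf v k)\<^sup>2)"
    by (simp add: Hk_norm_def numeral_2_eq_2 atMost_Suc add_ac)
  have "weak_deriv v \<in> Hk 1" using wv(1) ww(1,2) by auto
  then show "v \<in> Hk 2 \<inter> H01" using v wv(2) H01_of_sine_series(1)[OF v s2] by (auto simp: numeral_2_eq_2)
qed

text \<open>A common interface for \<open>L2\<close>, \<open>H01\<close> and
  \<open>Hk 2 \<inter> H01\<close> as weighted square-summable sequences. It records the implication
  from coefficients to the space, the direction in which regularity of a constructed function is
  proved.\<close>

definition sine_space :: "(real \<Rightarrow> real) set \<Rightarrow> ((real \<Rightarrow> real) \<Rightarrow> real) \<Rightarrow> (nat \<Rightarrow> real) \<Rightarrow> bool" where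
  "sine_space X N \<omega> \<longleftrightarrow> (\<forall>k. 0 \<le> \<omega> k) \<and> (\<forall>v\<in>L2. summable (\<lambda>k. \<omega> k * (sine.cf v k)\<^sup>2) \<longrightarrow>
     v \<in> X \<and> N v = sqrt (\<Sum>k. \<omega> k * (sine.cf v k)\<^sup>2))"

lemma sine_space_L2: "sine_space L2 L2_norm (\<lambda>k. 1)"
  using L2_parseval L2_norm_nonneg by (auto simp: sine_space_def sums_iff real_sqrt_unique)

lemma sine_space_H01: "sine_space H01 H01_norm (\<lambda>k. (om k)\<^sup>2)"
  using H01_of_sine_series by (auto simp: sine_space_def)

lemma sine_space_Hk_2: "sine_space (Hk 2 \<inter> H01) (Hk_norm 2) (\<lambda>k. 1 + (om k)\<^sup>2 + (om k)^4)"
  using Hk_2_of_sine_series by (auto simp: sine_space_def)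

section \<open>Bochner spaces in terms of sine coefficients\<close>

lemma dominated_series:
  fixes a :: "nat \<Rightarrow> nat \<Rightarrow> real"
  assumes "\<And>k. (\<lambda>n. a n k) \<longlonglongrightarrow> b k" "\<And>n k. \<bar>a n k\<bar> \<le> B k" "summable B"
  shows "(\<lambda>n. \<Sum>k. a n k) \<longlonglongrightarrow> (\<Sum>k. b k)"
  using tannerys_theorem[where a="\<lambda>k n. a n k" and b=b and F=sequentially and M=B] assms
  by (simp add: always_eventually split_beta)

text \<open>Completeness of Lebesgue measure. Norms such as \<open>N (u t)\<close> equal their
  measurable series only at almost every time.\<close>

lemma lebesgue_on_measurable_AE:
  fixes f g :: "real \<Rightarrow> real"
  assumes S: "S \<in> sets lebesgue" and f: "f \<in> borel_measurable (lebesgue_on S)"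
    and eq: "AE x in lebesgue_on S. f x = g x"
  shows "g \<in> borel_measurable (lebesgue_on S)"
proof (rule borel_measurable_if_D)
  have "(\<lambda>x. if x \<in> S then f x else 0) \<in> borel_measurable lebesgue"
    using f S by (simp add: borel_measurable_if)
  moreover have "AE x in lebesgue. x \<in> S \<longrightarrow> f x = g x"
    using eq S by (subst (asm) AE_restrict_space_iff) auto
  then have "AE x in lebesgue. (if x \<in> S then f x else 0) = (if x \<in> S then g x else 0)"
    by eventually_elim simp
  ultimately show "(\<lambda>x. if x \<in> S then g x else 0) \<in> borel_measurable lebesgue"
    by (rule borel_measurable_AE)
qed

lemma cf_diff: "u \<in> L2 \<Longrightarrow> v \<in> L2 \<Longrightarrow> sine.cf (\<lambda>x. u x - v x) k = sine.cf u k - sine.cf v k"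
  unfolding sine.cf_def by (simp add: left_diff_distrib sqint_mult_integrable L2_sqint sn_sqint)

lemma cf_cmult: "sine.cf (\<lambda>x. c * u x) k = c * sine.cf u k"
  unfolding sine.cf_def by (simp add: mult.assoc)

lemma cf_uminus: "sine.cf (\<lambda>x. - u x) k = - sine.cf u k"
  using cf_cmult[of "-1" u k] by simp

lemma cf_partial: "sine.cf (sine.partial b n) k = (if k < n then b k else 0)"
  unfolding sine.cf_def by (rule sine.integral_partial_e)

lemma cf_bound: "u \<in> L2 \<Longrightarrow> (sine.cf u k)\<^sup>2 \<le> (L2_norm u)\<^sup>2"
  using sine.bessel[OF L2_sqint, of u "Suc k"] sum_nonneg[of "{..<k}" "\<lambda>k. (sine.cf u k)\<^sup>2"]
  by (simp add: L2_norm_sq)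

lemma cf_tendsto:
  assumes u: "\<And>n. u n \<in> L2" "v \<in> L2" and lim: "(\<lambda>n. L2_norm (\<lambda>x. v x - u n x)) \<longlonglongrightarrow> 0"
  shows "(\<lambda>n. sine.cf (u n) k) \<longlonglongrightarrow> sine.cf v k"
proof -
  have "\<bar>sine.cf (u n) k - sine.cf v k\<bar> \<le> L2_norm (\<lambda>x. v x - u n x)" for n
  proof (rule power2_le_imp_le[OF _ L2_norm_nonneg])
    show "\<bar>sine.cf (u n) k - sine.cf v k\<bar>\<^sup>2 \<le> (L2_norm (\<lambda>x. v x - u n x))\<^sup>2"
      using cf_bound[OF L2_diff[OF u(2) u(1)[of n]], of k]
      by (simp add: cf_diff u power2_commute)
  qed
  then have "(\<lambda>n. sine.cf (u n) k - sine.cf v k) \<longlonglongrightarrow> 0"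
    by (intro Lim_null_comparison[OF always_eventually lim]) simp
  then show ?thesis using LIM_zero_iff by blast
qed

lemma simple_function_sine_partial:
  assumes "\<And>k. simple_function M (d k)"
  shows "simple_function M (\<lambda>t. sine.partial (\<lambda>k. d k t) n)"
proof (induction n)
  case 0
  then show ?case by (simp add: sine.partial_def[abs_def])
next
  case (Suc n)
  have "simple_function M (\<lambda>t. (\<lambda>f c x. f x + c * sn n x) (sine.partial (\<lambda>k. d k t) n) (d n t))"
    by (rule simple_function_compose2[OF Suc assms])
  then show ?case by (simp add: sine.partial_def[abs_def])
qed

text \<open>The bound by twice the coefficient is uniform in \<open>n\<close>; it provides one
  majorant that works in every weighted norm.\<close>

lemma simple_function_coefficients:
  assumes "\<And>k. (\<lambda>t. sine.cf (u t) k) \<in> borel_measurable M"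
  obtains d :: "nat \<Rightarrow> nat \<Rightarrow> 'a \<Rightarrow> real" where "\<And>k n. simple_function M (d k n)"
    "\<And>k t. t \<in> space M \<Longrightarrow> (\<lambda>n. d k n t) \<longlonglongrightarrow> sine.cf (u t) k"
    "\<And>k n t. t \<in> space M \<Longrightarrow> \<bar>d k n t\<bar> \<le> 2 * \<bar>sine.cf (u t) k\<bar>"
proof -
  have "\<forall>k. \<exists>F. (\<forall>i. simple_function M (F i)) \<and> (\<forall>x\<in>space M. (\<lambda>i. F i x) \<longlonglongrightarrow> sine.cf (u x) k) \<and>
    (\<forall>i. \<forall>x\<in>space M. dist (F i x) 0 \<le> 2 * dist (sine.cf (u x) k) 0)"
    by (intro allI borel_measurable_implies_sequence_metric assms)
  then obtain d where "\<forall>k. (\<forall>i. simple_function M (d k i)) \<and> (\<forall>x\<in>space M. (\<lambda>i. d k i x) \<longlonglongrightarrow> sine.cf (u x) k) \<and>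
    (\<forall>i. \<forall>x\<in>space M. dist (d k i x) 0 \<le> 2 * dist (sine.cf (u x) k) 0)"
    by (rule choice[THEN exE])
  then show thesis by (intro that[of d]) (auto simp: dist_real_def)
qed

text \<open>The k-th coefficient of the error when the first \<open>n\<close> coefficients are
  replaced by their n-th simple approximations and all later ones by 0.\<close>

definition rem :: "(nat \<Rightarrow> real) \<Rightarrow> (nat \<Rightarrow> nat \<Rightarrow> real) \<Rightarrow> nat \<Rightarrow> nat \<Rightarrow> real" where
  "rem c d n k = c k - (if k < n then d k n else 0)"

context
  fixes c :: "nat \<Rightarrow> real" and d :: "nat \<Rightarrow> nat \<Rightarrow> real"
  assumes lim: "\<And>k. (\<lambda>n. d k n) \<longlonglongrightarrow> c k" and bound: "\<And>k n. \<bar>d k n\<bar> \<le> 2 * \<bar>c k\<bar>"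
begin

lemma rem_bound: "\<bar>rem c d n k\<bar> \<le> 3 * \<bar>c k\<bar>" "(rem c d n k)\<^sup>2 \<le> 9 * (c k)\<^sup>2"
proof -
  show a: "\<bar>rem c d n k\<bar> \<le> 3 * \<bar>c k\<bar>" using bound[of k n] by (auto simp: rem_def)
  have "\<bar>rem c d n k\<bar>\<^sup>2 \<le> (3 * \<bar>c k\<bar>)\<^sup>2" by (rule power_mono[OF a]) simp
  then show "(rem c d n k)\<^sup>2 \<le> 9 * (c k)\<^sup>2" by (simp add: power_mult_distrib)
qed

lemma rem_tendsto: "(\<lambda>n. rem c d n k) \<longlonglongrightarrow> 0"
proof -
  have "(\<lambda>n. c k - d k n) \<longlonglongrightarrow> c k - c k" by (intro tendsto_intros lim)
  then have "(\<lambda>n. c k - d k n) \<longlonglongrightarrow> 0" by simp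
  then show ?thesis
    by (rule Lim_transform_eventually) (auto simp: rem_def intro!: eventually_sequentiallyI[of "Suc k"])
qed

lemma rem_weighted:
  assumes \<omega>: "\<And>k. 0 \<le> \<omega> k" and s: "summable (\<lambda>k. \<omega> k * (c k)\<^sup>2)"
  shows "summable (\<lambda>k. \<omega> k * (rem c d n k)\<^sup>2)" "(\<lambda>n. \<Sum>k. \<omega> k * (rem c d n k)\<^sup>2) \<longlonglongrightarrow> 0"
    "(\<Sum>k. \<omega> k * (rem c d n k)\<^sup>2) \<le> 9 * (\<Sum>k. \<omega> k * (c k)\<^sup>2)"
proof -
  have le: "\<omega> k * (rem c d n k)\<^sup>2 \<le> 9 * (\<omega> k * (c k)\<^sup>2)" for n k
    using mult_left_mono[OF rem_bound(2)[of n k] \<omega>[of k]] by simp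
  have s9: "summable (\<lambda>k. 9 * (\<omega> k * (c k)\<^sup>2))" using s by (rule summable_mult)
  show sr: "summable (\<lambda>k. \<omega> k * (rem c d n k)\<^sup>2)"
    by (rule summable_comparison_test'[OF s9, of 0]) (use le \<omega> in simp)
  show "(\<Sum>k. \<omega> k * (rem c d n k)\<^sup>2) \<le> 9 * (\<Sum>k. \<omega> k * (c k)\<^sup>2)"
    using suminf_le[OF le sr s9] by (simp add: suminf_mult[OF s])
  have "(\<lambda>n. \<Sum>k. \<omega> k * (rem c d n k)\<^sup>2) \<longlonglongrightarrow> (\<Sum>k. 0)"
  proof (rule dominated_series[OF _ _ s9])
    fix k
    have "(\<lambda>n. \<omega> k * (rem c d n k)\<^sup>2) \<longlonglongrightarrow> \<omega> k * 0\<^sup>2" by (intro tendsto_intros rem_tendsto)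
    then show "(\<lambda>n. \<omega> k * (rem c d n k)\<^sup>2) \<longlonglongrightarrow> 0" by simp
  next
    show "\<bar>\<omega> k * (rem c d n k)\<^sup>2\<bar> \<le> 9 * (\<omega> k * (c k)\<^sup>2)" for n k using le \<omega> by simp
  qed
  then show "(\<lambda>n. \<Sum>k. \<omega> k * (rem c d n k)\<^sup>2) \<longlonglongrightarrow> 0" by simp
qed

lemma norm_approximation:
  assumes X: "sine_space X N \<omega>" and u: "u \<in> L2" "\<And>k. sine.cf u k = c k"
    and s: "summable (\<lambda>k. \<omega> k * (c k)\<^sup>2)"
  shows "N (\<lambda>x. u x - sine.partial (\<lambda>k. d k n) n x) = sqrt (\<Sum>k. \<omega> k * (rem c d n k)\<^sup>2)"
    "(\<lambda>n. N (\<lambda>x. u x - sine.partial (\<lambda>k. d k n) n x)) \<longlonglongrightarrow> 0"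
proof -
  have \<omega>: "\<And>k. 0 \<le> \<omega> k" using X by (simp add: sine_space_def)
  have *: "N (\<lambda>x. u x - sine.partial (\<lambda>k. d k n) n x) = sqrt (\<Sum>k. \<omega> k * (rem c d n k)\<^sup>2)" for n
  proof -
    have L: "(\<lambda>x. u x - sine.partial (\<lambda>k. d k n) n x) \<in> L2" by (intro L2_diff u partial_L2)
    have cf: "sine.cf (\<lambda>x. u x - sine.partial (\<lambda>k. d k n) n x) k = rem c d n k" for k
      by (simp add: cf_diff u partial_L2 cf_partial rem_def)
    show ?thesis using X L rem_weighted(1)[OF \<omega> s, of n] unfolding sine_space_def by (simp add: cf)
  qed
  then show "N (\<lambda>x. u x - sine.partial (\<lambda>k. d k n) n x) = sqrt (\<Sum>k. \<omega> k * (rem c d n k)\<^sup>2)" .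
  have "(\<lambda>n. sqrt (\<Sum>k. \<omega> k * (rem c d n k)\<^sup>2)) \<longlonglongrightarrow> sqrt 0" by (intro tendsto_intros rem_weighted \<omega> s)
  then show "(\<lambda>n. N (\<lambda>x. u x - sine.partial (\<lambda>k. d k n) n x)) \<longlonglongrightarrow> 0" by (simp add: *)
qed

end

lemma partial_in_sine_space:
  assumes "sine_space X N \<omega>" shows "sine.partial b n \<in> X"
proof -
  have "summable (\<lambda>k. \<omega> k * (sine.cf (sine.partial b n) k)\<^sup>2)"
    by (rule summable_finite[of "{..<n}"]) (auto simp: cf_partial)
  then show ?thesis using assms partial_L2 unfolding sine_space_def by blast
qed

text \<open>Diagonal choice: the n-th simple function uses \<open>n\<close> modes, each with its
  n-th simple approximation. Measurability of a function with values in a space is thereby reduced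
  to that of scalar coefficients.\<close>

lemma strongly_measurable_sine:
  assumes X: "sine_space X N \<omega>" and meas: "\<And>k. (\<lambda>t. sine.cf (u t) k) \<in> borel_measurable M"
    and u: "AE t in M. u t \<in> L2 \<and> summable (\<lambda>k. \<omega> k * (sine.cf (u t) k)\<^sup>2)"
  shows "strongly_measurable M X N u"
  unfolding strongly_measurable_def
proof
  show "AE t in M. u t \<in> X" using u by eventually_elim (use X in \<open>auto simp: sine_space_def\<close>)
  obtain d :: "nat \<Rightarrow> nat \<Rightarrow> 'a \<Rightarrow> real" where d: "\<And>k n. simple_function M (d k n)"
    "\<And>k t. t \<in> space M \<Longrightarrow> (\<lambda>n. d k n t) \<longlonglongrightarrow> sine.cf (u t) k"
    "\<And>k n t. t \<in> space M \<Longrightarrow> \<bar>d k n t\<bar> \<le> 2 * \<bar>sine.cf (u t) k\<bar>"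
    by (rule simple_function_coefficients[OF meas]) (rule that)
  let ?s = "\<lambda>n t. sine.partial (\<lambda>k. d k n t) n"
  have "AE t in M. (\<lambda>n. N (\<lambda>x. u t x - ?s n t x)) \<longlonglongrightarrow> 0"
    using u AE_space
  proof eventually_elim
    case (elim t)
    show ?case
      by (rule norm_approximation(2)[OF d(2,3)[OF elim(2)] X, of "u t"]) (use elim in auto)
  qed
  moreover have "\<forall>n. simple_function M (?s n) \<and> ?s n ` space M \<subseteq> X"
    using d(1) by (auto intro: simple_function_sine_partial partial_in_sine_space[OF X])
  ultimately show "\<exists>s. (\<forall>n. simple_function M (s n) \<and> s n ` space M \<subseteq> X) \<and>
      (AE t in M. (\<lambda>n. N (\<lambda>x. u t x - s n t x)) \<longlonglongrightarrow> 0)"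
    by (intro exI[of _ ?s]) simp
qed

lemma sine_norm_AE:
  assumes X: "sine_space X N \<omega>"
    and u: "AE t in M. u t \<in> L2 \<and> summable (\<lambda>k. \<omega> k * (sine.cf (u t) k)\<^sup>2)"
  shows "AE t in M. (\<Sum>k. \<omega> k * (sine.cf (u t) k)\<^sup>2) = (N (u t))\<^sup>2"
  using u
proof eventually_elim
  case (elim t)
  then have "N (u t) = sqrt (\<Sum>k. \<omega> k * (sine.cf (u t) k)\<^sup>2)" and "\<And>k. 0 \<le> \<omega> k"
    using X by (auto simp: sine_space_def)
  with elim show ?case by (simp add: suminf_nonneg)
qed

lemma Bochner_L2_sine:
  assumes X: "sine_space X N \<omega>" and meas: "\<And>k. (\<lambda>t. sine.cf (u t) k) \<in> borel_measurable (time_interval T)"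
    and u: "AE t in time_interval T. u t \<in> L2 \<and> summable (\<lambda>k. \<omega> k * (sine.cf (u t) k)\<^sup>2)"
    and int: "integrable (time_interval T) (\<lambda>t. \<Sum>k. \<omega> k * (sine.cf (u t) k)\<^sup>2)"
  shows "u \<in> Bochner_L2 (time_interval T) X N"
proof -
  note AE = sine_norm_AE[OF X u]
  have m: "(\<lambda>t. \<Sum>k. \<omega> k * (sine.cf (u t) k)\<^sup>2) \<in> borel_measurable (time_interval T)"
    using int by blast
  then have "(\<lambda>t. (N (u t))\<^sup>2) \<in> borel_measurable (time_interval T)"
    by (rule lebesgue_on_measurable_AE[rotated, OF _ AE]) simp
  then have "integrable (time_interval T) (\<lambda>t. (N (u t))\<^sup>2)"
    using integrable_cong_AE[OF m _ AE] int by blast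
  then show ?thesis unfolding Bochner_L2_def using strongly_measurable_sine[OF X meas u] by blast
qed

lemma Bochner_Linf_sine:
  assumes X: "sine_space X N \<omega>" and meas: "\<And>k. (\<lambda>t. sine.cf (u t) k) \<in> borel_measurable M"
    and u: "AE t in M. u t \<in> L2 \<and> summable (\<lambda>k. \<omega> k * (sine.cf (u t) k)\<^sup>2)"
    and bd: "AE t in M. (\<Sum>k. \<omega> k * (sine.cf (u t) k)\<^sup>2) \<le> C"
  shows "u \<in> Bochner_Linf M X N"
proof -
  have "AE t in M. N (u t) \<le> sqrt C"
    using bd u
  proof eventually_elim
    case (elim t)
    then have "N (u t) = sqrt (\<Sum>k. \<omega> k * (sine.cf (u t) k)\<^sup>2)"
      using X by (auto simp: sine_space_def)
    with elim show ?case by simp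
  qed
  then show ?thesis unfolding Bochner_Linf_def using strongly_measurable_sine[OF X meas u] by blast
qed

text \<open>Meant for the given source: a simple function has simple coefficients, and convergence
  in \<open>L2\<close> gives convergence of each coefficient.\<close>

lemma strongly_measurable_cf:
  assumes "strongly_measurable (time_interval T) L2 L2_norm h"
  shows "AE t in time_interval T. h t \<in> L2" "(\<lambda>t. sine.cf (h t) k) \<in> borel_measurable (time_interval T)"
proof -
  let ?M = "time_interval T"
  show hL: "AE t in ?M. h t \<in> L2" using assms by (simp add: strongly_measurable_def)
  obtain s where s: "\<And>n. simple_function ?M (s n)" "\<And>n. s n ` space ?M \<subseteq> L2"
    "AE t in ?M. (\<lambda>n. L2_norm (\<lambda>x. h t x - s n t x)) \<longlonglongrightarrow> 0"
    using assms unfolding strongly_measurable_def by blast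
  have m: "(\<lambda>t. sine.cf (s n t) k) \<in> borel_measurable ?M" for n
    by (rule borel_measurable_simple_function, rule simple_function_compose1[OF s(1)])
  have "AE t in ?M. (\<lambda>n. sine.cf (s n t) k) \<longlonglongrightarrow> sine.cf (h t) k"
    using hL s(3) AE_space
  proof eventually_elim
    case (elim t)
    have "s n t \<in> L2" for n using s(2)[of n] elim(3) by blast
    then show ?case by (rule cf_tendsto[OF _ elim(1,2)])
  qed
  then have "AE t in ?M. lim (\<lambda>n. sine.cf (s n t) k) = sine.cf (h t) k"
    by eventually_elim (rule limI)
  then show "(\<lambda>t. sine.cf (h t) k) \<in> borel_measurable ?M"
    by (rule lebesgue_on_measurable_AE[rotated 2]) (auto intro: borel_measurable_lim_metric m)
qed

lemma simple_integral_in_eq: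
  assumes "finite_measure M" and s: "simple_function M s"
  shows "simple_integral_in M s x = (\<integral>t. s t x \<partial>M)"
proof -
  interpret finite_measure M by fact
  have fin: "finite (s ` space M)" and meas: "{t \<in> space M. s t = y} \<in> sets M" for y
    using simple_functionD(1)[OF s] simple_functionD(2)[OF s, of "{y}"]
    by (auto simp: vimage_def Int_def conj_commute)
  have "(\<integral>t. s t x \<partial>M) = (\<integral>t. (\<Sum>y\<in>s ` space M. indicator {t \<in> space M. s t = y} t * y x) \<partial>M)"
  proof (rule Bochner_Integration.integral_cong[OF refl])
    fix t assume t: "t \<in> space M"
    have "(\<Sum>y\<in>s ` space M. indicator {t \<in> space M. s t = y} t * y x)
        = (\<Sum>y\<in>s ` space M. if y = s t then y x else 0)"
      by (rule sum.cong) (use t in \<open>auto simp: indicator_def\<close>)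
    also have "\<dots> = s t x" using fin t by simp
    finally show "s t x = (\<Sum>y\<in>s ` space M. indicator {t \<in> space M. s t = y} t * y x)" by simp
  qed
  also have "\<dots> = (\<Sum>y\<in>s ` space M. measure M {t \<in> space M. s t = y} * y x)"
    by (subst Bochner_Integration.integral_sum) (auto simp: meas emeasure_finite less_top[symmetric])
  finally show ?thesis by (simp add: simple_integral_in_def)
qed

text \<open>A Bochner integral can be checked coefficient by coefficient. The diagonal simple
  functions of the measurability proof serve again; the first limit is dominated convergence in
  time, the second dominated convergence of the series over the modes.\<close>

lemma has_Bochner_integral_sine:
  assumes meas: "\<And>k. (\<lambda>t. sine.cf (u t) k) \<in> borel_measurable (time_interval T)"
    and u: "AE t in time_interval T. u t \<in> L2"
    and int: "integrable (time_interval T) (\<lambda>t. \<Sum>k. (sine.cf (u t) k)\<^sup>2)"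
    and I: "I \<in> L2" "\<And>k. sine.cf I k = (\<integral>t. sine.cf (u t) k \<partial>time_interval T)"
  shows "has_Bochner_integral_in (time_interval T) L2 L2_norm u I"
proof -
  let ?M = "time_interval T"
  let ?c = "\<lambda>k t. sine.cf (u t) k"
  let ?E = "\<lambda>t. \<Sum>k. (?c k t)\<^sup>2"
  interpret finite_measure ?M by (rule finite_measure_interval)
  have sm: "AE t in ?M. summable (\<lambda>k. (?c k t)\<^sup>2)"
    using u by eventually_elim (use L2_parseval in \<open>auto simp: sums_iff\<close>)
  have uu: "AE t in ?M. u t \<in> L2 \<and> summable (\<lambda>k. 1 * (?c k t)\<^sup>2)" using u sm by eventually_elim simp
  have smeas: "strongly_measurable ?M L2 L2_norm u"
    by (rule strongly_measurable_sine[OF sine_space_L2 meas uu])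
  obtain d where d: "\<And>k n. simple_function ?M (d k n)"
    "\<And>k t. t \<in> space ?M \<Longrightarrow> (\<lambda>n. d k n t) \<longlonglongrightarrow> ?c k t"
    "\<And>k n t. t \<in> space ?M \<Longrightarrow> \<bar>d k n t\<bar> \<le> 2 * \<bar>?c k t\<bar>"
    by (rule simple_function_coefficients[OF meas]) (rule that)
  have dm[measurable]: "d k n \<in> borel_measurable ?M" for k n by (rule borel_measurable_simple_function[OF d(1)])
  note meas[measurable]
  let ?s = "\<lambda>n t. sine.partial (\<lambda>k. d k n t) n"
  define r where "r n k t = ?c k t - (if k < n then d k n t else 0)" for n k t
  have r_rem: "rem (\<lambda>k. ?c k t) (\<lambda>k n. d k n t) n k = r n k t" for n k t
    by (simp add: rem_def r_def)
  have rm[measurable]: "r n k \<in> borel_measurable ?M" for n k unfolding r_def[abs_def] by simp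
  have rbound: "\<bar>r n k t\<bar> \<le> 3 * \<bar>?c k t\<bar>" "(r n k t)\<^sup>2 \<le> 9 * (?c k t)\<^sup>2"
    and rlim: "(\<lambda>n. r n k t) \<longlonglongrightarrow> 0" if "t \<in> space ?M" for n k t
    using rem_bound[where c="\<lambda>k. ?c k t" and d="\<lambda>k n. d k n t", OF d(2,3)[OF that]]
      rem_tendsto[where c="\<lambda>k. ?c k t" and d="\<lambda>k n. d k n t", OF d(2,3)[OF that]]
    unfolding r_rem by blast+
  define D where "D n t = (\<Sum>k. (r n k t)\<^sup>2)" for n t
  have Dm[measurable]: "D n \<in> borel_measurable ?M" for n unfolding D_def[abs_def] by measurable
  have Em[measurable]: "?E \<in> borel_measurable ?M" using int by blast
  have E0: "AE t in ?M. 0 \<le> ?E t" using sm by eventually_elim (rule suminf_nonneg, simp_all)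
  have D: "AE t in ?M. D n t \<le> 9 * ?E t \<and> (\<lambda>n. D n t) \<longlonglongrightarrow> 0 \<and> 0 \<le> D n t" for n
    using sm AE_space
  proof eventually_elim
    case (elim t)
    have 1: "summable (\<lambda>k. 1 * (?c k t)\<^sup>2)" using elim by simp
    note rw = rem_weighted[OF d(2,3)[OF elim(2)], of "\<lambda>k. 1", OF zero_le_one 1, unfolded r_rem mult_1]
    show ?case using rw suminf_nonneg[OF rw(1)] unfolding D_def by simp
  qed
  have norm_eq: "AE t in ?M. L2_norm (\<lambda>x. u t x - ?s n t x) = sqrt (D n t)" for n
    using uu AE_space
  proof eventually_elim
    case (elim t)
    show ?case
      using norm_approximation(1)[OF d(2,3)[OF elim(2)] sine_space_L2, where u="u t" and n=n] elim
      by (simp add: r_rem D_def)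
  qed
  \<comment> \<open>The error is at most the square root of \<open>9 * ?E t\<close>. Its majorant is
    kept linear in \<open>?E t\<close>, whose integrability is the hypothesis
    \<open>int\<close>.\<close>
  have Dle: "AE t in ?M. norm (sqrt (D n t)) \<le> 3 * (1 + ?E t)" for n
    using D[of n] E0
  proof eventually_elim
    case (elim t)
    have "?E t * 1 \<le> (1 + ?E t) * (1 + ?E t)" using elim by (intro mult_mono) auto
    moreover have "(3 * (1 + ?E t))\<^sup>2 = 9 * ((1 + ?E t) * (1 + ?E t))"
      unfolding power_mult_distrib power2_eq_square[of "1 + ?E t"] by simp
    ultimately have "D n t \<le> (3 * (1 + ?E t))\<^sup>2" using elim by linarith
    then show ?case using elim by (simp add: real_le_lsqrt)
  qed
  have Eint: "integrable ?M (\<lambda>t. 3 * (1 + ?E t))" using int by simp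
  have sDint: "integrable ?M (\<lambda>t. sqrt (D n t))" for n
  proof (rule Bochner_Integration.integrable_bound[OF Eint])
    show "AE t in ?M. norm (sqrt (D n t)) \<le> norm (3 * (1 + ?E t))"
      using Dle[of n] by eventually_elim simp
  qed measurable
  have "(\<lambda>n. \<integral>t. sqrt (D n t) \<partial>?M) \<longlonglongrightarrow> (\<integral>t. 0 \<partial>?M)"
  proof (rule integral_dominated_convergence[OF _ _ Eint _ Dle])
    show "AE t in ?M. (\<lambda>n. sqrt (D n t)) \<longlonglongrightarrow> 0"
      using D[of 0]
    proof eventually_elim
      case (elim t)
      then have "(\<lambda>n. sqrt (D n t)) \<longlonglongrightarrow> sqrt 0" by (intro tendsto_intros) simp
      then show ?case by simp
    qed
  qed measurable
  then have "(\<lambda>n. ennreal (\<integral>t. sqrt (D n t) \<partial>?M)) \<longlonglongrightarrow> ennreal 0"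
    by (intro tendsto_ennrealI) simp
  moreover have "(\<integral>\<^sup>+t. ennreal (L2_norm (\<lambda>x. u t x - ?s n t x)) \<partial>?M) = ennreal (\<integral>t. sqrt (D n t) \<partial>?M)" for n
  proof -
    have "(\<integral>\<^sup>+t. ennreal (L2_norm (\<lambda>x. u t x - ?s n t x)) \<partial>?M) = (\<integral>\<^sup>+t. ennreal (sqrt (D n t)) \<partial>?M)"
      by (rule nn_integral_cong_AE) (use norm_eq[of n] in \<open>eventually_elim, simp\<close>)
    also have "\<dots> = ennreal (\<integral>t. sqrt (D n t) \<partial>?M)"
      by (rule nn_integral_eq_integral[OF sDint]) (use D[of n] in \<open>eventually_elim, simp\<close>)
    finally show ?thesis .
  qed
  ultimately have lim1: "(\<lambda>n. \<integral>\<^sup>+t. ennreal (L2_norm (\<lambda>x. u t x - ?s n t x)) \<partial>?M) \<longlonglongrightarrow> 0" by simp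
  have c2: "integrable ?M (\<lambda>t. (?c k t)\<^sup>2)" for k
  proof (rule Bochner_Integration.integrable_bound[OF int])
    show "AE t in ?M. norm ((?c k t)\<^sup>2) \<le> norm (?E t)"
      using sm
    proof eventually_elim
      case (elim t)
      have "(?c k t)\<^sup>2 \<le> ?E t" using sum_le_suminf[OF elim, of "{k}"] by simp
      then show ?case by simp
    qed
  qed measurable
  have csq: "sqint ?M (?c k)" for k using c2 by (simp add: sqint_def)
  have cint: "integrable ?M (?c k)" for k by (rule sqint_integrable[OF finite_measure_interval csq])
  have dint: "integrable ?M (d k n)" for k n
  proof (rule Bochner_Integration.integrable_bound[of _ "\<lambda>t. 2 * ?c k t"])
    show "AE t in ?M. norm (d k n t) \<le> norm (2 * ?c k t)" using d(3) by (intro AE_I2) (simp add: abs_mult)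
  qed (use cint in auto)
  have r2: "integrable ?M (\<lambda>t. (r n k t)\<^sup>2)" for n k
  proof (rule Bochner_Integration.integrable_bound[of _ "\<lambda>t. 9 * (?c k t)\<^sup>2"])
    show "AE t in ?M. norm ((r n k t)\<^sup>2) \<le> norm (9 * (?c k t)\<^sup>2)" using rbound(2) by (intro AE_I2) simp
  qed (use c2 in auto)
  have rsq: "sqint ?M (r n k)" for n k using r2 by (simp add: sqint_def)
  have si: "simple_integral_in ?M (?s n) = sine.partial (\<lambda>k. \<integral>t. d k n t \<partial>?M) n" for n
  proof
    fix x
    have "simple_integral_in ?M (?s n) x = (\<integral>t. ?s n t x \<partial>?M)"
      by (intro simple_integral_in_eq finite_measure_interval simple_function_sine_partial d(1))
    also have "\<dots> = (\<Sum>k<n. (\<integral>t. d k n t \<partial>?M) * sn k x)"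
      unfolding sine.partial_def using dint by simp
    finally show "simple_integral_in ?M (?s n) x = sine.partial (\<lambda>k. \<integral>t. d k n t \<partial>?M) n x"
      by (simp add: sine.partial_def)
  qed
  define R where "R n k = (\<integral>t. r n k t \<partial>?M)" for n k
  have cfI: "sine.cf (\<lambda>x. I x - simple_integral_in ?M (?s n) x) k = R n k" for n k
    unfolding si cf_diff[OF I(1) partial_L2(1)] cf_partial I(2) R_def r_def
    using cint dint by (cases "k < n") auto
  have norm_I: "(L2_norm (\<lambda>x. I x - simple_integral_in ?M (?s n) x))\<^sup>2 = (\<Sum>k. (R n k)\<^sup>2)" for n
    using L2_parseval[of "\<lambda>x. I x - simple_integral_in ?M (?s n) x"] L2_diff[OF I(1) partial_L2(1)]
    unfolding cfI by (simp add: si sums_iff)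
  let ?\<mu> = "measure ?M (space ?M)"
  have one: "sqint ?M (\<lambda>x. 1)" by (rule sqint_bounded[OF finite_measure_interval, of _ _ _ 1]) auto
  \<comment> \<open>Cauchy-Schwarz in time against 1 moves the square inside the integral and gives
    a majorant that is summable over the modes and independent of \<open>n\<close>.\<close>
  have Rle: "(R n k)\<^sup>2 \<le> 9 * ?\<mu> * (\<integral>t. (?c k t)\<^sup>2 \<partial>?M)" for n k
  proof -
    have "(R n k)\<^sup>2 \<le> (\<integral>t. (r n k t)\<^sup>2 \<partial>?M) * ?\<mu>"
      using Cauchy_Schwarz_integral[OF rsq one] by (simp add: R_def)
    also have "\<dots> \<le> (\<integral>t. 9 * (?c k t)\<^sup>2 \<partial>?M) * ?\<mu>"
      by (intro mult_right_mono integral_mono r2) (use c2 rbound(2) in auto)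
    finally show ?thesis by (simp add: mult_ac)
  qed
  have Rlim: "(\<lambda>n. R n k) \<longlonglongrightarrow> 0" for k
  proof -
    have "(\<lambda>n. R n k) \<longlonglongrightarrow> (\<integral>t. 0 \<partial>?M)"
      unfolding R_def
    proof (rule integral_dominated_convergence[where w="\<lambda>t. 3 * \<bar>?c k t\<bar>"])
      show "integrable ?M (\<lambda>t. 3 * \<bar>?c k t\<bar>)" using cint by simp
      show "AE t in ?M. (\<lambda>n. r n k t) \<longlonglongrightarrow> 0" using rlim by (intro AE_I2)
      show "AE t in ?M. norm (r n k t) \<le> 3 * \<bar>?c k t\<bar>" for n using rbound(1) by (intro AE_I2) simp
    qed measurable
    then show ?thesis by simp
  qed
  have "summable (\<lambda>k. \<integral>t. (?c k t)\<^sup>2 \<partial>?M)"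
  proof (rule bounded_imp_summable)
    show "0 \<le> (\<integral>t. (?c k t)\<^sup>2 \<partial>?M)" for k by simp
    show "(\<Sum>k\<le>n. \<integral>t. (?c k t)\<^sup>2 \<partial>?M) \<le> (\<integral>t. ?E t \<partial>?M)" for n
    proof -
      have "(\<Sum>k\<le>n. \<integral>t. (?c k t)\<^sup>2 \<partial>?M) = (\<integral>t. (\<Sum>k\<le>n. (?c k t)\<^sup>2) \<partial>?M)" using c2 by simp
      also have "\<dots> \<le> (\<integral>t. ?E t \<partial>?M)"
      proof (rule integral_mono_AE)
        show "AE t in ?M. (\<Sum>k\<le>n. (?c k t)\<^sup>2) \<le> ?E t"
          using sm by eventually_elim (rule sum_le_suminf, auto)
      qed (use c2 int in auto)
      finally show ?thesis .
    qed
  qed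
  then have "summable (\<lambda>k. 9 * ?\<mu> * (\<integral>t. (?c k t)\<^sup>2 \<partial>?M))" by (rule summable_mult)
  then have "(\<lambda>n. \<Sum>k. (R n k)\<^sup>2) \<longlonglongrightarrow> (\<Sum>k. 0\<^sup>2)"
    by (rule dominated_series[rotated 2]) (use Rle Rlim in \<open>auto intro!: tendsto_power\<close>)
  then have "(\<lambda>n. (L2_norm (\<lambda>x. I x - simple_integral_in ?M (?s n) x))\<^sup>2) \<longlonglongrightarrow> 0"
    by (simp add: norm_I)
  then have "(\<lambda>n. sqrt ((L2_norm (\<lambda>x. I x - simple_integral_in ?M (?s n) x))\<^sup>2)) \<longlonglongrightarrow> sqrt 0"
    by (rule tendsto_real_sqrt)
  then have lim2: "(\<lambda>n. L2_norm (\<lambda>x. I x - simple_integral_in ?M (?s n) x)) \<longlonglongrightarrow> 0"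
    by (simp add: L2_norm_nonneg)
  have ss: "\<forall>n. simple_function ?M (?s n) \<and> ?s n ` space ?M \<subseteq> L2"
    using d(1) by (auto intro: simple_function_sine_partial partial_L2)
  show ?thesis
    unfolding has_Bochner_integral_in_def
    by (intro conjI smeas I(1) exI[of _ ?s] ss lim1 lim2)
qed

section \<open>Equicontinuity and Peano's theorem\<close>

text \<open>A diagonal subsequence converges on the countable set of pairs of a nonnegative rational
  time and a mode; equicontinuity extends this to all times. Both hypotheses are restricted to large
  \<open>n\<close> because the n-th Galerkin solution lives on a bounded time interval only.\<close>

lemma equicontinuous_selection:
  fixes y :: "nat \<Rightarrow> real \<Rightarrow> nat \<Rightarrow> real"
  assumes bd: "\<And>t k. t \<ge> 0 \<Longrightarrow> \<exists>B N. \<forall>n\<ge>N. \<bar>y n t k\<bar> \<le> B"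
    and equi: "\<And>T k \<epsilon>. \<epsilon> > 0 \<Longrightarrow> \<exists>\<delta>>0. \<exists>N. \<forall>n\<ge>N. \<forall>s\<in>{0..T}. \<forall>t\<in>{0..T}. \<bar>s - t\<bar> < \<delta> \<longrightarrow> \<bar>y n s k - y n t k\<bar> \<le> \<epsilon>"
  obtains r z where "strict_mono (r :: nat \<Rightarrow> nat)" "\<And>t k. t \<ge> 0 \<Longrightarrow> (\<lambda>n. y (r n) t k) \<longlonglongrightarrow> z t k"
proof -
  have "\<forall>t k. \<exists>B N. t \<ge> 0 \<longrightarrow> (\<forall>n\<ge>N. \<bar>y n t k\<bar> \<le> B)" using bd by blast
  then obtain B N where BN: "\<And>t k n. t \<ge> 0 \<Longrightarrow> n \<ge> N t k \<Longrightarrow> \<bar>y n t k\<bar> \<le> B t k"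
    by metis
  define B' where "B' t k = max 1 (B t k)" for t k
  define S where "S = {q :: real. q \<in> \<rat> \<and> q \<ge> 0} \<times> (UNIV :: nat set)"
  \<comment> \<open>\<open>function_convergent_subsequence\<close> asks for one bound at all indices
    and points: dividing by \<open>B'\<close>, which is at least 1, normalises it to 1, and the
    finitely many indices before \<open>N t k\<close> are set to 0.\<close>
  define Fn where "Fn n = (\<lambda>(t, k). if n \<ge> N t k then y n t k / B' t k else 0)" for n
  have "countable S" unfolding S_def
    by (intro countable_SIGMA countableI_type) (rule countable_subset[OF _ countable_rat], auto)
  moreover have "norm (Fn n x) \<le> 1" if "x \<in> S" for n x
  proof -
    obtain t k where x: "x = (t, k)" "t \<ge> 0" using \<open>x \<in> S\<close> by (auto simp: S_def)
    have "\<bar>y n t k\<bar> \<le> B' t k" if "n \<ge> N t k" using BN[OF x(2) that] by (simp add: B'_def)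
    moreover have "B' t k > 0" by (simp add: B'_def)
    ultimately show ?thesis by (simp add: Fn_def x abs_divide)
  qed
  ultimately obtain r where r: "strict_mono r" "\<And>x. x \<in> S \<Longrightarrow> \<exists>l. (\<lambda>n. Fn (r n) x) \<longlonglongrightarrow> l"
    using function_convergent_subsequence[of S Fn 1] by blast
  have ratconv: "\<exists>l. (\<lambda>n. y (r n) q k) \<longlonglongrightarrow> l" if q: "q \<in> \<rat>" "q \<ge> 0" for q k
  proof -
    have qS: "(q, k) \<in> S" using q by (simp add: S_def)
    obtain l where "(\<lambda>n. Fn (r n) (q, k)) \<longlonglongrightarrow> l" using r(2)[OF qS] by blast
    then have "(\<lambda>n. B' q k * Fn (r n) (q, k)) \<longlonglongrightarrow> B' q k * l" by (intro tendsto_intros)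
    moreover have "B' q k > 0" by (simp add: B'_def)
    then have "\<forall>\<^sub>F n in sequentially. B' q k * Fn (r n) (q, k) = y (r n) q k"
      using seq_suble[OF r(1)] by (intro eventually_sequentiallyI[of "N q k"]) (auto simp: Fn_def intro: order_trans)
    ultimately show ?thesis by (blast intro: Lim_transform_eventually)
  qed
  have "\<exists>l. (\<lambda>n. y (r n) t k) \<longlonglongrightarrow> l" if t: "t \<ge> 0" for t k
  proof -
    have "Cauchy (\<lambda>n. y (r n) t k)"
    proof (rule metric_CauchyI)
      fix \<epsilon> :: real assume "\<epsilon> > 0"
      then obtain \<delta> M where \<delta>: "\<delta> > 0" and M: "\<And>n s. n \<ge> M \<Longrightarrow> s \<in> {0..t+1} \<Longrightarrow> \<bar>s - t\<bar> < \<delta> \<Longrightarrow> \<bar>y n s k - y n t k\<bar> \<le> \<epsilon>/4"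
        using equi[of "\<epsilon>/4" "t+1" k] t by fastforce
      \<comment> \<open>Choosing the rational to the right of \<open>t\<close> keeps it nonnegative,
        and the cap 1 keeps it in \<open>{0..t+1}\<close>, where \<delta> was chosen.\<close>
      obtain q where q: "q \<in> \<rat>" "t < q" "q < t + min \<delta> 1"
        using Rats_dense_in_real[of t "t + min \<delta> 1"] \<delta> by auto
      obtain l where "(\<lambda>n. y (r n) q k) \<longlonglongrightarrow> l" using ratconv[of q k] q t by auto
      then have "Cauchy (\<lambda>n. y (r n) q k)" by (rule LIMSEQ_imp_Cauchy)
      then obtain K where K: "\<And>m n. m \<ge> K \<Longrightarrow> n \<ge> K \<Longrightarrow> dist (y (r m) q k) (y (r n) q k) < \<epsilon>/4"
        using metric_CauchyD[of _ "\<epsilon>/4"] \<open>\<epsilon> > 0\<close> by (metis divide_pos_pos zero_less_numeral)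
      have "dist (y (r m) t k) (y (r n) t k) < \<epsilon>" if "m \<ge> max K M" "n \<ge> max K M" for m n
      proof -
        have "r m \<ge> M" "r n \<ge> M" using that seq_suble[OF r(1)] by (auto intro: order_trans)
        moreover have qt: "q \<in> {0..t+1}" "\<bar>q - t\<bar> < \<delta>" using q t by auto
        ultimately have "\<bar>y (r m) q k - y (r m) t k\<bar> \<le> \<epsilon>/4" "\<bar>y (r n) q k - y (r n) t k\<bar> \<le> \<epsilon>/4"
          using M by blast+
        moreover have "\<bar>y (r m) q k - y (r n) q k\<bar> < \<epsilon>/4" using K[of m n] that by (simp add: dist_real_def)
        ultimately show ?thesis unfolding dist_real_def by linarith
      qed
      then show "\<exists>M. \<forall>m\<ge>M. \<forall>n\<ge>M. dist (y (r m) t k) (y (r n) t k) < \<epsilon>" by blast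
    qed
    then show ?thesis using real_Cauchy_convergent convergent_def by blast
  qed
  then have "\<And>t k. t \<ge> 0 \<Longrightarrow> (\<lambda>n. y (r n) t k) \<longlonglongrightarrow> lim (\<lambda>n. y (r n) t k)"
    using convergent_LIMSEQ_iff convergent_def by blast
  with r(1) show thesis by (rule that)
qed

lemma integral_lipschitz:
  fixes g :: "real \<Rightarrow> real"
  assumes g: "continuous_on {0..T} g" and B: "\<And>t. t \<in> {0..T} \<Longrightarrow> \<bar>g t\<bar> \<le> B"
    and ab: "a \<in> {0..T}" "b \<in> {0..T}"
  shows "\<bar>integral {0..a} g - integral {0..b} g\<bar> \<le> B * \<bar>a - b\<bar>"
proof -
  have "norm (integral {0..a} g - integral {0..b} g) \<le> B * norm (a - b)"
    by (rule field_differentiable_bound[of "{0..T}" _ g])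
      (use integral_has_real_derivative[OF g] B ab in auto)
  then show ?thesis by simp
qed

definition clip :: "real \<Rightarrow> real \<Rightarrow> real" where "clip T t = max 0 (min T t)"

text \<open>Iterates for the equation with time lag \<delta>, in which the slope at time
  \<open>s\<close> depends on the state at \<open>s - \<delta>\<close>. Clipping defines them for
  all real times, with value \<open>p\<close> before 0 and frozen after \<open>T\<close>, so the
  history is always available.\<close>

primrec delay :: "(real \<Rightarrow> (nat \<Rightarrow> real) \<Rightarrow> nat \<Rightarrow> real) \<Rightarrow> (nat \<Rightarrow> real) \<Rightarrow> real \<Rightarrow> real \<Rightarrow> nat \<Rightarrow> real \<Rightarrow> nat \<Rightarrow> real" where
  "delay G p T \<delta> 0 t k = p k"
| "delay G p T \<delta> (Suc j) t k = p k + integral {0..clip T t} (\<lambda>s. G s (delay G p T \<delta> j (s - \<delta>)) k)"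

text \<open>Tonelli's proof of Peano's theorem: the approximations solve the equation with a delay, so
  they are given by iterated integration.\<close>

lemma peano:
  fixes G :: "real \<Rightarrow> (nat \<Rightarrow> real) \<Rightarrow> nat \<Rightarrow> real" and p :: "nat \<Rightarrow> real"
  assumes T: "T > 0"
    and cont: "\<And>k s y s' y'. (\<And>j. s j \<in> {0..T}) \<Longrightarrow> s' \<in> {0..T} \<Longrightarrow> s \<longlonglongrightarrow> s' \<Longrightarrow>
      (\<And>i. (\<lambda>j. y j i) \<longlonglongrightarrow> y' i) \<Longrightarrow> (\<lambda>j. G (s j) (y j) k) \<longlonglongrightarrow> G s' y' k"
    and bnd: "\<And>k. \<exists>B. \<forall>s\<in>{0..T}. \<forall>y. \<bar>G s y k\<bar> \<le> B"
  obtains c where "\<And>k. c 0 k = p k"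
    "\<And>k t. t \<in> {0..T} \<Longrightarrow> ((\<lambda>t. c t k) has_real_derivative G t (c t) k) (at t within {0..T})"
proof -
  obtain B where B: "\<And>k s y. s \<in> {0..T} \<Longrightarrow> \<bar>G s y k\<bar> \<le> B k" using bnd by metis
  have B0: "B k \<ge> 0" for k using B[of 0 p k] T by auto
  have clip: "clip T t \<in> {0..T}" "\<bar>clip T s - clip T t\<bar> \<le> \<bar>s - t\<bar>" for s t
    using T by (auto simp: clip_def max_def min_def)
  have clip_id: "t \<in> {0..T} \<Longrightarrow> clip T t = t" for t by (auto simp: clip_def)
  have G_cont: "continuous_on {0..T} (\<lambda>s. G s (y s) k)" if "\<And>i. continuous_on {0..T} (\<lambda>s. y s i)" for y k
  proof (rule continuous_on_sequentiallyI)
    fix u a assume u: "\<forall>n. u n \<in> {0..T}" "a \<in> {0..T}" "u \<longlonglongrightarrow> a"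
    show "(\<lambda>n. G (u n) (y (u n)) k) \<longlonglongrightarrow> G a (y a) k"
      by (rule cont) (use u that in \<open>auto simp: continuous_on_sequentially o_def\<close>)
  qed
  have lip: "\<bar>delay G p T \<delta> j s k - delay G p T \<delta> j t k\<bar> \<le> B k * \<bar>s - t\<bar>" for \<delta> j s t k
  proof (induction j arbitrary: s t k)
    case 0
    then show ?case using B0 by simp
  next
    case (Suc j)
    have "continuous_on {0..T} (\<lambda>s. delay G p T \<delta> j (s - \<delta>) i)" for i
    proof (rule continuous_onI)
      fix x \<epsilon> :: real assume "\<epsilon> > 0"
      have "dist (delay G p T \<delta> j (x' - \<delta>) i) (delay G p T \<delta> j (x - \<delta>) i) \<le> \<epsilon>" if "dist x' x < \<epsilon> / (B i + 1)" for x'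
      proof -
        have "dist (delay G p T \<delta> j (x' - \<delta>) i) (delay G p T \<delta> j (x - \<delta>) i) \<le> B i * dist x' x"
          using Suc[of "x' - \<delta>" i "x - \<delta>"] by (simp add: dist_real_def)
        also have "\<dots> \<le> (B i + 1) * (\<epsilon> / (B i + 1))" using that B0[of i] by (intro mult_mono) auto
        finally show ?thesis using B0[of i] by simp
      qed
      moreover have "\<epsilon> / (B i + 1) > 0" using \<open>\<epsilon> > 0\<close> B0[of i] by simp
      ultimately show "\<exists>d>0. \<forall>x'\<in>{0..T}. dist x' x < d \<longrightarrow> dist (delay G p T \<delta> j (x' - \<delta>) i) (delay G p T \<delta> j (x - \<delta>) i) \<le> \<epsilon>"
        by blast
    qed
    then have "continuous_on {0..T} (\<lambda>s. G s (delay G p T \<delta> j (s - \<delta>)) k)" by (rule G_cont)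
    then have "\<bar>delay G p T \<delta> (Suc j) s k - delay G p T \<delta> (Suc j) t k\<bar> \<le> B k * \<bar>clip T s - clip T t\<bar>"
      using integral_lipschitz[of T "\<lambda>s. G s (delay G p T \<delta> j (s - \<delta>)) k" "B k" "clip T s" "clip T t"] B clip by simp
    also have "\<dots> \<le> B k * \<bar>s - t\<bar>" by (intro mult_left_mono clip B0)
    finally show ?case .
  qed
  have lip_cont: "continuous_on S (\<lambda>t. y (t - \<delta>) i)" if "\<And>s t. \<bar>y s i - y t i\<bar> \<le> B i * \<bar>s - t\<bar>" for y :: "real \<Rightarrow> nat \<Rightarrow> real" and i \<delta> S
  proof (rule continuous_onI)
    fix x \<epsilon> :: real assume "\<epsilon> > 0"
    have "dist (y (x' - \<delta>) i) (y (x - \<delta>) i) \<le> \<epsilon>" if "dist x' x < \<epsilon> / (B i + 1)" for x'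
    proof -
      have "dist (y (x' - \<delta>) i) (y (x - \<delta>) i) \<le> B i * dist x' x"
        using \<open>\<And>s t. \<bar>y s i - y t i\<bar> \<le> B i * \<bar>s - t\<bar>\<close>[of "x' - \<delta>" "x - \<delta>"] by (simp add: dist_real_def)
      also have "\<dots> \<le> (B i + 1) * (\<epsilon> / (B i + 1))" using that B0[of i] by (intro mult_mono) auto
      finally show ?thesis using B0[of i] by simp
    qed
    moreover have "\<epsilon> / (B i + 1) > 0" using \<open>\<epsilon> > 0\<close> B0[of i] by simp
    ultimately show "\<exists>d>0. \<forall>x'\<in>S. dist x' x < d \<longrightarrow> dist (y (x' - \<delta>) i) (y (x - \<delta>) i) \<le> \<epsilon>" by blast
  qed
  \<comment> \<open>The lag makes the iteration stationary: the j-th iterate is final up to time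
    \<open>j * \<delta>\<close>. Finitely many integrations therefore solve the delayed equation on
    [0,T].\<close>
  have stable: "delay G p T \<delta> (Suc j) t = delay G p T \<delta> j t" if "t \<le> real j * \<delta>" "t \<le> T" for \<delta> j t
    using that
  proof (induction j arbitrary: t)
    case 0
    then have "clip T t = 0" using T by (simp add: clip_def)
    then show ?case by (simp add: fun_eq_iff)
  next
    case (Suc j)
    have "delay G p T \<delta> (Suc (Suc j)) t k = delay G p T \<delta> (Suc j) t k" for k
    proof (cases "t \<le> 0")
      case True
      then have "clip T t = 0" using T by (simp add: clip_def)
      then show ?thesis by simp
    next
      case False
      then have ct: "clip T t = t" using Suc.prems by (intro clip_id) auto
      have "integral {0..t} (\<lambda>s. G s (delay G p T \<delta> (Suc j) (s - \<delta>)) k) = integral {0..t} (\<lambda>s. G s (delay G p T \<delta> j (s - \<delta>)) k)"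
      proof (rule Henstock_Kurzweil_Integration.integral_cong)
        fix s assume s: "s \<in> {0..t}"
        show "G s (delay G p T \<delta> (Suc j) (s - \<delta>)) k = G s (delay G p T \<delta> j (s - \<delta>)) k"
        proof (cases "s - \<delta> \<le> T")
          case True
          then have "delay G p T \<delta> (Suc j) (s - \<delta>) = delay G p T \<delta> j (s - \<delta>)"
            by (intro Suc.IH) (use s Suc.prems in \<open>auto simp: algebra_simps\<close>)
          then show ?thesis by (simp only:)
        next
          \<comment> \<open>This case forces \<delta> < 0, which contradicts \<open>0 < t\<close>
            and \<open>t <= real (Suc j) * \<delta>\<close>.\<close>
          case F: False
          then have "\<delta> < 0" using s Suc.prems by auto
          then have "real (Suc j) * \<delta> \<le> 0" by (simp add: mult_nonneg_nonpos)
          then show ?thesis using Suc.prems \<open>\<not> t \<le> 0\<close> by linarith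
        qed
      qed
      then have "p k + integral {0..clip T t} (\<lambda>s. G s (delay G p T \<delta> (Suc j) (s - \<delta>)) k)
          = p k + integral {0..clip T t} (\<lambda>s. G s (delay G p T \<delta> j (s - \<delta>)) k)"
        unfolding ct by (simp only:)
      then show ?thesis by (simp only: delay.simps(2)[symmetric])
    qed
    then show ?case by (simp add: fun_eq_iff)
  qed
  define \<delta> where "\<delta> n = inverse (real (Suc n))" for n
  \<comment> \<open>With lag 1/(n+1) this number of iterations reaches the ceiling of
    \<open>T\<close>.\<close>
  define y where "y n = delay G p T (\<delta> n) (Suc n * nat \<lceil>T\<rceil>)" for n
  have \<delta>pos: "\<delta> n > 0" for n by (simp add: \<delta>_def)
  have \<delta>0: "\<delta> \<longlonglongrightarrow> 0" unfolding \<delta>_def by (rule LIMSEQ_inverse_real_of_nat)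
  have ylip: "\<bar>y n s k - y n t k\<bar> \<le> B k * \<bar>s - t\<bar>" for n s t k unfolding y_def by (rule lip)
  have yc: "continuous_on S (\<lambda>t. y n (t - d) i)" for S n d i by (rule lip_cont) (rule ylip)
  have Gyc: "continuous_on {0..T} (\<lambda>s. G s (y n (s - \<delta> n)) k)" for n k by (rule G_cont) (rule yc)
  have yeq: "y n t k = p k + integral {0..t} (\<lambda>s. G s (y n (s - \<delta> n)) k)" if t: "t \<in> {0..T}" for n t k
  proof -
    have "real (Suc n * nat \<lceil>T\<rceil>) * \<delta> n = real (nat \<lceil>T\<rceil>)"
      unfolding \<delta>_def of_nat_mult using of_nat_neq_0[of n, where 'a=real] by (simp only: field_simps) simp
    moreover have "T \<le> real (nat \<lceil>T\<rceil>)" by (simp add: real_nat_ceiling_ge)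
    moreover have "t \<le> T" using t by simp
    ultimately have "t \<le> real (Suc n * nat \<lceil>T\<rceil>) * \<delta> n" "t \<le> T" by linarith+
    then have "y n t = delay G p T (\<delta> n) (Suc (Suc n * nat \<lceil>T\<rceil>)) t"
      unfolding y_def by (rule stable[symmetric])
    then show ?thesis by (simp only: delay.simps y_def[symmetric] clip_id[OF t])
  qed
  have y0: "y n 0 k = p k" for n k using yeq[of 0 n k] T by simp
  obtain r z where r: "strict_mono r" and z: "\<And>t k. t \<ge> 0 \<Longrightarrow> (\<lambda>n. y (r n) t k) \<longlonglongrightarrow> z t k"
  proof (rule equicontinuous_selection[of y])
    fix t :: real and k assume "t \<ge> 0"
    have "\<bar>y n t k\<bar> \<le> \<bar>p k\<bar> + B k * t" for n using ylip[of n t k 0] y0[of n k] \<open>t \<ge> 0\<close> by auto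
    then show "\<exists>B N. \<forall>n\<ge>N. \<bar>y n t k\<bar> \<le> B" by blast
  next
    fix T' :: real and k and \<epsilon> :: real assume \<epsilon>: "\<epsilon> > 0"
    have "\<bar>y n s k - y n t k\<bar> \<le> \<epsilon>" if "\<bar>s - t\<bar> < \<epsilon> / (B k + 1)" for n s t
    proof -
      have "\<bar>y n s k - y n t k\<bar> \<le> B k * \<bar>s - t\<bar>" by (rule ylip)
      also have "\<dots> \<le> (B k + 1) * (\<epsilon> / (B k + 1))" using that B0[of k] by (intro mult_mono) auto
      finally show ?thesis using B0[of k] by simp
    qed
    moreover have "\<epsilon> / (B k + 1) > 0" using \<epsilon> B0[of k] by simp
    ultimately show "\<exists>\<delta>>0. \<exists>N. \<forall>n\<ge>N. \<forall>s\<in>{0..T'}. \<forall>t\<in>{0..T'}. \<bar>s - t\<bar> < \<delta> \<longrightarrow> \<bar>y n s k - y n t k\<bar> \<le> \<epsilon>" by blast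
  qed (rule that)
  have \<delta>r: "(\<lambda>n. \<delta> (r n)) \<longlonglongrightarrow> 0" using LIMSEQ_subseq_LIMSEQ[OF \<delta>0 r] by (simp add: o_def)
  \<comment> \<open>The Lipschitz constant \<open>B i\<close> is the same for all approximations, so
    the vanishing lag does not change the limit.\<close>
  have zd: "(\<lambda>n. y (r n) (s - \<delta> (r n)) i) \<longlonglongrightarrow> z s i" if "s \<ge> 0" for s i
  proof -
    have "(\<lambda>n. y (r n) (s - \<delta> (r n)) i - y (r n) s i) \<longlonglongrightarrow> 0"
    proof (rule Lim_null_comparison[OF always_eventually])
      show "\<forall>n. norm (y (r n) (s - \<delta> (r n)) i - y (r n) s i) \<le> B i * \<delta> (r n)"
        using ylip[of _ "s - \<delta> (r _)" i s] \<delta>pos by (metis abs_minus_cancel abs_of_pos diff_diff_eq2 add_diff_cancel_left' minus_diff_eq real_norm_def abs_minus_commute)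
      have "(\<lambda>n. B i * \<delta> (r n)) \<longlonglongrightarrow> B i * 0" by (intro tendsto_intros \<delta>r)
      then show "(\<lambda>n. B i * \<delta> (r n)) \<longlonglongrightarrow> 0" by simp
    qed
    from tendsto_add[OF this z[OF that, of i]] show ?thesis by simp
  qed
  have zlip: "\<bar>z s k - z t k\<bar> \<le> B k * \<bar>s - t\<bar>" if "s \<ge> 0" "t \<ge> 0" for s t k
  proof (rule LIMSEQ_le_const2)
    show "(\<lambda>n. \<bar>y (r n) s k - y (r n) t k\<bar>) \<longlonglongrightarrow> \<bar>z s k - z t k\<bar>"
      by (intro tendsto_intros z that)
  qed (use ylip in auto)
  have zc: "continuous_on {0..T} (\<lambda>t. z t k)" for k
  proof -
    have "continuous_on {0..T} (\<lambda>t. z (clip T (t - 0)) k)"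
    proof (rule lip_cont)
      fix s t
      have "\<bar>z (clip T s) k - z (clip T t) k\<bar> \<le> B k * \<bar>clip T s - clip T t\<bar>" using clip(1) by (intro zlip) auto
      also have "\<dots> \<le> B k * \<bar>s - t\<bar>" by (intro mult_left_mono clip B0)
      finally show "\<bar>z (clip T s) k - z (clip T t) k\<bar> \<le> B k * \<bar>s - t\<bar>" .
    qed
    then show ?thesis by (rule continuous_on_eq) (simp add: clip_id)
  qed
  have Gzc: "continuous_on {0..T} (\<lambda>s. G s (z s) k)" for k by (rule G_cont) (rule zc)
  have zeq: "z t k = p k + integral {0..t} (\<lambda>s. G s (z s) k)" if t: "t \<in> {0..T}" for t k
  proof -
    have sub: "{0..t} \<subseteq> {0..T}" using t by auto
    have "(\<lambda>n. integral {0..t} (\<lambda>s. G s (y (r n) (s - \<delta> (r n))) k)) \<longlonglongrightarrow> integral {0..t} (\<lambda>s. G s (z s) k)"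
    proof (rule dominated_convergence(2)[where h="\<lambda>s. B k"])
      show "(\<lambda>s. G s (y (r n) (s - \<delta> (r n))) k) integrable_on {0..t}" for n
        by (rule integrable_continuous_real) (rule continuous_on_subset[OF Gyc sub])
      show "norm (G s (y (r n) (s - \<delta> (r n))) k) \<le> B k" if "s \<in> {0..t}" for n s
        using B[of s] that sub by auto
      show "(\<lambda>n. G s (y (r n) (s - \<delta> (r n))) k) \<longlonglongrightarrow> G s (z s) k" if "s \<in> {0..t}" for s
        by (rule cont) (use that sub zd in auto)
    qed (simp add: integrable_const_ivl)
    then have "(\<lambda>n. y (r n) t k) \<longlonglongrightarrow> p k + integral {0..t} (\<lambda>s. G s (z s) k)"
      unfolding yeq[OF t] by (intro tendsto_intros)
    then show ?thesis using z[of t k] t LIMSEQ_unique by auto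
  qed
  show thesis
  proof (rule that)
    show "z 0 k = p k" for k using zeq[of 0 k] T by simp
    fix k t assume t: "t \<in> {0..T}"
    have "((\<lambda>t. p k + integral {0..t} (\<lambda>s. G s (z s) k)) has_real_derivative 0 + G t (z t) k) (at t within {0..T})"
      by (intro DERIV_add DERIV_const integral_has_real_derivative Gzc t)
    then have d: "((\<lambda>t. p k + integral {0..t} (\<lambda>s. G s (z s) k)) has_real_derivative G t (z t) k) (at t within {0..T})" by simp
    show "((\<lambda>t. z t k) has_real_derivative G t (z t) k) (at t within {0..T})"
      by (rule has_field_derivative_transform_within[OF d zero_less_one t]) (simp add: zeq[symmetric])
  qed
qed

section \<open>Galerkin approximations\<close>

text \<open>An integral over \<open>{x..0}\<close> vanishes for \<open>x >= 0\<close>, so the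
  difference \<open>?G\<close> is the oriented integral from 0 to \<open>x\<close>. Near a given
  \<open>x\<close> it differs by a constant from an integral with a fixed lower end
  \<open>- K\<close>.\<close>

lemma antiderivative_exists:
  fixes g :: "real \<Rightarrow> real"
  assumes g: "continuous_on UNIV g"
  obtains G where "G 0 = 0" "\<And>x. (G has_real_derivative g x) (at x)"
proof -
  let ?G = "\<lambda>x. integral {0..x} g - integral {x..0} g"
  have "(?G has_real_derivative g x) (at x)" for x
  proof -
  define K where "K = \<bar>x\<bar> + 1"
  have gc: "continuous_on S g" for S using g continuous_on_subset by blast
  have gi: "g integrable_on {p..q}" for p q by (rule integrable_continuous_real[OF gc])
  have "((\<lambda>y. integral {- K..y} g) has_real_derivative g x) (at x within {- K..K})"
    by (rule integral_has_real_derivative[OF gc]) (auto simp: K_def)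
  moreover have "at x within {- K..K} = at x"
    by (rule at_within_interior) (auto simp: K_def)
  ultimately have "((\<lambda>y. integral {- K..y} g) has_real_derivative g x) (at x)" by simp
  then have "((\<lambda>y. integral {- K..y} g - integral {- K..0} g) has_real_derivative g x - 0) (at x)"
    by (intro DERIV_diff DERIV_const)
  then have d: "((\<lambda>y. integral {- K..y} g - integral {- K..0} g) has_real_derivative g x) (at x)" by simp
  show ?thesis
  proof (rule has_field_derivative_transform_within_open[OF d, of "{- K<..<K}"])
    fix y assume y: "y \<in> {- K<..<K}"
    show "integral {- K..y} g - integral {- K..0} g = ?G y"
    proof (cases "y \<ge> 0")
      case True
      have "integral {- K..0} g + integral {0..y} g = integral {- K..y} g"
        by (rule Henstock_Kurzweil_Integration.integral_combine) (use y True gi in auto)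
      moreover have "integral {y..0} g = 0" using True by (cases "y = 0") auto
      ultimately show ?thesis by simp
    next
      case False
      have "integral {- K..y} g + integral {y..0} g = integral {- K..0} g"
        by (rule Henstock_Kurzweil_Integration.integral_combine) (use y False gi in auto)
      then show ?thesis using False by simp
    qed
  qed (auto simp: K_def)
  qed
  then show thesis by (intro that[of ?G]) simp_all
qed

text \<open>Every derivative is gauge integrable, so continuity is asked of the majorant \<psi>
  only.\<close>

lemma deriv_le_integral:
  fixes \<phi> \<psi> :: "real \<Rightarrow> real"
  assumes t: "0 \<le> t" and d: "\<And>s. s \<in> {0..t} \<Longrightarrow> (\<phi> has_real_derivative \<phi>' s) (at s within {0..t})"
    and le: "\<And>s. s \<in> {0..t} \<Longrightarrow> \<phi>' s \<le> \<psi> s" and \<psi>: "continuous_on {0..t} \<psi>"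
  shows "\<phi> t \<le> \<phi> 0 + integral {0..t} \<psi>"
proof -
  have "(\<phi>' has_integral (\<phi> t - \<phi> 0)) {0..t}"
    by (rule fundamental_theorem_of_calculus[OF t])
      (use d in \<open>auto simp: has_real_derivative_iff_has_vector_derivative\<close>)
  moreover have "(\<psi> has_integral integral {0..t} \<psi>) {0..t}"
    using integrable_continuous_real[OF \<psi>] by (rule integrable_integral)
  ultimately have "\<phi> t - \<phi> 0 \<le> integral {0..t} \<psi>" using le by (rule has_integral_le)
  then show ?thesis by simp
qed

lemma primitive_upper_bound:
  fixes G g :: "real \<Rightarrow> real"
  assumes G: "\<And>x. (G has_real_derivative g x) (at x)" "G 0 = 0"
    and g: "\<And>x. x \<ge> 0 \<Longrightarrow> g x \<le> K + b * x" and x: "x \<ge> 0"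
  shows "G x \<le> K * x + b * x\<^sup>2 / 2"
proof -
  have "K * 0 + b * 0\<^sup>2 / 2 - G 0 \<le> K * x + b * x\<^sup>2 / 2 - G x"
  proof (rule DERIV_nonneg_imp_nondecreasing[OF x])
    fix y assume y: "0 \<le> y" "y \<le> x"
    have "((\<lambda>x. K * x + b * x\<^sup>2 / 2) has_real_derivative K + b * y) (at y)"
      by (auto intro!: derivative_eq_intros)
    from DERIV_diff[OF this G(1)] g[OF y(1)]
    show "\<exists>z. ((\<lambda>x. K * x + b * x\<^sup>2 / 2 - G x) has_real_derivative z) (at y) \<and> 0 \<le> z" by auto
  qed
  then show ?thesis using G(2) by simp
qed

text \<open>The squared \<open>H01_norm\<close> of the sine polynomial with the first
  \<open>n\<close> coefficients of \<open>c\<close>.\<close>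

definition V :: "nat \<Rightarrow> (nat \<Rightarrow> real) \<Rightarrow> real" where
  "V n c = (\<Sum>k<n. (om k)\<^sup>2 * (c k)\<^sup>2)"

lemma V_nonneg: "0 \<le> V n c"
  by (simp add: V_def sum_nonneg)

lemma sum_sq_le_V: "(\<Sum>k<n. (c k)\<^sup>2) \<le> V n c"
  unfolding V_def
proof (rule sum_mono)
  fix k
  show "(c k)\<^sup>2 \<le> (om k)\<^sup>2 * (c k)\<^sup>2" using mult_right_mono[OF om_sq_le(2)[of k], of "(c k)\<^sup>2"] by simp
qed

lemma coefficient_le_V: "k < n \<Longrightarrow> (c k)\<^sup>2 \<le> V n c"
  using sum_sq_le_V[of c n] member_le_sum[of k "{..<n}" "\<lambda>k. (c k)\<^sup>2"] by simp

text \<open>The telescoping bound 2 for the sum of 1/(k+1)^2 together with \<open>pi >= 2\<close>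
  gives 2/4. The value 1/2 cancels the bound 2 for the square of \<open>sn\<close>, so the embedding
  below has constant 1.\<close>

lemma sum_inverse_om_sq: "(\<Sum>k<n. 1 / (om k)\<^sup>2) \<le> 1 / 2"
proof -
  have "(\<Sum>k<n. 1 / (real k + 1)\<^sup>2) \<le> 2"
  proof -
    have "(\<Sum>k<Suc j. 1 / (real k + 1)\<^sup>2) \<le> 2 - 1 / (real j + 1)" for j
    proof (induction j)
      case (Suc j)
      have "1 / (real (Suc j) + 1)\<^sup>2 \<le> 1 / ((real j + 1) * (real j + 2))"
        by (intro divide_left_mono) (auto simp: power2_eq_square intro!: mult_mono)
      also have "\<dots> = 1 / (real j + 1) - 1 / (real j + 2)" by (simp add: field_simps)
      finally have le: "1 / (real (Suc j) + 1)\<^sup>2 \<le> 1 / (real j + 1) - 1 / (real j + 2)" .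
      have e: "real (Suc j) + 1 = real j + 2" by simp
      show ?case using Suc le unfolding sum.lessThan_Suc[of _ "Suc j"] e by linarith
    qed simp
    then have "(\<Sum>k<Suc n. 1 / (real k + 1)\<^sup>2) \<le> 2" by (smt (verit) divide_nonneg_nonneg of_nat_0_le_iff)
    moreover have "(\<Sum>k<n. 1 / (real k + 1)\<^sup>2) \<le> (\<Sum>k<Suc n. 1 / (real k + 1)\<^sup>2)" by simp
    ultimately show ?thesis by linarith
  qed
  moreover have "1 / (om k)\<^sup>2 \<le> (1/4) * (1 / (real k + 1)\<^sup>2)" for k
  proof -
    have "2\<^sup>2 \<le> pi\<^sup>2" by (rule power_mono) (use pi_ge_two in auto)
    then have "4 * (real k + 1)\<^sup>2 \<le> (om k)\<^sup>2" unfolding om_def power_mult_distrib by (simp add: mult.commute mult_right_mono)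
    then show ?thesis using om_pos[of k] by (simp add: field_simps)
  qed
  then have "(\<Sum>k<n. 1 / (om k)\<^sup>2) \<le> (\<Sum>k<n. (1/4) * (1 / (real k + 1)\<^sup>2))" by (rule sum_mono)
  moreover have "\<dots> = (1/4) * (\<Sum>k<n. 1 / (real k + 1)\<^sup>2)" by (rule sum_distrib_left[symmetric])
  ultimately show ?thesis by linarith
qed

text \<open>The one-dimensional Sobolev embedding, as Cauchy-Schwarz with the weights
  \<open>om k\<close>. The index set is general so that tails of series are covered as well as
  partial sums.\<close>

lemma sum_abs_le_sqrt:
  assumes "finite I" "(\<Sum>k\<in>I. 1 / (om k)\<^sup>2) \<le> 1 / 2"
  shows "(\<Sum>k\<in>I. \<bar>c k * sn k x\<bar>)\<^sup>2 \<le> (\<Sum>k\<in>I. (om k)\<^sup>2 * (c k)\<^sup>2)"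
proof -
  have "(\<Sum>k\<in>I. \<bar>c k * sn k x\<bar>) = (\<Sum>k\<in>I. (om k * \<bar>c k\<bar>) * (\<bar>sn k x\<bar> / om k))"
    using om_pos by (intro sum.cong) (auto simp: abs_mult less_imp_neq[THEN not_sym])
  then have "(\<Sum>k\<in>I. \<bar>c k * sn k x\<bar>)\<^sup>2 \<le> (\<Sum>k\<in>I. (om k * \<bar>c k\<bar>)\<^sup>2) * (\<Sum>k\<in>I. (\<bar>sn k x\<bar> / om k)\<^sup>2)"
    using Cauchy_Schwarz_ineq_sum[of "\<lambda>k. om k * \<bar>c k\<bar>" "\<lambda>k. \<bar>sn k x\<bar> / om k" I] by simp
  also have "\<dots> \<le> (\<Sum>k\<in>I. (om k)\<^sup>2 * (c k)\<^sup>2) * 1"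
  proof (rule mult_mono)
    have "(\<bar>sn k x\<bar> / om k)\<^sup>2 \<le> 2 * (1 / (om k)\<^sup>2)" for k
    proof -
      have "\<bar>sn k x\<bar>\<^sup>2 \<le> (sqrt 2)\<^sup>2" by (rule power_mono[OF sn_bound]) simp
      then show ?thesis by (simp add: power_divide divide_right_mono)
    qed
    then have "(\<Sum>k\<in>I. (\<bar>sn k x\<bar> / om k)\<^sup>2) \<le> (\<Sum>k\<in>I. 2 * (1 / (om k)\<^sup>2))" by (rule sum_mono)
    also have "\<dots> = 2 * (\<Sum>k\<in>I. 1 / (om k)\<^sup>2)" by (rule sum_distrib_left[symmetric])
    also have "\<dots> \<le> 1" using assms(2) by simp
    finally show "(\<Sum>k\<in>I. (\<bar>sn k x\<bar> / om k)\<^sup>2) \<le> 1" .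
  qed (auto simp: power_mult_distrib sum_nonneg)
  finally show ?thesis by simp
qed

lemma partial_sq_le_V: "(sine.partial c n x)\<^sup>2 \<le> V n c"
proof -
  have "(sine.partial c n x)\<^sup>2 \<le> (\<Sum>k<n. \<bar>c k * sn k x\<bar>)\<^sup>2"
    unfolding sine.partial_def abs_le_square_iff[symmetric] using sum_abs[of "\<lambda>k. c k * sn k x" "{..<n}"] by (simp add: sum_nonneg)
  also have "\<dots> \<le> V n c" unfolding V_def by (rule sum_abs_le_sqrt[OF finite_lessThan sum_inverse_om_sq])
  finally show ?thesis .
qed

lemma partial_continuous: "continuous_on S (sine.partial c n)"
  unfolding sine.partial_def[abs_def] by (intro continuous_intros sn_cont)

lemma partial_joint_continuous:
  assumes "\<And>k. k < n \<Longrightarrow> continuous_on S (\<lambda>t. c t k)"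
  shows "continuous_on (S \<times> A) (\<lambda>(t, x). sine.partial (c t) n x)"
  unfolding sine.partial_def split_beta
proof (intro continuous_on_sum continuous_on_mult)
  fix k assume "k \<in> {..<n}"
  then show "continuous_on (S \<times> A) (\<lambda>p. c (fst p) k)"
    by (intro continuous_on_compose2[OF assms]) (auto intro: continuous_intros)
  show "continuous_on (S \<times> A) (\<lambda>p. sn k (snd p))"
    by (rule continuous_on_compose2[OF sn_cont[of UNIV]]) (auto intro: continuous_intros)
qed

section \<open>A priori estimates for the Galerkin systems\<close>

locale problem =
  fixes lam m \<beta> \<gamma> :: real and f a :: "real \<Rightarrow> real"
  assumes lam: "lam > 0" and f_cont: "continuous_on UNIV f" and a_cont: "continuous_on {0..} a"
    and m: "m > 0" and a_ge: "\<And>s. s \<ge> 0 \<Longrightarrow> m \<le> a s" and \<beta>: "\<beta> > 0" and \<gamma>: "\<gamma> > 0"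
    and diss: "\<And>r. f r * r \<le> \<gamma> + \<beta> * r\<^sup>2"
begin

definition F :: "nat \<Rightarrow> (nat \<Rightarrow> real) \<Rightarrow> nat \<Rightarrow> real" where
  "F n c k = lam * (LINT x|lebesgue_on \<Omega>. f (sine.partial c n x) * sn k x)"

definition rhs :: "nat \<Rightarrow> (real \<Rightarrow> nat \<Rightarrow> real) \<Rightarrow> real \<Rightarrow> (nat \<Rightarrow> real) \<Rightarrow> nat \<Rightarrow> real" where
  "rhs n h t c k = - (om k)\<^sup>2 * a (V n c) * c k + F n c k + h t k"

text \<open>The source is given by its coefficients and is continuous in time, so solutions are
  classical and all energy computations are ordinary calculus.\<close>

definition galerkin :: "nat \<Rightarrow> (real \<Rightarrow> nat \<Rightarrow> real) \<Rightarrow> real \<Rightarrow> (real \<Rightarrow> nat \<Rightarrow> real) \<Rightarrow> bool" where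
  "galerkin n h T c \<longleftrightarrow> (\<forall>k<n. continuous_on {0..T} (\<lambda>t. h t k)) \<and>
     (\<forall>t\<in>{0..T}. \<forall>k<n. ((\<lambda>t. c t k) has_real_derivative rhs n h t (c t) k) (at t within {0..T}))"

lemma f_cont_on: "continuous_on S f"
  using f_cont continuous_on_subset by blast

lemma f_partial_cont: "continuous_on S (\<lambda>x. f (sine.partial c n x))"
  by (rule continuous_on_compose2[OF f_cont partial_continuous]) simp

lemma f_partial_sqint: "sqint (lebesgue_on \<Omega>) (\<lambda>x. f (sine.partial c n x))"
  by (rule sqint_continuous[OF f_partial_cont])

lemma F_eq: "F n c k = lam * integral {0..1} (\<lambda>x. f (sine.partial c n x) * sn k x)"
  unfolding F_def by (subst LINT_interval_eq) (auto intro!: continuous_intros f_partial_cont sn_cont)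

lemma galerkin_restrict:
  assumes "galerkin n h T c" "t \<le> T" shows "galerkin n h t c"
proof -
  have sub: "{0..t} \<subseteq> {0..T}" using assms by auto
  show ?thesis
    unfolding galerkin_def
  proof (intro conjI allI ballI impI)
    fix k assume k: "k < n"
    show "continuous_on {0..t} (\<lambda>t. h t k)"
      using assms(1) k unfolding galerkin_def by (intro continuous_on_subset[OF _ sub]) simp
    fix s assume "s \<in> {0..t}"
    then show "((\<lambda>t. c t k) has_real_derivative rhs n h s (c s) k) (at s within {0..t})"
      using assms(1) k subsetD[OF sub] unfolding galerkin_def by (intro has_field_derivative_subset[OF _ sub]) simp
  qed
qed

context
  fixes n h T c assumes gal: "galerkin n h T c"
begin

lemma h_cont: "k < n \<Longrightarrow> continuous_on {0..T} (\<lambda>t. h t k)"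
  using gal by (simp add: galerkin_def)

lemma c_deriv: "t \<in> {0..T} \<Longrightarrow> k < n \<Longrightarrow> ((\<lambda>t. c t k) has_real_derivative rhs n h t (c t) k) (at t within {0..T})"
  using gal by (simp add: galerkin_def)

lemma c_cont: "k < n \<Longrightarrow> continuous_on {0..T} (\<lambda>t. c t k)"
  by (rule DERIV_continuous_on) (rule c_deriv)

lemma V_cont: "continuous_on {0..T} (\<lambda>t. V n (c t))"
  unfolding V_def by (intro continuous_intros c_cont) auto

lemma aV_cont: "continuous_on {0..T} (\<lambda>t. a (V n (c t)))"
  by (rule continuous_on_compose2[OF a_cont V_cont]) (auto simp: V_nonneg)

lemma fU_joint_cont: "continuous_on ({0..T} \<times> A) (\<lambda>(t, x). f (sine.partial (c t) n x))"
proof -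
  have "continuous_on ({0..T} \<times> A) (\<lambda>p. f ((\<lambda>(t, x). sine.partial (c t) n x) p))"
    by (rule continuous_on_compose2[OF f_cont partial_joint_continuous[OF c_cont]]) auto
  then show ?thesis by (simp add: split_beta)
qed

lemma sn_joint_cont: "continuous_on (S \<times> A) (\<lambda>(t, x). sn k x)" for S :: "real set"
  unfolding split_beta by (rule continuous_on_compose2[OF sn_cont[of UNIV]]) (auto intro: continuous_intros)

lemma F_cont: "continuous_on {0..T} (\<lambda>t. F n (c t) k)"
proof -
  have "continuous_on ({0..T} \<times> cbox 0 1) (\<lambda>(t, x). f (sine.partial (c t) n x) * sn k x)"
    using continuous_on_mult[OF fU_joint_cont sn_joint_cont] by (simp add: split_beta)
  then have "continuous_on {0..T} (\<lambda>t. integral (cbox 0 1) (\<lambda>x. f (sine.partial (c t) n x) * sn k x))"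
    by (rule integral_continuous_on_param)
  then show ?thesis unfolding F_eq by (intro continuous_intros) simp
qed

lemma rhs_cont: "k < n \<Longrightarrow> continuous_on {0..T} (\<lambda>t. rhs n h t (c t) k)"
  unfolding rhs_def by (intro continuous_intros aV_cont c_cont F_cont h_cont)

lemma sum_F:
  "(\<Sum>k<n. b k * F n d k) = lam * (LINT x|lebesgue_on \<Omega>. f (sine.partial d n x) * sine.partial b n x)"
proof -
  have "(LINT x|lebesgue_on \<Omega>. sine.partial b n x * f (sine.partial d n x)) =
    (\<Sum>k<n. b k * (LINT x|lebesgue_on \<Omega>. sn k x * f (sine.partial d n x)))"
    by (rule sine.integral_partial_mult[OF f_partial_sqint])
  then show ?thesis by (simp add: F_def mult.commute sum_distrib_left mult.left_commute)
qed

lemma h_sq_cont: "continuous_on {0..T} (\<lambda>t. \<Sum>k<n. (h t k)\<^sup>2)"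
  by (intro continuous_intros h_cont) auto

text \<open>The system is tested with the solution: the diffusion has a sign because
  \<open>a\<close> is positive, \<open>diss\<close> bounds the reaction, and an integrating factor
  takes the place of Gronwall's lemma.\<close>

lemma L2_bound:
  assumes T: "0 \<le> T"
  shows "(\<Sum>k<n. (c T k)\<^sup>2) \<le> exp ((2 * lam * \<beta> + 1) * T) *
    (V n (c 0) + 2 * lam * \<gamma> * T + integral {0..T} (\<lambda>t. \<Sum>k<n. (h t k)\<^sup>2))"
proof -
  let ?S = "\<lambda>t. \<Sum>k<n. (c t k)\<^sup>2" and ?h = "\<lambda>t. \<Sum>k<n. (h t k)\<^sup>2"
  \<comment> \<open>The part \<open>2 * lam * \<beta>\<close> comes from the reaction, the 1 from
    splitting the product with the source into squares.\<close>
  let ?\<kappa> = "2 * lam * \<beta> + 1"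
  let ?S' = "\<lambda>t. \<Sum>k<n. 2 * c t k * rhs n h t (c t) k"
  have S': "?S' t \<le> 2 * lam * (\<gamma> + \<beta> * ?S t) + ?S t + ?h t" for t
  proof -
    have "?S' t = (\<Sum>k<n. - (2 * a (V n (c t))) * ((om k)\<^sup>2 * (c t k)\<^sup>2) + 2 * (c t k * F n (c t) k) + 2 * c t k * h t k)"
      by (rule sum.cong[OF refl]) (simp add: rhs_def algebra_simps power2_eq_square)
    also have "\<dots> = - (2 * a (V n (c t))) * V n (c t) + 2 * (\<Sum>k<n. c t k * F n (c t) k) + (\<Sum>k<n. 2 * c t k * h t k)"
      unfolding sum.distrib sum_distrib_left[symmetric] V_def[symmetric] ..
    also have "- (2 * a (V n (c t))) * V n (c t) \<le> 0" using a_ge[OF V_nonneg, of n "c t"] V_nonneg[of n "c t"] m by simp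
    also have "(\<Sum>k<n. 2 * c t k * h t k) \<le> (\<Sum>k<n. (c t k)\<^sup>2 + (h t k)\<^sup>2)"
      by (rule sum_mono) (rule sum_squares_bound)
    also have "(\<Sum>k<n. c t k * F n (c t) k) \<le> lam * (\<gamma> + \<beta> * ?S t)"
    proof -
      have "(LINT x|lebesgue_on \<Omega>. f (sine.partial (c t) n x) * sine.partial (c t) n x)
          \<le> (LINT x|lebesgue_on \<Omega>. \<gamma> + \<beta> * (sine.partial (c t) n x)\<^sup>2)"
      proof (rule integral_mono)
        show "integrable (lebesgue_on \<Omega>) (\<lambda>x. f (sine.partial (c t) n x) * sine.partial (c t) n x)"
          by (rule sqint_mult_integrable[OF f_partial_sqint sine.partial_sqint])
        show "integrable (lebesgue_on \<Omega>) (\<lambda>x. \<gamma> + \<beta> * (sine.partial (c t) n x)\<^sup>2)"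
          using sine.partial_sqint[of "c t" n] finite_measure.integrable_const[OF finite_measure_interval]
          by (auto simp: sqint_def)
      qed (rule diss)
      also have "\<dots> = \<gamma> + \<beta> * ?S t"
        using sine.partial_sqint[of "c t" n] finite_measure.integrable_const[OF finite_measure_interval]
        by (subst Bochner_Integration.integral_add) (auto simp: sqint_def LINT_const_\<Omega> sine.integral_partial_sq simp del: lebesgue_integral_const)
      finally show ?thesis unfolding sum_F using lam by (simp add: mult_left_mono)
    qed
    finally show ?thesis by (simp add: sum.distrib algebra_simps)
  qed
  have "exp (- ?\<kappa> * T) * ?S T \<le> exp (- ?\<kappa> * 0) * ?S 0 + integral {0..T} (\<lambda>t. 2 * lam * \<gamma> + ?h t)"
  proof (rule deriv_le_integral[OF T])
    fix t assume t: "t \<in> {0..T}"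
    have "(?S has_real_derivative ?S' t) (at t within {0..T})"
      by (rule DERIV_sum, rule DERIV_cong, rule DERIV_power[OF c_deriv[OF t]]) auto
    moreover have "((\<lambda>t. exp (- ?\<kappa> * t)) has_real_derivative exp (- ?\<kappa> * t) * - ?\<kappa>) (at t within {0..T})"
      by (auto intro!: derivative_eq_intros)
    ultimately show "((\<lambda>t. exp (- ?\<kappa> * t) * ?S t) has_real_derivative
        exp (- ?\<kappa> * t) * - ?\<kappa> * ?S t + ?S' t * exp (- ?\<kappa> * t)) (at t within {0..T})"
      by (rule DERIV_mult[rotated])
    have "exp (- ?\<kappa> * t) * (?S' t - ?\<kappa> * ?S t) \<le> exp (- ?\<kappa> * t) * (2 * lam * \<gamma> + ?h t)"
      using S'[of t] by (intro mult_left_mono) (auto simp: algebra_simps)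
    also have "\<dots> \<le> 1 * (2 * lam * \<gamma> + ?h t)"
    proof (rule mult_right_mono)
      have "0 \<le> ?\<kappa> * t" using lam \<beta> t by (intro mult_nonneg_nonneg) auto
      then show "exp (- ?\<kappa> * t) \<le> 1" unfolding mult_minus_left by simp
      show "0 \<le> 2 * lam * \<gamma> + ?h t" using lam \<gamma> by (intro add_nonneg_nonneg sum_nonneg) auto
    qed
    finally show "exp (- ?\<kappa> * t) * - ?\<kappa> * ?S t + ?S' t * exp (- ?\<kappa> * t) \<le> 2 * lam * \<gamma> + ?h t"
      by (simp add: algebra_simps)
  qed (intro continuous_intros h_sq_cont)
  also have "integral {0..T} (\<lambda>t. 2 * lam * \<gamma> + ?h t) = 2 * lam * \<gamma> * T + integral {0..T} ?h"
    using T integrable_continuous_real[OF h_sq_cont] by (subst Henstock_Kurzweil_Integration.integral_add) auto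
  also have "exp (- ?\<kappa> * 0) * ?S 0 \<le> V n (c 0)" using sum_sq_le_V[of "c 0" n] by simp
  finally have "exp (- ?\<kappa> * T) * ?S T \<le> V n (c 0) + 2 * lam * \<gamma> * T + integral {0..T} ?h" by simp
  then have "exp (?\<kappa> * T) * (exp (- ?\<kappa> * T) * ?S T) \<le> exp (?\<kappa> * T) * (V n (c 0) + 2 * lam * \<gamma> * T + integral {0..T} ?h)"
    by (rule mult_left_mono) simp
  moreover have "exp (?\<kappa> * T) * exp (- ?\<kappa> * T) = 1" unfolding mult_minus_left by (rule exp_minus_inverse)
  then have "exp (?\<kappa> * T) * (exp (- ?\<kappa> * T) * ?S T) = ?S T" by (simp only: mult.assoc[symmetric] mult_1)
  ultimately show ?thesis by (simp only:)
qed

text \<open>The energy \<open>1/2 A(V) - \<lambda> \<integral> \<Phi>(u) dx\<close>, with primitives \<open>A\<close> of \<open>a\<close> and \<open>\<Phi>\<close> of \<open>f\<close>,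
  decreases up to the contribution of the source.\<close>

lemma energy_bound:
  assumes T: "0 \<le> T" and A: "\<And>x. (A has_real_derivative a (max 0 x)) (at x)"
    and \<Phi>: "\<And>x. (\<Phi> has_real_derivative f x) (at x)"
  shows "A (V n (c T)) / 2 - lam * integral {0..1} (\<lambda>x. \<Phi> (sine.partial (c T) n x)) \<le>
    A (V n (c 0)) / 2 - lam * integral {0..1} (\<lambda>x. \<Phi> (sine.partial (c 0) n x)) +
    integral {0..T} (\<lambda>t. (1/4) * (\<Sum>k<n. (h t k)\<^sup>2))"
proof (rule deriv_le_integral[OF T])
  fix t assume t: "t \<in> {0..T}"
  let ?c' = "\<lambda>t k. rhs n h t (c t) k"
  have "((\<lambda>t. V n (c t)) has_real_derivative (\<Sum>k<n. (om k)\<^sup>2 * (2 * c t k * ?c' t k))) (at t within {0..T})"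
    unfolding V_def
    by (rule DERIV_sum, rule DERIV_cmult, rule DERIV_cong, rule DERIV_power[OF c_deriv[OF t]]) auto
  then have "((\<lambda>t. A (V n (c t))) has_real_derivative
      a (V n (c t)) * (\<Sum>k<n. (om k)\<^sup>2 * (2 * c t k * ?c' t k))) (at t within {0..T})"
    using DERIV_chain2[OF A, of "\<lambda>t. V n (c t)" _ t "{0..T}"] V_nonneg[of n "c t"] by (simp add: max_def)
  then have dA: "((\<lambda>t. A (V n (c t)) / 2) has_real_derivative
      a (V n (c t)) * (\<Sum>k<n. (om k)\<^sup>2 * (2 * c t k * ?c' t k)) / 2) (at t within {0..T})"
    by (rule DERIV_cdivide)
  have \<Phi>c: "continuous_on S \<Phi>" for S
    by (intro continuous_at_imp_continuous_on ballI DERIV_isCont[OF \<Phi>])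
  \<comment> \<open>The Leibniz rule asks for joint continuity of the derivative in time and space;
    the continuity of the source in time enters here.\<close>
  have "((\<lambda>t. integral (cbox 0 1) (\<lambda>x. \<Phi> (sine.partial (c t) n x))) has_real_derivative
      integral (cbox 0 1) (\<lambda>x. f (sine.partial (c t) n x) * sine.partial (?c' t) n x)) (at t within {0..T})"
  proof (rule leibniz_rule_field_derivative[where fx="\<lambda>t x. f (sine.partial (c t) n x) * sine.partial (?c' t) n x"])
    fix s x :: real assume s: "s \<in> {0..T}"
    have "((\<lambda>s. sine.partial (c s) n x) has_real_derivative sine.partial (?c' s) n x) (at s within {0..T})"
      unfolding sine.partial_def by (intro DERIV_sum DERIV_cmult_right c_deriv s) auto
    then show "((\<lambda>s. \<Phi> (sine.partial (c s) n x)) has_real_derivative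
        f (sine.partial (c s) n x) * sine.partial (?c' s) n x) (at s within {0..T})"
      by (rule DERIV_chain2[OF \<Phi>])
  next
    show "(\<lambda>x. \<Phi> (sine.partial (c s) n x)) integrable_on cbox 0 1" for s
      by (rule integrable_continuous, rule continuous_on_compose2[OF \<Phi>c[of UNIV] partial_continuous]) simp
    have "continuous_on ({0..T} \<times> cbox 0 1) (\<lambda>(t, x). sine.partial (?c' t) n x)"
      by (rule partial_joint_continuous) (rule rhs_cont)
    from continuous_on_mult[OF fU_joint_cont this]
    show "continuous_on ({0..T} \<times> cbox 0 1) (\<lambda>(t, x). f (sine.partial (c t) n x) * sine.partial (?c' t) n x)"
      by (simp add: split_beta)
  qed (use t in auto)
  also have "integral (cbox 0 1) (\<lambda>x. f (sine.partial (c t) n x) * sine.partial (?c' t) n x)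
      = (LINT x|lebesgue_on \<Omega>. f (sine.partial (c t) n x) * sine.partial (?c' t) n x)"
    by (subst LINT_interval_eq) (auto intro!: continuous_intros f_partial_cont partial_continuous)
  finally have "((\<lambda>t. lam * integral {0..1} (\<lambda>x. \<Phi> (sine.partial (c t) n x))) has_real_derivative
      lam * (LINT x|lebesgue_on \<Omega>. f (sine.partial (c t) n x) * sine.partial (?c' t) n x)) (at t within {0..T})"
    by (intro DERIV_cmult) simp
  then have d\<Phi>: "((\<lambda>t. lam * integral {0..1} (\<lambda>x. \<Phi> (sine.partial (c t) n x))) has_real_derivative
      (\<Sum>k<n. ?c' t k * F n (c t) k)) (at t within {0..T})"
    by (simp only: sum_F)
  show "((\<lambda>t. A (V n (c t)) / 2 - lam * integral {0..1} (\<lambda>x. \<Phi> (sine.partial (c t) n x))) has_real_derivative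
      a (V n (c t)) * (\<Sum>k<n. (om k)\<^sup>2 * (2 * c t k * ?c' t k)) / 2 - (\<Sum>k<n. ?c' t k * F n (c t) k)) (at t within {0..T})"
    by (rule DERIV_diff[OF dA d\<Phi>])
  have "a (V n (c t)) * (\<Sum>k<n. (om k)\<^sup>2 * (2 * c t k * ?c' t k)) / 2 - (\<Sum>k<n. ?c' t k * F n (c t) k)
      = (\<Sum>k<n. ?c' t k * (a (V n (c t)) * (om k)\<^sup>2 * c t k - F n (c t) k))"
    by (simp add: sum_distrib_left sum_divide_distrib right_diff_distrib sum_subtractf mult_ac)
  \<comment> \<open>By the equation the bracket is the source minus the time derivative. Completing
    the square then leaves a quarter of the squared source.\<close>
  also have "\<dots> = (\<Sum>k<n. ?c' t k * (h t k - ?c' t k))"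
    by (rule sum.cong[OF refl]) (simp add: rhs_def)
  also have "\<dots> \<le> (\<Sum>k<n. (1/4) * (h t k)\<^sup>2)"
  proof (rule sum_mono)
    fix k
    have "0 \<le> (h t k / 2 - ?c' t k)\<^sup>2" by simp
    then show "?c' t k * (h t k - ?c' t k) \<le> (1/4) * (h t k)\<^sup>2" by (simp add: power2_eq_square algebra_simps)
  qed
  finally show "a (V n (c t)) * (\<Sum>k<n. (om k)\<^sup>2 * (2 * c t k * ?c' t k)) / 2 - (\<Sum>k<n. ?c' t k * F n (c t) k)
      \<le> (1/4) * (\<Sum>k<n. (h t k)\<^sup>2)" by (simp add: sum_distrib_left)
qed (intro continuous_intros h_sq_cont)

end

text \<open>For \<open>x >= 1\<close> dividing the dissipativity condition by \<open>x\<close>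
  bounds \<open>f\<close> from above by an affine function; on [-1,1] continuity does it, and the
  negative axis is reflected. The bound on \<Phi> is one-sided: it may tend to minus infinity
  arbitrarily fast.\<close>

lemma f_primitive:
  obtains \<Phi> K where "\<And>x. (\<Phi> has_real_derivative f x) (at x)" "K \<ge> 0" "\<And>u. \<Phi> u \<le> K * (1 + u\<^sup>2)"
proof -
  obtain \<Phi> where \<Phi>: "\<Phi> 0 = 0" "\<And>x. (\<Phi> has_real_derivative f x) (at x)"
    using antiderivative_exists[OF f_cont] by metis
  obtain B where B: "\<And>x. x \<in> {-1..1} \<Longrightarrow> \<bar>f x\<bar> \<le> B" "B \<ge> 0" using continuous_bounded_01[OF f_cont_on] by metis
  have pos: "f x \<le> (B + \<gamma>) + \<beta> * x" if "x \<ge> 0" for x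
  proof (cases "x \<le> 1")
    case True
    then show ?thesis using B(1)[of x] that \<gamma> \<beta> by (smt (verit) atLeastAtMost_iff mult_nonneg_nonneg)
  next
    case False
    then have "f x * x \<le> (\<gamma> + \<beta> * x) * x" using diss[of x] \<gamma> by (simp add: power2_eq_square algebra_simps) (smt (verit) mult_le_cancel_left1)
    then show ?thesis using False B(2) by simp
  qed
  have neg: "- f (- x) \<le> (B + \<gamma>) + \<beta> * x" if "x \<ge> 0" for x
  proof (cases "x \<le> 1")
    case True
    then show ?thesis using B(1)[of "- x"] that \<gamma> \<beta> by (smt (verit) atLeastAtMost_iff mult_nonneg_nonneg)
  next
    case False
    then have "- f (- x) * x \<le> (\<gamma> + \<beta> * x) * x" using diss[of "- x"] \<gamma> by (simp add: power2_eq_square algebra_simps) (smt (verit) mult_le_cancel_left1)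
    then have "- f (- x) \<le> \<gamma> + \<beta> * x" by (rule mult_right_le_imp_le) (use False in simp)
    then show ?thesis using B(2) by simp
  qed
  have \<Phi>m: "((\<lambda>x. \<Phi> (- x)) has_real_derivative - f (- x)) (at x)" for x
  proof -
    have "((\<lambda>x::real. - x) has_real_derivative - 1) (at x)" by (auto intro!: derivative_eq_intros)
    from DERIV_chain2[OF \<Phi>(2)[of "- x"] this] show ?thesis by simp
  qed
  let ?K = "B + \<gamma> + \<beta>"
  have fin: "(B + \<gamma>) * \<bar>u\<bar> + \<beta> * \<bar>u\<bar>\<^sup>2 / 2 \<le> ?K * (1 + u\<^sup>2)" for u
  proof -
    have "\<bar>u\<bar> \<le> 1 + u\<^sup>2" using sum_squares_bound[of "\<bar>u\<bar>" 1] by simp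
    then have "(B + \<gamma>) * \<bar>u\<bar> \<le> (B + \<gamma>) * (1 + u\<^sup>2)" using B(2) \<gamma> by (intro mult_left_mono) auto
    moreover have "\<beta> * \<bar>u\<bar>\<^sup>2 / 2 \<le> \<beta> * (1 + u\<^sup>2)" using \<beta> by (simp add: algebra_simps)
    ultimately show ?thesis by (simp add: algebra_simps)
  qed
  have "\<Phi> u \<le> ?K * (1 + u\<^sup>2)" for u
  proof (cases "u \<ge> 0")
    case True
    then show ?thesis using primitive_upper_bound[OF \<Phi>(2,1) pos True] fin[of u] by simp
  next
    case False
    then show ?thesis using primitive_upper_bound[of "\<lambda>x. \<Phi> (- x)", OF \<Phi>m _ neg, of "- u"] \<Phi>(1) fin[of u] by simp
  qed
  then show thesis using that[OF \<Phi>(2), of ?K] B(2) \<gamma> \<beta> by simp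
qed

text \<open>The constant is fixed before \<open>n\<close>, \<open>h\<close> and \<open>c\<close>,
  and a solution is asked to exist only up to the time \<open>t\<close> in question. This makes it
  usable both for continuing Galerkin solutions and for bounds uniform in \<open>n\<close>.\<close>

lemma galerkin_bound:
  assumes T: "T \<ge> 0" and P: "P \<ge> 0"
  obtains C where "\<And>n h c t. galerkin n h t c \<Longrightarrow> V n (c 0) \<le> P \<Longrightarrow>
    integral {0..t} (\<lambda>t. \<Sum>k<n. (h t k)\<^sup>2) \<le> H \<Longrightarrow> t \<in> {0..T} \<Longrightarrow> V n (c t) \<le> C"
proof -
  obtain \<Phi> K where \<Phi>: "\<And>x. (\<Phi> has_real_derivative f x) (at x)" and K: "K \<ge> 0" "\<And>u. \<Phi> u \<le> K * (1 + u\<^sup>2)"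
    using f_primitive by metis
  \<comment> \<open>\<open>a\<close> is controlled on the half line only, so its constant extension
    to the left is integrated; along solutions \<open>V\<close> is nonnegative.\<close>
  have "continuous_on UNIV (\<lambda>x. a (max 0 x))"
    by (rule continuous_on_compose2[OF a_cont]) (auto intro!: continuous_intros)
  then obtain A where A: "A 0 = 0" "\<And>x. (A has_real_derivative a (max 0 x)) (at x)"
    by (rule antiderivative_exists) (rule that)
  have \<Phi>c: "continuous_on S \<Phi>" for S
    by (intro continuous_at_imp_continuous_on ballI DERIV_isCont[OF \<Phi>])
  obtain B where B: "\<And>x. x \<in> {- sqrt P..sqrt P} \<Longrightarrow> \<bar>\<Phi> x\<bar> \<le> B" "B \<ge> 0"
    using continuous_bounded_01[OF \<Phi>c] by metis
  have A_mono: "A v - m * v \<le> A w - m * w" if "0 \<le> v" "v \<le> w" for v w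
  proof (rule DERIV_nonneg_imp_nondecreasing[OF that(2)])
    fix y assume "v \<le> y" "y \<le> w"
    have "((\<lambda>v. A v - m * v) has_real_derivative a (max 0 y) - m) (at y)"
      using DERIV_diff[OF A(2) DERIV_cmult_Id] by blast
    then show "\<exists>z. ((\<lambda>v. A v - m * v) has_real_derivative z) (at y) \<and> 0 \<le> z" using a_ge[of "max 0 y"] by auto
  qed
  have A_ge: "m * v \<le> A v" if "v \<ge> 0" for v using A_mono[of 0 v] A(1) that by simp
  have A_le: "A v \<le> A P" if "0 \<le> v" "v \<le> P" for v
    using A_mono[OF that] mult_left_mono[OF that(2), of m] m by linarith
  let ?S = "exp ((2 * lam * \<beta> + 1) * T) * (P + 2 * lam * \<gamma> * T + H)"
  \<comment> \<open>The energy inequality solved for \<open>V\<close> by means of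
    \<open>A v >= m * v\<close>: \<open>A P / 2\<close> and \<open>lam * B\<close> bound the initial
    energy, \<open>H / 4\<close> the source, and the last term the integral of \<Phi> through the
    \<open>L2\<close> bound \<open>?S\<close>.\<close>
  define C where "C = (2 / m) * (A P / 2 + lam * B + H / 4 + lam * (K * (1 + ?S)))"
  show thesis
  proof (rule that)
    fix n h c t assume gt: "galerkin n h t c" and V0: "V n (c 0) \<le> P"
      and Ht: "integral {0..t} (\<lambda>t. \<Sum>k<n. (h t k)\<^sup>2) \<le> H" and t: "t \<in> {0..T}"
    have hi: "(\<lambda>t. \<Sum>k<n. (h t k)\<^sup>2) integrable_on {0..t}"
      by (rule integrable_continuous_real, rule h_sq_cont[OF gt])
    have H0: "0 \<le> integral {0..t} (\<lambda>t. \<Sum>k<n. (h t k)\<^sup>2)"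
      by (rule Henstock_Kurzweil_Integration.integral_nonneg) (use hi t in \<open>auto simp: sum_nonneg\<close>)
    have S: "(\<Sum>k<n. (c t k)\<^sup>2) \<le> ?S"
    proof -
      have "(\<Sum>k<n. (c t k)\<^sup>2) \<le> exp ((2 * lam * \<beta> + 1) * t) * (V n (c 0) + 2 * lam * \<gamma> * t + integral {0..t} (\<lambda>t. \<Sum>k<n. (h t k)\<^sup>2))"
        using L2_bound[OF gt] t by simp
      also have "\<dots> \<le> ?S"
      proof (rule mult_mono)
        show "exp ((2 * lam * \<beta> + 1) * t) \<le> exp ((2 * lam * \<beta> + 1) * T)"
          using t lam \<beta> unfolding exp_le_cancel_iff by (intro mult_left_mono) auto
        have "2 * lam * \<gamma> * t \<le> 2 * lam * \<gamma> * T" using t lam \<gamma> by (intro mult_left_mono) auto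
        then show "V n (c 0) + 2 * lam * \<gamma> * t + integral {0..t} (\<lambda>t. \<Sum>k<n. (h t k)\<^sup>2) \<le> P + 2 * lam * \<gamma> * T + H"
          using V0 Ht by linarith
        show "0 \<le> V n (c 0) + 2 * lam * \<gamma> * t + integral {0..t} (\<lambda>t. \<Sum>k<n. (h t k)\<^sup>2)"
          using V_nonneg[of n "c 0"] H0 t lam \<gamma> by (intro add_nonneg_nonneg) auto
      qed simp
      finally show ?thesis .
    qed
    have \<Phi>i: "(\<lambda>x. \<Phi> (sine.partial b n x)) integrable_on {0..1}" for b
      by (rule integrable_continuous_real, rule continuous_on_compose2[OF \<Phi>c[of UNIV] partial_continuous]) simp
    \<comment> \<open>\<Phi> has no global lower bound, but the initial function takes values in
      [- sqrt P, sqrt P] by the embedding, where \<Phi> is bounded by \<open>B\<close>.\<close>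
    have "integral {0..1::real} (\<lambda>x. - B) \<le> integral {0..1} (\<lambda>x. \<Phi> (sine.partial (c 0) n x))"
    proof (rule Henstock_Kurzweil_Integration.integral_le)
      fix x
      have "(sine.partial (c 0) n x)\<^sup>2 \<le> P" using partial_sq_le_V[of "c 0" n x] V0 by linarith
      then have "\<bar>sine.partial (c 0) n x\<bar> \<le> sqrt P" by (simp add: real_le_rsqrt)
      then show "- B \<le> \<Phi> (sine.partial (c 0) n x)" using B(1)[of "sine.partial (c 0) n x"] by (auto simp: abs_le_iff)
    qed (use \<Phi>i in auto)
    then have \<Phi>0: "- B \<le> integral {0..1} (\<lambda>x. \<Phi> (sine.partial (c 0) n x))" by simp
    have "integral {0..1} (\<lambda>x. \<Phi> (sine.partial (c t) n x)) \<le> integral {0..1} (\<lambda>x. K * (1 + (sine.partial (c t) n x)\<^sup>2))"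
      by (rule Henstock_Kurzweil_Integration.integral_le) (use \<Phi>i K(2) in \<open>auto intro!: integrable_continuous_real continuous_intros partial_continuous\<close>)
    also have "\<dots> = (LINT x|lebesgue_on \<Omega>. K * (1 + (sine.partial (c t) n x)\<^sup>2))"
      by (subst LINT_interval_eq) (auto intro!: continuous_intros partial_continuous)
    also have "\<dots> = K * (1 + (\<Sum>k<n. (c t k)\<^sup>2))"
      using sine.partial_sqint[of "c t" n] finite_measure.integrable_const[OF finite_measure_interval]
      by (simp add: sqint_def sine.integral_partial_sq LINT_const_\<Omega> del: lebesgue_integral_const)
    also have "\<dots> \<le> K * (1 + ?S)" using S K(1) by (intro mult_left_mono) auto
    finally have \<Phi>t: "integral {0..1} (\<lambda>x. \<Phi> (sine.partial (c t) n x)) \<le> K * (1 + ?S)" .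
    have "A (V n (c t)) / 2 - lam * integral {0..1} (\<lambda>x. \<Phi> (sine.partial (c t) n x)) \<le>
      A (V n (c 0)) / 2 - lam * integral {0..1} (\<lambda>x. \<Phi> (sine.partial (c 0) n x)) +
      integral {0..t} (\<lambda>t. (1/4) * (\<Sum>k<n. (h t k)\<^sup>2))"
      by (rule energy_bound[OF gt _ A(2) \<Phi>]) (use t in auto)
    moreover have "integral {0..t} (\<lambda>t. (1/4) * (\<Sum>k<n. (h t k)\<^sup>2)) \<le> H / 4" using Ht by simp
    moreover have "lam * - B \<le> lam * integral {0..1} (\<lambda>x. \<Phi> (sine.partial (c 0) n x))"
      using \<Phi>0 lam by (intro mult_left_mono) auto
    moreover have "lam * integral {0..1} (\<lambda>x. \<Phi> (sine.partial (c t) n x)) \<le> lam * (K * (1 + ?S))"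
      using \<Phi>t lam by (intro mult_left_mono) auto
    moreover have "A (V n (c 0)) \<le> A P" by (rule A_le[OF V_nonneg V0])
    ultimately have "A (V n (c t)) / 2 \<le> A P / 2 + lam * B + H / 4 + lam * (K * (1 + ?S))" by linarith
    moreover have "m * V n (c t) \<le> A (V n (c t))" by (rule A_ge[OF V_nonneg])
    ultimately have "m * V n (c t) / 2 \<le> A P / 2 + lam * B + H / 4 + lam * (K * (1 + ?S))" by linarith
    then have "(2 / m) * (m * V n (c t) / 2) \<le> C" unfolding C_def using m by (intro mult_left_mono) auto
    then show "V n (c t) \<le> C" using m by simp
  qed
qed

end

text \<open>Bootstrap: the weak bound \<open>R\<close> on [0,t] improves to the strictly smaller
  \<open>C\<close> at \<open>t\<close>, so a continuous \<open>v\<close> that starts below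
  \<open>C\<close> can never cross \<open>R\<close>.\<close>

lemma continuity_argument:
  fixes v :: "real \<Rightarrow> real"
  assumes v: "continuous_on {0..T} v" and v0: "v 0 \<le> C" and CR: "C < R"
    and step: "\<And>t. t \<in> {0..T} \<Longrightarrow> (\<And>s. s \<in> {0..t} \<Longrightarrow> v s \<le> R) \<Longrightarrow> v t \<le> C"
    and t: "t \<in> {0..T}"
  shows "v t \<le> C"
proof -
  have "v s \<le> R" if s: "s \<in> {0..T}" for s
  proof (rule ccontr)
    assume "\<not> v s \<le> R"
    \<comment> \<open>The times at which \<open>v\<close> has reached \<open>R\<close>; at the least
      of them \<open>v\<close> equals \<open>R\<close>, while it is below \<open>R\<close>
      before.\<close>
    define A where "A = {0..T} \<inter> v -` {R..}"
    have "closed A"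
      unfolding A_def by (rule continuous_closed_preimage[OF v]) auto
    moreover have "bounded A" unfolding A_def by (rule bounded_subset[of "{0..T}"]) auto
    ultimately have "compact A" by (simp add: compact_eq_bounded_closed)
    have "s \<in> A" using s \<open>\<not> v s \<le> R\<close> by (simp add: A_def)
    then have "A \<noteq> {}" by blast
    from compact_attains_inf[OF \<open>compact A\<close> this]
    obtain t0 where t0: "t0 \<in> A" "\<And>t. t \<in> A \<Longrightarrow> t0 \<le> t" by blast
    have t0T: "t0 \<in> {0..T}" "R \<le> v t0" using t0(1) by (auto simp: A_def)
    have "v t0 \<le> R"
    proof (rule ccontr)
      assume "\<not> v t0 \<le> R"
      moreover have "v 0 \<le> R" using v0 CR by simp
      ultimately obtain s where "0 \<le> s" "s \<le> t0" "v s = R"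
        using IVT'[of v 0 R t0] t0T continuous_on_subset[OF v, of "{0..t0}"] by auto
      then have "s \<in> A" using t0T by (auto simp: A_def)
      then show False using t0(2)[of s] \<open>s \<le> t0\<close> \<open>v s = R\<close> \<open>\<not> v t0 \<le> R\<close> by auto
    qed
    then have "v s \<le> R" if "s \<in> {0..t0}" for s
    proof (cases "s = t0")
      case False
      then have "s \<notin> A" using t0(2)[of s] that by auto
      then show ?thesis using that t0T by (auto simp: A_def)
    qed simp
    then have "v t0 \<le> C" by (rule step[OF t0T(1)])
    then show False using t0T(2) CR by simp
  qed
  then show ?thesis by (intro step[OF t]) (use t in auto)
qed

definition clamp1 :: "real \<Rightarrow> real \<Rightarrow> real" where "clamp1 R y = max (- R) (min R y)"

text \<open>Young's inequality with weight \<open>\<mu> * m\<close>: half of the dissipation absorbs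
  the forcing, the other half remains.\<close>

lemma mode_derivative:
  fixes \<mu> m :: real
  assumes "\<mu> > 0" "m > 0" "m \<le> \<alpha>"
  shows "2 * d * (- \<mu> * \<alpha> * d + g) \<le> - (\<mu> * m) * d\<^sup>2 + g\<^sup>2 / (\<mu> * m)"
proof -
  have "2 * d * g \<le> (\<mu> * m) * d\<^sup>2 + g\<^sup>2 / (\<mu> * m)"
  proof -
    have "0 \<le> ((\<mu> * m) * d - g)\<^sup>2 / (\<mu> * m)" using assms by simp
    also have "\<dots> = (\<mu> * m) * d\<^sup>2 - 2 * d * g + g\<^sup>2 / (\<mu> * m)"
      using assms by (simp add: power2_diff field_simps power2_eq_square)
    finally show ?thesis by simp
  qed
  moreover have "\<mu> * (m * d\<^sup>2) \<le> \<mu> * (\<alpha> * d\<^sup>2)" using assms by (intro mult_left_mono mult_right_mono) auto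
  moreover have "2 * d * (- \<mu> * \<alpha> * d + g) = - 2 * (\<mu> * (\<alpha> * d\<^sup>2)) + 2 * d * g"
    by (simp add: algebra_simps power2_eq_square)
  ultimately show ?thesis by (simp add: mult.assoc)
qed

text \<open>With \<open>\<mu> = (om k)^2\<close> the left side is the share of one mode in the
  squared \<open>H01\<close> norm. The factor \<mu> cancels the 1/\<mu> from Young's inequality, so
  nothing is lost at high frequency. The exponential kernel of the first estimate yields the tail
  bound, the second estimate yields the \<open>Hk 2\<close> bound.\<close>

lemma mode_estimate:
  fixes d g \<alpha> :: "real \<Rightarrow> real" and \<mu> m T :: real
  assumes T: "0 \<le> T" and d: "\<And>t. t \<in> {0..T} \<Longrightarrow> (d has_real_derivative - \<mu> * \<alpha> t * d t + g t) (at t within {0..T})"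
    and \<mu>: "\<mu> > 0" and m: "m > 0" and \<alpha>: "\<And>t. t \<in> {0..T} \<Longrightarrow> m \<le> \<alpha> t" and g: "continuous_on {0..T} g"
  shows "\<mu> * (d T)\<^sup>2 \<le> \<mu> * (d 0)\<^sup>2 + (1 / m) * integral {0..T} (\<lambda>s. exp (- (\<mu> * m) * (T - s)) * (g s)\<^sup>2)"
    and "integral {0..T} (\<lambda>s. \<mu>\<^sup>2 * (d s)\<^sup>2) \<le> (\<mu> * (d 0)\<^sup>2 + (1 / m) * integral {0..T} (\<lambda>s. (g s)\<^sup>2)) / m"
proof -
  let ?\<kappa> = "\<mu> * m"
  let ?D = "\<lambda>t. 2 * d t * (- \<mu> * \<alpha> t * d t + g t)"
  have \<kappa>: "?\<kappa> > 0" using \<mu> m by simp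
  have dc: "continuous_on {0..T} d" by (rule DERIV_continuous_on) (rule d)
  have d2: "((\<lambda>t. (d t)\<^sup>2) has_real_derivative ?D t) (at t within {0..T})" if "t \<in> {0..T}" for t
    by (rule DERIV_cong, rule DERIV_power[OF d[OF that]]) simp
  have Dle: "?D t \<le> - ?\<kappa> * (d t)\<^sup>2 + (g t)\<^sup>2 / ?\<kappa>" if "t \<in> {0..T}" for t
    by (rule mode_derivative[OF \<mu> m \<alpha>[OF that]])
  have gi: "(\<lambda>s. exp (?\<kappa> * s) * (g s)\<^sup>2) integrable_on {0..T}"
    by (intro integrable_continuous_real continuous_intros g)
  have "exp (?\<kappa> * T) * (d T)\<^sup>2 \<le> exp (?\<kappa> * 0) * (d 0)\<^sup>2 + integral {0..T} (\<lambda>s. (1 / ?\<kappa>) * (exp (?\<kappa> * s) * (g s)\<^sup>2))"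
  proof (rule deriv_le_integral[OF T])
    fix t assume t: "t \<in> {0..T}"
    have "((\<lambda>t. exp (?\<kappa> * t)) has_real_derivative exp (?\<kappa> * t) * ?\<kappa>) (at t within {0..T})"
      by (auto intro!: derivative_eq_intros)
    from DERIV_mult[OF this d2[OF t]]
    show "((\<lambda>t. exp (?\<kappa> * t) * (d t)\<^sup>2) has_real_derivative
        exp (?\<kappa> * t) * ?\<kappa> * (d t)\<^sup>2 + ?D t * exp (?\<kappa> * t)) (at t within {0..T})" .
    have "exp (?\<kappa> * t) * (?\<kappa> * (d t)\<^sup>2 + ?D t) \<le> exp (?\<kappa> * t) * ((g t)\<^sup>2 / ?\<kappa>)"
      using Dle[OF t] by (intro mult_left_mono) auto
    then show "exp (?\<kappa> * t) * ?\<kappa> * (d t)\<^sup>2 + ?D t * exp (?\<kappa> * t) \<le> (1 / ?\<kappa>) * (exp (?\<kappa> * t) * (g t)\<^sup>2)"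
      by (simp add: algebra_simps)
  qed (intro continuous_intros g)
  then have "\<mu> * exp (- ?\<kappa> * T) * (exp (?\<kappa> * T) * (d T)\<^sup>2) \<le> \<mu> * exp (- ?\<kappa> * T) *
      ((d 0)\<^sup>2 + (1 / ?\<kappa>) * integral {0..T} (\<lambda>s. exp (?\<kappa> * s) * (g s)\<^sup>2))"
    using \<mu> by (intro mult_left_mono) auto
  also have "\<mu> * exp (- ?\<kappa> * T) * (exp (?\<kappa> * T) * (d T)\<^sup>2) = \<mu> * (d T)\<^sup>2"
  proof -
    have "exp (- ?\<kappa> * T) * exp (?\<kappa> * T) = 1" by (simp add: exp_add[symmetric])
    have "\<mu> * exp (- ?\<kappa> * T) * (exp (?\<kappa> * T) * (d T)\<^sup>2) = (exp (- ?\<kappa> * T) * exp (?\<kappa> * T)) * (\<mu> * (d T)\<^sup>2)"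
      by (simp only: mult_ac)
    also have "\<dots> = \<mu> * (d T)\<^sup>2" unfolding \<open>exp (- ?\<kappa> * T) * exp (?\<kappa> * T) = 1\<close> by simp
    finally show ?thesis .
  qed
  also have "\<mu> * exp (- ?\<kappa> * T) * ((d 0)\<^sup>2 + (1 / ?\<kappa>) * integral {0..T} (\<lambda>s. exp (?\<kappa> * s) * (g s)\<^sup>2))
     = exp (- ?\<kappa> * T) * (\<mu> * (d 0)\<^sup>2) + (1 / m) * (exp (- ?\<kappa> * T) * integral {0..T} (\<lambda>s. exp (?\<kappa> * s) * (g s)\<^sup>2))"
    using \<mu> m by (simp add: field_simps)
  also have "exp (- ?\<kappa> * T) * (\<mu> * (d 0)\<^sup>2) \<le> 1 * (\<mu> * (d 0)\<^sup>2)"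
  proof (rule mult_right_mono)
    have "0 \<le> ?\<kappa> * T" using \<kappa> T by simp
    then show "exp (- ?\<kappa> * T) \<le> 1" unfolding mult_minus_left by simp
  qed (use \<mu> in simp)
  also have "exp (- ?\<kappa> * T) * integral {0..T} (\<lambda>s. exp (?\<kappa> * s) * (g s)\<^sup>2)
      = integral {0..T} (\<lambda>s. exp (- ?\<kappa> * T) * (exp (?\<kappa> * s) * (g s)\<^sup>2))"
    by simp
  also have "\<dots> = integral {0..T} (\<lambda>s. exp (- ?\<kappa> * (T - s)) * (g s)\<^sup>2)"
  proof (rule Henstock_Kurzweil_Integration.integral_cong)
    fix s
    have "exp (- ?\<kappa> * T) * exp (?\<kappa> * s) = exp (- ?\<kappa> * (T - s))" by (simp add: exp_add[symmetric] algebra_simps)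
    then show "exp (- ?\<kappa> * T) * (exp (?\<kappa> * s) * (g s)\<^sup>2) = exp (- ?\<kappa> * (T - s)) * (g s)\<^sup>2"
      by (simp only: mult.assoc[symmetric])
  qed
  finally show "\<mu> * (d T)\<^sup>2 \<le> \<mu> * (d 0)\<^sup>2 + (1 / m) * integral {0..T} (\<lambda>s. exp (- ?\<kappa> * (T - s)) * (g s)\<^sup>2)" by simp
  have d2i: "(\<lambda>s. (d s)\<^sup>2) integrable_on {0..T}" and g2i: "(\<lambda>s. (g s)\<^sup>2) integrable_on {0..T}"
    by (intro integrable_continuous_real continuous_intros dc g)+
  have "(d T)\<^sup>2 \<le> (d 0)\<^sup>2 + integral {0..T} (\<lambda>s. (1 / ?\<kappa>) * (g s)\<^sup>2 - ?\<kappa> * (d s)\<^sup>2)"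
  proof (rule deriv_le_integral[OF T d2])
    show "?D t \<le> (1 / ?\<kappa>) * (g t)\<^sup>2 - ?\<kappa> * (d t)\<^sup>2" if "t \<in> {0..T}" for t
      using Dle[OF that] by simp
    show "continuous_on {0..T} (\<lambda>s. (1 / ?\<kappa>) * (g s)\<^sup>2 - ?\<kappa> * (d s)\<^sup>2)"
      by (intro continuous_on_diff continuous_on_mult continuous_on_const continuous_on_power dc g)
  qed
  also have "integral {0..T} (\<lambda>s. (1 / ?\<kappa>) * (g s)\<^sup>2 - ?\<kappa> * (d s)\<^sup>2)
      = (1 / ?\<kappa>) * integral {0..T} (\<lambda>s. (g s)\<^sup>2) - ?\<kappa> * integral {0..T} (\<lambda>s. (d s)\<^sup>2)"
  proof (subst Henstock_Kurzweil_Integration.integral_diff)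
    show "(\<lambda>s. (1 / ?\<kappa>) * (g s)\<^sup>2) integrable_on {0..T}" "(\<lambda>s. ?\<kappa> * (d s)\<^sup>2) integrable_on {0..T}"
      by (intro integrable_continuous_real continuous_on_mult continuous_on_const continuous_on_power dc g)+
  qed (simp only: integral_mult_right)
  finally have "?\<kappa> * integral {0..T} (\<lambda>s. (d s)\<^sup>2) \<le> (d 0)\<^sup>2 + (1 / ?\<kappa>) * integral {0..T} (\<lambda>s. (g s)\<^sup>2) - (d T)\<^sup>2"
    by linarith
  also have "\<dots> \<le> (d 0)\<^sup>2 + (1 / ?\<kappa>) * integral {0..T} (\<lambda>s. (g s)\<^sup>2)" by simp
  finally have "(\<mu> / m) * (?\<kappa> * integral {0..T} (\<lambda>s. (d s)\<^sup>2)) \<le> (\<mu> / m) * ((d 0)\<^sup>2 + (1 / ?\<kappa>) * integral {0..T} (\<lambda>s. (g s)\<^sup>2))"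
    using \<mu> m by (intro mult_left_mono) auto
  moreover have "(\<mu> / m) * (?\<kappa> * I) = \<mu>\<^sup>2 * I" "(\<mu> / m) * (x + (1 / ?\<kappa>) * I) = (\<mu> * x + (1 / m) * I) / m" for I x
    using \<mu> m by (simp_all add: field_simps power2_eq_square)
  ultimately show "integral {0..T} (\<lambda>s. \<mu>\<^sup>2 * (d s)\<^sup>2) \<le> (\<mu> * (d 0)\<^sup>2 + (1 / m) * integral {0..T} (\<lambda>s. (g s)\<^sup>2)) / m"
    unfolding integral_mult_right by (simp only:)
qed

section \<open>Solvability of the Galerkin systems\<close>

context problem
begin

lemma F_cong: "(\<And>i. i < n \<Longrightarrow> c i = d i) \<Longrightarrow> F n c k = F n d k"
proof -
  assume "\<And>i. i < n \<Longrightarrow> c i = d i"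
  then have "sine.partial c n = sine.partial d n" by (simp add: sine.partial_def[abs_def])
  then show ?thesis by (simp add: F_def)
qed

lemma rhs_cong: "(\<And>i. i < n \<Longrightarrow> c i = d i) \<Longrightarrow> k < n \<Longrightarrow> rhs n h t c k = rhs n h t d k"
proof -
  assume *: "\<And>i. i < n \<Longrightarrow> c i = d i" "k < n"
  then have "V n c = V n d" by (simp add: V_def)
  moreover have "F n c k = F n d k" by (rule F_cong) (rule *(1))
  ultimately show ?thesis using * by (simp add: rhs_def)
qed

text \<open>Bessel's inequality. \<open>N\<close> is independent of \<open>n\<close>, since
  \<open>f\<close> of a sine polynomial has coefficients in all modes.\<close>

lemma F_sq_sum:
  assumes "\<And>x. x \<in> \<Omega> \<Longrightarrow> \<bar>f (sine.partial c n x)\<bar> \<le> M"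
  shows "(\<Sum>k<N. (F n c k)\<^sup>2) \<le> (lam * M)\<^sup>2"
proof -
  have Fcf: "F n c k = lam * sine.cf (\<lambda>x. f (sine.partial c n x)) k" for k by (simp add: F_def sine.cf_def)
  have "(\<Sum>k<N. (F n c k)\<^sup>2) = lam\<^sup>2 * (\<Sum>k<N. (sine.cf (\<lambda>x. f (sine.partial c n x)) k)\<^sup>2)"
    by (simp add: Fcf power_mult_distrib sum_distrib_left)
  also have "\<dots> \<le> lam\<^sup>2 * (LINT x|lebesgue_on \<Omega>. (f (sine.partial c n x))\<^sup>2)"
    by (intro mult_left_mono sine.bessel f_partial_sqint) simp
  also have "\<dots> \<le> lam\<^sup>2 * (LINT x|lebesgue_on \<Omega>. M\<^sup>2)"
  proof (intro mult_left_mono integral_mono)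
    show "integrable (lebesgue_on \<Omega>) (\<lambda>x. (f (sine.partial c n x))\<^sup>2)" using f_partial_sqint by (rule sqintD(2))
    show "integrable (lebesgue_on \<Omega>) (\<lambda>x. M\<^sup>2)"
      using finite_measure_interval finite_measure.integrable_const by blast
    fix x assume "x \<in> space (lebesgue_on \<Omega>)"
    then have "\<bar>f (sine.partial c n x)\<bar> \<le> M" by (intro assms) simp
    then show "(f (sine.partial c n x))\<^sup>2 \<le> M\<^sup>2" by (metis abs_ge_zero power2_abs power_mono)
  qed simp
  finally show ?thesis by (simp add: LINT_const_\<Omega> power_mult_distrib del: lebesgue_integral_const)
qed

lemma f_bounded_of_V:
  obtains M where "M \<ge> 0" "\<And>u. u\<^sup>2 \<le> C \<Longrightarrow> \<bar>f u\<bar> \<le> M"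
proof -
  obtain M where M: "\<And>x. x \<in> {- sqrt C..sqrt C} \<Longrightarrow> \<bar>f x\<bar> \<le> M" "M \<ge> 0"
    using continuous_bounded_01[OF f_cont_on] by metis
  have "\<bar>f u\<bar> \<le> M" if "u\<^sup>2 \<le> C" for u
  proof (rule M(1))
    have "\<bar>u\<bar> \<le> sqrt C" using that by (simp add: real_le_rsqrt)
    then show "u \<in> {- sqrt C..sqrt C}" by auto
  qed
  with M(2) show thesis by (rule that)
qed

text \<open>Without a growth condition on \<open>f\<close>, domination comes from a uniform bound on
  the arguments; the estimates on \<open>V\<close> provide it.\<close>

lemma nemytskii_tendsto:
  fixes U :: "nat \<Rightarrow> real \<Rightarrow> real"
  assumes U: "\<And>j. U j \<in> borel_measurable (lebesgue_on \<Omega>)" and C: "\<And>j x. x \<in> \<Omega> \<Longrightarrow> (U j x)\<^sup>2 \<le> C"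
    and lim: "\<And>x. x \<in> \<Omega> \<Longrightarrow> (\<lambda>j. U j x) \<longlonglongrightarrow> W x"
  shows "(\<lambda>j. LINT x|lebesgue_on \<Omega>. f (U j x) * sn k x) \<longlonglongrightarrow> (LINT x|lebesgue_on \<Omega>. f (W x) * sn k x)"
proof -
  obtain M where M: "M \<ge> 0" "\<And>u. u\<^sup>2 \<le> C \<Longrightarrow> \<bar>f u\<bar> \<le> M" by (rule f_bounded_of_V) (rule that)
  have fm: "f \<in> borel_measurable borel" by (rule borel_measurable_continuous_onI[OF f_cont])
  have sm: "sn k \<in> borel_measurable (lebesgue_on \<Omega>)" using sn_sqint by (rule sqintD(1))
  have Wm: "W \<in> borel_measurable (lebesgue_on \<Omega>)"
    by (rule borel_measurable_LIMSEQ_real[OF _ U]) (use lim in simp)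
  show ?thesis
  proof (rule integral_dominated_convergence[where w="\<lambda>x. M * sqrt 2"])
    show "(\<lambda>x. f (W x) * sn k x) \<in> borel_measurable (lebesgue_on \<Omega>)"
      by (intro borel_measurable_times measurable_compose[OF Wm fm] sm)
    show "(\<lambda>x. f (U j x) * sn k x) \<in> borel_measurable (lebesgue_on \<Omega>)" for j
      by (intro borel_measurable_times measurable_compose[OF U fm] sm)
    show "integrable (lebesgue_on \<Omega>) (\<lambda>x. M * sqrt 2)"
      using finite_measure_interval finite_measure.integrable_const by blast
    show "AE x in lebesgue_on \<Omega>. (\<lambda>j. f (U j x) * sn k x) \<longlonglongrightarrow> f (W x) * sn k x"
    proof (rule AE_I2)
      fix x assume "x \<in> space (lebesgue_on \<Omega>)"
      then have l: "(\<lambda>j. U j x) \<longlonglongrightarrow> W x" by (intro lim) simp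
      have "(\<lambda>j. f (U j x)) \<longlonglongrightarrow> f (W x)"
        by (rule continuous_on_tendsto_compose[OF f_cont l]) auto
      then show "(\<lambda>j. f (U j x) * sn k x) \<longlonglongrightarrow> f (W x) * sn k x" by (rule tendsto_mult_right)
    qed
    show "AE x in lebesgue_on \<Omega>. norm (f (U j x) * sn k x) \<le> M * sqrt 2" for j
    proof (rule AE_I2)
      fix x assume "x \<in> space (lebesgue_on \<Omega>)"
      then have "\<bar>f (U j x)\<bar> \<le> M" by (intro M(2) C) simp
      then show "norm (f (U j x) * sn k x) \<le> M * sqrt 2"
        unfolding real_norm_def abs_mult by (intro mult_mono sn_bound M(1)) auto
    qed
  qed
qed

text \<open>\<open>peano\<close> wants a bounded right-hand side, hence the clamp at
  \<open>R\<close>. It is inactive as long as \<open>V\<close> is at most \<open>R^2\<close>; there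
  \<open>galerkin_bound\<close> applies and improves the bound, so
  \<open>continuity_argument\<close> excludes that the clamp ever acts.\<close>

lemma galerkin_exists:
  assumes T: "T > 0" and h: "\<And>k. k < n \<Longrightarrow> continuous_on {0..T} (\<lambda>t. h t k)"
  obtains c where "galerkin n h T c" "\<And>k. k < n \<Longrightarrow> c 0 k = p k" "\<And>t k. k \<ge> n \<Longrightarrow> c t k = 0"
proof -
  define H where "H = integral {0..T} (\<lambda>t. \<Sum>k<n. (h t k)\<^sup>2)"
  obtain C where C: "\<And>n' h c t. galerkin n' h t c \<Longrightarrow> V n' (c 0) \<le> V n p \<Longrightarrow>
    integral {0..t} (\<lambda>t. \<Sum>k<n'. (h t k)\<^sup>2) \<le> H \<Longrightarrow> t \<in> {0..T} \<Longrightarrow> V n' (c t) \<le> C"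
    by (rule galerkin_bound[OF less_imp_le[OF T] V_nonneg[of n p], of H]) (rule that)
  \<comment> \<open>The summand 1 gives \<open>R >= 1\<close>, hence \<open>R <= R^2\<close>, so
    that \<open>R^2\<close> exceeds both \<open>C\<close> and \<open>V n p\<close>.\<close>
  define R where "R = \<bar>C\<bar> + \<bar>V n p\<bar> + 1"
  have "R * 1 \<le> R * R" unfolding R_def by (intro mult_left_mono) auto
  then have "R \<le> R\<^sup>2" by (simp add: power2_eq_square)
  moreover have R0: "R > 0" "C < R" "V n p < R" by (auto simp: R_def)
  ultimately have R: "R > 0" "C < R\<^sup>2" "V n p < R\<^sup>2" by linarith+
  have cl: "\<bar>clamp1 R y\<bar> \<le> R" "\<bar>y\<bar> \<le> R \<Longrightarrow> clamp1 R y = y" for y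
    using R(1) by (auto simp: clamp1_def max_def min_def abs_le_iff)
  have cl2: "(clamp1 R y)\<^sup>2 \<le> R\<^sup>2" for y using power_mono[OF cl(1)[of y] abs_ge_zero, of 2] by simp
  define W where "W = (\<Sum>k<n. (om k)\<^sup>2 * R\<^sup>2)"
  have VW: "V n (\<lambda>i. clamp1 R (y i)) \<le> W" for y
    unfolding V_def W_def by (intro sum_mono mult_left_mono cl2) simp
  \<comment> \<open>Modes from \<open>n\<close> on have zero velocity, so the infinite system handed
    to \<open>peano\<close> is in effect finite-dimensional.\<close>
  define G where "G t y k = (if k < n then rhs n h t (\<lambda>i. clamp1 R (y i)) k else 0)" for t y k
  obtain c where c0: "\<And>k. c 0 k = (if k < n then p k else 0)"
    and cd: "\<And>k t. t \<in> {0..T} \<Longrightarrow> ((\<lambda>t. c t k) has_real_derivative G t (c t) k) (at t within {0..T})"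
  proof (rule peano[OF T, of G "\<lambda>k. if k < n then p k else 0"])
    fix k s s' and y :: "nat \<Rightarrow> nat \<Rightarrow> real" and y'
    assume s: "\<And>j. s j \<in> {0..T}" "s' \<in> {0..T}" "s \<longlonglongrightarrow> s'" and y: "\<And>i. (\<lambda>j. y j i) \<longlonglongrightarrow> y' i"
    show "(\<lambda>j. G (s j) (y j) k) \<longlonglongrightarrow> G s' y' k"
    proof (cases "k < n")
      case True
      have ycl: "(\<lambda>j. clamp1 R (y j i)) \<longlonglongrightarrow> clamp1 R (y' i)" for i
        unfolding clamp1_def by (intro tendsto_intros y)
      have Vl: "(\<lambda>j. V n (\<lambda>i. clamp1 R (y j i))) \<longlonglongrightarrow> V n (\<lambda>i. clamp1 R (y' i))"
        unfolding V_def by (intro tendsto_intros ycl)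
      have al: "(\<lambda>j. a (V n (\<lambda>i. clamp1 R (y j i)))) \<longlonglongrightarrow> a (V n (\<lambda>i. clamp1 R (y' i)))"
        by (rule continuous_on_tendsto_compose[OF a_cont Vl]) (simp_all add: V_nonneg)
      have hl: "(\<lambda>j. h (s j) k) \<longlonglongrightarrow> h s' k"
        by (rule continuous_on_tendsto_compose[OF h[OF True] s(3,2)]) (use s(1) in simp)
      have Fl: "(\<lambda>j. F n (\<lambda>i. clamp1 R (y j i)) k) \<longlonglongrightarrow> F n (\<lambda>i. clamp1 R (y' i)) k"
        unfolding F_def
      proof (intro tendsto_mult_left nemytskii_tendsto)
        show "sine.partial (\<lambda>i. clamp1 R (y j i)) n \<in> borel_measurable (lebesgue_on \<Omega>)" for j
          by (rule sqintD(1)[OF sine.partial_sqint])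
        show "(sine.partial (\<lambda>i. clamp1 R (y j i)) n x)\<^sup>2 \<le> W" for j x
          by (rule order_trans[OF partial_sq_le_V VW])
        show "(\<lambda>j. sine.partial (\<lambda>i. clamp1 R (y j i)) n x) \<longlonglongrightarrow> sine.partial (\<lambda>i. clamp1 R (y' i)) n x" for x
          unfolding sine.partial_def by (intro tendsto_intros ycl)
      qed
      show ?thesis unfolding G_def rhs_def using True by (simp only: if_True) (intro tendsto_intros al ycl Fl hl)
    qed (simp add: G_def)
  next
    fix k
    have "continuous_on {0..W} a" by (rule continuous_on_subset[OF a_cont]) auto
    then obtain A where A: "\<And>x. x \<in> {0..W} \<Longrightarrow> \<bar>a x\<bar> \<le> A" "A \<ge> 0"
      by (rule continuous_bounded_01) (rule that)
    obtain M where M: "M \<ge> 0" "\<And>u. u\<^sup>2 \<le> W \<Longrightarrow> \<bar>f u\<bar> \<le> M" by (rule f_bounded_of_V) (rule that)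
    show "\<exists>B. \<forall>s\<in>{0..T}. \<forall>y. \<bar>G s y k\<bar> \<le> B"
    proof (cases "k < n")
      case True
      obtain Bh where Bh: "\<And>t. t \<in> {0..T} \<Longrightarrow> \<bar>h t k\<bar> \<le> Bh" "Bh \<ge> 0"
        by (rule continuous_bounded_01[OF h[OF True]]) (rule that)
      have "\<bar>G s y k\<bar> \<le> (om k)\<^sup>2 * A * R + lam * M + Bh" if s: "s \<in> {0..T}" for s y
      proof -
        let ?y = "\<lambda>i. clamp1 R (y i)"
        have "\<bar>a (V n ?y)\<bar> \<le> A" using A(1) VW V_nonneg by simp
        then have 1: "\<bar>- (om k)\<^sup>2 * a (V n ?y) * ?y k\<bar> \<le> (om k)\<^sup>2 * A * R"
          unfolding abs_mult by (intro mult_mono cl) (auto simp: A(2))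
        have "(F n ?y k)\<^sup>2 \<le> (\<Sum>i<Suc k. (F n ?y i)\<^sup>2)" by (rule member_le_sum) auto
        also have "\<dots> \<le> (lam * M)\<^sup>2"
          by (rule F_sq_sum) (rule M(2), rule order_trans[OF partial_sq_le_V VW])
        finally have 2: "\<bar>F n ?y k\<bar> \<le> lam * M"
          using lam M(1) by (simp add: abs_le_square_iff[symmetric])
        have "\<bar>G s y k\<bar> \<le> \<bar>- (om k)\<^sup>2 * a (V n ?y) * ?y k\<bar> + \<bar>F n ?y k\<bar> + \<bar>h s k\<bar>"
          using True unfolding G_def rhs_def by (simp only: if_True)
        then show ?thesis using 1 2 Bh(1)[OF s] by linarith
      qed
      then show ?thesis by blast
    qed (auto simp: G_def)
  qed (rule that)
  have small: "galerkin n h t c" if t: "t \<in> {0..T}" and le: "\<And>s. s \<in> {0..t} \<Longrightarrow> V n (c s) \<le> R\<^sup>2" for t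
    unfolding galerkin_def
  proof (intro conjI allI ballI impI)
    have sub: "{0..t} \<subseteq> {0..T}" using t by auto
    fix k assume k: "k < n"
    show "continuous_on {0..t} (\<lambda>t. h t k)" by (rule continuous_on_subset[OF h[OF k] sub])
    fix s assume s: "s \<in> {0..t}"
    have "clamp1 R (c s i) = c s i" if "i < n" for i
    proof (rule cl(2))
      have "(c s i)\<^sup>2 \<le> R\<^sup>2" using coefficient_le_V[OF that, of "c s"] le[OF s] by linarith
      then show "\<bar>c s i\<bar> \<le> R" using R(1) by (simp add: abs_le_square_iff[symmetric])
    qed
    then have "rhs n h s (\<lambda>i. clamp1 R (c s i)) k = rhs n h s (c s) k" by (rule rhs_cong[OF _ k])
    then have "G s (c s) k = rhs n h s (c s) k" using k by (simp add: G_def)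
    then show "((\<lambda>t. c t k) has_real_derivative rhs n h s (c s) k) (at s within {0..t})"
      using cd[of s k] s subsetD[OF sub s] by (intro has_field_derivative_subset[OF _ sub]) simp
  qed
  have V0: "V n (c 0) = V n p" by (simp add: V_def c0)
  have cc: "continuous_on {0..T} (\<lambda>t. c t k)" for k by (rule DERIV_continuous_on) (rule cd)
  have Vc: "continuous_on {0..T} (\<lambda>t. V n (c t))" unfolding V_def by (intro continuous_intros cc)
  have hsq: "(\<lambda>t. \<Sum>k<n. (h t k)\<^sup>2) integrable_on {0..t}" if "t \<in> {0..T}" for t
    by (intro integrable_continuous_real continuous_intros continuous_on_subset[OF h]) (use that in auto)
  have V_le: "V n (c t) \<le> max C (V n p)" if "t \<in> {0..T}" for t
  proof (rule continuity_argument[OF Vc _ _ _ that, where R="R\<^sup>2"])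
    show "V n (c 0) \<le> max C (V n p)" by (simp add: V0)
    show "max C (V n p) < R\<^sup>2" using R by simp
    fix t assume t: "t \<in> {0..T}" and le: "\<And>s. s \<in> {0..t} \<Longrightarrow> V n (c s) \<le> R\<^sup>2"
    have "integral {0..t} (\<lambda>t. \<Sum>k<n. (h t k)\<^sup>2) \<le> H"
      unfolding H_def by (rule integral_subset_le) (use t hsq[OF t] hsq[of T] T in \<open>auto simp: sum_nonneg\<close>)
    then have "V n (c t) \<le> C" using C[OF small[OF t le]] V0 t by simp
    then show "V n (c t) \<le> max C (V n p)" by simp
  qed
  have gal: "galerkin n h T c"
  proof (rule small)
    show "T \<in> {0..T}" using T by simp
    show "V n (c s) \<le> R\<^sup>2" if "s \<in> {0..T}" for s using V_le[OF that] R by simp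
  qed
  \<comment> \<open>Setting the higher modes to 0 at all times lets sums over \<open>k < n\<close>
    be compared termwise with full series later.\<close>
  define c' where "c' t k = (if k < n then c t k else 0)" for t k
  have ceq: "((\<lambda>t. c' t k) has_real_derivative rhs n h t (c' t) k) (at t within {0..T})" if "t \<in> {0..T}" "k < n" for t k
  proof -
    have "rhs n h t (c' t) k = rhs n h t (c t) k" by (rule rhs_cong) (use that in \<open>auto simp: c'_def\<close>)
    then show ?thesis using c_deriv[OF gal that] that by (simp add: c'_def)
  qed
  have "galerkin n h T c'" unfolding galerkin_def using h ceq by blast
  then show thesis by (rule that) (auto simp: c'_def c0)
qed

end

section \<open>The approximating sequence and its uniform estimates\<close>

lemma time_interval_mono:
  fixes w :: "real \<Rightarrow> real"
  assumes w: "integrable (time_interval T') w" and le: "T \<le> T'"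
  shows "integrable (time_interval T) w"
    and "(\<And>t. 0 \<le> w t) \<Longrightarrow> (LINT t|time_interval T. w t) \<le> (LINT t|time_interval T'. w t)"
proof -
  have i': "integrable lebesgue (\<lambda>t. indicator {0<..<T'} t *\<^sub>R w t)"
    using w by (simp add: integrable_restrict_space)
  then have i: "integrable lebesgue (\<lambda>t. indicator {0<..<T} t *\<^sub>R w t)"
  proof -
    have sub: "{0<..<T} \<subseteq> {0<..<T'}" using le by auto
    show ?thesis
      using set_integrable_subset[of lebesgue "{0<..<T'}" w "{0<..<T}", OF _ _ sub] i' by (simp add: set_integrable_def)
  qed
  then show "integrable (time_interval T) w" by (simp add: integrable_restrict_space)
  assume "\<And>t. 0 \<le> w t"
  then have "(LINT t|lebesgue. indicator {0<..<T} t *\<^sub>R w t) \<le> (LINT t|lebesgue. indicator {0<..<T'} t *\<^sub>R w t)"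
    by (intro integral_mono[OF i i']) (use le in \<open>auto simp: indicator_def\<close>)
  then show "(LINT t|time_interval T. w t) \<le> (LINT t|time_interval T'. w t)"
    by (simp add: integral_restrict_space)
qed

lemma integral_sq_eq_LINT:
  fixes g :: "real \<Rightarrow> real"
  assumes "continuous_on UNIV g" shows "integral {0..t} (\<lambda>s. (g s)\<^sup>2) = (LINT s|time_interval t. (g s)\<^sup>2)"
  by (rule LINT_interval_eq[symmetric]) (intro continuous_intros continuous_on_subset[OF assms], simp)

lemma integral_exp_le:
  fixes \<kappa> :: real
  assumes "\<kappa> > 0" "0 \<le> t" shows "integral {0..t} (\<lambda>s. exp (- \<kappa> * (t - s))) \<le> 1 / \<kappa>"
proof -
  have "((\<lambda>s. exp (- \<kappa> * (t - s))) has_integral (exp (- \<kappa> * (t - t)) / \<kappa> - exp (- \<kappa> * (t - 0)) / \<kappa>)) {0..t}"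
    by (rule fundamental_theorem_of_calculus[OF assms(2)])
      (use assms in \<open>auto intro!: derivative_eq_intros simp: has_real_derivative_iff_has_vector_derivative[symmetric]\<close>)
  then have "integral {0..t} (\<lambda>s. exp (- \<kappa> * (t - s))) = 1 / \<kappa> - exp (- \<kappa> * t) / \<kappa>"
    by (simp add: integral_unique)
  then show ?thesis using assms by simp
qed

text \<open>The data in coefficient form: \<open>p\<close> is square summable with the
  \<open>H01\<close> weights, and \<open>hh_sum\<close> is square integrability of the source in
  time and space with sum and integral exchanged.\<close>

locale evolution = problem +
  fixes p :: "nat \<Rightarrow> real" and hh :: "real \<Rightarrow> nat \<Rightarrow> real"
  assumes p: "summable (\<lambda>k. (om k)\<^sup>2 * (p k)\<^sup>2)"
    and hh: "\<And>T k. T > 0 \<Longrightarrow> sqint (time_interval T) (\<lambda>t. hh t k)"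
    and hh_sum: "\<And>T. T > 0 \<Longrightarrow> summable (\<lambda>k. LINT t|time_interval T. (hh t k)\<^sup>2)"

text \<open>The horizon n+1 grows with \<open>n\<close>, so every bounded time interval is covered
  from some index on and a single subsequence serves all times.\<close>

locale approximation = evolution +
  fixes g c :: "nat \<Rightarrow> real \<Rightarrow> nat \<Rightarrow> real"
  assumes g_cont: "\<And>n k. continuous_on UNIV (\<lambda>t. g n t k)"
    and g_close: "\<And>n k. (LINT t|time_interval (real n + 1). (hh t k - g n t k)\<^sup>2) \<le> 1 / (real n + 1)\<^sup>2"
    and gal: "\<And>n. galerkin n (g n) (real n + 1) (c n)"
    and c0: "\<And>n k. k < n \<Longrightarrow> c n 0 k = p k"
    and c_high: "\<And>n t k. n \<le> k \<Longrightarrow> c n t k = 0"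

lemma (in evolution) approximation_exists: "\<exists>g c. approximation lam m \<beta> \<gamma> f a p hh g c"
proof -
  have "\<exists>G. continuous_on UNIV G \<and> (LINT t|time_interval (real n + 1). (hh t k - G t)\<^sup>2) \<le> 1 / (real n + 1)\<^sup>2" for n k
  proof -
    obtain G where "continuous_on UNIV G" "(LINT t|time_interval (real n + 1). (hh t k - G t)\<^sup>2) < 1 / (real n + 1)\<^sup>2"
      by (rule continuous_dense_sqint[OF hh, of "real n + 1" "1 / (real n + 1)\<^sup>2"]) auto
    then show ?thesis by (intro exI[of _ G]) simp
  qed
  then obtain G where G: "\<And>n k. continuous_on UNIV (G n k)"
    "\<And>n k. (LINT t|time_interval (real n + 1). (hh t k - G n k t)\<^sup>2) \<le> 1 / (real n + 1)\<^sup>2"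
    by metis
  define g where "g n t k = G n k t" for n t k
  have gc: "continuous_on UNIV (\<lambda>t. g n t k)" for n k using G(1) by (simp add: g_def)
  have "\<exists>c. galerkin n (g n) (real n + 1) c \<and> (\<forall>k<n. c 0 k = p k) \<and> (\<forall>t k. n \<le> k \<longrightarrow> c t k = 0)" for n
  proof -
    have T: "real n + 1 > 0" by simp
    obtain c where "galerkin n (g n) (real n + 1) c" "\<And>k. k < n \<Longrightarrow> c 0 k = p k" "\<And>t k. k \<ge> n \<Longrightarrow> c t k = 0"
      by (rule galerkin_exists[OF T, of n "g n" p]) (rule continuous_on_subset[OF gc], simp, rule that)
    then show ?thesis by blast
  qed
  then obtain c where c: "\<And>n. galerkin n (g n) (real n + 1) (c n)" "\<And>n k. k < n \<Longrightarrow> c n 0 k = p k"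
    "\<And>n t k. n \<le> k \<Longrightarrow> c n t k = 0" by metis
  have "approximation lam m \<beta> \<gamma> f a p hh g c"
    by unfold_locales (use gc G(2) c in \<open>auto simp: g_def\<close>)
  then show ?thesis by blast
qed

context approximation
begin

definition hsum :: "real \<Rightarrow> real" where "hsum T = (\<Sum>k. LINT t|time_interval T. (hh t k)\<^sup>2)"
definition psum :: real where "psum = (\<Sum>k. (om k)\<^sup>2 * (p k)\<^sup>2)"

lemma g_sqint: "sqint (time_interval T) (\<lambda>t. g n t k)"
  by (rule sqint_continuous) (rule continuous_on_subset[OF g_cont], simp)

lemma g_close_T:
  assumes "T > 0" "T \<le> real n + 1"
  shows "(LINT t|time_interval T. (hh t k - g n t k)\<^sup>2) \<le> 1 / (real n + 1)\<^sup>2"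
proof -
  have "integrable (time_interval (real n + 1)) (\<lambda>t. (hh t k - g n t k)\<^sup>2)"
    by (rule sqintD(2)[OF sqint_diff[OF hh g_sqint]]) simp
  from time_interval_mono(2)[OF this assms(2)] show ?thesis using g_close[of n k] by simp
qed

text \<open>At most \<open>n\<close> modes are summed, so one power of \<open>real n + 1\<close> in
  the approximation error survives. The index set is general because tails are estimated
  too.\<close>

lemma g_sum:
  assumes T: "T > 0" "T \<le> real n + 1" and I: "I \<subseteq> {..<n}"
  shows "(\<Sum>k\<in>I. LINT t|time_interval T. (g n t k)\<^sup>2) \<le> 2 * (\<Sum>k\<in>I. LINT t|time_interval T. (hh t k)\<^sup>2) + 2 / (real n + 1)"
proof -
  have fin: "finite I" using I finite_subset by blast
  have "(LINT t|time_interval T. (g n t k)\<^sup>2) \<le> 2 * (LINT t|time_interval T. (hh t k)\<^sup>2) + 2 * (1 / (real n + 1)\<^sup>2)" for k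
  proof -
    have "(LINT t|time_interval T. (g n t k - 0)\<^sup>2) \<le> 2 * (LINT t|time_interval T. (g n t k - hh t k)\<^sup>2) + 2 * (LINT t|time_interval T. (hh t k - 0)\<^sup>2)"
      by (rule integral_sq_triangle[OF g_sqint hh[OF T(1)] sqint_zero])
    moreover have "(LINT t|time_interval T. (g n t k - hh t k)\<^sup>2) = (LINT t|time_interval T. (hh t k - g n t k)\<^sup>2)"
      by (simp only: power2_commute)
    ultimately show ?thesis using g_close_T[OF T, of k] by simp
  qed
  then have "(\<Sum>k\<in>I. LINT t|time_interval T. (g n t k)\<^sup>2) \<le> (\<Sum>k\<in>I. 2 * (LINT t|time_interval T. (hh t k)\<^sup>2) + 2 * (1 / (real n + 1)\<^sup>2))"
    by (rule sum_mono)
  also have "\<dots> = 2 * (\<Sum>k\<in>I. LINT t|time_interval T. (hh t k)\<^sup>2) + real (card I) * (2 * (1 / (real n + 1)\<^sup>2))"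
    by (simp add: sum.distrib sum_distrib_left)
  also have "real (card I) * (2 * (1 / (real n + 1)\<^sup>2)) \<le> (real n + 1) * (2 * (1 / (real n + 1)\<^sup>2))"
    using card_mono[OF _ I] by (intro mult_right_mono) auto
  also have "\<dots> = 2 / (real n + 1)"
  proof -
    have *: "x * (2 * (1 / x\<^sup>2)) = 2 / x" if "x > 0" for x :: real using that by (simp add: power2_eq_square)
    show ?thesis by (rule *) simp
  qed
  finally show ?thesis by simp
qed

lemma hsum_ge: "T > 0 \<Longrightarrow> finite I \<Longrightarrow> (\<Sum>k\<in>I. LINT t|time_interval T. (hh t k)\<^sup>2) \<le> hsum T"
  unfolding hsum_def by (rule sum_le_suminf[OF hh_sum]) auto

lemma g_sum_bound:
  assumes T: "T > 0" "T \<le> real n + 1" and I: "I \<subseteq> {..<n}" and t: "t \<in> {0..T}"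
  shows "(\<Sum>k\<in>I. integral {0..t} (\<lambda>s. (g n s k)\<^sup>2)) \<le> (\<Sum>k\<in>I. LINT t|time_interval T. (g n t k)\<^sup>2)"
proof (rule sum_mono)
  fix k
  show "integral {0..t} (\<lambda>s. (g n s k)\<^sup>2) \<le> (LINT t|time_interval T. (g n t k)\<^sup>2)"
    unfolding integral_sq_eq_LINT[OF g_cont]
    by (rule time_interval_mono(2)[OF sqintD(2)[OF g_sqint]]) (use t in auto)
qed

lemma g_sum_bound':
  assumes "T > 0" "T \<le> real n + 1" "t \<in> {0..T}"
  shows "(\<Sum>k<n. integral {0..t} (\<lambda>s. (g n s k)\<^sup>2)) \<le> 2 * hsum T + 2"
proof -
  have "(\<Sum>k<n. integral {0..t} (\<lambda>s. (g n s k)\<^sup>2)) \<le> 2 * (\<Sum>k<n. LINT t|time_interval T. (hh t k)\<^sup>2) + 2 / (real n + 1)"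
    by (rule order_trans[OF g_sum_bound[OF assms(1,2) _ assms(3)] g_sum[OF assms(1,2)]]) auto
  moreover have "2 / (real n + 1) \<le> 2" by (simp add: field_simps)
  ultimately show ?thesis using hsum_ge[OF assms(1), of "{..<n}"] by simp
qed

lemma V0_le: "V n (c n 0) \<le> psum"
proof -
  have "V n (c n 0) = (\<Sum>k<n. (om k)\<^sup>2 * (p k)\<^sup>2)" by (simp add: V_def c0)
  also have "\<dots> \<le> psum" unfolding psum_def by (rule sum_le_suminf[OF p]) auto
  finally show ?thesis .
qed

lemma psum_nonneg: "0 \<le> psum"
  unfolding psum_def by (rule suminf_nonneg[OF p]) simp

lemma gal_T: "T \<le> real n + 1 \<Longrightarrow> galerkin n (g n) T (c n)"
  by (rule galerkin_restrict[OF gal])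

lemma V_bound:
  assumes T: "T > 0"
  obtains C where "\<And>n t. T \<le> real n + 1 \<Longrightarrow> t \<in> {0..T} \<Longrightarrow> V n (c n t) \<le> C" "C \<ge> 0"
proof -
  obtain C where C: "\<And>n h c t. galerkin n h t c \<Longrightarrow> V n (c 0) \<le> psum \<Longrightarrow>
    integral {0..t} (\<lambda>t. \<Sum>k<n. (h t k)\<^sup>2) \<le> 2 * hsum T + 2 \<Longrightarrow> t \<in> {0..T} \<Longrightarrow> V n (c t) \<le> C"
    by (rule galerkin_bound[OF less_imp_le[OF T] psum_nonneg, of "2 * hsum T + 2"]) (rule that)
  have C': "V n (c n t) \<le> C" if n: "T \<le> real n + 1" and t: "t \<in> {0..T}" for n t
  proof (rule C[where n=n and h="g n" and c="c n" and t=t, OF _ V0_le _ t])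
    show "galerkin n (g n) t (c n)" by (rule gal_T) (use n t in auto)
    have "integral {0..t} (\<lambda>t. \<Sum>k<n. (g n t k)\<^sup>2) = (\<Sum>k<n. integral {0..t} (\<lambda>s. (g n s k)\<^sup>2))"
      by (rule Henstock_Kurzweil_Integration.integral_sum)
        (auto intro!: integrable_continuous_real continuous_intros continuous_on_subset[OF g_cont])
    then show "integral {0..t} (\<lambda>t. \<Sum>k<n. (g n t k)\<^sup>2) \<le> 2 * hsum T + 2"
      using g_sum_bound'[OF T n t] by simp
  qed
  have "V n (c n t) \<le> max C 0" if "T \<le> real n + 1" "t \<in> {0..T}" for n t using C'[OF that] by simp
  moreover have "0 \<le> max C 0" by simp
  ultimately show thesis by (rule that)
qed

lemma F_bounds:
  assumes T: "T > 0"
  obtains B where "\<And>n t N. T \<le> real n + 1 \<Longrightarrow> t \<in> {0..T} \<Longrightarrow> (\<Sum>k<N. (F n (c n t) k)\<^sup>2) \<le> B\<^sup>2"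
    "\<And>n t k. T \<le> real n + 1 \<Longrightarrow> t \<in> {0..T} \<Longrightarrow> \<bar>F n (c n t) k\<bar> \<le> B" "B \<ge> 0"
proof -
  obtain C where C: "\<And>n t. T \<le> real n + 1 \<Longrightarrow> t \<in> {0..T} \<Longrightarrow> V n (c n t) \<le> C" "C \<ge> 0" by (rule V_bound[OF T]) (rule that)
  obtain M where M: "M \<ge> 0" "\<And>u. u\<^sup>2 \<le> C \<Longrightarrow> \<bar>f u\<bar> \<le> M" by (rule f_bounded_of_V) (rule that)
  have 1: "(\<Sum>k<N. (F n (c n t) k)\<^sup>2) \<le> (lam * M)\<^sup>2" if "T \<le> real n + 1" "t \<in> {0..T}" for n t N
    by (rule F_sq_sum) (rule M(2), rule order_trans[OF partial_sq_le_V C(1)[OF that]])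
  have 2: "\<bar>F n (c n t) k\<bar> \<le> lam * M" if "T \<le> real n + 1" "t \<in> {0..T}" for n t k
  proof -
    have "(F n (c n t) k)\<^sup>2 \<le> (\<Sum>i<Suc k. (F n (c n t) i)\<^sup>2)" by (rule member_le_sum) auto
    also have "\<dots> \<le> (lam * M)\<^sup>2" by (rule 1[OF that])
    finally show ?thesis using lam M(1) by (simp add: abs_le_square_iff[symmetric])
  qed
  show thesis by (rule that[OF 1 2]) (use lam M(1) in auto)
qed

lemma aV_bound:
  assumes T: "T > 0"
  obtains A where "\<And>n t. T \<le> real n + 1 \<Longrightarrow> t \<in> {0..T} \<Longrightarrow> \<bar>a (V n (c n t))\<bar> \<le> A" "A \<ge> 0"
proof -
  obtain C where C: "\<And>n t. T \<le> real n + 1 \<Longrightarrow> t \<in> {0..T} \<Longrightarrow> V n (c n t) \<le> C" "C \<ge> 0" by (rule V_bound[OF T]) (rule that)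
  have "continuous_on {0..C} a" by (rule continuous_on_subset[OF a_cont]) auto
  then obtain A where A: "\<And>x. x \<in> {0..C} \<Longrightarrow> \<bar>a x\<bar> \<le> A" "A \<ge> 0"
    by (rule continuous_bounded_01) (rule that)
  show thesis by (rule that[OF A(1) A(2)]) (use C V_nonneg in auto)
qed

lemma c_bound:
  assumes "V n (c n t) \<le> C" shows "\<bar>c n t k\<bar> \<le> sqrt C"
proof (cases "k < n")
  case True
  then have "(c n t k)\<^sup>2 \<le> C" using coefficient_le_V[OF True, of "c n t"] assms by linarith
  then show ?thesis by (simp add: real_le_rsqrt)
next
  case False
  then show ?thesis using c_high[of n k t] order_trans[OF V_nonneg assms] by simp
qed

lemma reaction_diffusion_bound:
  assumes T: "T > 0"
  obtains L where "\<And>n t. T \<le> real n + 1 \<Longrightarrow> t \<in> {0..T} \<Longrightarrow>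
    \<bar>- (om k)\<^sup>2 * a (V n (c n t)) * c n t k + F n (c n t) k\<bar> \<le> L" "L \<ge> 0"
proof -
  obtain C where C: "\<And>n t. T \<le> real n + 1 \<Longrightarrow> t \<in> {0..T} \<Longrightarrow> V n (c n t) \<le> C" "C \<ge> 0" by (rule V_bound[OF T]) (rule that)
  obtain A where A: "\<And>n t. T \<le> real n + 1 \<Longrightarrow> t \<in> {0..T} \<Longrightarrow> \<bar>a (V n (c n t))\<bar> \<le> A" "A \<ge> 0" by (rule aV_bound[OF T]) (rule that)
  obtain B where B: "\<And>n t N. T \<le> real n + 1 \<Longrightarrow> t \<in> {0..T} \<Longrightarrow> (\<Sum>k<N. (F n (c n t) k)\<^sup>2) \<le> B\<^sup>2"
    "\<And>n t k. T \<le> real n + 1 \<Longrightarrow> t \<in> {0..T} \<Longrightarrow> \<bar>F n (c n t) k\<bar> \<le> B" "B \<ge> 0" by (rule F_bounds[OF T]) (rule that)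
  show thesis
  proof (rule that)
    fix n t assume nt: "T \<le> real n + 1" "t \<in> {0..T}"
    have "\<bar>- (om k)\<^sup>2 * a (V n (c n t)) * c n t k\<bar> \<le> (om k)\<^sup>2 * A * sqrt C"
      unfolding abs_mult by (intro mult_mono A(1)[OF nt] c_bound[OF C(1)[OF nt]]) (auto simp: A(2))
    then show "\<bar>- (om k)\<^sup>2 * a (V n (c n t)) * c n t k + F n (c n t) k\<bar> \<le> (om k)\<^sup>2 * A * sqrt C + B"
      using B(2)[OF nt, of k] by linarith
  qed (use A(2) B(3) C(2) in auto)
qed

text \<open>The coefficients have no common Lipschitz constant, since the sources \<open>g n\<close>
  are controlled only in the square mean over time. Reaction and diffusion are bounded by
  \<open>L\<close>, and \<open>|g| <= 1 / \<eta> + \<eta> * g^2\<close> splits the source into a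
  Lipschitz part and a part with small integral.\<close>

lemma c_equicontinuous:
  assumes \<epsilon>: "\<epsilon> > 0"
  shows "\<exists>\<delta>>0. \<exists>N. \<forall>n\<ge>N. \<forall>s\<in>{0..T}. \<forall>t\<in>{0..T}. \<bar>s - t\<bar> < \<delta> \<longrightarrow> \<bar>c n s k - c n t k\<bar> \<le> \<epsilon>"
proof -
  define T' where "T' = max T 1"
  have T': "T' > 0" "{0..T} \<subseteq> {0..T'}" by (auto simp: T'_def)
  obtain L where L: "\<And>n t. T' \<le> real n + 1 \<Longrightarrow> t \<in> {0..T'} \<Longrightarrow>
    \<bar>- (om k)\<^sup>2 * a (V n (c n t)) * c n t k + F n (c n t) k\<bar> \<le> L" "L \<ge> 0" by (rule reaction_diffusion_bound[OF T'(1)]) (rule that)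
  define H where "H = 2 * hsum T' + 2"
  have H: "H > 0" using hsum_ge[OF T'(1), of "{}"] by (simp add: H_def)
  \<comment> \<open>\<open>H\<close> bounds the time integral of the squared source, so its part
    weighted by \<eta> costs at most \<epsilon>/2; \<delta> gives the other half to the Lipschitz
    part with constant \<open>L + 1 / \<eta>\<close>.\<close>
  define \<eta> where "\<eta> = \<epsilon> / (2 * H)"
  have \<eta>: "\<eta> > 0" using H \<epsilon> by (simp add: \<eta>_def)
  define \<delta> where "\<delta> = \<epsilon> / (2 * (L + 1 / \<eta>))"
  have L\<eta>: "L + 1 / \<eta> > 0" using L(2) \<eta> by (simp add: add_nonneg_pos)
  have \<delta>: "\<delta> > 0" unfolding \<delta>_def using \<epsilon> L\<eta> by simp
  have key: "\<bar>c n t k - c n s k\<bar> \<le> \<epsilon>" if n: "n \<ge> max (nat \<lceil>T'\<rceil>) (Suc k)" and st: "0 \<le> s" "s \<le> t" "t \<le> T'" "t - s < \<delta>" for n s t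
  proof -
    have nT: "T' \<le> real n + 1" using n by linarith
    have kn: "k < n" using n by simp
    note gT = gal_T[OF nT]
    have sub: "{s..t} \<subseteq> {0..T'}" using st by auto
    have d: "((\<lambda>t. c n t k) has_real_derivative rhs n (g n) x (c n x) k) (at x within {s..t})" if "x \<in> {s..t}" for x
      using c_deriv[OF gT _ kn, of x] that sub by (intro has_field_derivative_subset[OF _ sub]) auto
    have "((\<lambda>x. rhs n (g n) x (c n x) k) has_integral (c n t k - c n s k)) {s..t}"
      by (rule fundamental_theorem_of_calculus[OF st(2)]) (use d in \<open>auto simp: has_real_derivative_iff_has_vector_derivative\<close>)
    then have eq: "c n t k - c n s k = integral {s..t} (\<lambda>x. rhs n (g n) x (c n x) k)" by (simp add: integral_unique)
    have gc: "continuous_on S (\<lambda>x. g n x k)" for S using g_cont continuous_on_subset by blast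
    have gi: "(\<lambda>x. (g n x k)\<^sup>2) integrable_on {u..v}" for u v by (intro integrable_continuous_real continuous_intros gc)
    have "norm (integral {s..t} (\<lambda>x. rhs n (g n) x (c n x) k)) \<le> integral {s..t} (\<lambda>x. (L + 1 / \<eta>) + \<eta> * (g n x k)\<^sup>2)"
    proof (rule integral_norm_bound_integral)
      show "(\<lambda>x. rhs n (g n) x (c n x) k) integrable_on {s..t}"
        by (rule integrable_continuous_real, rule continuous_on_subset[OF rhs_cont[OF gT kn] sub])
      show "(\<lambda>x. (L + 1 / \<eta>) + \<eta> * (g n x k)\<^sup>2) integrable_on {s..t}"
        by (intro integrable_continuous_real continuous_intros gc)
      fix x assume "x \<in> {s..t}"
      then have "\<bar>- (om k)\<^sup>2 * a (V n (c n x)) * c n x k + F n (c n x) k\<bar> \<le> L" using sub by (intro L(1)[OF nT]) auto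
      moreover have "\<bar>g n x k\<bar> \<le> 1 / \<eta> + \<eta> * (g n x k)\<^sup>2"
      proof -
        have "2 * \<bar>g n x k\<bar> \<le> 1 / \<eta> + \<eta> * (g n x k)\<^sup>2"
        proof -
          have "0 \<le> (1 - \<eta> * \<bar>g n x k\<bar>)\<^sup>2 / \<eta>" using \<eta> by simp
          also have "\<dots> = 1 / \<eta> - 2 * \<bar>g n x k\<bar> + \<eta> * (g n x k)\<^sup>2" using \<eta> by (simp add: power2_diff field_simps power2_eq_square)
          finally show ?thesis by simp
        qed
        then show ?thesis by linarith
      qed
      ultimately show "norm (rhs n (g n) x (c n x) k) \<le> (L + 1 / \<eta>) + \<eta> * (g n x k)\<^sup>2"
        unfolding rhs_def real_norm_def by linarith
    qed
    also have "\<dots> = (L + 1 / \<eta>) * (t - s) + \<eta> * integral {s..t} (\<lambda>x. (g n x k)\<^sup>2)"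
    proof (subst Henstock_Kurzweil_Integration.integral_add)
      show "(\<lambda>x. \<eta> * (g n x k)\<^sup>2) integrable_on {s..t}"
        by (intro integrable_continuous_real continuous_intros gc)
    qed (use st in \<open>auto simp: mult.commute\<close>)
    also have "\<dots> \<le> \<epsilon> / 2 + \<epsilon> / 2"
    proof (rule add_mono)
      have "(L + 1 / \<eta>) * (t - s) \<le> (L + 1 / \<eta>) * \<delta>" using st L\<eta> by (intro mult_left_mono) auto
      also have "\<dots> = \<epsilon> / 2"
      proof -
        have *: "x * (\<epsilon> / (2 * x)) = \<epsilon> / 2" if "x > 0" for x using that by simp
        show ?thesis unfolding \<delta>_def by (rule *[OF L\<eta>])
      qed
      finally show "(L + 1 / \<eta>) * (t - s) \<le> \<epsilon> / 2" .
      have "integral {s..t} (\<lambda>x. (g n x k)\<^sup>2) \<le> integral {0..T'} (\<lambda>x. (g n x k)\<^sup>2)"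
        by (rule integral_subset_le[OF sub gi gi]) simp
      also have "\<dots> \<le> (\<Sum>j<n. integral {0..T'} (\<lambda>x. (g n x j)\<^sup>2))"
        using kn by (intro member_le_sum) (auto intro!: Henstock_Kurzweil_Integration.integral_nonneg integrable_continuous_real continuous_intros continuous_on_subset[OF g_cont])
      also have "\<dots> \<le> H" unfolding H_def using T' by (intro g_sum_bound' nT) auto
      finally have "\<eta> * integral {s..t} (\<lambda>x. (g n x k)\<^sup>2) \<le> \<eta> * H" using \<eta> by (intro mult_left_mono) auto
      then show "\<eta> * integral {s..t} (\<lambda>x. (g n x k)\<^sup>2) \<le> \<epsilon> / 2" using H by (simp add: \<eta>_def)
    qed
    finally show ?thesis using eq by simp
  qed
  have "\<bar>c n s k - c n t k\<bar> \<le> \<epsilon>" if n: "n \<ge> max (nat \<lceil>T'\<rceil>) (Suc k)" and st: "s \<in> {0..T}" "t \<in> {0..T}" "\<bar>s - t\<bar> < \<delta>" for n s t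
  proof (cases "s \<le> t")
    case True
    then show ?thesis using key[OF n, of s t] st T'(2) by (auto simp: abs_minus_commute)
  next
    case False
    then show ?thesis using key[OF n, of t s] st T'(2) by auto
  qed
  then show ?thesis using \<delta> by blast
qed

text \<open>The exponential kernel is kept on \<open>F\<close>, whose sum of squares over the modes
  is bounded uniformly in time, and dropped on the source, whose tails are small by
  summability.\<close>

lemma mode_bounds:
  assumes T: "T > 0" and nT: "T \<le> real n + 1" and t: "t \<in> {0..T}" and k: "k < n"
  shows "(om k)\<^sup>2 * (c n t k)\<^sup>2 \<le> (om k)\<^sup>2 * (p k)\<^sup>2 + (2 / m) *
      (integral {0..t} (\<lambda>s. exp (- ((om k)\<^sup>2 * m) * (t - s)) * (F n (c n s) k)\<^sup>2) + integral {0..t} (\<lambda>s. (g n s k)\<^sup>2))"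
    and "integral {0..t} (\<lambda>s. (om k)^4 * (c n s k)\<^sup>2) \<le>
      ((om k)\<^sup>2 * (p k)\<^sup>2 + (2 / m) * (integral {0..t} (\<lambda>s. (F n (c n s) k)\<^sup>2) + integral {0..t} (\<lambda>s. (g n s k)\<^sup>2))) / m"
proof -
  have gt: "galerkin n (g n) t (c n)" by (rule gal_T) (use t nT in auto)
  have t0: "0 \<le> t" using t by simp
  let ?E = "\<lambda>s. exp (- ((om k)\<^sup>2 * m) * (t - s))"
  let ?G = "\<lambda>s. F n (c n s) k + g n s k"
  have Gc: "continuous_on {0..t} ?G" by (intro continuous_intros F_cont[OF gt] continuous_on_subset[OF g_cont]) simp
  have d: "((\<lambda>t. c n t k) has_real_derivative - (om k)\<^sup>2 * a (V n (c n s)) * c n s k + ?G s) (at s within {0..t})" if "s \<in> {0..t}" for s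
    by (rule DERIV_cong[OF c_deriv[OF gt that k]]) (simp add: rhs_def)
  have \<mu>: "(om k)\<^sup>2 > 0" using om_pos[of k] by simp
  note me = mode_estimate[OF t0 d \<mu> m a_ge[OF V_nonneg] Gc]
  have sq: "(?G s)\<^sup>2 \<le> 2 * (F n (c n s) k)\<^sup>2 + 2 * (g n s k)\<^sup>2" for s
    using sum_squares_bound[of "F n (c n s) k" "g n s k"] by (simp add: power2_sum)
  have E1: "?E s \<le> 1" if "s \<in> {0..t}" for s
  proof -
    have "0 \<le> ((om k)\<^sup>2 * m) * (t - s)" using that m by simp
    then show ?thesis unfolding mult_minus_left by simp
  qed
  have Ei: "(\<lambda>s. ?E s * (F n (c n s) k)\<^sup>2) integrable_on {0..t}" and Fi: "(\<lambda>s. (F n (c n s) k)\<^sup>2) integrable_on {0..t}"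
    and gi: "(\<lambda>s. (g n s k)\<^sup>2) integrable_on {0..t}"
    by (intro integrable_continuous_real continuous_intros F_cont[OF gt] continuous_on_subset[OF g_cont], simp?)+
  have Ei2: "(\<lambda>s. 2 * (?E s * (F n (c n s) k)\<^sup>2)) integrable_on {0..t}" and Fi2: "(\<lambda>s. 2 * (F n (c n s) k)\<^sup>2) integrable_on {0..t}"
    and gi2: "(\<lambda>s. 2 * (g n s k)\<^sup>2) integrable_on {0..t}"
    by (intro integrable_continuous_real continuous_intros F_cont[OF gt] continuous_on_subset[OF g_cont], simp?)+
  have "integral {0..t} (\<lambda>s. ?E s * (?G s)\<^sup>2) \<le> integral {0..t} (\<lambda>s. 2 * (?E s * (F n (c n s) k)\<^sup>2) + 2 * (g n s k)\<^sup>2)"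
  proof (rule Henstock_Kurzweil_Integration.integral_le)
    show "(\<lambda>s. ?E s * (?G s)\<^sup>2) integrable_on {0..t}" by (intro integrable_continuous_real continuous_intros Gc)
    show "(\<lambda>s. 2 * (?E s * (F n (c n s) k)\<^sup>2) + 2 * (g n s k)\<^sup>2) integrable_on {0..t}"
      by (intro Henstock_Kurzweil_Integration.integrable_add Ei2 gi2)
    fix s assume "s \<in> {0..t}"
    have "?E s * (?G s)\<^sup>2 \<le> ?E s * (2 * (F n (c n s) k)\<^sup>2) + ?E s * (2 * (g n s k)\<^sup>2)"
      using mult_left_mono[OF sq, of "?E s" s] by (simp add: distrib_left)
    moreover have "?E s * (2 * (g n s k)\<^sup>2) \<le> 1 * (2 * (g n s k)\<^sup>2)"
      using E1[OF \<open>s \<in> {0..t}\<close>] by (intro mult_right_mono) auto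
    ultimately show "?E s * (?G s)\<^sup>2 \<le> 2 * (?E s * (F n (c n s) k)\<^sup>2) + 2 * (g n s k)\<^sup>2" by simp
  qed
  also have "\<dots> = 2 * integral {0..t} (\<lambda>s. ?E s * (F n (c n s) k)\<^sup>2) + 2 * integral {0..t} (\<lambda>s. (g n s k)\<^sup>2)"
    by (subst Henstock_Kurzweil_Integration.integral_add[OF Ei2 gi2]) simp
  finally have "(1 / m) * integral {0..t} (\<lambda>s. ?E s * (?G s)\<^sup>2) \<le>
      (1 / m) * (2 * integral {0..t} (\<lambda>s. ?E s * (F n (c n s) k)\<^sup>2) + 2 * integral {0..t} (\<lambda>s. (g n s k)\<^sup>2))"
    using m by (intro mult_left_mono) auto
  also have "\<dots> = (2 / m) * (integral {0..t} (\<lambda>s. ?E s * (F n (c n s) k)\<^sup>2) + integral {0..t} (\<lambda>s. (g n s k)\<^sup>2))"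
    by (simp add: distrib_left add_divide_distrib)
  finally show "(om k)\<^sup>2 * (c n t k)\<^sup>2 \<le> (om k)\<^sup>2 * (p k)\<^sup>2 + (2 / m) *
      (integral {0..t} (\<lambda>s. ?E s * (F n (c n s) k)\<^sup>2) + integral {0..t} (\<lambda>s. (g n s k)\<^sup>2))"
    using me(1) c0[OF k] by simp
  have "integral {0..t} (\<lambda>s. (?G s)\<^sup>2) \<le> integral {0..t} (\<lambda>s. 2 * (F n (c n s) k)\<^sup>2 + 2 * (g n s k)\<^sup>2)"
    by (rule Henstock_Kurzweil_Integration.integral_le)
      (intro integrable_continuous_real continuous_on_power Gc, intro Henstock_Kurzweil_Integration.integrable_add Fi2 gi2, rule sq)
  also have "\<dots> = 2 * integral {0..t} (\<lambda>s. (F n (c n s) k)\<^sup>2) + 2 * integral {0..t} (\<lambda>s. (g n s k)\<^sup>2)"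
    by (subst Henstock_Kurzweil_Integration.integral_add[OF Fi2 gi2]) simp
  finally have "(1 / m) * integral {0..t} (\<lambda>s. (?G s)\<^sup>2) \<le>
      (1 / m) * (2 * integral {0..t} (\<lambda>s. (F n (c n s) k)\<^sup>2) + 2 * integral {0..t} (\<lambda>s. (g n s k)\<^sup>2))"
    using m by (intro mult_left_mono) auto
  also have "\<dots> = (2 / m) * (integral {0..t} (\<lambda>s. (F n (c n s) k)\<^sup>2) + integral {0..t} (\<lambda>s. (g n s k)\<^sup>2))"
    by (simp add: distrib_left add_divide_distrib)
  finally have "((om k)\<^sup>2 * (p k)\<^sup>2 + (1 / m) * integral {0..t} (\<lambda>s. (?G s)\<^sup>2)) / m \<le>
     ((om k)\<^sup>2 * (p k)\<^sup>2 + (2 / m) * (integral {0..t} (\<lambda>s. (F n (c n s) k)\<^sup>2) + integral {0..t} (\<lambda>s. (g n s k)\<^sup>2))) / m"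
    using m by (intro divide_right_mono add_left_mono) auto
  moreover have "((om k)\<^sup>2)\<^sup>2 = (om k)^4" by (simp flip: power_mult)
  ultimately show "integral {0..t} (\<lambda>s. (om k)^4 * (c n s k)\<^sup>2) \<le>
      ((om k)\<^sup>2 * (p k)\<^sup>2 + (2 / m) * (integral {0..t} (\<lambda>s. (F n (c n s) k)\<^sup>2) + integral {0..t} (\<lambda>s. (g n s k)\<^sup>2))) / m"
    using me(2) c0[OF k] by simp
qed

lemma om_mono: "j \<le> k \<Longrightarrow> (om j)\<^sup>2 \<le> (om k)\<^sup>2"
  by (intro power_mono) (auto simp: om_def)

text \<open>Parabolic smoothing makes the high modes small uniformly in the approximation.\<close>

lemma V_tail_bound:
  assumes T: "T > 0" and B: "\<And>n t N. T \<le> real n + 1 \<Longrightarrow> t \<in> {0..T} \<Longrightarrow> (\<Sum>k<N. (F n (c n t) k)\<^sup>2) \<le> B\<^sup>2"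
    and nT: "T \<le> real n + 1" and t: "t \<in> {0..T}"
  shows "(\<Sum>k\<in>{K..<n}. (om k)\<^sup>2 * (c n t k)\<^sup>2) \<le> (\<Sum>k\<in>{K..<n}. (om k)\<^sup>2 * (p k)\<^sup>2) +
    (2 / m) * (B\<^sup>2 / ((om K)\<^sup>2 * m) + (2 * (\<Sum>k\<in>{K..<n}. LINT t|time_interval T. (hh t k)\<^sup>2) + 2 / (real n + 1)))"
proof -
  have gt: "galerkin n (g n) t (c n)" by (rule gal_T) (use t nT in auto)
  let ?\<kappa> = "(om K)\<^sup>2 * m"
  have \<kappa>: "?\<kappa> > 0" using om_pos[of K] m by simp
  let ?E = "\<lambda>k s. exp (- ((om k)\<^sup>2 * m) * (t - s))"
  have "(\<Sum>k\<in>{K..<n}. integral {0..t} (\<lambda>s. ?E k s * (F n (c n s) k)\<^sup>2)) = integral {0..t} (\<lambda>s. \<Sum>k\<in>{K..<n}. ?E k s * (F n (c n s) k)\<^sup>2)"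
    by (rule Henstock_Kurzweil_Integration.integral_sum[symmetric])
      (auto intro!: integrable_continuous_real continuous_intros F_cont[OF gt])
  also have "\<dots> \<le> integral {0..t} (\<lambda>s. B\<^sup>2 * ?E K s)"
  proof (rule Henstock_Kurzweil_Integration.integral_le)
    show "(\<lambda>s. \<Sum>k\<in>{K..<n}. ?E k s * (F n (c n s) k)\<^sup>2) integrable_on {0..t}"
      by (intro integrable_continuous_real continuous_intros F_cont[OF gt])
    show "(\<lambda>s. B\<^sup>2 * ?E K s) integrable_on {0..t}"
      by (intro integrable_continuous_real continuous_intros)
    fix s assume s: "s \<in> {0..t}"
    have "(\<Sum>k\<in>{K..<n}. ?E k s * (F n (c n s) k)\<^sup>2) \<le> (\<Sum>k\<in>{K..<n}. ?E K s * (F n (c n s) k)\<^sup>2)"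
    proof (intro sum_mono mult_right_mono)
      fix k assume "k \<in> {K..<n}"
      then have "((om K)\<^sup>2 * m) * (t - s) \<le> ((om k)\<^sup>2 * m) * (t - s)"
        using om_mono[of K k] m s by (intro mult_right_mono) auto
      then show "?E k s \<le> ?E K s" by simp
    qed simp
    also have "\<dots> = ?E K s * (\<Sum>k\<in>{K..<n}. (F n (c n s) k)\<^sup>2)" by (rule sum_distrib_left[symmetric])
    also have "\<dots> \<le> ?E K s * B\<^sup>2"
    proof (rule mult_left_mono)
      have "(\<Sum>k\<in>{K..<n}. (F n (c n s) k)\<^sup>2) \<le> (\<Sum>k<n. (F n (c n s) k)\<^sup>2)" by (rule sum_mono2) auto
      also have "\<dots> \<le> B\<^sup>2" by (rule B[OF nT]) (use s t in auto)
      finally show "(\<Sum>k\<in>{K..<n}. (F n (c n s) k)\<^sup>2) \<le> B\<^sup>2" .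
    qed simp
    finally show "(\<Sum>k\<in>{K..<n}. ?E k s * (F n (c n s) k)\<^sup>2) \<le> B\<^sup>2 * ?E K s" by (simp add: mult.commute)
  qed
  also have "\<dots> = B\<^sup>2 * integral {0..t} (?E K)" by simp
  also have "\<dots> \<le> B\<^sup>2 * (1 / ?\<kappa>)" using t by (intro mult_left_mono integral_exp_le \<kappa>) auto
  finally have 1: "(\<Sum>k\<in>{K..<n}. integral {0..t} (\<lambda>s. ?E k s * (F n (c n s) k)\<^sup>2)) \<le> B\<^sup>2 / ?\<kappa>" by simp
  have 2: "(\<Sum>k\<in>{K..<n}. integral {0..t} (\<lambda>s. (g n s k)\<^sup>2)) \<le> 2 * (\<Sum>k\<in>{K..<n}. LINT t|time_interval T. (hh t k)\<^sup>2) + 2 / (real n + 1)"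
    by (rule order_trans[OF g_sum_bound[OF T nT _ t] g_sum[OF T nT]]) auto
  have "(\<Sum>k\<in>{K..<n}. (om k)\<^sup>2 * (c n t k)\<^sup>2) \<le> (\<Sum>k\<in>{K..<n}. (om k)\<^sup>2 * (p k)\<^sup>2 + (2 / m) *
      (integral {0..t} (\<lambda>s. ?E k s * (F n (c n s) k)\<^sup>2) + integral {0..t} (\<lambda>s. (g n s k)\<^sup>2)))"
    by (intro sum_mono mode_bounds(1)[OF T nT t]) simp
  also have "\<dots> = (\<Sum>k\<in>{K..<n}. (om k)\<^sup>2 * (p k)\<^sup>2) + (2 / m) *
      ((\<Sum>k\<in>{K..<n}. integral {0..t} (\<lambda>s. ?E k s * (F n (c n s) k)\<^sup>2)) + (\<Sum>k\<in>{K..<n}. integral {0..t} (\<lambda>s. (g n s k)\<^sup>2)))"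
    by (simp only: sum.distrib sum_distrib_left[symmetric])
  also have "\<dots> \<le> (\<Sum>k\<in>{K..<n}. (om k)\<^sup>2 * (p k)\<^sup>2) + (2 / m) * (B\<^sup>2 / ?\<kappa> + (2 * (\<Sum>k\<in>{K..<n}. LINT t|time_interval T. (hh t k)\<^sup>2) + 2 / (real n + 1)))"
    using m by (intro add_left_mono mult_left_mono add_mono 1 2) auto
  finally show ?thesis .
qed

text \<open>Three contributions become small as \<open>K\<close> grows: the tails of the initial
  value and of the source by summability, and the reaction through the factor 1/(om K)^2 left by
  integrating the kernel.\<close>

lemma V_tail:
  assumes T: "T > 0" and \<epsilon>: "\<epsilon> > 0"
  shows "\<exists>K N. \<forall>n\<ge>N. \<forall>t\<in>{0..T}. (\<Sum>k\<in>{K..<n}. (om k)\<^sup>2 * (c n t k)\<^sup>2) \<le> \<epsilon>"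
proof -
  obtain B where B: "\<And>n t N. T \<le> real n + 1 \<Longrightarrow> t \<in> {0..T} \<Longrightarrow> (\<Sum>k<N. (F n (c n t) k)\<^sup>2) \<le> B\<^sup>2"
    "\<And>n t k. T \<le> real n + 1 \<Longrightarrow> t \<in> {0..T} \<Longrightarrow> \<bar>F n (c n t) k\<bar> \<le> B" "B \<ge> 0" by (rule F_bounds[OF T]) (rule that)
  have tail: "\<exists>K0. \<forall>K\<ge>K0. \<forall>n. (\<Sum>k\<in>{K..<n}. x k) \<le> \<eta>" if "summable x" "\<eta> > 0" for x :: "nat \<Rightarrow> real" and \<eta>
  proof -
    obtain K0 where K0: "\<And>K n. K \<ge> K0 \<Longrightarrow> norm (sum x {K..<n}) < \<eta>"
      using \<open>summable x\<close> \<open>\<eta> > 0\<close> unfolding summable_Cauchy by blast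
    have "sum x {K..<n} \<le> \<eta>" if "K \<ge> K0" for K n using K0[OF that, of n] by simp
    then show ?thesis by blast
  qed
  \<comment> \<open>The initial tail costs \<eta> and the rest \<open>(2 / m)\<close> times 4\<eta>,
    together at most 3\<epsilon>/4.\<close>
  define \<eta> where "\<eta> = min (\<epsilon> / 4) (\<epsilon> * m / 16)"
  have \<eta>: "\<eta> > 0" "\<eta> \<le> \<epsilon> / 4" "(2 / m) * (2 * \<eta>) \<le> \<epsilon> / 4"
  proof -
    show "\<eta> > 0" "\<eta> \<le> \<epsilon> / 4" using \<epsilon> m by (auto simp: \<eta>_def)
    have "(2 / m) * (2 * \<eta>) \<le> (2 / m) * (2 * (\<epsilon> * m / 16))" using m by (intro mult_left_mono) (auto simp: \<eta>_def)
    also have "\<dots> = \<epsilon> / 4" using m by simp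
    finally show "(2 / m) * (2 * \<eta>) \<le> \<epsilon> / 4" .
  qed
  obtain K1 where K1: "\<And>K n. K \<ge> K1 \<Longrightarrow> (\<Sum>k\<in>{K..<n}. (om k)\<^sup>2 * (p k)\<^sup>2) \<le> \<eta>" using tail[OF p \<eta>(1)] by blast
  obtain K2 where K2: "\<And>K n. K \<ge> K2 \<Longrightarrow> (\<Sum>k\<in>{K..<n}. LINT t|time_interval T. (hh t k)\<^sup>2) \<le> \<eta>"
    using tail[OF hh_sum[OF T] \<eta>(1)] by blast
  obtain K3 where K3: "real K3 > B\<^sup>2 / (m * \<eta>)" using reals_Archimedean2 by blast
  obtain N where N: "real N > 2 / \<eta> + T" using reals_Archimedean2 by blast
  define K where "K = max (max K1 K2) K3"
  have om_ge: "real K \<le> (om K)\<^sup>2"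
  proof -
    have "real K * 1 \<le> (real K + 1) * pi" by (intro mult_mono) (use pi_gt3 in auto)
    then have "real K \<le> om K" by (simp add: om_def)
    also have "om K * 1 \<le> om K * om K" using om_ge_1[of K] by (intro mult_left_mono) auto
    finally show ?thesis by (simp add: power2_eq_square)
  qed
  have BK: "B\<^sup>2 / ((om K)\<^sup>2 * m) \<le> \<eta>"
  proof -
    have "B\<^sup>2 / (m * \<eta>) \<le> (om K)\<^sup>2" using K3 om_ge unfolding K_def by linarith
    then have "B\<^sup>2 \<le> (om K)\<^sup>2 * (m * \<eta>)" using m \<eta>(1) by (simp add: field_simps)
    then show ?thesis using m om_pos[of K] by (simp add: field_simps)
  qed
  have "(\<Sum>k\<in>{K..<n}. (om k)\<^sup>2 * (c n t k)\<^sup>2) \<le> \<epsilon>" if n: "n \<ge> N" and t: "t \<in> {0..T}" for n t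
  proof -
    have \<eta>N: "2 / \<eta> > 0" using \<eta>(1) by simp
    have nT: "T \<le> real n + 1" using n N \<eta>N by linarith
    have "2 / \<eta> \<le> real n + 1" using n N T by linarith
    then have nn: "2 / (real n + 1) \<le> \<eta>" using \<eta>(1) by (simp add: field_simps)
    have "K \<ge> K1" "K \<ge> K2" by (auto simp: K_def)
    then have "B\<^sup>2 / ((om K)\<^sup>2 * m) + (2 * (\<Sum>k\<in>{K..<n}. LINT t|time_interval T. (hh t k)\<^sup>2) + 2 / (real n + 1)) \<le> 2 * (2 * \<eta>)"
      using BK K2[of K n] nn by linarith
    then have "(2 / m) * (B\<^sup>2 / ((om K)\<^sup>2 * m) + (2 * (\<Sum>k\<in>{K..<n}. LINT t|time_interval T. (hh t k)\<^sup>2) + 2 / (real n + 1)))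
        \<le> (2 / m) * (2 * (2 * \<eta>))" using m by (intro mult_left_mono) auto
    then show ?thesis
      using V_tail_bound[OF T B(1) nT t, of K] K1[OF \<open>K \<ge> K1\<close>, of n] \<eta>(2,3) \<epsilon> by linarith
  qed
  then show ?thesis by blast
qed

text \<open>The weight \<open>(om k)^4\<close> is that of the second space derivative: the
  integrated dissipation of the \<open>H01\<close> estimate, summed over the modes.\<close>

lemma H2_bound:
  assumes T: "T > 0"
  obtains Q where "\<And>n. T \<le> real n + 1 \<Longrightarrow> (\<Sum>k<n. integral {0..T} (\<lambda>s. (om k)^4 * (c n s k)\<^sup>2)) \<le> Q"
proof -
  obtain B where B: "\<And>n t N. T \<le> real n + 1 \<Longrightarrow> t \<in> {0..T} \<Longrightarrow> (\<Sum>k<N. (F n (c n t) k)\<^sup>2) \<le> B\<^sup>2"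
    "\<And>n t k. T \<le> real n + 1 \<Longrightarrow> t \<in> {0..T} \<Longrightarrow> \<bar>F n (c n t) k\<bar> \<le> B" "B \<ge> 0" by (rule F_bounds[OF T]) (rule that)
  have "(\<Sum>k<n. integral {0..T} (\<lambda>s. (om k)^4 * (c n s k)\<^sup>2)) \<le> (psum + (2 / m) * (B\<^sup>2 * T + (2 * hsum T + 2))) / m"
    if nT: "T \<le> real n + 1" for n
  proof -
    have TT: "T \<in> {0..T}" using T by simp
    note gT = gal_T[OF nT]
    have Fi: "(\<lambda>s. (F n (c n s) k)\<^sup>2) integrable_on {0..T}" for k
      by (intro integrable_continuous_real continuous_intros F_cont[OF gT])
    have "(\<Sum>k<n. integral {0..T} (\<lambda>s. (F n (c n s) k)\<^sup>2)) = integral {0..T} (\<lambda>s. \<Sum>k<n. (F n (c n s) k)\<^sup>2)"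
      by (rule Henstock_Kurzweil_Integration.integral_sum[symmetric]) (auto intro: Fi)
    also have "\<dots> \<le> integral {0..T} (\<lambda>s. B\<^sup>2)"
      by (rule Henstock_Kurzweil_Integration.integral_le) (auto intro!: integrable_sum Fi B(1)[OF nT])
    also have "\<dots> = B\<^sup>2 * T" using T by simp
    finally have 1: "(\<Sum>k<n. integral {0..T} (\<lambda>s. (F n (c n s) k)\<^sup>2)) \<le> B\<^sup>2 * T" .
    have 2: "(\<Sum>k<n. (om k)\<^sup>2 * (p k)\<^sup>2) \<le> psum" unfolding psum_def by (rule sum_le_suminf[OF p]) auto
    have "(\<Sum>k<n. integral {0..T} (\<lambda>s. (om k)^4 * (c n s k)\<^sup>2)) \<le> (\<Sum>k<n. ((om k)\<^sup>2 * (p k)\<^sup>2 + (2 / m) *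
      (integral {0..T} (\<lambda>s. (F n (c n s) k)\<^sup>2) + integral {0..T} (\<lambda>s. (g n s k)\<^sup>2))) / m)"
      by (intro sum_mono mode_bounds(2)[OF T nT TT]) simp
    also have "\<dots> = ((\<Sum>k<n. (om k)\<^sup>2 * (p k)\<^sup>2) + (2 / m) *
      ((\<Sum>k<n. integral {0..T} (\<lambda>s. (F n (c n s) k)\<^sup>2)) + (\<Sum>k<n. integral {0..T} (\<lambda>s. (g n s k)\<^sup>2)))) / m"
      by (simp only: sum_divide_distrib[symmetric] sum.distrib sum_distrib_left[symmetric])
    also have "\<dots> \<le> (psum + (2 / m) * (B\<^sup>2 * T + (2 * hsum T + 2))) / m"
      using m by (intro divide_right_mono add_mono mult_left_mono 1 2 g_sum_bound'[OF T nT TT]) auto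
    finally show ?thesis .
  qed
  then show thesis by (rule that)
qed

lemma limit_exists:
  obtains r z where "strict_mono (r :: nat \<Rightarrow> nat)" "\<And>t k. t \<ge> 0 \<Longrightarrow> (\<lambda>n. c (r n) t k) \<longlonglongrightarrow> z t k"
proof (rule equicontinuous_selection[of c])
  fix t :: real and k assume t: "t \<ge> 0"
  have T: "t + 1 > 0" using t by simp
  obtain C where C: "\<And>n s. t + 1 \<le> real n + 1 \<Longrightarrow> s \<in> {0..t+1} \<Longrightarrow> V n (c n s) \<le> C" "C \<ge> 0" by (rule V_bound[OF T]) (rule that)
  have "\<bar>c n t k\<bar> \<le> sqrt C" if "n \<ge> nat \<lceil>t\<rceil>" for n
    by (rule c_bound[OF C(1)]) (use that t in \<open>linarith, auto\<close>)
  then show "\<exists>B N. \<forall>n\<ge>N. \<bar>c n t k\<bar> \<le> B" by blast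
next
  fix T k and \<epsilon> :: real assume "\<epsilon> > 0"
  then show "\<exists>\<delta>>0. \<exists>N. \<forall>n\<ge>N. \<forall>s\<in>{0..T}. \<forall>t\<in>{0..T}. \<bar>s - t\<bar> < \<delta> \<longrightarrow> \<bar>c n s k - c n t k\<bar> \<le> \<epsilon>"
    by (rule c_equicontinuous)
qed (rule that)

end

section \<open>Passage to the limit\<close>

text \<open>Termwise convergence and uniformly small tails. The finite tail sums of the limit
  inherit the bound termwise, so summability of the limit is obtained rather than assumed.\<close>

lemma series_tendsto_tail:
  fixes x :: "nat \<Rightarrow> nat \<Rightarrow> real"
  assumes lim: "\<And>k. (\<lambda>n. x n k) \<longlonglongrightarrow> y k" and fin: "\<And>n k. s n \<le> k \<Longrightarrow> x n k = 0"
    and tail: "\<And>\<epsilon>. \<epsilon> > 0 \<Longrightarrow> \<exists>K N. \<forall>n\<ge>N. (\<Sum>k\<in>{K..<s n}. \<bar>x n k\<bar>) \<le> \<epsilon>"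
  shows "summable (\<lambda>k. \<bar>y k\<bar>)" "(\<lambda>n. \<Sum>k<s n. x n k) \<longlonglongrightarrow> (\<Sum>k. y k)"
proof -
  have ytail: "\<exists>K N. (\<forall>n\<ge>N. (\<Sum>k\<in>{K..<s n}. \<bar>x n k\<bar>) \<le> \<epsilon>) \<and> (\<forall>M. (\<Sum>k\<in>{K..<M}. \<bar>y k\<bar>) \<le> \<epsilon>)" if \<epsilon>: "\<epsilon> > 0" for \<epsilon>
  proof -
    obtain K N where KN: "\<And>n. n \<ge> N \<Longrightarrow> (\<Sum>k\<in>{K..<s n}. \<bar>x n k\<bar>) \<le> \<epsilon>" using tail[OF \<epsilon>] by blast
    have "(\<Sum>k\<in>{K..<M}. \<bar>y k\<bar>) \<le> \<epsilon>" for M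
    proof (rule LIMSEQ_le_const2)
      show "(\<lambda>n. \<Sum>k\<in>{K..<M}. \<bar>x n k\<bar>) \<longlonglongrightarrow> (\<Sum>k\<in>{K..<M}. \<bar>y k\<bar>)" by (intro tendsto_intros lim)
      have "(\<Sum>k\<in>{K..<M}. \<bar>x n k\<bar>) \<le> \<epsilon>" if "n \<ge> N" for n
      proof -
        have "(\<Sum>k\<in>{K..<M}. \<bar>x n k\<bar>) \<le> (\<Sum>k\<in>{K..<max M (s n)}. \<bar>x n k\<bar>)" by (rule sum_mono2) auto
        also have "\<dots> = (\<Sum>k\<in>{K..<s n}. \<bar>x n k\<bar>)"
          by (rule sum.mono_neutral_right) (auto simp: fin)
        also have "\<dots> \<le> \<epsilon>" by (rule KN[OF that])
        finally show ?thesis .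
      qed
      then show "\<exists>N. \<forall>n\<ge>N. (\<Sum>k\<in>{K..<M}. \<bar>x n k\<bar>) \<le> \<epsilon>" by blast
    qed
    with KN show ?thesis by blast
  qed
  obtain K where K: "\<And>M. (\<Sum>k\<in>{K..<M}. \<bar>y k\<bar>) \<le> 1" using ytail[of 1] by auto
  have split: "(\<Sum>k<M. w k) = (\<Sum>k<K. w k) + (\<Sum>k\<in>{K..<M}. w k)" if "K \<le> M" for w :: "nat \<Rightarrow> real" and K M
    using sum.atLeastLessThan_concat[of 0 K M w] that by (simp add: atLeast0LessThan)
  show sy: "summable (\<lambda>k. \<bar>y k\<bar>)"
  proof (rule bounded_imp_summable)
    fix n
    have "(\<Sum>k\<le>n. \<bar>y k\<bar>) \<le> (\<Sum>k<max K (Suc n). \<bar>y k\<bar>)" by (rule sum_mono2) auto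
    also have "\<dots> = (\<Sum>k<K. \<bar>y k\<bar>) + (\<Sum>k\<in>{K..<max K (Suc n)}. \<bar>y k\<bar>)" by (rule split) simp
    also have "\<dots> \<le> (\<Sum>k<K. \<bar>y k\<bar>) + 1" using K by simp
    finally show "(\<Sum>k\<le>n. \<bar>y k\<bar>) \<le> (\<Sum>k<K. \<bar>y k\<bar>) + 1" .
  qed simp
  show "(\<lambda>n. \<Sum>k<s n. x n k) \<longlonglongrightarrow> (\<Sum>k. y k)"
  proof (rule LIMSEQ_I)
    fix \<epsilon> :: real assume "\<epsilon> > 0"
    then obtain K N where KN: "\<And>n. n \<ge> N \<Longrightarrow> (\<Sum>k\<in>{K..<s n}. \<bar>x n k\<bar>) \<le> \<epsilon>/4" "\<And>M. (\<Sum>k\<in>{K..<M}. \<bar>y k\<bar>) \<le> \<epsilon>/4"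
      using ytail[of "\<epsilon>/4"] by auto
    have "(\<lambda>n. \<Sum>k<K. x n k) \<longlonglongrightarrow> (\<Sum>k<K. y k)" by (intro tendsto_intros lim)
    then obtain N' where N': "\<And>n. n \<ge> N' \<Longrightarrow> norm ((\<Sum>k<K. x n k) - (\<Sum>k<K. y k)) < \<epsilon>/4"
      using LIMSEQ_D[of _ _ "\<epsilon>/4"] \<open>\<epsilon> > 0\<close> by (metis divide_pos_pos zero_less_numeral)
    have ys: "summable (\<lambda>k. \<bar>y (k + K)\<bar>)" using summable_ignore_initial_segment[OF sy, of K] .
    have "\<bar>\<Sum>k. y (k + K)\<bar> \<le> (\<Sum>k. \<bar>y (k + K)\<bar>)" by (rule summable_rabs[OF ys])
    also have "\<dots> \<le> \<epsilon>/4"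
    proof (rule suminf_le_const[OF ys])
      fix M
      have "(\<Sum>k<M. \<bar>y (k + K)\<bar>) = (\<Sum>k\<in>{K..<M + K}. \<bar>y k\<bar>)"
        using sum.shift_bounds_nat_ivl[of "\<lambda>k. \<bar>y k\<bar>" 0 K M] by (simp add: atLeast0LessThan)
      then show "(\<Sum>k<M. \<bar>y (k + K)\<bar>) \<le> \<epsilon>/4" using KN(2) by simp
    qed
    finally have yt: "\<bar>\<Sum>k. y (k + K)\<bar> \<le> \<epsilon>/4" .
    have "summable y" using sy by (rule summable_rabs_cancel)
    then have ysum: "(\<Sum>k. y k) = (\<Sum>k. y (k + K)) + (\<Sum>k<K. y k)" by (rule suminf_split_initial_segment)
    have "norm ((\<Sum>k<s n. x n k) - (\<Sum>k. y k)) < \<epsilon>" if n: "n \<ge> max N N'" for n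
    proof -
      have "(\<Sum>k<s n. x n k) = (\<Sum>k<K. x n k) + (\<Sum>k\<in>{K..<s n}. x n k)"
      proof (cases "K \<le> s n")
        case False
        then have "(\<Sum>k<s n. x n k) = (\<Sum>k<K. x n k)" by (intro sum.mono_neutral_left) (auto simp: fin)
        then show ?thesis using False by simp
      qed (rule split)
      moreover have "\<bar>\<Sum>k\<in>{K..<s n}. x n k\<bar> \<le> \<epsilon>/4"
        using sum_abs[of "x n" "{K..<s n}"] KN(1)[of n] n by linarith
      moreover have "\<bar>(\<Sum>k<K. x n k) - (\<Sum>k<K. y k)\<bar> < \<epsilon>/4" using N'[of n] n by simp
      ultimately show ?thesis using ysum yt \<open>\<epsilon> > 0\<close> unfolding real_norm_def by linarith
    qed
    then show "\<exists>no. \<forall>n\<ge>no. norm ((\<Sum>k<s n. x n k) - (\<Sum>k. y k)) < \<epsilon>" by blast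
  qed
qed

locale limit_problem = approximation +
  fixes r :: "nat \<Rightarrow> nat" and z :: "real \<Rightarrow> nat \<Rightarrow> real"
  assumes r: "strict_mono r" and z: "\<And>t k. t \<ge> 0 \<Longrightarrow> (\<lambda>n. c (r n) t k) \<longlonglongrightarrow> z t k"
begin

definition Vz :: "real \<Rightarrow> real" where "Vz t = (\<Sum>k. (om k)\<^sup>2 * (z t k)\<^sup>2)"
text \<open>A pointwise sum rather than a limit in \<open>L2\<close>: the values
  \<open>f (uz t x)\<close> and the uniform bound on \<open>uz\<close> refer to individual
  points.\<close>

definition uz :: "real \<Rightarrow> real \<Rightarrow> real" where "uz t x = (\<Sum>k. z t k * sn k x)"
definition Fz :: "real \<Rightarrow> nat \<Rightarrow> real" where "Fz t k = lam * (LINT x|lebesgue_on \<Omega>. f (uz t x) * sn k x)"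
definition Dz :: "real \<Rightarrow> nat \<Rightarrow> real" where "Dz t k = - (om k)\<^sup>2 * a (Vz t) * z t k + Fz t k + hh t k"

lemma r_ge: "n \<le> r n" using seq_suble[OF r] .

lemma V_tail_r:
  assumes "t \<ge> 0" "\<epsilon> > 0"
  shows "\<exists>K N. \<forall>n\<ge>N. (\<Sum>k\<in>{K..<r n}. (om k)\<^sup>2 * (c (r n) t k)\<^sup>2) \<le> \<epsilon>"
proof -
  obtain K N where "\<forall>n\<ge>N. \<forall>s\<in>{0..t+1}. (\<Sum>k\<in>{K..<n}. (om k)\<^sup>2 * (c n s k)\<^sup>2) \<le> \<epsilon>"
    using V_tail[of "t + 1" \<epsilon>] assms by auto
  moreover have "t \<in> {0..t+1}" "\<And>n. n \<ge> N \<Longrightarrow> r n \<ge> N" using assms(1) r_ge order_trans by auto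
  ultimately have "\<forall>n\<ge>N. (\<Sum>k\<in>{K..<r n}. (om k)\<^sup>2 * (c (r n) t k)\<^sup>2) \<le> \<epsilon>" by blast
  then show ?thesis by blast
qed

lemma V_tendsto:
  assumes t: "t \<ge> 0"
  shows "summable (\<lambda>k. (om k)\<^sup>2 * (z t k)\<^sup>2)" "(\<lambda>n. V (r n) (c (r n) t)) \<longlonglongrightarrow> Vz t"
proof -
  have 1: "(\<lambda>n. (om k)\<^sup>2 * (c (r n) t k)\<^sup>2) \<longlonglongrightarrow> (om k)\<^sup>2 * (z t k)\<^sup>2" for k by (intro tendsto_intros z t)
  have 2: "(om k)\<^sup>2 * (c (r n) t k)\<^sup>2 = 0" if "r n \<le> k" for n k using c_high[OF that] by simp
  have 3: "\<exists>K N. \<forall>n\<ge>N. (\<Sum>k\<in>{K..<r n}. \<bar>(om k)\<^sup>2 * (c (r n) t k)\<^sup>2\<bar>) \<le> \<epsilon>" if "\<epsilon> > 0" for \<epsilon>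
    using V_tail_r[OF t that] by simp
  note s = series_tendsto_tail[OF 1 2 3]
  from s(1) show "summable (\<lambda>k. (om k)\<^sup>2 * (z t k)\<^sup>2)" by simp
  from s(2) show "(\<lambda>n. V (r n) (c (r n) t)) \<longlonglongrightarrow> Vz t" by (simp add: V_def Vz_def)
qed

lemma partial_tendsto:
  assumes t: "t \<ge> 0"
  shows "summable (\<lambda>k. \<bar>z t k * sn k x\<bar>)" "(\<lambda>n. sine.partial (c (r n) t) (r n) x) \<longlonglongrightarrow> uz t x"
proof -
  have 1: "(\<lambda>n. c (r n) t k * sn k x) \<longlonglongrightarrow> z t k * sn k x" for k by (intro tendsto_intros z t)
  have 2: "c (r n) t k * sn k x = 0" if "r n \<le> k" for n k using c_high[OF that] by simp
  have 3: "\<exists>K N. \<forall>n\<ge>N. (\<Sum>k\<in>{K..<r n}. \<bar>c (r n) t k * sn k x\<bar>) \<le> \<epsilon>" if "\<epsilon> > 0" for \<epsilon>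
  proof -
    obtain K N where KN: "\<And>n. n \<ge> N \<Longrightarrow> (\<Sum>k\<in>{K..<r n}. (om k)\<^sup>2 * (c (r n) t k)\<^sup>2) \<le> \<epsilon>\<^sup>2"
      using V_tail_r[OF t, of "\<epsilon>\<^sup>2"] \<open>\<epsilon> > 0\<close> by auto
    have "(\<Sum>k\<in>{K..<r n}. \<bar>c (r n) t k * sn k x\<bar>) \<le> \<epsilon>" if "n \<ge> N" for n
    proof (rule power2_le_imp_le)
      have "(\<Sum>k\<in>{K..<r n}. 1 / (om k)\<^sup>2) \<le> (\<Sum>k<r n. 1 / (om k)\<^sup>2)" by (rule sum_mono2) auto
      then have "(\<Sum>k\<in>{K..<r n}. 1 / (om k)\<^sup>2) \<le> 1 / 2" using sum_inverse_om_sq[of "r n"] by linarith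
      from sum_abs_le_sqrt[OF _ this, of "c (r n) t" x] KN[OF that]
      show "(\<Sum>k\<in>{K..<r n}. \<bar>c (r n) t k * sn k x\<bar>)\<^sup>2 \<le> \<epsilon>\<^sup>2" by simp
    qed (use \<open>\<epsilon> > 0\<close> in simp)
    then show ?thesis by blast
  qed
  note s = series_tendsto_tail[OF 1 2 3]
  from s(1) show "summable (\<lambda>k. \<bar>z t k * sn k x\<bar>)" .
  from s(2) show "(\<lambda>n. sine.partial (c (r n) t) (r n) x) \<longlonglongrightarrow> uz t x" by (simp add: sine.partial_def uz_def)
qed

lemma eventually_r: "\<forall>\<^sub>F n in sequentially. T \<le> real (r n) + 1 \<and> k < r n"
proof (rule eventually_sequentiallyI[of "nat \<lceil>T\<rceil> + Suc k"])
  fix n assume "nat \<lceil>T\<rceil> + Suc k \<le> n"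
  with r_ge[of n] show "T \<le> real (r n) + 1 \<and> k < r n" by linarith
qed

lemma r_large:
  obtains J where "\<And>n. n \<ge> J \<Longrightarrow> T \<le> real (r n) + 1 \<and> k < r n"
  using eventually_r[of T k] unfolding eventually_sequentially by blast

lemma Vz_bound:
  assumes T: "T > 0"
  obtains C where "\<And>t. t \<in> {0..T} \<Longrightarrow> Vz t \<le> C" "\<And>t x. t \<in> {0..T} \<Longrightarrow> (uz t x)\<^sup>2 \<le> C" "C \<ge> 0"
proof -
  obtain C where C: "\<And>n t. T \<le> real n + 1 \<Longrightarrow> t \<in> {0..T} \<Longrightarrow> V n (c n t) \<le> C" "C \<ge> 0" by (rule V_bound[OF T]) (rule that)
  show thesis
  proof (rule that[OF _ _ C(2)])
    fix t assume t: "t \<in> {0..T}"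
    have ev: "\<forall>\<^sub>F n in sequentially. V (r n) (c (r n) t) \<le> C"
      using eventually_r[of T 0] by eventually_elim (rule C(1)[OF _ t], simp)
    show "Vz t \<le> C" by (rule tendsto_upperbound[OF V_tendsto(2) ev]) (use t in auto)
    fix x
    have evu: "\<forall>\<^sub>F n in sequentially. (sine.partial (c (r n) t) (r n) x)\<^sup>2 \<le> C"
      using ev by eventually_elim (rule order_trans[OF partial_sq_le_V])
    have "(\<lambda>n. (sine.partial (c (r n) t) (r n) x)\<^sup>2) \<longlonglongrightarrow> (uz t x)\<^sup>2"
      using t by (intro tendsto_intros partial_tendsto) auto
    then show "(uz t x)\<^sup>2 \<le> C" by (rule tendsto_upperbound[OF _ evu]) simp
  qed
qed

lemma Vz_nonneg: "t \<ge> 0 \<Longrightarrow> 0 \<le> Vz t"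
  unfolding Vz_def by (rule suminf_nonneg[OF V_tendsto(1)]) auto

lemma uz_L2:
  assumes t: "t \<ge> 0" shows "uz t \<in> L2" "sine.cf (uz t) k = z t k"
proof -
  let ?M = "lebesgue_on \<Omega>"
  have T: "t + 1 > 0" using t by simp
  obtain C where C: "\<And>s. s \<in> {0..t+1} \<Longrightarrow> Vz s \<le> C" "\<And>s x. s \<in> {0..t+1} \<Longrightarrow> (uz s x)\<^sup>2 \<le> C" "C \<ge> 0"
    by (rule Vz_bound[OF T]) (rule that)
  have ub: "\<bar>uz t x\<bar> \<le> sqrt C" for x using C(2)[of t x] t by (simp add: real_le_rsqrt)
  have pl: "(\<lambda>N. sine.partial (z t) N x) \<longlonglongrightarrow> uz t x" for x
    unfolding sine.partial_def uz_def by (rule summable_LIMSEQ[OF summable_rabs_cancel[OF partial_tendsto(1)[OF t]]])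
  have pm: "sine.partial (z t) N \<in> borel_measurable ?M" for N by (rule sqintD(1)[OF sine.partial_sqint])
  have um: "uz t \<in> borel_measurable ?M" by (rule borel_measurable_LIMSEQ_real[OF pl pm])
  have us: "sqint ?M (uz t)" by (rule sqint_bounded[OF finite_measure_interval um, of "sqrt C"]) (use ub in auto)
  then show "uz t \<in> L2" by (simp add: L2_iff_sqint)
  have pb: "\<bar>sine.partial (z t) N x\<bar> \<le> sqrt C" for N x
  proof -
    have "V N (z t) \<le> Vz t" unfolding V_def Vz_def by (rule sum_le_suminf[OF V_tendsto(1)[OF t]]) auto
    then have "(sine.partial (z t) N x)\<^sup>2 \<le> C" using partial_sq_le_V[of "z t" N x] C(1)[of t] t by simp
    then show ?thesis by (simp add: real_le_rsqrt)
  qed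
  have "(\<lambda>N. LINT x|?M. (sine.partial (z t) N x - uz t x)\<^sup>2) \<longlonglongrightarrow> (LINT x|?M. 0)"
  proof (rule integral_dominated_convergence[where w="\<lambda>x. (2 * sqrt C)\<^sup>2"])
    show "integrable ?M (\<lambda>x. (2 * sqrt C)\<^sup>2)" using finite_measure_interval finite_measure.integrable_const by blast
    show "AE x in ?M. (\<lambda>N. (sine.partial (z t) N x - uz t x)\<^sup>2) \<longlonglongrightarrow> 0"
    proof (rule AE_I2)
      fix x
      have "(\<lambda>N. (sine.partial (z t) N x - uz t x)\<^sup>2) \<longlonglongrightarrow> (uz t x - uz t x)\<^sup>2" by (intro tendsto_intros pl)
      then show "(\<lambda>N. (sine.partial (z t) N x - uz t x)\<^sup>2) \<longlonglongrightarrow> 0" by simp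
    qed
    show "AE x in ?M. norm ((sine.partial (z t) N x - uz t x)\<^sup>2) \<le> (2 * sqrt C)\<^sup>2" for N
    proof (rule AE_I2)
      fix x
      have "\<bar>sine.partial (z t) N x - uz t x\<bar> \<le> \<bar>2 * sqrt C\<bar>" using pb[of N x] ub[of x] by linarith
      then show "norm ((sine.partial (z t) N x - uz t x)\<^sup>2) \<le> (2 * sqrt C)\<^sup>2" by (simp only: abs_le_square_iff real_norm_def abs_power2)
    qed
  qed (use pm um in auto)
  then have "(\<lambda>N. LINT x|?M. (sine.partial (z t) N x - uz t x)\<^sup>2) \<longlonglongrightarrow> 0" by simp
  from sine.cf_limit(1)[OF us this] show "sine.cf (uz t) k = z t k" by simp
qed

lemma F_tendsto:
  assumes t: "t \<ge> 0" shows "(\<lambda>n. F (r n) (c (r n) t) k) \<longlonglongrightarrow> Fz t k"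
proof -
  have T: "t + 1 > 0" using t by simp
  obtain C where C: "\<And>n s. t + 1 \<le> real n + 1 \<Longrightarrow> s \<in> {0..t+1} \<Longrightarrow> V n (c n s) \<le> C" "C \<ge> 0" by (rule V_bound[OF T]) (rule that)
  \<comment> \<open>The bound \<open>C\<close> holds only once the horizon has passed
    \<open>t + 1\<close>, so the first \<open>J\<close> members are skipped before dominated
    convergence is applied.\<close>
  obtain J where J': "\<And>n. n \<ge> J \<Longrightarrow> t + 1 \<le> real (r n) + 1 \<and> 0 < r n" by (rule r_large[of "t + 1" 0]) (rule that)
  then have J: "\<And>n. n \<ge> J \<Longrightarrow> t + 1 \<le> real (r n) + 1" by blast
  have "(\<lambda>n. LINT x|lebesgue_on \<Omega>. f (sine.partial (c (r (n + J)) t) (r (n + J)) x) * sn k x) \<longlonglongrightarrow> (LINT x|lebesgue_on \<Omega>. f (uz t x) * sn k x)"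
  proof (rule nemytskii_tendsto)
    show "sine.partial (c (r (n + J)) t) (r (n + J)) \<in> borel_measurable (lebesgue_on \<Omega>)" for n
      by (rule sqintD(1)[OF sine.partial_sqint])
    show "(sine.partial (c (r (n + J)) t) (r (n + J)) x)\<^sup>2 \<le> C" for n x
      by (rule order_trans[OF partial_sq_le_V C(1)[OF J]]) (use t in auto)
    show "(\<lambda>n. sine.partial (c (r (n + J)) t) (r (n + J)) x) \<longlonglongrightarrow> uz t x" for x
      using LIMSEQ_ignore_initial_segment[OF partial_tendsto(2)[OF t], of J] .
  qed
  then have "(\<lambda>n. F (r (n + J)) (c (r (n + J)) t) k) \<longlonglongrightarrow> Fz t k"
    unfolding F_def Fz_def by (rule tendsto_mult_left)
  then show ?thesis by (rule LIMSEQ_offset)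
qed

lemma Fz_bound:
  assumes T: "T > 0"
  obtains B where "\<And>t N. t \<in> {0..T} \<Longrightarrow> (\<Sum>k<N. (Fz t k)\<^sup>2) \<le> B"
proof -
  obtain B where B: "\<And>n t N. T \<le> real n + 1 \<Longrightarrow> t \<in> {0..T} \<Longrightarrow> (\<Sum>k<N. (F n (c n t) k)\<^sup>2) \<le> B\<^sup>2"
    "\<And>n t k. T \<le> real n + 1 \<Longrightarrow> t \<in> {0..T} \<Longrightarrow> \<bar>F n (c n t) k\<bar> \<le> B" "B \<ge> 0" by (rule F_bounds[OF T]) (rule that)
  have "(\<Sum>k<N. (Fz t k)\<^sup>2) \<le> B\<^sup>2" if t: "t \<in> {0..T}" for t N
  proof (rule tendsto_upperbound)
    show "(\<lambda>n. \<Sum>k<N. (F (r n) (c (r n) t) k)\<^sup>2) \<longlonglongrightarrow> (\<Sum>k<N. (Fz t k)\<^sup>2)"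
      using t by (intro tendsto_intros F_tendsto) auto
    show "\<forall>\<^sub>F n in sequentially. (\<Sum>k<N. (F (r n) (c (r n) t) k)\<^sup>2) \<le> B\<^sup>2"
      using eventually_r[of T 0] by eventually_elim (rule B(1)[OF _ t], simp)
  qed simp
  then show thesis by (rule that)
qed

text \<open>Measurability in time comes from pointwise limits of continuous functions. The
  hypothesis on \<open>w n\<close> is conditional because early approximations may not reach up to
  \<open>T\<close> or may not contain mode \<open>k\<close>.\<close>

lemma measurable_limit:
  fixes w :: "nat \<Rightarrow> real \<Rightarrow> real"
  assumes "\<And>n. T \<le> real (r n) + 1 \<Longrightarrow> k < r n \<Longrightarrow> continuous_on {0..T} (w n)"
    and lim: "\<And>t. t \<ge> 0 \<Longrightarrow> (\<lambda>n. w n t) \<longlonglongrightarrow> v t"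
  shows "v \<in> borel_measurable (time_interval T)"
proof -
  obtain J where J: "\<And>n. n \<ge> J \<Longrightarrow> T \<le> real (r n) + 1 \<and> k < r n" by (rule r_large[of T k]) (rule that)
  show ?thesis
  proof (rule borel_measurable_LIMSEQ_real)
    show "(\<lambda>n. w (n + J) t) \<longlonglongrightarrow> v t" if "t \<in> space (time_interval T)" for t
      using that by (intro LIMSEQ_ignore_initial_segment lim) simp
    show "w (n + J) \<in> borel_measurable (time_interval T)" for n
      by (rule continuous_imp_measurable_interval, rule continuous_on_subset[OF assms(1)]) (use J[of "n + J"] in auto)
  qed
qed

lemma z_measurable: "(\<lambda>t. z t k) \<in> borel_measurable (time_interval T)"
  by (rule measurable_limit[OF c_cont[OF gal_T] z])

lemma aVz_measurable: "(\<lambda>t. a (Vz t)) \<in> borel_measurable (time_interval T)"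
proof (rule measurable_limit[OF aV_cont[OF gal_T]])
  show "(\<lambda>n. a (V (r n) (c (r n) t))) \<longlonglongrightarrow> a (Vz t)" if "t \<ge> 0" for t
    by (rule continuous_on_tendsto_compose[OF a_cont V_tendsto(2)[OF that]])
      (simp_all add: Vz_nonneg that V_nonneg)
qed

lemma Vz_measurable: "Vz \<in> borel_measurable (time_interval T)"
  by (rule measurable_limit[OF V_cont[OF gal_T] V_tendsto(2)])

lemma Fz_measurable: "(\<lambda>t. Fz t k) \<in> borel_measurable (time_interval T)"
  by (rule measurable_limit[OF F_cont[OF gal_T] F_tendsto])

lemma hh_measurable: "(\<lambda>t. hh t k) \<in> borel_measurable (time_interval T)"
proof (cases "T > 0")
  case False
  then have "space (time_interval T) = {}" by simp
  then show ?thesis by (auto simp: measurable_def)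
qed (use hh in \<open>auto simp: sqint_def\<close>)

lemma z_0: "z 0 k = p k"
proof -
  have "(\<lambda>n. c (r n) 0 k) \<longlonglongrightarrow> p k"
    by (rule tendsto_eventually) (use eventually_r[of 0 k] in \<open>eventually_elim, simp add: c0\<close>)
  then show ?thesis using z[of 0 k] LIMSEQ_unique by auto
qed

lemma reaction_diffusion_limit:
  assumes T: "T > 0"
  shows "integrable (time_interval T) (\<lambda>s. - (om k)\<^sup>2 * a (Vz s) * z s k + Fz s k)"
    "(\<lambda>n. LINT s|time_interval T. - (om k)\<^sup>2 * a (V (r n) (c (r n) s)) * c (r n) s k + F (r n) (c (r n) s) k)
      \<longlonglongrightarrow> (LINT s|time_interval T. - (om k)\<^sup>2 * a (Vz s) * z s k + Fz s k)"
proof -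
  let ?M = "time_interval T"
  let ?w = "\<lambda>n s. - (om k)\<^sup>2 * a (V n (c n s)) * c n s k + F n (c n s) k"
  obtain L where L: "\<And>n t. T \<le> real n + 1 \<Longrightarrow> t \<in> {0..T} \<Longrightarrow> \<bar>?w n t\<bar> \<le> L" "L \<ge> 0"
    by (rule reaction_diffusion_bound[OF T, of k]) (rule that)
  obtain J where J: "\<And>n. n \<ge> J \<Longrightarrow> T \<le> real (r n) + 1 \<and> k < r n" by (rule r_large[of T k]) (rule that)
  have lim: "(\<lambda>n. ?w (r n) s) \<longlonglongrightarrow> - (om k)\<^sup>2 * a (Vz s) * z s k + Fz s k" if "s \<ge> 0" for s
  proof (intro tendsto_intros z F_tendsto that)
    show "(\<lambda>n. a (V (r n) (c (r n) s))) \<longlonglongrightarrow> a (Vz s)"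
      by (rule continuous_on_tendsto_compose[OF a_cont V_tendsto(2)[OF that]]) (simp_all add: Vz_nonneg that V_nonneg)
  qed
  have wm: "?w (r (n + J)) \<in> borel_measurable ?M" for n
  proof (rule continuous_imp_measurable_interval, rule continuous_on_subset)
    have "T \<le> real (r (n + J)) + 1" "k < r (n + J)" using J[of "n + J"] by auto
    then show "continuous_on {0..T} (?w (r (n + J)))"
      by (intro continuous_intros aV_cont[OF gal_T] c_cont[OF gal_T] F_cont[OF gal_T])
  qed auto
  note D = integral_dominated_convergence[where M="?M" and s="\<lambda>n. ?w (r (n + J))" and w="\<lambda>_. L"
      and f="\<lambda>s. - (om k)\<^sup>2 * a (Vz s) * z s k + Fz s k"]
  have fm: "(\<lambda>s. - (om k)\<^sup>2 * a (Vz s) * z s k + Fz s k) \<in> borel_measurable ?M"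
    using z_measurable aVz_measurable Fz_measurable by measurable
  have Li: "integrable ?M (\<lambda>_. L)" using finite_measure_interval finite_measure.integrable_const by blast
  have AEl: "AE s in ?M. (\<lambda>n. ?w (r (n + J)) s) \<longlonglongrightarrow> - (om k)\<^sup>2 * a (Vz s) * z s k + Fz s k"
    by (rule AE_I2) (rule LIMSEQ_ignore_initial_segment[OF lim], simp)
  have AEb: "AE s in ?M. norm (?w (r (n + J)) s) \<le> L" for n
    unfolding real_norm_def by (rule AE_I2) (rule L(1), use J[of "n + J"] in auto)
  show "integrable ?M (\<lambda>s. - (om k)\<^sup>2 * a (Vz s) * z s k + Fz s k)"
    by (rule integrable_dominated_convergence[OF fm wm Li AEl AEb])
  show "(\<lambda>n. LINT s|?M. ?w (r n) s) \<longlonglongrightarrow> (LINT s|?M. - (om k)\<^sup>2 * a (Vz s) * z s k + Fz s k)"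
    by (rule LIMSEQ_offset[of _ J]) (rule integral_dominated_convergence[OF fm wm Li AEl AEb])
qed

lemma source_limit:
  assumes T: "T > 0"
  shows "(\<lambda>n. LINT s|time_interval T. g (r n) s k) \<longlonglongrightarrow> (LINT s|time_interval T. hh s k)"
proof -
  let ?M = "time_interval T"
  have one: "sqint ?M (\<lambda>x. 1)" by (rule sqint_bounded[OF finite_measure_interval, of _ _ _ 1]) auto
  have "(\<lambda>n. LINT s|?M. (g (r n) s k - hh s k)\<^sup>2) \<longlonglongrightarrow> 0"
  proof (rule Lim_null_comparison)
    show "\<forall>\<^sub>F n in sequentially. norm (LINT s|?M. (g (r n) s k - hh s k)\<^sup>2) \<le> inverse (real (Suc n))"
      using eventually_r[of T k]
    proof eventually_elim
      case (elim n)
      have "(LINT s|?M. (g (r n) s k - hh s k)\<^sup>2) = (LINT s|?M. (hh s k - g (r n) s k)\<^sup>2)" by (simp only: power2_commute)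
      also have "\<dots> \<le> 1 / (real (r n) + 1)\<^sup>2" by (rule g_close_T[OF T]) (use elim in simp)
      also have "\<dots> \<le> 1 / (real (Suc n))"
      proof (rule divide_left_mono)
        have "real (Suc n) * 1 \<le> (real (r n) + 1) * (real (r n) + 1)" using r_ge[of n] by (intro mult_mono) auto
        then show "real (Suc n) \<le> (real (r n) + 1)\<^sup>2" by (simp add: power2_eq_square)
      qed auto
      finally show ?case by (simp add: inverse_eq_divide)
    qed
    show "(\<lambda>n. inverse (real (Suc n))) \<longlonglongrightarrow> 0" by (rule LIMSEQ_inverse_real_of_nat)
  qed
  from integral_mult_tendsto[OF g_sqint hh[OF T] one this] show ?thesis by simp
qed

text \<open>Reaction and diffusion converge under a constant majorant, whereas the source is
  unbounded in time and converges in the square mean; hence the two parts of the integral are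
  treated separately.\<close>

lemma z_equation:
  assumes T: "T > 0"
  shows "integrable (time_interval T) (\<lambda>s. Dz s k)" "z T k = p k + (LINT s|time_interval T. Dz s k)"
proof -
  let ?M = "time_interval T"
  let ?w = "\<lambda>n s. - (om k)\<^sup>2 * a (V n (c n s)) * c n s k + F n (c n s) k"
  note rd = reaction_diffusion_limit[OF T, of k]
  have hi: "integrable ?M (\<lambda>s. hh s k)" by (rule sqint_integrable[OF finite_measure_interval hh[OF T]])
  show "integrable ?M (\<lambda>s. Dz s k)" unfolding Dz_def by (rule Bochner_Integration.integrable_add[OF rd(1) hi])
  have D: "(LINT s|?M. Dz s k) = (LINT s|?M. - (om k)\<^sup>2 * a (Vz s) * z s k + Fz s k) + (LINT s|?M. hh s k)"
    unfolding Dz_def by (rule Bochner_Integration.integral_add[OF rd(1) hi])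
  have "(\<lambda>n. p k + ((LINT s|?M. ?w (r n) s) + (LINT s|?M. g (r n) s k))) \<longlonglongrightarrow> p k + (LINT s|?M. Dz s k)"
    unfolding D by (intro tendsto_intros rd(2) source_limit[OF T])
  then have "(\<lambda>n. c (r n) T k) \<longlonglongrightarrow> p k + (LINT s|?M. Dz s k)"
  proof (rule Lim_transform_eventually)
    show "\<forall>\<^sub>F n in sequentially. p k + ((LINT s|?M. ?w (r n) s) + (LINT s|?M. g (r n) s k)) = c (r n) T k"
      using eventually_r[of T k]
    proof eventually_elim
      case (elim n)
      then have kn: "k < r n" and gT: "galerkin (r n) (g (r n)) T (c (r n))" by (auto intro: gal_T)
      have wc: "continuous_on {0..T} (?w (r n))" by (intro continuous_intros aV_cont[OF gT] c_cont[OF gT] F_cont[OF gT] kn)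
      have wi: "integrable ?M (?w (r n))" by (rule sqint_integrable[OF finite_measure_interval sqint_continuous[OF wc]])
      have gi: "integrable ?M (\<lambda>s. g (r n) s k)" by (rule sqint_integrable[OF finite_measure_interval g_sqint])
      have "(LINT s|?M. rhs (r n) (g (r n)) s (c (r n) s) k) = c (r n) T k - c (r n) 0 k"
        by (rule LINT_FTC[OF less_imp_le[OF T] c_deriv[OF gT _ kn] rhs_cont[OF gT kn]])
      moreover have "(LINT s|?M. rhs (r n) (g (r n)) s (c (r n) s) k) = (LINT s|?M. ?w (r n) s) + (LINT s|?M. g (r n) s k)"
        unfolding rhs_def by (rule Bochner_Integration.integral_add[OF wi gi])
      ultimately show ?case using c0[OF kn] by simp
    qed
  qed
  moreover have "(\<lambda>n. c (r n) T k) \<longlonglongrightarrow> z T k" by (rule z) (use T in simp)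
  ultimately show "z T k = p k + (LINT s|?M. Dz s k)" using LIMSEQ_unique by blast
qed

text \<open>Fatou is applied to the first \<open>N\<close> modes only, which every late
  approximation contains. The resulting bound \<open>Q\<close> does not depend on \<open>N\<close>,
  so the full series is integrable.\<close>

lemma H2_regularity:
  assumes T: "T > 0"
  shows "AE t in time_interval T. summable (\<lambda>k. (om k)^4 * (z t k)\<^sup>2)"
    "integrable (time_interval T) (\<lambda>t. \<Sum>k. (om k)^4 * (z t k)\<^sup>2)"
proof -
  let ?M = "time_interval T"
  let ?w = "\<lambda>k t. (om k)^4 * (z t k)\<^sup>2"
  obtain Q where Q: "\<And>n. T \<le> real n + 1 \<Longrightarrow> (\<Sum>k<n. integral {0..T} (\<lambda>s. (om k)^4 * (c n s k)\<^sup>2)) \<le> Q" by (rule H2_bound[OF T]) (rule that)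
  have key: "integrable ?M (\<lambda>t. \<Sum>k<N. ?w k t)" "(LINT t|?M. (\<Sum>k<N. ?w k t)) \<le> Q" for N
  proof -
    obtain J where J: "\<And>n. n \<ge> J \<Longrightarrow> T \<le> real (r n) + 1 \<and> N < r n" by (rule r_large[of T N]) (rule that)
    let ?f = "\<lambda>n t. \<Sum>k<N. (om k)^4 * (c (r (n + J)) t k)\<^sup>2"
    have cc: "continuous_on {0..T} (\<lambda>t. (om k)^4 * (c (r (n + J)) t k)\<^sup>2)" if "k < N" for n k
      using J[of "n + J"] that by (intro continuous_intros c_cont[OF gal_T]) auto
    have fi: "integrable ?M (?f n)" for n
      by (rule sqint_integrable[OF finite_measure_interval sqint_continuous]) (rule continuous_on_sum, rule cc, simp)
    have fQ: "(LINT t|?M. ?f n t) \<le> Q" for n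
    proof -
      have "(LINT t|?M. ?f n t) = (\<Sum>k<N. LINT t|?M. (om k)^4 * (c (r (n + J)) t k)\<^sup>2)"
        by (rule Bochner_Integration.integral_sum)
          (rule sqint_integrable[OF finite_measure_interval sqint_continuous[OF cc]], simp)
      also have "\<dots> = (\<Sum>k<N. integral {0..T} (\<lambda>t. (om k)^4 * (c (r (n + J)) t k)\<^sup>2))"
        by (rule sum.cong[OF refl], rule LINT_interval_eq[OF cc]) simp
      also have "\<dots> \<le> (\<Sum>k<r (n + J). integral {0..T} (\<lambda>t. (om k)^4 * (c (r (n + J)) t k)\<^sup>2))"
      proof (rule sum_mono2)
        fix k assume k: "k \<in> {..<r (n + J)} - {..<N}"
        have "continuous_on {0..T} (\<lambda>t. (om k)^4 * (c (r (n + J)) t k)\<^sup>2)"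
          using J[of "n + J"] k by (intro continuous_intros c_cont[OF gal_T]) auto
        then show "0 \<le> integral {0..T} (\<lambda>t. (om k)^4 * (c (r (n + J)) t k)\<^sup>2)"
          by (intro Henstock_Kurzweil_Integration.integral_nonneg integrable_continuous_real) auto
      qed (use J[of "n + J"] in auto)
      also have "\<dots> \<le> Q" by (rule Q) (use J[of "n + J"] in simp)
      finally show ?thesis .
    qed
    have f0: "AE t in ?M. 0 \<le> ?f n t" for n by (rule AE_I2) (simp add: sum_nonneg)
    have lim: "AE t in ?M. (\<lambda>n. ?f n t) \<longlonglongrightarrow> (\<Sum>k<N. ?w k t)"
    proof (rule AE_I2)
      fix t assume "t \<in> space ?M"
      then have "(\<lambda>n. \<Sum>k<N. (om k)^4 * (c (r n) t k)\<^sup>2) \<longlonglongrightarrow> (\<Sum>k<N. ?w k t)" by (intro tendsto_intros z) simp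
      then show "(\<lambda>n. ?f n t) \<longlonglongrightarrow> (\<Sum>k<N. ?w k t)" by (rule LIMSEQ_ignore_initial_segment)
    qed
    have wm: "(\<lambda>t. \<Sum>k<N. ?w k t) \<in> borel_measurable ?M" using z_measurable by measurable
    have ev: "\<forall>\<^sub>F n in sequentially. (LINT t|?M. ?f n t) \<le> Q" by (rule always_eventually) (use fQ in blast)
    show "integrable ?M (\<lambda>t. \<Sum>k<N. ?w k t)" by (rule Fatou_bound(1)[OF fi f0 wm lim ev])
    show "(LINT t|?M. (\<Sum>k<N. ?w k t)) \<le> Q" by (rule Fatou_bound(2)[OF fi f0 wm lim ev])
  qed
  have wi: "integrable ?M (?w k)" for k
  proof (rule Bochner_Integration.integrable_bound[OF key(1)[of "Suc k"]])
    show "?w k \<in> borel_measurable ?M" using z_measurable by measurable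
    show "AE t in ?M. norm (?w k t) \<le> norm (\<Sum>k<Suc k. ?w k t)"
    proof (rule AE_I2)
      fix t
      have "?w k t \<le> (\<Sum>i<Suc k. ?w i t)" by (rule member_le_sum) auto
      then show "norm (?w k t) \<le> norm (\<Sum>k<Suc k. ?w k t)" by (simp add: sum_nonneg)
    qed
  qed
  have s: "summable (\<lambda>k. LINT t|?M. \<bar>?w k t\<bar>)"
  proof (rule bounded_imp_summable)
    show "(\<Sum>k\<le>n. LINT t|?M. \<bar>?w k t\<bar>) \<le> Q" for n
    proof -
      have "(\<Sum>k\<le>n. LINT t|?M. \<bar>?w k t\<bar>) = (LINT t|?M. (\<Sum>k<Suc n. ?w k t))"
        using wi by (simp add: lessThan_Suc_atMost)
      then show ?thesis using key(2)[of "Suc n"] by simp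
    qed
  qed simp
  have AEs: "AE t in ?M. summable (\<lambda>k. norm (?w k t))"
    using AE_summable_of_integrals[OF wi s] by simp
  then show "AE t in ?M. summable (\<lambda>k. ?w k t)" by eventually_elim simp
  show "integrable ?M (\<lambda>t. \<Sum>k. ?w k t)"
    by (rule integrable_suminf[OF wi AEs]) (use s in simp)
qed

lemma hh_AE_summable:
  assumes T: "T > 0"
  shows "AE t in time_interval T. summable (\<lambda>k. (hh t k)\<^sup>2)" "integrable (time_interval T) (\<lambda>t. \<Sum>k. (hh t k)\<^sup>2)"
proof -
  have i: "integrable (time_interval T) (\<lambda>t. (hh t k)\<^sup>2)" for k by (rule sqintD(2)[OF hh[OF T]])
  have s: "summable (\<lambda>k. LINT t|time_interval T. \<bar>(hh t k)\<^sup>2\<bar>)" using hh_sum[OF T] by simp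
  have AEs: "AE t in time_interval T. summable (\<lambda>k. norm ((hh t k)\<^sup>2))" using AE_summable_of_integrals[OF i s] by simp
  then show "AE t in time_interval T. summable (\<lambda>k. (hh t k)\<^sup>2)" by eventually_elim simp
  show "integrable (time_interval T) (\<lambda>t. \<Sum>k. (hh t k)\<^sup>2)" by (rule integrable_suminf[OF i AEs]) (use s in simp)
qed

lemma Dz_measurable: "(\<lambda>t. Dz t k) \<in> borel_measurable (time_interval T)"
  unfolding Dz_def using z_measurable aVz_measurable Fz_measurable hh_measurable by measurable

text \<open>The \<open>Hk 2\<close> bound becomes a bound on the time derivative:
  \<open>a (Vz t)\<close> is bounded on [0,T], so the diffusion term is controlled by the weights
  \<open>(om k)^4\<close>; reaction and source are square summable already.\<close>

lemma Dz_summable: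
  assumes T: "T > 0"
  shows "AE t in time_interval T. summable (\<lambda>k. (Dz t k)\<^sup>2)" "integrable (time_interval T) (\<lambda>t. \<Sum>k. (Dz t k)\<^sup>2)"
proof -
  let ?M = "time_interval T"
  obtain C where C: "\<And>t. t \<in> {0..T} \<Longrightarrow> Vz t \<le> C" "\<And>t x. t \<in> {0..T} \<Longrightarrow> (uz t x)\<^sup>2 \<le> C" "C \<ge> 0"
    by (rule Vz_bound[OF T]) (rule that)
  have "continuous_on {0..C} a" by (rule continuous_on_subset[OF a_cont]) auto
  then obtain A where A: "\<And>x. x \<in> {0..C} \<Longrightarrow> \<bar>a x\<bar> \<le> A" "A \<ge> 0" by (rule continuous_bounded_01) (rule that)
  obtain B where B: "\<And>t N. t \<in> {0..T} \<Longrightarrow> (\<Sum>k<N. (Fz t k)\<^sup>2) \<le> B" by (rule Fz_bound[OF T]) (rule that)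
  let ?S = "\<lambda>t k. 3 * (A\<^sup>2 * ((om k)^4 * (z t k)\<^sup>2) + (Fz t k)\<^sup>2 + (hh t k)\<^sup>2)"
  have le: "(Dz t k)\<^sup>2 \<le> ?S t k" if t: "t \<in> {0..T}" for t k
  proof -
    have tri: "(x + y + w)\<^sup>2 \<le> 3 * (x\<^sup>2 + y\<^sup>2 + w\<^sup>2)" for x y w :: real
    proof -
      have "0 \<le> (x - y)\<^sup>2 + (y - w)\<^sup>2 + (x - w)\<^sup>2" by simp
      then show ?thesis by (simp add: power2_eq_square algebra_simps)
    qed
    have "\<bar>a (Vz t)\<bar>\<^sup>2 \<le> A\<^sup>2" by (rule power_mono[OF A(1)]) (use C(1)[OF t] Vz_nonneg t in auto)
    then have "(a (Vz t))\<^sup>2 * ((om k)^4 * (z t k)\<^sup>2) \<le> A\<^sup>2 * ((om k)^4 * (z t k)\<^sup>2)" by (intro mult_right_mono) auto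
    moreover have "(- (om k)\<^sup>2 * a (Vz t) * z t k)\<^sup>2 = (a (Vz t))\<^sup>2 * ((om k)^4 * (z t k)\<^sup>2)"
      by (simp add: power_mult_distrib mult_ac flip: power_mult)
    ultimately have le1: "(- (om k)\<^sup>2 * a (Vz t) * z t k)\<^sup>2 \<le> A\<^sup>2 * ((om k)^4 * (z t k)\<^sup>2)" by (simp only:)
    have "3 * ((- (om k)\<^sup>2 * a (Vz t) * z t k)\<^sup>2 + (Fz t k)\<^sup>2 + (hh t k)\<^sup>2) \<le> ?S t k"
      by (rule mult_left_mono[OF add_right_mono[OF add_right_mono[OF le1]]]) simp
    then show ?thesis unfolding Dz_def by (rule order_trans[OF tri])
  qed
  have AE: "AE t in ?M. summable (\<lambda>k. (Dz t k)\<^sup>2) \<and> (\<Sum>k. (Dz t k)\<^sup>2) \<le>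
      3 * (A\<^sup>2 * (\<Sum>k. (om k)^4 * (z t k)\<^sup>2) + B + (\<Sum>k. (hh t k)\<^sup>2))"
    using H2_regularity(1)[OF T] hh_AE_summable(1)[OF T] AE_space
  proof eventually_elim
    case (elim t)
    then have t: "t \<in> {0..T}" by simp
    have sF: "summable (\<lambda>k. (Fz t k)\<^sup>2)"
      by (rule bounded_imp_summable[where B=B]) (use B[OF t] in \<open>simp_all only: lessThan_Suc_atMost[symmetric] zero_le_power2\<close>)
    have FB: "(\<Sum>k. (Fz t k)\<^sup>2) \<le> B" by (rule suminf_le_const[OF sF B[OF t]])
    note s1 = summable_mult[OF elim(1), of "A\<^sup>2"]
    note s12 = summable_add[OF s1 sF]
    note sS = summable_mult[OF summable_add[OF s12 elim(2)], of 3]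
    have sD: "summable (\<lambda>k. (Dz t k)\<^sup>2)" by (rule summable_comparison_test'[OF sS, of 0]) (use le[OF t] in simp)
    have "(\<Sum>k. (Dz t k)\<^sup>2) \<le> (\<Sum>k. ?S t k)" by (rule suminf_le[OF le[OF t] sD sS])
    also have "\<dots> = 3 * (A\<^sup>2 * (\<Sum>k. (om k)^4 * (z t k)\<^sup>2) + (\<Sum>k. (Fz t k)\<^sup>2) + (\<Sum>k. (hh t k)\<^sup>2))"
      using suminf_mult[OF summable_add[OF s12 elim(2)], of 3] suminf_add[OF s12 elim(2)] suminf_add[OF s1 sF]
        suminf_mult[OF elim(1), of "A\<^sup>2"] by simp
    finally show ?case using sD FB by simp
  qed
  then show "AE t in ?M. summable (\<lambda>k. (Dz t k)\<^sup>2)" by eventually_elim simp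
  show "integrable ?M (\<lambda>t. \<Sum>k. (Dz t k)\<^sup>2)"
  proof (rule Bochner_Integration.integrable_bound)
    show "integrable ?M (\<lambda>t. 3 * (A\<^sup>2 * (\<Sum>k. (om k)^4 * (z t k)\<^sup>2) + B + (\<Sum>k. (hh t k)\<^sup>2)))"
      using H2_regularity(2)[OF T] hh_AE_summable(2)[OF T] finite_measure.integrable_const[OF finite_measure_interval]
      by (intro integrable_mult_right Bochner_Integration.integrable_add) auto
    show "(\<lambda>t. \<Sum>k. (Dz t k)\<^sup>2) \<in> borel_measurable ?M" using Dz_measurable by measurable
    show "AE t in ?M. norm (\<Sum>k. (Dz t k)\<^sup>2) \<le> norm (3 * (A\<^sup>2 * (\<Sum>k. (om k)^4 * (z t k)\<^sup>2) + B + (\<Sum>k. (hh t k)\<^sup>2)))"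
      using AE
    proof eventually_elim
      case (elim t)
      then have "0 \<le> (\<Sum>k. (Dz t k)\<^sup>2)" by (intro suminf_nonneg) auto
      then show ?case using elim by simp
    qed
  qed
qed

end

section \<open>Integration of coefficient series in time and integration by parts\<close>

lemma nonneg_series_integral:
  fixes Y :: "'a \<Rightarrow> nat \<Rightarrow> real"
  assumes Y: "\<And>k. (\<lambda>t. Y t k) \<in> borel_measurable M" "\<And>t k. 0 \<le> Y t k"
    and s: "AE t in M. summable (Y t)" and i: "integrable M (\<lambda>t. \<Sum>k. Y t k)"
  shows "integrable M (\<lambda>t. Y t k)" "(\<lambda>k. LINT t|M. Y t k) sums (LINT t|M. (\<Sum>k. Y t k))"
proof -
  have le: "AE t in M. (\<Sum>k\<in>I. Y t k) \<le> (\<Sum>k. Y t k)" if "finite I" for I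
    using s by eventually_elim (rule sum_le_suminf, simp_all add: that Y)
  have ik: "integrable M (\<lambda>t. Y t k)" for k
    by (rule Bochner_Integration.integrable_bound[OF i Y(1)]) (use le[of "{k}"] in \<open>auto simp: Y intro: order_trans[OF _ abs_ge_self]\<close>)
  then show "integrable M (\<lambda>t. Y t k)" .
  have b: "(\<Sum>k\<in>I. LINT t|M. \<bar>Y t k\<bar>) \<le> (LINT t|M. (\<Sum>k. Y t k))" if "finite I" for I
  proof -
    have "(\<Sum>k\<in>I. LINT t|M. \<bar>Y t k\<bar>) = (LINT t|M. (\<Sum>k\<in>I. Y t k))"
      using ik by (simp add: Y)
    also have "\<dots> \<le> (LINT t|M. (\<Sum>k. Y t k))"
      by (rule integral_mono_AE[OF _ i le[OF that]]) (use ik in simp)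
    finally show ?thesis .
  qed
  have "summable (\<lambda>k. LINT t|M. \<bar>Y t k\<bar>)"
    by (rule bounded_imp_summable[where B="LINT t|M. (\<Sum>k. Y t k)"]) (use b in \<open>simp_all\<close>)
  then show "(\<lambda>k. LINT t|M. Y t k) sums (LINT t|M. (\<Sum>k. Y t k))"
    by (intro sums_integral[OF ik]) (use s in \<open>simp_all add: Y\<close>)
qed

lemma square_series_components:
  fixes X :: "'a \<Rightarrow> nat \<Rightarrow> real"
  assumes X: "\<And>k. (\<lambda>t. X t k) \<in> borel_measurable M"
    and s: "AE t in M. summable (\<lambda>k. (X t k)\<^sup>2)" and i: "integrable M (\<lambda>t. \<Sum>k. (X t k)\<^sup>2)"
  shows "sqint M (\<lambda>t. X t k)" "summable (\<lambda>k. LINT t|M. (X t k)\<^sup>2)"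
proof -
  have m: "(\<lambda>t. (X t k)\<^sup>2) \<in> borel_measurable M" for k using X[of k] by measurable
  note n = nonneg_series_integral[where Y="\<lambda>t k. (X t k)\<^sup>2", OF m _ s i]
  show "sqint M (\<lambda>t. X t k)" unfolding sqint_def using X n(1) by simp
  show "summable (\<lambda>k. LINT t|M. (X t k)\<^sup>2)" using n(2) by (simp add: sums_iff)
qed

text \<open>Termwise integration of the inner product with a fixed vector:
  \<open>|x y| <= x^2 + y^2\<close> makes the integrals of the absolute values summable, the
  constants \<open>(v k)^2\<close> being integrable because the measure is finite.\<close>

lemma product_series:
  fixes X :: "'a \<Rightarrow> nat \<Rightarrow> real"
  assumes fin: "finite_measure M" and X: "\<And>k. (\<lambda>t. X t k) \<in> borel_measurable M"
    and s: "AE t in M. summable (\<lambda>k. (X t k)\<^sup>2)" and i: "integrable M (\<lambda>t. \<Sum>k. (X t k)\<^sup>2)"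
    and v: "summable (\<lambda>k. (v k)\<^sup>2)"
  shows "AE t in M. summable (\<lambda>k. X t k * v k)" "integrable M (\<lambda>t. \<Sum>k. X t k * v k)"
    "(\<lambda>k. LINT t|M. X t k * v k) sums (LINT t|M. (\<Sum>k. X t k * v k))"
proof -
  interpret finite_measure M by (rule fin)
  note c = square_series_components[OF X s i]
  have I: "integrable M (\<lambda>t. X t k * v k)" for k
    using sqint_integrable[OF fin c(1)] by simp
  have "(LINT t|M. \<bar>X t k * v k\<bar>) \<le> (LINT t|M. (X t k)\<^sup>2) + measure M (space M) * (v k)\<^sup>2" for k
  proof -
    have "\<bar>x * y\<bar> \<le> x\<^sup>2 + y\<^sup>2" for x y :: real
    proof -
      have "0 \<le> (\<bar>x\<bar> - \<bar>y\<bar>)\<^sup>2" by simp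
      then have "2 * (\<bar>x\<bar> * \<bar>y\<bar>) \<le> x\<^sup>2 + y\<^sup>2" unfolding power2_diff by simp
      moreover have "0 \<le> \<bar>x\<bar> * \<bar>y\<bar>" by simp
      ultimately show ?thesis unfolding abs_mult by linarith
    qed
    then have "(LINT t|M. \<bar>X t k * v k\<bar>) \<le> (LINT t|M. (X t k)\<^sup>2 + (v k)\<^sup>2)"
      by (intro Bochner_Integration.integral_mono integrable_abs[OF I] Bochner_Integration.integrable_add sqintD(2)[OF c(1)]) simp_all
    also have "\<dots> = (LINT t|M. (X t k)\<^sup>2) + measure M (space M) * (v k)\<^sup>2"
      using sqintD(2)[OF c(1)] by simp
    finally show ?thesis .
  qed
  then have S: "summable (\<lambda>k. LINT t|M. \<bar>X t k * v k\<bar>)"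
    by (intro summable_comparison_test'[OF summable_add[OF c(2) summable_mult[OF v, of "measure M (space M)"]], of 0]) simp
  note A = AE_summable_of_integrals[OF I S]
  show "AE t in M. summable (\<lambda>k. X t k * v k)" using A by eventually_elim (rule summable_rabs_cancel)
  have A': "AE t in M. summable (\<lambda>k. norm (X t k * v k))" using A by simp
  have S': "summable (\<lambda>k. LINT t|M. norm (X t k * v k))" using S by simp
  show "integrable M (\<lambda>t. \<Sum>k. X t k * v k)" by (rule integrable_suminf[OF I A' S'])
  show "(\<lambda>k. LINT t|M. X t k * v k) sums (LINT t|M. (\<Sum>k. X t k * v k))" by (rule sums_integral[OF I A' S'])
qed

lemma integrable_times_continuous:
  fixes g \<phi> :: "real \<Rightarrow> real"
  assumes g: "integrable (time_interval T) g" and \<phi>: "continuous_on {0..T} \<phi>"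
  shows "integrable (time_interval T) (\<lambda>t. g t * \<phi> t)"
proof -
  obtain B where B: "\<And>x. x \<in> {0..T} \<Longrightarrow> \<bar>\<phi> x\<bar> \<le> B" "B \<ge> 0" by (rule continuous_bounded_01[OF \<phi>]) (rule that)
  have m: "\<phi> \<in> borel_measurable (time_interval T)"
    by (rule continuous_imp_measurable_interval[OF continuous_on_subset[OF \<phi>]]) auto
  have "integrable (time_interval T) (\<lambda>t. B * g t)" using g by simp
  then show ?thesis
  proof (rule Bochner_Integration.integrable_bound)
    show "(\<lambda>t. g t * \<phi> t) \<in> borel_measurable (time_interval T)" using g m by measurable
    show "AE t in time_interval T. norm (g t * \<phi> t) \<le> norm (B * g t)"
    proof (rule AE_I2)
      fix t assume "t \<in> space (time_interval T)"
      then have "\<bar>\<phi> t\<bar> \<le> B" using B(1) by simp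
      then have "\<bar>g t\<bar> * \<bar>\<phi> t\<bar> \<le> \<bar>g t\<bar> * B" by (rule mult_left_mono) simp
      then show "norm (g t * \<phi> t) \<le> norm (B * g t)" using B(2) by (simp add: abs_mult mult.commute)
    qed
  qed
qed

lemma time_interval_restrict:
  fixes w :: "real \<Rightarrow> real"
  assumes "s \<le> T"
  shows "(LINT t|time_interval s. w t) = (LINT t|time_interval T. w t * indicator {0<..<s} t)"
proof -
  have "(LINT t|time_interval s. w t) = (LINT t|lebesgue. indicator {0<..<s} t *\<^sub>R w t)"
    by (rule integral_restrict_space) simp
  also have "\<dots> = (LINT t|lebesgue. indicator {0<..<T} t *\<^sub>R (w t * indicator {0<..<s} t))"
    using assms by (intro Bochner_Integration.integral_cong) (auto simp: indicator_def)
  also have "\<dots> = (LINT t|time_interval T. w t * indicator {0<..<s} t)"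
    by (rule integral_restrict_space[symmetric]) simp
  finally show ?thesis .
qed

lemma sqint_time_interval_mono:
  fixes w :: "real \<Rightarrow> real"
  assumes w: "sqint (time_interval T) w" and le: "s \<le> T"
  shows "sqint (time_interval s) w" "(LINT t|time_interval s. (w t)\<^sup>2) \<le> (LINT t|time_interval T. (w t)\<^sup>2)"
proof -
  have "integrable (time_interval s) w"
    by (rule time_interval_mono(1)[OF sqint_integrable[OF finite_measure_interval w] le])
  then show "sqint (time_interval s) w"
    unfolding sqint_def using time_interval_mono(1)[OF sqintD(2)[OF w] le] by simp
  show "(LINT t|time_interval s. (w t)\<^sup>2) \<le> (LINT t|time_interval T. (w t)\<^sup>2)"
    by (rule time_interval_mono(2)[OF sqintD(2)[OF w] le]) simp
qed

lemma LINT_sq_le: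
  fixes w :: "real \<Rightarrow> real"
  assumes "sqint (time_interval T) w" "T \<ge> 0"
  shows "(LINT t|time_interval T. w t)\<^sup>2 \<le> T * (LINT t|time_interval T. (w t)\<^sup>2)"
proof -
  have 1: "sqint (time_interval T) (\<lambda>t. 1)" by (rule sqint_continuous) simp
  have "(LINT t|time_interval T. 1 * w t)\<^sup>2 \<le> (LINT t|time_interval T. 1\<^sup>2) * (LINT t|time_interval T. (w t)\<^sup>2)"
    by (rule Cauchy_Schwarz_integral[OF 1 assms(1)])
  moreover have "(LINT t|time_interval T. 1\<^sup>2) = T"
    using LINT_interval_eq[of 0 T "\<lambda>_. 1"] assms(2) by simp
  ultimately show ?thesis by simp
qed

text \<open>Integration by parts for a primitive of an \<open>L\<^sup>2\<close> function, by approximating the derivative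
  with continuous functions.\<close>

lemma integration_by_parts_sqint:
  fixes \<phi> D W :: "real \<Rightarrow> real"
  assumes T: "T > 0" and D: "sqint (time_interval T) D" and Wm: "W \<in> borel_measurable (time_interval T)"
    and W: "\<And>t. t \<in> {0<..<T} \<Longrightarrow> W t = W0 + (LINT s|time_interval t. D s)"
    and \<phi>: "\<And>t. (\<phi> has_real_derivative \<phi>' t) (at t)" "continuous_on UNIV \<phi>'" "\<phi> 0 = 0" "\<phi> T = 0"
  shows "(LINT t|time_interval T. W t * \<phi>' t) = - (LINT t|time_interval T. D t * \<phi> t)"
proof -
  let ?M = "time_interval T"
  have "\<exists>g. continuous_on UNIV g \<and> (LINT t|?M. (D t - g t)\<^sup>2) < 1 / (real j + 1)" for j :: nat
  proof -
    have "(0::real) < 1 / (real j + 1)" by simp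
    then obtain g where g: "continuous_on UNIV g" "(LINT t|?M. (D t - g t)\<^sup>2) < 1 / (real j + 1)"
      by (rule continuous_dense_sqint[OF D]) (rule that)
    then show ?thesis by (intro exI[of _ g] conjI)
  qed
  then obtain G where G: "\<And>j. continuous_on UNIV (G j)" "\<And>j. (LINT t|?M. (D t - G j t)\<^sup>2) < 1 / (real j + 1)" by metis
  have Gc: "continuous_on {0..t} (G j)" for j t by (rule continuous_on_subset[OF G(1)]) simp
  define P where "P j t = W0 + integral {0..t} (G j)" for j t
  have Pd: "(P j has_real_derivative G j t) (at t within {0..T})" if "t \<in> {0..T}" for j t
    unfolding P_def by (rule derivative_eq_intros integral_has_real_derivative[OF Gc that] refl | simp)+
  have Pc: "continuous_on {0..T} (P j)" for j
    by (rule DERIV_continuous_on[OF Pd])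
  have \<phi>c: "continuous_on {0..T} \<phi>" "continuous_on {0..T} \<phi>'"
    using DERIV_continuous_on[of "{0..T}" \<phi> \<phi>', OF has_field_derivative_at_within[OF \<phi>(1)]]
      continuous_on_subset[OF \<phi>(2)] by simp_all
  note Ps = sqint_continuous[OF Pc] and Gs = sqint_continuous[OF Gc] and \<phi>s = sqint_continuous[OF \<phi>c(1)] sqint_continuous[OF \<phi>c(2)]
  have z: "(LINT t|?M. P j t * \<phi>' t) + (LINT t|?M. G j t * \<phi> t) = 0" for j
  proof -
    have "(LINT t|?M. P j t * \<phi>' t + G j t * \<phi> t) = P j T * \<phi> T - P j 0 * \<phi> 0"
    proof (rule LINT_FTC)
      show "((\<lambda>t. P j t * \<phi> t) has_real_derivative P j t * \<phi>' t + G j t * \<phi> t) (at t within {0..T})" if "t \<in> {0..T}" for t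
        using DERIV_mult[OF Pd[OF that] has_field_derivative_at_within[OF \<phi>(1)]] by (simp add: ac_simps)
      show "continuous_on {0..T} (\<lambda>t. P j t * \<phi>' t + G j t * \<phi> t)"
        by (intro continuous_intros Pc \<phi>c Gc)
    qed (use T in simp)
    then show ?thesis
      using Bochner_Integration.integral_add[OF sqint_mult_integrable[OF Ps \<phi>s(2)] sqint_mult_integrable[OF Gs \<phi>s(1)]]
      by (simp add: \<phi>)
  qed
  \<comment> \<open>The primitives converge uniformly on (0,T): Cauchy-Schwarz on (0,t) turns the
    squared error of the derivatives into a pointwise error, at the price of the factor
    \<open>T\<close>.\<close>
  have close: "(P j t - W t)\<^sup>2 \<le> T / (real j + 1)" if t: "t \<in> {0<..<T}" for j t
  proof -
    have tT: "t \<le> T" "0 \<le> t" using t by auto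
    note d = sqint_diff[OF D Gs[of T j]]
    note d' = sqint_time_interval_mono[OF d tT(1)]
    have "(LINT s|time_interval t. D s - G j s) = W t - P j t"
      unfolding P_def W[OF t] LINT_interval_eq[OF Gc, symmetric]
      by (subst Bochner_Integration.integral_diff)
        (simp_all add: sqint_integrable[OF finite_measure_interval] sqint_time_interval_mono(1)[OF D tT(1)] Gs)
    then have "(P j t - W t)\<^sup>2 = (LINT s|time_interval t. D s - G j s)\<^sup>2" by (simp add: power2_commute)
    also have "\<dots> \<le> t * (LINT s|time_interval t. (D s - G j s)\<^sup>2)" by (rule LINT_sq_le[OF d'(1) tT(2)])
    also have "\<dots> \<le> T * (1 / (real j + 1))"
      using d'(2) G(2)[of j] tT by (intro mult_mono) auto
    finally show ?thesis by simp
  qed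
  have diffs: "sqint ?M (\<lambda>t. P j t - W t)" for j
  proof (rule sqint_bounded[OF finite_measure_interval])
    show "(\<lambda>t. P j t - W t) \<in> borel_measurable ?M" using sqintD(1)[OF Ps] Wm by measurable
    show "AE t in ?M. \<bar>P j t - W t\<bar> \<le> sqrt (T / (real j + 1))"
      by (rule AE_I2) (use close in \<open>auto intro: real_le_rsqrt\<close>)
  qed
  \<comment> \<open>\<open>W\<close> is only assumed measurable; its square integrability comes from
    the bounded distance to the continuous \<open>P 0\<close>.\<close>
  have Ws: "sqint ?M W" using sqint_diff[OF Ps[of 0] diffs[of 0]] by simp
  have li: "(\<lambda>j. K / (real j + 1)) \<longlonglongrightarrow> 0" for K :: real by real_asymp
  have "(\<lambda>j. LINT t|?M. (P j t - W t)\<^sup>2) \<longlonglongrightarrow> 0"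
  proof (rule tendsto_sandwich[OF _ _ tendsto_const li[of "T * T"]])
    show "\<forall>\<^sub>F j in sequentially. (LINT t|?M. (P j t - W t)\<^sup>2) \<le> T * T / (real j + 1)"
    proof (rule always_eventually, rule allI)
      fix j
      have "(LINT t|?M. (P j t - W t)\<^sup>2) \<le> (LINT t|?M. T / (real j + 1))"
        by (rule integral_mono_AE[OF sqintD(2)[OF diffs] sqint_integrable[OF finite_measure_interval sqint_continuous]])
          (use close in auto)
      also have "\<dots> = T * T / (real j + 1)"
        using LINT_interval_eq[of 0 T "\<lambda>_. T / (real j + 1)"] T by simp
      finally show "(LINT t|?M. (P j t - W t)\<^sup>2) \<le> T * T / (real j + 1)" .
    qed
  qed simp
  note l1 = integral_mult_tendsto[OF Ps Ws \<phi>s(2) this]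
  have "(\<lambda>j. LINT t|?M. (G j t - D t)\<^sup>2) \<longlonglongrightarrow> 0"
  proof (rule tendsto_sandwich[OF _ _ tendsto_const li[of 1]])
    show "\<forall>\<^sub>F j in sequentially. (LINT t|?M. (G j t - D t)\<^sup>2) \<le> 1 / (real j + 1)"
      using G(2) by (subst power2_commute) (simp add: less_imp_le)
  qed simp
  note l2 = integral_mult_tendsto[OF Gs D \<phi>s(1) this]
  have "(\<lambda>j. 0) \<longlonglongrightarrow> (LINT t|?M. W t * \<phi>' t) + (LINT t|?M. D t * \<phi> t)"
    using tendsto_add[OF l1 l2] unfolding z .
  then have "(LINT t|?M. W t * \<phi>' t) + (LINT t|?M. D t * \<phi> t) = 0"
    by (simp add: LIMSEQ_const_iff)
  then show ?thesis by simp
qed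

lemma locally_integrable_half_line:
  fixes g :: "real \<Rightarrow> real"
  assumes g: "\<And>T. T > 0 \<Longrightarrow> integrable (time_interval T) g"
  shows "locally_integrable_on g {0<..}"
  unfolding locally_integrable_on_def
proof (intro allI impI)
  fix K :: "real set" assume K: "compact K \<and> K \<subseteq> {0<..}"
  then have "bounded K" by (intro compact_imp_bounded) simp
  then obtain B where B: "\<forall>x\<in>K. \<bar>x\<bar> \<le> B" unfolding bounded_real by (rule exE)
  let ?T = "\<bar>B\<bar> + 1"
  have "K \<subseteq> {0<..<?T}" using K B by fastforce
  moreover have "locally_integrable_on g {0<..<?T}" by (rule integrable_locally_integrable[OF _ g]) auto
  ultimately show "g absolutely_integrable_on K" unfolding locally_integrable_on_def using K by simp
qed

lemma test_function_half_line:
  assumes \<phi>: "\<phi> \<in> test_functions {0<..}"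
  obtains T where "T > 0" "\<And>t. t \<ge> T \<Longrightarrow> \<phi> t = 0" "\<And>t. t \<ge> T \<Longrightarrow> deriv \<phi> t = 0"
proof -
  have "compact (closure {x. \<phi> x \<noteq> 0})" using \<phi> unfolding test_functions_def by simp
  then have "bounded (closure {x. \<phi> x \<noteq> 0})" by (rule compact_imp_bounded)
  then obtain B where B: "\<forall>x\<in>closure {x. \<phi> x \<noteq> 0}. \<bar>x\<bar> \<le> B" unfolding bounded_real by (rule exE)
  have z: "\<phi> t = 0" if "t > \<bar>B\<bar>" for t
  proof (rule ccontr)
    assume "\<phi> t \<noteq> 0"
    then have "t \<in> closure {x. \<phi> x \<noteq> 0}" by (intro subsetD[OF closure_subset]) simp
    from bspec[OF B this] that show False by linarith
  qed
  \<comment> \<open>The shift by 1 puts \<open>t\<close> inside an open set on which \<phi>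
    vanishes, so the derivative vanishes too.\<close>
  have "deriv \<phi> t = 0" if t: "t \<ge> \<bar>B\<bar> + 1" for t
  proof -
    have tB: "t \<in> {\<bar>B\<bar><..}" using t by simp
    have "((\<lambda>_. 0) has_real_derivative deriv \<phi> t) (at t)"
      by (rule has_field_derivative_transform_within_open[OF test_functionsD(1)[OF \<phi>] open_greaterThan tB]) (simp add: z)
    then show ?thesis by (rule DERIV_unique[OF _ DERIV_const])
  qed
  then show thesis by (intro that[of "\<bar>B\<bar> + 1"]) (use z in auto)
qed

lemma LINT_half_line_eq:
  fixes g \<psi> :: "real \<Rightarrow> real"
  assumes "\<And>t. t \<ge> T \<Longrightarrow> \<psi> t = 0"
  shows "(LINT t|lebesgue_on {0<..}. g t * \<psi> t) = (LINT t|time_interval T. g t * \<psi> t)"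
proof -
  have "(LINT t|lebesgue_on {0<..}. g t * \<psi> t) = (LINT t|lebesgue. indicator {0<..} t *\<^sub>R (g t * \<psi> t))"
    by (rule integral_restrict_space) simp
  also have "\<dots> = (LINT t|lebesgue. indicator {0<..<T} t *\<^sub>R (g t * \<psi> t))"
    using assms by (intro Bochner_Integration.integral_cong) (auto simp: indicator_def not_less)
  also have "\<dots> = (LINT t|time_interval T. g t * \<psi> t)"
    by (rule integral_restrict_space[symmetric]) simp
  finally show ?thesis .
qed

lemma coefficients_exist:
  assumes "summable (\<lambda>k. (b k)\<^sup>2)"
  shows "\<exists>v. v \<in> L2 \<and> (\<forall>k. sine.cf v k = b k)"
proof -
  obtain g where g: "sqint (lebesgue_on \<Omega>) g" "(\<lambda>n. LINT x|lebesgue_on \<Omega>. (sine.partial b n x - g x)\<^sup>2) \<longlonglongrightarrow> 0"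
    by (rule sine.riesz_fischer[OF assms]) (rule that)
  then show ?thesis using sine.cf_limit(1)[OF g] unfolding L2_iff_sqint by (intro exI[of _ g]) simp
qed

text \<open>The first part lets the integral be constructed from its coefficients by Riesz-Fischer;
  the second confirms that a function with these coefficients is the Bochner integral.\<close>

lemma weighted_Bochner_integral:
  fixes u :: "real \<Rightarrow> real \<Rightarrow> real"
  assumes meas: "\<And>k. (\<lambda>t. sine.cf (u t) k) \<in> borel_measurable (time_interval T)"
    and u: "AE t in time_interval T. u t \<in> L2"
    and int: "integrable (time_interval T) (\<lambda>t. \<Sum>k. (sine.cf (u t) k)\<^sup>2)"
    and \<phi>: "continuous_on {0..T} \<phi>"
  shows "summable (\<lambda>k. (LINT t|time_interval T. \<phi> t * sine.cf (u t) k)\<^sup>2)"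
    and "I \<in> L2 \<Longrightarrow> (\<And>k. sine.cf I k = (LINT t|time_interval T. \<phi> t * sine.cf (u t) k)) \<Longrightarrow>
      has_Bochner_integral_in (time_interval T) L2 L2_norm (\<lambda>t x. \<phi> t * u t x) I"
proof -
  let ?M = "time_interval T"
  have m\<phi>: "\<phi> \<in> borel_measurable ?M"
    by (rule continuous_imp_measurable_interval[OF continuous_on_subset[OF \<phi>]]) auto
  have s: "AE t in ?M. summable (\<lambda>k. (sine.cf (u t) k)\<^sup>2)"
    using u by eventually_elim (use L2_parseval in \<open>auto simp: sums_iff\<close>)
  note c = square_series_components[OF meas s int]
  have "(LINT t|?M. \<phi> t * sine.cf (u t) k)\<^sup>2 \<le> (LINT t|?M. (\<phi> t)\<^sup>2) * (LINT t|?M. (sine.cf (u t) k)\<^sup>2)" for k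
    by (rule Cauchy_Schwarz_integral[OF sqint_continuous[OF \<phi>] c(1)])
  then show "summable (\<lambda>k. (LINT t|?M. \<phi> t * sine.cf (u t) k)\<^sup>2)"
    by (intro summable_comparison_test'[OF summable_mult[OF c(2), of "LINT t|?M. (\<phi> t)\<^sup>2"], of 0]) simp
  assume I: "I \<in> L2" "\<And>k. sine.cf I k = (LINT t|?M. \<phi> t * sine.cf (u t) k)"
  show "has_Bochner_integral_in ?M L2 L2_norm (\<lambda>t x. \<phi> t * u t x) I"
  proof (rule has_Bochner_integral_sine)
    show "(\<lambda>t. sine.cf (\<lambda>x. \<phi> t * u t x) k) \<in> borel_measurable ?M" for k
      unfolding cf_cmult using m\<phi> meas[of k] by measurable
    show "AE t in ?M. (\<lambda>x. \<phi> t * u t x) \<in> L2" using u by eventually_elim (rule L2_cmult)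
    show "sine.cf I k = (LINT t|?M. sine.cf (\<lambda>x. \<phi> t * u t x) k)" for k unfolding cf_cmult by (rule I(2))
    have i2: "integrable ?M (\<lambda>t. (\<Sum>k. (sine.cf (u t) k)\<^sup>2) * (\<phi> t)\<^sup>2)"
      by (rule integrable_times_continuous[OF int]) (intro continuous_intros \<phi>)
    have eq: "AE t in ?M. (\<Sum>k. (sine.cf (u t) k)\<^sup>2) * (\<phi> t)\<^sup>2 = (\<Sum>k. (sine.cf (\<lambda>x. \<phi> t * u t x) k)\<^sup>2)"
      using s by eventually_elim (simp add: cf_cmult power_mult_distrib suminf_mult mult.commute)
    show "integrable ?M (\<lambda>t. \<Sum>k. (sine.cf (\<lambda>x. \<phi> t * u t x) k)\<^sup>2)"
      by (rule integrable_cong_AE_imp[OF i2 lebesgue_on_measurable_AE[OF _ borel_measurable_integrable[OF i2] eq]]) (use eq in auto)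
  qed (rule I(1))
qed

section \<open>Regularity and weak form of the limit\<close>

context limit_problem
begin

lemma cf_uz_measurable: "(\<lambda>t. sine.cf (uz t) k) \<in> borel_measurable (time_interval T)"
proof -
  have "sine.cf (uz t) k = z t k" if "t \<in> space (time_interval T)" for t
    by (rule uz_L2(2)) (use that in simp)
  then show ?thesis by (rule iffD2[OF measurable_cong z_measurable])
qed

lemma z_square_sums: "t \<ge> 0 \<Longrightarrow> (\<lambda>k. (z t k)\<^sup>2) sums (L2_norm (uz t))\<^sup>2"
  using L2_parseval[OF uz_L2(1)] by (simp add: uz_L2(2))

lemma z_square_le_Vz:
  assumes t: "t \<ge> 0" shows "(\<Sum>k. (z t k)\<^sup>2) \<le> Vz t"
  unfolding Vz_def
proof (rule suminf_le)
  show "(z t k)\<^sup>2 \<le> (om k)\<^sup>2 * (z t k)\<^sup>2" for k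
    using mult_right_mono[OF om_sq_le(2)[of k] zero_le_power2[of "z t k"]] by simp
  show "summable (\<lambda>k. (z t k)\<^sup>2)" using z_square_sums[OF t] by (rule sums_summable)
  show "summable (\<lambda>k. (om k)\<^sup>2 * (z t k)\<^sup>2)" by (rule V_tendsto(1)[OF t])
qed

lemma uz_H01:
  assumes t: "t \<ge> 0" shows "uz t \<in> H01" "(H01_norm (uz t))\<^sup>2 = Vz t"
proof -
  have s: "summable (\<lambda>k. (om k)\<^sup>2 * (sine.cf (uz t) k)\<^sup>2)" using V_tendsto(1)[OF t] by (simp add: uz_L2(2)[OF t])
  note H = H01_of_sine_series[OF uz_L2(1)[OF t] s]
  show "uz t \<in> H01" by (rule H(1))
  show "(H01_norm (uz t))\<^sup>2 = Vz t" unfolding H(2) uz_L2(2)[OF t] Vz_def[symmetric] by (simp add: Vz_nonneg[OF t])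
qed

lemma uz_regularity:
  assumes T: "T > 0"
  shows "uz \<in> Bochner_Linf (time_interval T) L2 L2_norm"
    and "uz \<in> Bochner_L2 (time_interval T) H01 H01_norm"
    and "uz \<in> Bochner_Linf (time_interval T) H01 H01_norm"
    and "uz \<in> Bochner_L2 (time_interval T) (Hk 2 \<inter> H01) (Hk_norm 2)"
proof -
  let ?M = "time_interval T"
  obtain C where C: "\<And>t. t \<in> {0..T} \<Longrightarrow> Vz t \<le> C" "\<And>t x. t \<in> {0..T} \<Longrightarrow> (uz t x)\<^sup>2 \<le> C" "C \<ge> 0"
    by (rule Vz_bound[OF T]) (rule that)
  have sp: "t \<ge> 0" "t \<in> {0..T}" if "t \<in> space ?M" for t using that by simp_all
  note cfz = uz_L2(2)[OF sp(1)]
  show "uz \<in> Bochner_Linf ?M L2 L2_norm"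
  proof (rule Bochner_Linf_sine[OF sine_space_L2 cf_uz_measurable, where C=C])
    show "AE t in ?M. uz t \<in> L2 \<and> summable (\<lambda>k. 1 * (sine.cf (uz t) k)\<^sup>2)"
      by (rule AE_I2) (use sums_summable[OF z_square_sums[OF sp(1)]] in \<open>simp add: cfz uz_L2(1)[OF sp(1)]\<close>)
    show "AE t in ?M. (\<Sum>k. 1 * (sine.cf (uz t) k)\<^sup>2) \<le> C"
      by (rule AE_I2) (use order_trans[OF z_square_le_Vz[OF sp(1)] C(1)[OF sp(2)]] in \<open>simp add: cfz\<close>)
  qed
  have H: "AE t in ?M. uz t \<in> L2 \<and> summable (\<lambda>k. (om k)\<^sup>2 * (sine.cf (uz t) k)\<^sup>2)"
    by (rule AE_I2) (use V_tendsto(1)[OF sp(1)] in \<open>simp add: cfz uz_L2(1)[OF sp(1)]\<close>)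
  have Vsum: "(\<Sum>k. (om k)\<^sup>2 * (sine.cf (uz t) k)\<^sup>2) = Vz t" if "t \<in> space ?M" for t
    unfolding Vz_def by (simp only: cfz[OF that])
  show "uz \<in> Bochner_Linf ?M H01 H01_norm"
  proof (rule Bochner_Linf_sine[OF sine_space_H01 cf_uz_measurable H, where C=C])
    show "AE t in ?M. (\<Sum>k. (om k)\<^sup>2 * (sine.cf (uz t) k)\<^sup>2) \<le> C"
      by (rule AE_I2) (simp only: Vsum C(1)[OF sp(2)])
  qed
  show "uz \<in> Bochner_L2 ?M H01 H01_norm"
  proof (rule Bochner_L2_sine[OF sine_space_H01 cf_uz_measurable H])
    have "AE t in ?M. norm (Vz t) \<le> C"
      by (rule AE_I2) (simp only: real_norm_def abs_of_nonneg[OF Vz_nonneg[OF sp(1)]] C(1)[OF sp(2)])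
    then have "integrable ?M Vz"
      by (rule finite_measure.integrable_const_bound[OF finite_measure_interval _ Vz_measurable])
    moreover have "integrable ?M (\<lambda>t. \<Sum>k. (om k)\<^sup>2 * (sine.cf (uz t) k)\<^sup>2) = integrable ?M Vz"
      by (rule Bochner_Integration.integrable_cong[OF refl]) (rule Vsum)
    ultimately show "integrable ?M (\<lambda>t. \<Sum>k. (om k)\<^sup>2 * (sine.cf (uz t) k)\<^sup>2)" by (simp only:)
  qed
  let ?w = "\<lambda>k. 1 + (om k)\<^sup>2 + (om k)^4"
  \<comment> \<open>Since \<open>om k >= 1\<close>, each of the three weights is at most
    \<open>(om k)^4\<close>.\<close>
  have le: "?w k * x\<^sup>2 \<le> 3 * ((om k)^4 * x\<^sup>2)" for k x
  proof -
    have "?w k \<le> 3 * (om k)^4" using om_sq_le[of k] by linarith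
    from mult_right_mono[OF this zero_le_power2[of x]] show ?thesis by simp
  qed
  have A: "AE t in ?M. (\<forall>k. sine.cf (uz t) k = z t k) \<and> summable (\<lambda>k. ?w k * (z t k)\<^sup>2) \<and>
      (\<Sum>k. ?w k * (z t k)\<^sup>2) \<le> 3 * (\<Sum>k. (om k)^4 * (z t k)\<^sup>2)"
    using H2_regularity(1)[OF T] AE_space
  proof eventually_elim
    case (elim t)
    note s3 = summable_mult[OF elim(1), of 3]
    have w0: "0 \<le> ?w k * (z t k)\<^sup>2" for k by (intro mult_nonneg_nonneg add_nonneg_nonneg) auto
    have s: "summable (\<lambda>k. ?w k * (z t k)\<^sup>2)"
      by (rule summable_comparison_test'[OF s3, of 0]) (use le w0 in \<open>simp only: real_norm_def abs_of_nonneg\<close>)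
    have "(\<Sum>k. ?w k * (z t k)\<^sup>2) \<le> (\<Sum>k. 3 * ((om k)^4 * (z t k)\<^sup>2))" by (rule suminf_le[OF le s s3])
    then show ?case using s cfz[OF elim(2)] suminf_mult[OF elim(1), of 3] by simp
  qed
  show "uz \<in> Bochner_L2 ?M (Hk 2 \<inter> H01) (Hk_norm 2)"
  proof (rule Bochner_L2_sine[OF sine_space_Hk_2 cf_uz_measurable])
    show "AE t in ?M. uz t \<in> L2 \<and> summable (\<lambda>k. ?w k * (sine.cf (uz t) k)\<^sup>2)"
      using A AE_space by eventually_elim (simp add: uz_L2(1))
    have i3: "integrable ?M (\<lambda>t. 3 * (\<Sum>k. (om k)^4 * (z t k)\<^sup>2))" using H2_regularity(2)[OF T] by simp
    show "integrable ?M (\<lambda>t. \<Sum>k. ?w k * (sine.cf (uz t) k)\<^sup>2)"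
    proof (rule Bochner_Integration.integrable_bound[OF i3])
      have "(\<lambda>t. ?w k * (sine.cf (uz t) k)\<^sup>2) \<in> borel_measurable ?M" for k using cf_uz_measurable[of k T] by measurable
      then show "(\<lambda>t. \<Sum>k. ?w k * (sine.cf (uz t) k)\<^sup>2) \<in> borel_measurable ?M" by (rule borel_measurable_suminf)
      show "AE t in ?M. norm (\<Sum>k. ?w k * (sine.cf (uz t) k)\<^sup>2) \<le> norm (3 * (\<Sum>k. (om k)^4 * (z t k)\<^sup>2))"
        using A
      proof eventually_elim
        case (elim t)
        have w0: "0 \<le> ?w k * (z t k)\<^sup>2" for k by (intro mult_nonneg_nonneg add_nonneg_nonneg) auto
        have "0 \<le> (\<Sum>k. ?w k * (z t k)\<^sup>2)" by (rule suminf_nonneg) (use elim w0 in auto)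
        moreover have "(\<Sum>k. ?w k * (sine.cf (uz t) k)\<^sup>2) = (\<Sum>k. ?w k * (z t k)\<^sup>2)" using elim by simp
        ultimately show ?case using elim by (simp only: real_norm_def)  linarith
      qed
    qed
  qed
qed

text \<open>The time derivative, assembled from its coefficients. At the null set of times where
  these are not square summable the choice is arbitrary.\<close>

definition wz :: "real \<Rightarrow> real \<Rightarrow> real" where
  "wz t = (SOME v. v \<in> L2 \<and> (\<forall>k. sine.cf v k = Dz t k))"

lemma wz:
  assumes T: "T > 0" shows "AE t in time_interval T. wz t \<in> L2 \<and> (\<forall>k. sine.cf (wz t) k = Dz t k)"
  using Dz_summable(1)[OF T]
proof eventually_elim
  case (elim t)
  show ?case unfolding wz_def by (rule someI_ex[OF coefficients_exist[OF elim]])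
qed

lemma cf_wz:
  assumes T: "T > 0"
  shows "(\<lambda>t. sine.cf (wz t) k) \<in> borel_measurable (time_interval T)"
    "integrable (time_interval T) (\<lambda>t. \<Sum>k. (sine.cf (wz t) k)\<^sup>2)"
proof -
  have eq: "AE t in time_interval T. Dz t k = sine.cf (wz t) k" for k using wz[OF T] by eventually_elim simp
  show "(\<lambda>t. sine.cf (wz t) k) \<in> borel_measurable (time_interval T)"
    by (rule lebesgue_on_measurable_AE[OF _ Dz_measurable eq]) simp
  have eq2: "AE t in time_interval T. (\<Sum>k. (Dz t k)\<^sup>2) = (\<Sum>k. (sine.cf (wz t) k)\<^sup>2)"
    using wz[OF T] by eventually_elim simp
  show "integrable (time_interval T) (\<lambda>t. \<Sum>k. (sine.cf (wz t) k)\<^sup>2)"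
    by (rule integrable_cong_AE_imp[OF Dz_summable(2)[OF T] lebesgue_on_measurable_AE[OF _ borel_measurable_integrable[OF Dz_summable(2)[OF T]] eq2]])
      (use eq2 in auto)
qed

lemma wz_Bochner_L2:
  assumes T: "T > 0" shows "wz \<in> Bochner_L2 (time_interval T) L2 L2_norm"
proof (rule Bochner_L2_sine[OF sine_space_L2 cf_wz(1)[OF T]])
  show "AE t in time_interval T. wz t \<in> L2 \<and> summable (\<lambda>k. 1 * (sine.cf (wz t) k)\<^sup>2)"
    using wz[OF T] Dz_summable(1)[OF T] by eventually_elim simp
  show "integrable (time_interval T) (\<lambda>t. \<Sum>k. 1 * (sine.cf (wz t) k)\<^sup>2)" using cf_wz(2)[OF T] by simp
qed

lemma z_sqint: "T > 0 \<Longrightarrow> sqint (time_interval T) (\<lambda>t. z t k)"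
  and z_series_integrable: "T > 0 \<Longrightarrow> integrable (time_interval T) (\<lambda>t. \<Sum>k. (z t k)\<^sup>2)"
  and z_series_summable: "AE t in time_interval T. summable (\<lambda>k. (z t k)\<^sup>2)"
proof -
  show s: "AE t in time_interval T. summable (\<lambda>k. (z t k)\<^sup>2)" for T
    by (rule AE_I2) (use sums_summable[OF z_square_sums] in simp)
  assume T: "T > 0"
  obtain C where C: "\<And>t. t \<in> {0..T} \<Longrightarrow> Vz t \<le> C" "\<And>t x. t \<in> {0..T} \<Longrightarrow> (uz t x)\<^sup>2 \<le> C" "C \<ge> 0"
    by (rule Vz_bound[OF T]) (rule that)
  show i: "integrable (time_interval T) (\<lambda>t. \<Sum>k. (z t k)\<^sup>2)"
  proof (rule finite_measure.integrable_const_bound[OF finite_measure_interval, where B=C])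
    have "(\<lambda>t. (z t k)\<^sup>2) \<in> borel_measurable (time_interval T)" for k using z_measurable[of k T] by measurable
    then show "(\<lambda>t. \<Sum>k. (z t k)\<^sup>2) \<in> borel_measurable (time_interval T)" by (rule borel_measurable_suminf)
    show "AE t in time_interval T. norm (\<Sum>k. (z t k)\<^sup>2) \<le> C"
    proof (rule AE_I2)
      fix t assume "t \<in> space (time_interval T)"
      then have t: "t \<ge> 0" "t \<in> {0..T}" by simp_all
      have "0 \<le> (\<Sum>k. (z t k)\<^sup>2)" using suminf_nonneg[OF sums_summable[OF z_square_sums[OF t(1)]]] by simp
      then show "norm (\<Sum>k. (z t k)\<^sup>2) \<le> C" using z_square_le_Vz[OF t(1)] C(1)[OF t(2)] by simp
    qed
  qed
  show "sqint (time_interval T) (\<lambda>t. z t k)" by (rule square_series_components(1)[OF z_measurable s i])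
qed

lemma Dz_sqint: "T > 0 \<Longrightarrow> sqint (time_interval T) (\<lambda>t. Dz t k)"
  by (rule square_series_components(1)[OF Dz_measurable Dz_summable])

text \<open>Both Bochner integrals are determined by their coefficients, so the claim reduces to
  scalar integration by parts for each \<open>z t k\<close>, which is a primitive of
  \<open>Dz t k\<close>.\<close>

lemma has_time_deriv_uz:
  assumes T: "T > 0" shows "has_time_deriv T uz wz"
  unfolding has_time_deriv_def
proof
  fix \<phi> assume \<phi>: "\<phi> \<in> test_functions {0<..<T}"
  let ?M = "time_interval T"
  note \<phi>c = test_functionsD(2)[OF \<phi>, of "{0..T}"] and \<phi>'c = test_functionsD(3)[OF \<phi>, of "{0..T}"]
  have uL2: "AE t in ?M. uz t \<in> L2" by (rule AE_I2) (simp add: uz_L2)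
  have wL2: "AE t in ?M. wz t \<in> L2" using wz[OF T] by eventually_elim simp
  have cfz: "(\<Sum>k. (sine.cf (uz t) k)\<^sup>2) = (\<Sum>k. (z t k)\<^sup>2)" if "t \<in> space ?M" for t
    using that by (simp add: uz_L2(2))
  have "integrable ?M (\<lambda>t. \<Sum>k. (sine.cf (uz t) k)\<^sup>2) = integrable ?M (\<lambda>t. \<Sum>k. (z t k)\<^sup>2)"
    by (rule Bochner_Integration.integrable_cong[OF refl]) (rule cfz)
  then have ui: "integrable ?M (\<lambda>t. \<Sum>k. (sine.cf (uz t) k)\<^sup>2)" using z_series_integrable[OF T] by (simp only:)
  note U = weighted_Bochner_integral[OF cf_uz_measurable uL2 ui \<phi>'c]
  note W = weighted_Bochner_integral(2)[OF cf_wz(1)[OF T] wL2 cf_wz(2)[OF T] \<phi>c]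
  obtain I where I: "I \<in> L2" "\<forall>k. sine.cf I k = (LINT t|?M. deriv \<phi> t * sine.cf (uz t) k)"
    using coefficients_exist[OF U(1)] by (elim exE conjE)
  have "sine.cf (\<lambda>x. - I x) k = (LINT t|?M. \<phi> t * sine.cf (wz t) k)" for k
  proof -
    have "(LINT t|?M. deriv \<phi> t * sine.cf (uz t) k) = (LINT t|?M. z t k * deriv \<phi> t)"
      by (rule Bochner_Integration.integral_cong) (simp_all add: uz_L2(2) mult.commute)
    also have "\<dots> = - (LINT t|?M. Dz t k * \<phi> t)"
    proof (rule integration_by_parts_sqint[OF T Dz_sqint[OF T] z_measurable, where ?W0.0="p k"])
      show "z t k = p k + (LINT s|time_interval t. Dz s k)" if "t \<in> {0<..<T}" for t
        by (rule z_equation(2)) (use that in simp)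
      show "(\<phi> has_real_derivative deriv \<phi> t) (at t)" for t by (rule test_functionsD(1)[OF \<phi>])
      show "continuous_on UNIV (deriv \<phi>)" by (rule test_functionsD(3)[OF \<phi>])
      show "\<phi> 0 = 0" "\<phi> T = 0" by (rule test_functionsD(4)[OF \<phi>], simp)+
    qed
    also have "(LINT t|?M. Dz t k * \<phi> t) = (LINT t|?M. \<phi> t * sine.cf (wz t) k)"
    proof (rule integral_cong_AE)
      show "(\<lambda>t. Dz t k * \<phi> t) \<in> borel_measurable ?M"
        using Dz_measurable[of k T] sqintD(1)[OF sqint_continuous[OF \<phi>c]] by measurable
      show "(\<lambda>t. \<phi> t * sine.cf (wz t) k) \<in> borel_measurable ?M"
        using cf_wz(1)[OF T, of k] sqintD(1)[OF sqint_continuous[OF \<phi>c]] by measurable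
      show "AE t in ?M. Dz t k * \<phi> t = \<phi> t * sine.cf (wz t) k" using wz[OF T] by eventually_elim simp
    qed
    finally show ?thesis unfolding cf_uminus using I(2) by simp
  qed
  moreover have "(\<lambda>x. - I x) \<in> L2" using L2_cmult[OF I(1), of "-1"] by simp
  ultimately show "\<exists>I. has_Bochner_integral_in ?M L2 L2_norm (\<lambda>t x. deriv \<phi> t * uz t x) I \<and>
      has_Bochner_integral_in ?M L2 L2_norm (\<lambda>t x. \<phi> t * wz t x) (\<lambda>x. - I x)"
    using U(2)[OF I(1)] I(2) W by (intro exI[of _ I]) simp
qed

text \<open>Written over the common interval (0,T), the increment is \<open>Dz\<close> integrated
  against a difference of indicators whose square has integral at most \<open>s - t\<close>;
  Cauchy-Schwarz gives Hoelder continuity of exponent 1/2.\<close>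

lemma z_increment:
  assumes T: "T > 0" and ts: "0 \<le> t" "t \<le> s" "s \<le> T"
  shows "(z s k - z t k)\<^sup>2 \<le> (s - t) * (LINT \<tau>|time_interval T. (Dz \<tau> k)\<^sup>2)"
proof -
  let ?M = "time_interval T"
  let ?i = "\<lambda>\<sigma>. indicator {0<..<\<sigma>} :: real \<Rightarrow> real"
  have zz: "z \<sigma> k = p k + (LINT \<tau>|?M. Dz \<tau> k * ?i \<sigma> \<tau>)" if "0 \<le> \<sigma>" "\<sigma> \<le> T" for \<sigma>
  proof (cases "\<sigma> = 0")
    case True then show ?thesis by (simp add: z_0)
  next
    case False
    then show ?thesis using z_equation(2)[of \<sigma> k] that time_interval_restrict[OF that(2), of "\<lambda>\<tau>. Dz \<tau> k"] by simp
  qed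
  have si: "sqint ?M (?i \<sigma>)" for \<sigma>
  proof (rule sqint_bounded[OF finite_measure_interval, where B=1])
    show "?i \<sigma> \<in> borel_measurable ?M" by (rule measurable_restrict_space1[OF borel_measurable_indicator]) simp
  qed (simp add: indicator_def)
  let ?q = "\<lambda>\<tau>. ?i s \<tau> - ?i t \<tau>"
  note D = Dz_sqint[OF T, of k]
  have "z s k - z t k = (LINT \<tau>|?M. ?q \<tau> * Dz \<tau> k)"
    using Bochner_Integration.integral_diff[OF sqint_mult_integrable[OF D si[of s]] sqint_mult_integrable[OF D si[of t]]] ts
    by (simp add: zz algebra_simps)
  then have "(z s k - z t k)\<^sup>2 \<le> (LINT \<tau>|?M. (?q \<tau>)\<^sup>2) * (LINT \<tau>|?M. (Dz \<tau> k)\<^sup>2)"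
    using Cauchy_Schwarz_integral[OF sqint_diff[OF si[of s] si[of t]] D] by simp
  also have "\<dots> \<le> (s - t) * (LINT \<tau>|?M. (Dz \<tau> k)\<^sup>2)"
  proof (rule mult_right_mono)
    have "(LINT \<tau>|?M. (?q \<tau>)\<^sup>2) = (LINT \<tau>|lebesgue. indicator {0<..<T} \<tau> *\<^sub>R (?q \<tau>)\<^sup>2)"
      by (rule integral_restrict_space) simp
    also have "\<dots> \<le> (LINT \<tau>|lebesgue. indicator {t..s} \<tau>)"
    proof (rule integral_mono')
      show "integrable lebesgue (indicator {t..s} :: real \<Rightarrow> real)"
        by (rule integrable_real_indicator) (use ts in simp_all)
    qed (use ts in \<open>auto simp: indicator_def\<close>)
    also have "\<dots> = s - t" using ts by simp
    finally show "(LINT \<tau>|?M. (?q \<tau>)\<^sup>2) \<le> s - t" .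
  qed simp
  finally show ?thesis .
qed

text \<open>The increments of the coefficients are summed over \<open>k\<close>; the constants are
  summable because the time derivative is square integrable in time and space.\<close>

lemma uz_continuous:
  assumes t: "t \<ge> 0" shows "((\<lambda>s. L2_norm (\<lambda>x. uz s x - uz t x)) \<longlongrightarrow> 0) (at t within {0..})"
proof -
  define T where "T = t + 1"
  have T: "T > 0" using t by (simp add: T_def)
  note c = square_series_components(2)[OF Dz_measurable Dz_summable[OF T]]
  define Q where "Q = (\<Sum>k. LINT \<tau>|time_interval T. (Dz \<tau> k)\<^sup>2)"
  have b: "L2_norm (\<lambda>x. uz s x - uz t x) \<le> sqrt (\<bar>s - t\<bar> * Q)" if s: "s \<in> {0..T}" for s
  proof -
    have s0: "s \<ge> 0" using s by simp
    note L = L2_parseval[OF L2_diff[OF uz_L2(1)[OF s0] uz_L2(1)[OF t]], unfolded cf_diff[OF uz_L2(1)[OF s0] uz_L2(1)[OF t]] uz_L2(2)[OF s0] uz_L2(2)[OF t]]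
    have le: "(z s k - z t k)\<^sup>2 \<le> \<bar>s - t\<bar> * (LINT \<tau>|time_interval T. (Dz \<tau> k)\<^sup>2)" for k
    proof (cases "t \<le> s")
      case True then show ?thesis using z_increment[OF T t True, of k] s by simp
    next
      case False
      then have "(z t k - z s k)\<^sup>2 \<le> (t - s) * (LINT \<tau>|time_interval T. (Dz \<tau> k)\<^sup>2)"
        by (intro z_increment[OF T s0]) (simp_all add: T_def)
      then show ?thesis using False by (simp only: power2_commute[of "z s k"]) simp
    qed
    have "(L2_norm (\<lambda>x. uz s x - uz t x))\<^sup>2 = (\<Sum>k. (z s k - z t k)\<^sup>2)" using L by (rule sums_unique)
    also have "\<dots> \<le> (\<Sum>k. \<bar>s - t\<bar> * (LINT \<tau>|time_interval T. (Dz \<tau> k)\<^sup>2))"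
      by (rule suminf_le[OF le sums_summable[OF L] summable_mult[OF c]])
    also have "\<dots> = \<bar>s - t\<bar> * Q" unfolding Q_def by (rule suminf_mult[OF c])
    finally show ?thesis by (rule real_le_rsqrt)
  qed
  show ?thesis
  proof (rule tendsto_sandwich[OF _ _ tendsto_const])
    show "\<forall>\<^sub>F s in at t within {0..}. 0 \<le> L2_norm (\<lambda>x. uz s x - uz t x)"
      by (rule always_eventually) (simp add: L2_norm_nonneg)
    have "\<forall>\<^sub>F s in at t within {0..}. s \<in> {0..T}"
      unfolding eventually_at by (rule exI[of _ 1]) (auto simp: T_def dist_real_def)
    then show "\<forall>\<^sub>F s in at t within {0..}. L2_norm (\<lambda>x. uz s x - uz t x) \<le> sqrt (\<bar>s - t\<bar> * Q)"
      by eventually_elim (rule b)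
    have "((\<lambda>s. sqrt (\<bar>s - t\<bar> * Q)) \<longlongrightarrow> sqrt (\<bar>t - t\<bar> * Q)) (at t within {0..})" by (intro tendsto_intros)
    then show "((\<lambda>s. sqrt (\<bar>s - t\<bar> * Q)) \<longlongrightarrow> 0) (at t within {0..})" by simp
  qed
qed

lemma uz_initial_value:
  assumes u0: "u0 \<in> L2" "\<And>k. p k = sine.cf u0 k" shows "has_initial_value uz u0"
  \<comment> \<open>\<open>uz\<close> is defined and continuous at every time, so it serves as its
    own representative.\<close>
  unfolding has_initial_value_def
proof (intro exI[of _ uz] conjI allI impI)
  show "AE x in lebesgue_on \<Omega>. uz 0 x = u0 x"
  proof (rule sine.cf_eq_imp_AE_eq[OF L2_sqint L2_sqint])
    show "sine.cf (uz 0) = sine.cf u0" by (rule ext) (simp add: uz_L2(2) z_0 u0(2))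
  qed (simp_all add: uz_L2(1) u0)
qed (simp_all add: uz_L2(1) uz_continuous)

end

context limit_problem
begin

lemma Fz_cf:
  assumes t: "t \<ge> 0" shows "(\<lambda>x. f (uz t x)) \<in> L2" "Fz t k = lam * sine.cf (\<lambda>x. f (uz t x)) k"
proof -
  have T: "t + 1 > 0" using t by simp
  obtain C where C: "\<And>s. s \<in> {0..t+1} \<Longrightarrow> Vz s \<le> C" "\<And>s x. s \<in> {0..t+1} \<Longrightarrow> (uz s x)\<^sup>2 \<le> C" "C \<ge> 0"
    by (rule Vz_bound[OF T]) (rule that)
  obtain B where B: "B \<ge> 0" "\<And>u. u\<^sup>2 \<le> C \<Longrightarrow> \<bar>f u\<bar> \<le> B" by (rule f_bounded_of_V) (rule that)
  have tin: "t \<in> {0..t+1}" using t by simp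
  show "(\<lambda>x. f (uz t x)) \<in> L2" unfolding L2_iff_sqint
  proof (rule sqint_bounded[OF finite_measure_interval])
    have "f \<in> borel_measurable borel" by (rule borel_measurable_continuous_onI[OF f_cont])
    then show "(\<lambda>x. f (uz t x)) \<in> borel_measurable (lebesgue_on \<Omega>)"
      by (rule measurable_compose[OF sqintD(1)[OF L2_sqint[OF uz_L2(1)[OF t]]]])
    show "AE x in lebesgue_on \<Omega>. \<bar>f (uz t x)\<bar> \<le> B" by (rule AE_I2) (rule B(2)[OF C(2)[OF tin]])
  qed
  show "Fz t k = lam * sine.cf (\<lambda>x. f (uz t x)) k" unfolding Fz_def sine.cf_def ..
qed

lemma Fz_series:
  assumes T: "T > 0"
  shows "AE t in time_interval T. summable (\<lambda>k. (Fz t k)\<^sup>2)" "integrable (time_interval T) (\<lambda>t. \<Sum>k. (Fz t k)\<^sup>2)"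
proof -
  obtain B where B: "\<And>t N. t \<in> {0..T} \<Longrightarrow> (\<Sum>k<N. (Fz t k)\<^sup>2) \<le> B" by (rule Fz_bound[OF T]) (rule that)
  have s: "summable (\<lambda>k. (Fz t k)\<^sup>2)" if t: "t \<in> {0..T}" for t
    by (rule bounded_imp_summable[where B=B]) (use B[OF t] in \<open>simp_all only: lessThan_Suc_atMost[symmetric] zero_le_power2\<close>)
  have sp: "t \<in> {0..T}" if "t \<in> space (time_interval T)" for t using that by simp
  show "AE t in time_interval T. summable (\<lambda>k. (Fz t k)\<^sup>2)" by (rule AE_I2) (rule s[OF sp])
  show "integrable (time_interval T) (\<lambda>t. \<Sum>k. (Fz t k)\<^sup>2)"
  proof (rule finite_measure.integrable_const_bound[OF finite_measure_interval])
    have "(\<lambda>t. (Fz t k)\<^sup>2) \<in> borel_measurable (time_interval T)" for k using Fz_measurable[of k T] by measurable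
    then show "(\<lambda>t. \<Sum>k. (Fz t k)\<^sup>2) \<in> borel_measurable (time_interval T)" by (rule borel_measurable_suminf)
    show "AE t in time_interval T. norm (\<Sum>k. (Fz t k)\<^sup>2) \<le> B"
    proof (rule AE_I2)
      fix t assume "t \<in> space (time_interval T)"
      note t = sp[OF this]
      have "0 \<le> (\<Sum>k. (Fz t k)\<^sup>2)" by (rule suminf_nonneg[OF s[OF t]]) simp
      then show "norm (\<Sum>k. (Fz t k)\<^sup>2) \<le> B" using suminf_le_const[OF s[OF t] B[OF t]] by simp
    qed
  qed
qed

text \<open>The series is the inner product of \<open>wz t\<close> with \<open>v\<close>.
  Cauchy-Schwarz gives its square integrability in time, the form in which
  \<open>integration_by_parts_sqint\<close> takes a derivative.\<close>

lemma series_sqint: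
  assumes T: "T > 0" and v: "v \<in> L2"
  shows "sqint (time_interval T) (\<lambda>t. \<Sum>k. Dz t k * sine.cf v k)"
proof -
  have vs: "summable (\<lambda>k. (sine.cf v k)\<^sup>2)" using L2_parseval[OF v] by (rule sums_summable)
  note P = product_series[OF finite_measure_interval Dz_measurable Dz_summable[OF T] vs]
  show ?thesis unfolding sqint_def
  proof
    show m: "(\<lambda>t. \<Sum>k. Dz t k * sine.cf v k) \<in> borel_measurable (time_interval T)"
      using P(2) by (rule borel_measurable_integrable)
    have i: "integrable (time_interval T) (\<lambda>t. (L2_norm v)\<^sup>2 * (\<Sum>k. (Dz t k)\<^sup>2))" using Dz_summable(2)[OF T] by simp
    show "integrable (time_interval T) (\<lambda>t. (\<Sum>k. Dz t k * sine.cf v k)\<^sup>2)"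
    proof (rule Bochner_Integration.integrable_bound[OF i])
      show "(\<lambda>t. (\<Sum>k. Dz t k * sine.cf v k)\<^sup>2) \<in> borel_measurable (time_interval T)" using m by measurable
      show "AE t in time_interval T. norm ((\<Sum>k. Dz t k * sine.cf v k)\<^sup>2) \<le> norm ((L2_norm v)\<^sup>2 * (\<Sum>k. (Dz t k)\<^sup>2))"
        using wz[OF T]
      proof eventually_elim
        case (elim t)
        have "(\<Sum>k. Dz t k * sine.cf v k) = L2_inner (wz t) v"
          using L2_inner_sums[of "wz t" v] elim v by (simp add: sums_iff)
        moreover have "(\<Sum>k. (Dz t k)\<^sup>2) = (L2_norm (wz t))\<^sup>2"
          using L2_parseval[of "wz t"] elim by (simp add: sums_iff)
        moreover have "(L2_inner (wz t) v)\<^sup>2 \<le> (L2_norm (wz t))\<^sup>2 * (L2_norm v)\<^sup>2"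
          unfolding L2_inner_def L2_norm_sq by (rule Cauchy_Schwarz_integral) (use elim v in \<open>simp_all add: L2_sqint\<close>)
        ultimately show ?case by (simp add: mult.commute)
      qed
    qed
  qed
qed

text \<open>The coefficient equations are multiplied by the coefficients of \<open>v\<close> and
  summed. The summed derivative \<open>E\<close> is the derivative of the mass term, and a test
  function on the half line reduces everything to a bounded interval.\<close>

lemma weak_form:
  assumes h: "\<And>T. T > 0 \<Longrightarrow> AE t in time_interval T. h t \<in> L2" "\<And>t k. hh t k = sine.cf (h t) k"
    and v: "v \<in> H01"
  defines "mass \<equiv> (\<lambda>t. L2_inner (uz t) v)"
    and "diffusion \<equiv> (\<lambda>t. a ((H01_norm (uz t))\<^sup>2) * L2_inner (weak_deriv (uz t)) (weak_deriv v))"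
    and "reaction \<equiv> (\<lambda>t. lam * L2_inner (\<lambda>x. f (uz t x)) v)"
    and "source \<equiv> (\<lambda>t. L2_inner (h t) v)"
  shows "locally_integrable_on mass {0<..}" "locally_integrable_on diffusion {0<..}"
    "locally_integrable_on reaction {0<..}" "locally_integrable_on source {0<..}"
    "\<phi> \<in> test_functions {0<..} \<Longrightarrow>
      distr_deriv (distr_of {0<..} mass) \<phi> + distr_of {0<..} diffusion \<phi> =
      distr_of {0<..} reaction \<phi> + distr_of {0<..} source \<phi>"
proof -
  have vL: "v \<in> L2" using H01_imp_sine_series(1)[OF v] .
  define b where "b = sine.cf v"
  have vs: "summable (\<lambda>k. (b k)\<^sup>2)" unfolding b_def using L2_parseval[OF vL] by (rule sums_summable)
  define E where "E t = (\<Sum>k. Dz t k * b k)" for t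
  have mass_sums: "(\<lambda>k. z t k * b k) sums mass t" if t: "t \<ge> 0" for t
    using L2_inner_sums[OF uz_L2(1)[OF t] vL] unfolding mass_def b_def uz_L2(2)[OF t] .
  have reac_sums: "(\<lambda>k. Fz t k * b k) sums reaction t" if t: "t \<ge> 0" for t
    using sums_mult[OF L2_inner_sums[OF Fz_cf(1)[OF t] vL], of lam]
    unfolding reaction_def b_def Fz_cf(2)[OF t] by (simp only: mult.assoc)
  have diff_sums: "(\<lambda>k. (om k)\<^sup>2 * a (Vz t) * z t k * b k) sums diffusion t" if t: "t \<ge> 0" for t
    using sums_mult[OF H01_inner_sums[OF uz_H01(1)[OF t] v], of "a (Vz t)"]
    unfolding diffusion_def b_def uz_H01(2)[OF t] uz_L2(2)[OF t] by (simp only: mult_ac)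
  have iE: "integrable (time_interval T) E" and sE: "AE t in time_interval T. summable (\<lambda>k. Dz t k * b k)"
    and lE: "(\<lambda>k. LINT t|time_interval T. Dz t k * b k) sums (LINT t|time_interval T. E t)" if T: "T > 0" for T
    unfolding E_def by (rule product_series[OF finite_measure_interval Dz_measurable Dz_summable[OF T] vs])+
  have im: "integrable (time_interval T) mass" if T: "T > 0" for T
  proof -
    have "integrable (time_interval T) (\<lambda>t. \<Sum>k. z t k * b k)"
      by (rule product_series(2)[OF finite_measure_interval z_measurable z_series_summable z_series_integrable[OF T] vs])
    moreover have "integrable (time_interval T) (\<lambda>t. \<Sum>k. z t k * b k) = integrable (time_interval T) mass"
      by (rule Bochner_Integration.integrable_cong[OF refl]) (use mass_sums in \<open>simp add: sums_iff\<close>)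
    ultimately show ?thesis by (simp only:)
  qed
  have ir: "integrable (time_interval T) reaction" if T: "T > 0" for T
  proof -
    have "integrable (time_interval T) (\<lambda>t. \<Sum>k. Fz t k * b k)"
      by (rule product_series(2)[OF finite_measure_interval Fz_measurable Fz_series[OF T] vs])
    moreover have "integrable (time_interval T) (\<lambda>t. \<Sum>k. Fz t k * b k) = integrable (time_interval T) reaction"
      by (rule Bochner_Integration.integrable_cong[OF refl]) (use reac_sums in \<open>simp add: sums_iff\<close>)
    ultimately show ?thesis by (simp only:)
  qed
  have src_sums: "AE t in time_interval T. (\<lambda>k. hh t k * b k) sums source t" if T: "T > 0" for T
    using h(1)[OF T]
  proof eventually_elim
    case (elim t)
    show ?case unfolding source_def b_def h(2) by (rule L2_inner_sums[OF elim vL])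
  qed
  have isrc: "integrable (time_interval T) source" if T: "T > 0" for T
  proof -
    have i: "integrable (time_interval T) (\<lambda>t. \<Sum>k. hh t k * b k)"
      by (rule product_series(2)[OF finite_measure_interval hh_measurable hh_AE_summable[OF T] vs])
    have eq: "AE t in time_interval T. (\<Sum>k. hh t k * b k) = source t"
      using src_sums[OF T] by eventually_elim (simp add: sums_iff)
    show ?thesis
      by (rule integrable_cong_AE_imp[OF i lebesgue_on_measurable_AE[OF _ borel_measurable_integrable[OF i] eq]])
        (use eq in auto)
  qed
  \<comment> \<open>The tested equation at almost every time. It also gives measurability and
    integrability of the diffusion term, inherited from the other three terms.\<close>
  have balance: "AE t in time_interval T. reaction t + source t - E t = diffusion t" if T: "T > 0" for T
    using src_sums[OF T] AE_space
  proof eventually_elim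
    case (elim t)
    then have t: "t \<ge> 0" by simp
    have "(\<lambda>k. Fz t k * b k + hh t k * b k - (om k)\<^sup>2 * a (Vz t) * z t k * b k) sums (reaction t + source t - diffusion t)"
      by (rule sums_diff[OF sums_add[OF reac_sums[OF t] elim(1)] diff_sums[OF t]])
    moreover have "Fz t k * b k + hh t k * b k - (om k)\<^sup>2 * a (Vz t) * z t k * b k = Dz t k * b k" for k
      unfolding Dz_def by (simp add: algebra_simps)
    ultimately have "E t = reaction t + source t - diffusion t" unfolding E_def by (simp add: sums_iff)
    then show ?case by simp
  qed
  have idif: "integrable (time_interval T) diffusion" if T: "T > 0" for T
  proof -
    have i: "integrable (time_interval T) (\<lambda>t. reaction t + source t - E t)"
      by (intro Bochner_Integration.integrable_diff Bochner_Integration.integrable_add ir isrc iE T)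
    show ?thesis
      by (rule integrable_cong_AE_imp[OF i lebesgue_on_measurable_AE[OF _ borel_measurable_integrable[OF i] balance[OF T]]])
        (use balance[OF T] in auto)
  qed
  show "locally_integrable_on mass {0<..}" "locally_integrable_on diffusion {0<..}"
    "locally_integrable_on reaction {0<..}" "locally_integrable_on source {0<..}"
    by (rule locally_integrable_half_line, rule im idif ir isrc, assumption)+
  assume \<phi>: "\<phi> \<in> test_functions {0<..}"
  obtain T where T: "T > 0" "\<And>t. t \<ge> T \<Longrightarrow> \<phi> t = 0" "\<And>t. t \<ge> T \<Longrightarrow> deriv \<phi> t = 0"
    by (rule test_function_half_line[OF \<phi>]) (rule that)
  let ?M = "time_interval T"
  note \<phi>c = test_functionsD(2)[OF \<phi>, of "{0..T}"]
  \<comment> \<open>Termwise integration exhibits \<open>mass\<close> as a primitive of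
    \<open>E\<close> with initial value \<open>mass 0\<close>, so the derivative can be moved to the
    test function.\<close>
  have parts: "(LINT t|?M. mass t * deriv \<phi> t) = - (LINT t|?M. E t * \<phi> t)"
  proof (rule integration_by_parts_sqint[OF T(1), where ?W0.0="mass 0"])
    show "sqint ?M E" unfolding E_def b_def by (rule series_sqint[OF T(1) vL])
    show "mass \<in> borel_measurable ?M" by (rule borel_measurable_integrable[OF im[OF T(1)]])
    show "mass t = mass 0 + (LINT s|time_interval t. E s)" if t: "t \<in> {0<..<T}" for t
    proof -
      have t0: "t > 0" "t \<ge> 0" using t by simp_all
      have "(\<lambda>k. z 0 k * b k + (LINT s|time_interval t. Dz s k * b k)) sums (mass 0 + (LINT s|time_interval t. E s))"
        by (rule sums_add[OF mass_sums lE[OF t0(1)]]) simp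
      moreover have "z 0 k * b k + (LINT s|time_interval t. Dz s k * b k) = z t k * b k" for k
        using z_equation(2)[OF t0(1), of k] by (simp add: z_0 distrib_right)
      ultimately have "(\<lambda>k. z t k * b k) sums (mass 0 + (LINT s|time_interval t. E s))" by (simp only:)
      then show ?thesis by (rule sums_unique2[OF mass_sums[OF t0(2)]])
    qed
    show "(\<phi> has_real_derivative deriv \<phi> t) (at t)" for t by (rule test_functionsD(1)[OF \<phi>])
    show "continuous_on UNIV (deriv \<phi>)" by (rule test_functionsD(3)[OF \<phi>])
    show "\<phi> 0 = 0" by (rule test_functionsD(4)[OF \<phi>]) simp
    show "\<phi> T = 0" by (rule T(2)) simp
  qed
  note c = integrable_times_continuous[OF _ \<phi>c]
  have "(LINT t|?M. diffusion t * \<phi> t) = (LINT t|?M. reaction t * \<phi> t + source t * \<phi> t - E t * \<phi> t)"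
  proof (rule integral_cong_AE)
    show "AE t in ?M. diffusion t * \<phi> t = reaction t * \<phi> t + source t * \<phi> t - E t * \<phi> t"
      using balance[OF T(1)] by eventually_elim (simp flip: distrib_right left_diff_distrib)
    show "(\<lambda>t. diffusion t * \<phi> t) \<in> borel_measurable ?M" by (rule borel_measurable_integrable[OF c[OF idif[OF T(1)]]])
    show "(\<lambda>t. reaction t * \<phi> t + source t * \<phi> t - E t * \<phi> t) \<in> borel_measurable ?M"
      by (intro borel_measurable_diff borel_measurable_add borel_measurable_integrable[OF c[OF ir[OF T(1)]]]
          borel_measurable_integrable[OF c[OF isrc[OF T(1)]]] borel_measurable_integrable[OF c[OF iE[OF T(1)]]])
  qed
  also have "\<dots> = (LINT t|?M. reaction t * \<phi> t) + (LINT t|?M. source t * \<phi> t) - (LINT t|?M. E t * \<phi> t)"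
    by (subst Bochner_Integration.integral_diff, intro Bochner_Integration.integrable_add c ir isrc T(1), intro c iE T(1),
        subst Bochner_Integration.integral_add, intro c ir T(1), intro c isrc T(1), rule refl)
  finally have bal: "(LINT t|?M. diffusion t * \<phi> t) =
      (LINT t|?M. reaction t * \<phi> t) + (LINT t|?M. source t * \<phi> t) - (LINT t|?M. E t * \<phi> t)" .
  have H: "(LINT t|lebesgue_on {0<..}. g t * \<phi> t) = (LINT t|?M. g t * \<phi> t)" for g by (rule LINT_half_line_eq) (rule T(2))
  have H': "(LINT t|lebesgue_on {0<..}. g t * deriv \<phi> t) = (LINT t|?M. g t * deriv \<phi> t)" for g
    by (rule LINT_half_line_eq) (rule T(3))
  show "distr_deriv (distr_of {0<..} mass) \<phi> + distr_of {0<..} diffusion \<phi> =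
      distr_of {0<..} reaction \<phi> + distr_of {0<..} source \<phi>"
    unfolding distr_deriv_def distr_of_def H H' parts bal by simp
qed

lemma uz_strong_solution:
  assumes h: "\<And>T. T > 0 \<Longrightarrow> AE t in time_interval T. h t \<in> L2" "\<And>t k. hh t k = sine.cf (h t) k"
    and u0: "u0 \<in> L2" "\<And>k. p k = sine.cf u0 k"
  shows "strong_solution lam a f h u0 uz"
  unfolding strong_solution_def weak_solution_def Let_def
  by (intro conjI allI impI ballI bexI[of _ wz] uz_regularity weak_form[OF h] uz_initial_value[OF u0]
      has_time_deriv_uz wz_Bochner_L2)

end

text \<open>Passage from functions to coefficients: \<open>sine.cf (h t)\<close> is defined at every
  time, and on each bounded interval the times at which \<open>h t\<close> is not in
  \<open>L2\<close> form a null set, so the source hypotheses become those of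
  \<open>evolution\<close>.\<close>

lemma (in problem) strong_solution_exists:
  assumes h: "\<And>T. T > 0 \<Longrightarrow> h \<in> Bochner_L2 (time_interval T) L2 L2_norm" and u0: "u0 \<in> H01"
  shows "\<exists>u. strong_solution lam a f h u0 u"
proof -
  have sm: "strongly_measurable (time_interval T) L2 L2_norm h"
    and int: "integrable (time_interval T) (\<lambda>t. (L2_norm (h t))\<^sup>2)" if "T > 0" for T
    using h[OF that] unfolding Bochner_L2_def by simp_all
  note hL = strongly_measurable_cf(1)[OF sm]
  have s: "AE t in time_interval T. summable (\<lambda>k. (sine.cf (h t) k)\<^sup>2)" if "T > 0" for T
    using hL[OF that] by eventually_elim (rule sums_summable[OF L2_parseval])
  have i: "integrable (time_interval T) (\<lambda>t. \<Sum>k. (sine.cf (h t) k)\<^sup>2)" if T: "T > 0" for T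
  proof -
    have eq: "AE t in time_interval T. (L2_norm (h t))\<^sup>2 = (\<Sum>k. (sine.cf (h t) k)\<^sup>2)"
      using hL[OF T] by eventually_elim (rule sums_unique[OF L2_parseval])
    show ?thesis
      by (rule integrable_cong_AE_imp[OF int[OF T] lebesgue_on_measurable_AE[OF _ borel_measurable_integrable[OF int[OF T]] eq]])
        (use eq in auto)
  qed
  interpret evolution lam m \<beta> \<gamma> f a "sine.cf u0" "\<lambda>t. sine.cf (h t)"
  proof unfold_locales
    show "summable (\<lambda>k. (om k)\<^sup>2 * (sine.cf u0 k)\<^sup>2)" by (rule H01_imp_sine_series(2)[OF u0])
    fix T :: real assume T: "T > 0"
    note c = square_series_components[OF strongly_measurable_cf(2)[OF sm[OF T]] s[OF T] i[OF T]]
    show "sqint (time_interval T) (\<lambda>t. sine.cf (h t) k)" for k by (rule c(1))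
    show "summable (\<lambda>k. LINT t|time_interval T. (sine.cf (h t) k)\<^sup>2)" by (rule c(2))
  qed
  obtain g c where "approximation lam m \<beta> \<gamma> f a (sine.cf u0) (\<lambda>t. sine.cf (h t)) g c"
    using approximation_exists by (elim exE)
  then interpret approximation lam m \<beta> \<gamma> f a "sine.cf u0" "\<lambda>t. sine.cf (h t)" g c .
  obtain r z where rz: "strict_mono (r :: nat \<Rightarrow> nat)" "\<And>t k. t \<ge> 0 \<Longrightarrow> (\<lambda>n. c (r n) t k) \<longlonglongrightarrow> z t k"
    by (rule limit_exists) (rule that)
  interpret limit_problem lam m \<beta> \<gamma> f a "sine.cf u0" "\<lambda>t. sine.cf (h t)" g c r z
    by unfold_locales (rule rz, rule rz(2))
  show ?thesis
    by (rule exI, rule uz_strong_solution[OF hL _ H01_imp_sine_series(1)[OF u0]]) auto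
qed

theorem theorem5:
  fixes lam m \<beta> \<gamma> :: real
    and f a :: "real \<Rightarrow> real"
    and h :: "real \<Rightarrow> real \<Rightarrow> real"
    and u0 :: "real \<Rightarrow> real"
  assumes "lam > 0"
    and "continuous_on UNIV f"
    and "continuous_on {0..} a"
    and "m > 0" and "\<forall>s\<ge>0. a s \<ge> m"
    and "\<forall>T>0. h \<in> Bochner_L2 (time_interval T) L2 L2_norm"
    and "\<beta> > 0" and "\<gamma> > 0" and "\<forall>r. f r * r \<le> \<gamma> + \<beta> * r\<^sup>2"
    and "u0 \<in> H01"
  shows "\<exists>u. strong_solution lam a f h u0 u"
proof -
  interpret problem lam m \<beta> \<gamma> f a
    by unfold_locales (use assms in auto)
  show ?thesis by (rule strong_solution_exists) (use assms in auto)
qed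

end
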